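(* If $S \in \mathcal{T}$, then $S - T_{\tilde{S}} \in \mathcal{C}_{\mathcal{T}}$.
   Context: $D$ is the open unit disk in $\mathbb{C}$ and $dA$ is area measure on $D$ normalized so that $D$ has measure $1$. The Bergman space $L^2_a$ is the Hilbert space of analytic functions on $D$ lying in $L^2(D,dA)$; $\langle\cdot,\cdot\rangle$ is taken in $L^2(D,dA)$. $\mathcal{B}(L^2_a)$ is the set of bounded operators on $L^2_a$. For $z\in D$, $k_z(w)=(1-|z|^2)/(1-\bar z w)^2$ is the normalized reproducing kernel. For $S\in\mathcal{B}(L^2_a)$, the Berezin transform of $S$ is the (bounded) function $\tilde S$ on $D$ given by $\tilde S(z)=\langle Sk_z,k_z\rangle$. For $u\in L^\infty(D,dA)$, $T_u$ is the Toeplitz operator on $L^2_a$, $T_uf=P(uf)$, with $P$ the orthogonal projection of $L^2(D,dA)$ onto $L^2_a$. $H^\infty$ is the algebra of bounded analytic functions on $D$. $\mathcal{T}$ is the $C^*$-subalgebra of $\mathcal{B}(L^2_a)$ generated by $\{T_g: g\in H^\infty\}$. The commutator ideal $\mathcal{C}_{\mathcal{T}}$ is the smallest closed two-sided ideal of $\mathcal{T}$ containing all operators $RS-SR$ with $R,S\in\mathcal{T}$. *)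

theory Defs
  imports "HOL-Complex_Analysis.Complex_Analysis"
begin

abbreviation unit_disk :: "complex set"
  where "unit_disk \<equiv> ball 0 1"

text \<open>The measure lives on the disk only, so functions are unconstrained outside of it.\<close>

definition dA :: "complex measure"
  where "dA = uniform_measure (lebesgue_on unit_disk) unit_disk"

definition L2_inner :: "(complex \<Rightarrow> complex) \<Rightarrow> (complex \<Rightarrow> complex) \<Rightarrow> complex"
  where "L2_inner f g = (\<integral>w. f w * cnj (g w) \<partial>dA)"

lemma space_dA [simp]: "space dA = unit_disk"
  by (simp add: dA_def)

lemma sets_dA [simp]: "sets dA = sets (lebesgue_on unit_disk)"
  by (simp add: dA_def)

lemma emeasure_dA_disk: "emeasure dA unit_disk = 1"
proof -
  have "emeasure (lebesgue_on unit_disk) unit_disk = emeasure lborel unit_disk"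
    by (simp add: emeasure_restrict_space)
  moreover have "emeasure lborel unit_disk \<noteq> 0"
  proof
    assume "emeasure lborel unit_disk = 0"
    then have "negligible unit_disk"
      by (simp add: negligible_iff_emeasure0)
    then show False
      using open_not_negligible[of unit_disk] by simp
  qed
  moreover have "emeasure lborel unit_disk \<noteq> \<infinity>"
    using emeasure_bounded_finite[of unit_disk] by (simp add: less_top)
  ultimately show ?thesis
    unfolding dA_def by (intro emeasure_uniform_measure_1) simp_all
qed

lemma finite_measure_dA: "finite_measure dA"
  by (rule finite_measureI) (simp add: emeasure_dA_disk)

lemma AE_dA_iff: "(AE w in dA. P w) \<longleftrightarrow> (AE w in lebesgue_on unit_disk. P w)"
proof -
  have fin: "emeasure (lebesgue_on unit_disk) unit_disk \<noteq> \<infinity>"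
    using emeasure_bounded_finite[of unit_disk]
    by (simp add: emeasure_restrict_space less_top)
  have pos: "emeasure (lebesgue_on unit_disk) unit_disk \<noteq> 0"
  proof
    assume "emeasure (lebesgue_on unit_disk) unit_disk = 0"
    then have "emeasure dA unit_disk = 0"
      by (simp add: dA_def emeasure_uniform_measure)
    then show False
      by (simp add: emeasure_dA_disk)
  qed
  have "(AE w in dA. P w) \<longleftrightarrow> (AE w in lebesgue_on unit_disk. w \<in> unit_disk \<longrightarrow> P w)"
    unfolding dA_def using fin pos by (subst AE_uniform_measure) (auto simp: less_top)
  also have "\<dots> \<longleftrightarrow> (AE w in lebesgue_on unit_disk. P w)"
    by (rule AE_cong) simp
  finally show ?thesis .
qed

lemma holomorphic_measurable_dA:
  assumes "f holomorphic_on unit_disk"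
  shows "f \<in> borel_measurable dA"
proof -
  have "f \<in> borel_measurable (lebesgue_on unit_disk)"
    using assms by (intro continuous_imp_measurable_on_sets_lebesgue)
      (auto intro: holomorphic_on_imp_continuous_on)
  then show ?thesis
    by (simp add: measurable_def)
qed

text \<open>
  Representatives are normalized to vanish off the disk, so that equality of elements of the
  Bergman space is equality of analytic functions on the disk.
\<close>

definition bergman_set :: "(complex \<Rightarrow> complex) set"
  where "bergman_set =
    {f. f holomorphic_on unit_disk \<and> integrable dA (\<lambda>w. (norm (f w))\<^sup>2) \<and> (\<forall>w. w \<notin> unit_disk \<longrightarrow> f w = 0)}"

lemma bergman_set_measurable: "f \<in> bergman_set \<Longrightarrow> f \<in> borel_measurable dA"
  by (simp add: bergman_set_def holomorphic_measurable_dA)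

lemma bergman_set_zero: "(\<lambda>_. 0) \<in> bergman_set"
  by (simp add: bergman_set_def)

lemma bergman_set_add:
  assumes "f \<in> bergman_set" "g \<in> bergman_set"
  shows "(\<lambda>w. f w + g w) \<in> bergman_set"
proof -
  have [measurable]: "f \<in> borel_measurable dA" "g \<in> borel_measurable dA"
    using assms by (auto intro: bergman_set_measurable)
  have "integrable dA (\<lambda>w. (norm (f w + g w))\<^sup>2)"
  proof (rule Bochner_Integration.integrable_bound)
    show "integrable dA (\<lambda>w. 2 * (norm (f w))\<^sup>2 + 2 * (norm (g w))\<^sup>2)"
      using assms by (simp add: bergman_set_def)
    have "(norm (f w + g w))\<^sup>2 \<le> 2 * (norm (f w))\<^sup>2 + 2 * (norm (g w))\<^sup>2" for w
    proof -
      have "(norm (f w + g w))\<^sup>2 \<le> (norm (f w) + norm (g w))\<^sup>2"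
        by (intro power_mono norm_triangle_ineq) simp
      also have "\<dots> \<le> 2 * (norm (f w))\<^sup>2 + 2 * (norm (g w))\<^sup>2"
        using sum_squares_bound[of "norm (f w)" "norm (g w)"] by (simp add: power2_sum)
      finally show ?thesis .
    qed
    then show "AE w in dA. norm ((norm (f w + g w))\<^sup>2) \<le> norm (2 * (norm (f w))\<^sup>2 + 2 * (norm (g w))\<^sup>2)"
      by simp
  qed measurable
  then show ?thesis
    using assms by (auto simp: bergman_set_def intro!: holomorphic_intros)
qed

lemma bergman_set_mult:
  assumes "f \<in> bergman_set"
  shows "(\<lambda>w. c * f w) \<in> bergman_set"
  using assms by (auto simp: bergman_set_def norm_mult power_mult_distrib intro!: holomorphic_intros)

lemma bergman_set_integrable_inner:
  assumes "f \<in> bergman_set" "g \<in> bergman_set"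
  shows "integrable dA (\<lambda>w. f w * cnj (g w))"
proof (rule Bochner_Integration.integrable_bound)
  have [measurable]: "f \<in> borel_measurable dA" "g \<in> borel_measurable dA"
    using assms by (auto intro: bergman_set_measurable)
  have [measurable]: "cnj \<in> borel_measurable borel"
    by (intro borel_measurable_continuous_onI continuous_intros)
  show "(\<lambda>w. f w * cnj (g w)) \<in> borel_measurable dA"
    by measurable
  show "integrable dA (\<lambda>w. (norm (f w))\<^sup>2 + (norm (g w))\<^sup>2)"
    using assms by (simp add: bergman_set_def)
  have "norm (f w * cnj (g w)) \<le> (norm (f w))\<^sup>2 + (norm (g w))\<^sup>2" for w
  proof -
    have "2 * (norm (f w) * norm (g w)) \<le> (norm (f w))\<^sup>2 + (norm (g w))\<^sup>2"
      using sum_squares_bound[of "norm (f w)" "norm (g w)"] by simp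
    moreover have "0 \<le> norm (f w) * norm (g w)"
      by simp
    ultimately have "norm (f w) * norm (g w) \<le> (norm (f w))\<^sup>2 + (norm (g w))\<^sup>2"
      by linarith
    then show ?thesis
      by (simp add: norm_mult)
  qed
  then show "AE w in dA. norm (f w * cnj (g w)) \<le> norm ((norm (f w))\<^sup>2 + (norm (g w))\<^sup>2)"
    by simp
qed

lemma L2_inner_self:
  "L2_inner f f = of_real (\<integral>w. (norm (f w))\<^sup>2 \<partial>dA)"
proof -
  have "L2_inner f f = (\<integral>w. complex_of_real ((norm (f w))\<^sup>2) \<partial>dA)"
    unfolding L2_inner_def by (intro Bochner_Integration.integral_cong) (simp_all only: complex_norm_square)
  then show ?thesis
    by (simp only: integral_complex_of_real)
qed

lemma L2_inner_commute: "L2_inner g f = cnj (L2_inner f g)"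
proof -
  have "cnj (L2_inner f g) = (\<integral>w. cnj (f w * cnj (g w)) \<partial>dA)"
    unfolding L2_inner_def by (rule Bochner_Integration.integral_cnj[symmetric])
  then show ?thesis
    unfolding L2_inner_def by (simp add: mult.commute)
qed

lemma bergman_set_eq_zero:
  assumes f: "f \<in> bergman_set" and 0: "L2_inner f f = 0"
  shows "f = (\<lambda>_. 0)"
proof -
  have hol: "f holomorphic_on unit_disk"
    and int: "integrable dA (\<lambda>w. (norm (f w))\<^sup>2)"
    and out: "\<And>w. w \<notin> unit_disk \<Longrightarrow> f w = 0"
    using f by (auto simp: bergman_set_def)
  have "(\<integral>w. (norm (f w))\<^sup>2 \<partial>dA) = 0"
    using 0 by (simp add: L2_inner_self)
  then have "AE w in dA. (norm (f w))\<^sup>2 = 0"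
    using integral_nonneg_eq_0_iff_AE[OF int] by simp
  then have "AE w in lebesgue_on unit_disk. f w = 0"
    by (simp add: AE_dA_iff)
  then have "AE w in lebesgue. w \<in> unit_disk \<longrightarrow> f w = 0"
    by (simp add: AE_restrict_space_iff)
  then have neg: "negligible {w \<in> unit_disk. f w \<noteq> 0}"
    by (simp add: AE_iff_null_sets negligible_iff_null_sets eventually_ae_filter)
       (metis (mono_tags, lifting) mem_Collect_eq negligible_iff_null_sets negligible_subset subsetI)
  have "open {w \<in> unit_disk. f w \<noteq> 0}"
    using continuous_open_preimage[OF holomorphic_on_imp_continuous_on[OF hol], of "- {0}"]
    by (simp add: vimage_def Int_def open_Compl)
  with neg have "{w \<in> unit_disk. f w \<noteq> 0} = {}"
    using open_not_negligible by blast
  then show ?thesis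
    using out by (intro ext) blast
qed

typedef bergman = bergman_set
  using bergman_set_zero by blast

setup_lifting type_definition_bergman

instantiation bergman :: real_inner
begin

lift_definition zero_bergman :: bergman is "\<lambda>_. 0"
  by (rule bergman_set_zero)

lift_definition plus_bergman :: "bergman \<Rightarrow> bergman \<Rightarrow> bergman" is "\<lambda>f g w. f w + g w"
  by (rule bergman_set_add)

lift_definition uminus_bergman :: "bergman \<Rightarrow> bergman" is "\<lambda>f w. - f w"
  using bergman_set_mult[of _ "-1"] by simp

lift_definition minus_bergman :: "bergman \<Rightarrow> bergman \<Rightarrow> bergman" is "\<lambda>f g w. f w - g w"
  using bergman_set_add[OF _ bergman_set_mult[of _ "-1"]] by simp

lift_definition scaleR_bergman :: "real \<Rightarrow> bergman \<Rightarrow> bergman" is "\<lambda>r f w. of_real r * f w"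
  by (rule bergman_set_mult)

lift_definition inner_bergman :: "bergman \<Rightarrow> bergman \<Rightarrow> real" is "\<lambda>f g. Re (L2_inner f g)" .

definition norm_bergman :: "bergman \<Rightarrow> real"
  where "norm_bergman f = sqrt (inner f f)"

definition sgn_bergman :: "bergman \<Rightarrow> bergman"
  where "sgn_bergman f = inverse (norm f) *\<^sub>R f"

definition dist_bergman :: "bergman \<Rightarrow> bergman \<Rightarrow> real"
  where "dist_bergman f g = norm (f - g)"

definition uniformity_bergman :: "(bergman \<times> bergman) filter"
  where "uniformity_bergman = (INF e\<in>{0<..}. principal {(x, y). dist x y < e})"

definition open_bergman :: "bergman set \<Rightarrow> bool"
  where "open_bergman U = (\<forall>x\<in>U. eventually (\<lambda>(x', y). x' = x \<longrightarrow> y \<in> U) uniformity)"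

instance
proof
  fix f g h :: bergman and a b :: real
  show "f + g + h = f + (g + h)" by transfer (simp add: add.assoc)
  show "f + g = g + f" by transfer (simp add: add.commute)
  show "0 + f = f" by transfer simp
  show "- f + f = 0" by transfer simp
  show "f - g = f + - g" by transfer simp
  show "a *\<^sub>R (f + g) = a *\<^sub>R f + a *\<^sub>R g" by transfer (simp add: distrib_left)
  show "(a + b) *\<^sub>R f = a *\<^sub>R f + b *\<^sub>R f" by transfer (simp add: distrib_right)
  show "a *\<^sub>R b *\<^sub>R f = (a * b) *\<^sub>R f" by transfer (simp add: mult.assoc)
  show "1 *\<^sub>R f = f" by transfer simp
  show "inner f g = inner g f"
    by transfer (metis L2_inner_commute complex_cnj(1) cnj.sel(1))
  show "inner (f + g) h = inner f h + inner g h"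
    by transfer (simp add: L2_inner_def distrib_right bergman_set_integrable_inner)
  show "inner (a *\<^sub>R f) g = a * inner f g"
    by transfer (simp add: L2_inner_def mult.assoc)
  show "0 \<le> inner f f"
    by transfer (simp add: L2_inner_self)
  show "inner f f = 0 \<longleftrightarrow> f = 0"
  proof transfer
    fix f assume f: "f \<in> bergman_set"
    show "Re (L2_inner f f) = 0 \<longleftrightarrow> f = (\<lambda>_. 0)"
      using bergman_set_eq_zero[OF f] by (auto simp: L2_inner_self)
  qed
qed (simp_all add: norm_bergman_def sgn_bergman_def dist_bergman_def uniformity_bergman_def
      open_bergman_def)

end

lift_definition scaleC :: "complex \<Rightarrow> bergman \<Rightarrow> bergman" is "\<lambda>c f w. c * f w"
  by (rule bergman_set_mult)

definition cinner :: "bergman \<Rightarrow> bergman \<Rightarrow> complex"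
  where "cinner f g = L2_inner (Rep_bergman f) (Rep_bergman g)"

lemma norm_scaleC: "norm (scaleC c f) = norm c * norm f"
proof -
  have "inner (scaleC c f) (scaleC c f) = (norm c)\<^sup>2 * inner f f"
    by transfer (simp add: L2_inner_self norm_mult power_mult_distrib)
  then show ?thesis
    by (simp add: norm_eq_sqrt_inner real_sqrt_mult)
qed

lemma bounded_linear_scaleC: "bounded_linear (scaleC c)"
proof
  show "scaleC c (f + g) = scaleC c f + scaleC c g" for f g
    by transfer (simp add: distrib_left)
  show "scaleC c (r *\<^sub>R f) = r *\<^sub>R scaleC c f" for r f
    by transfer (simp add: mult.left_commute)
  show "\<exists>K. \<forall>f. norm (scaleC c f) \<le> norm f * K"
    by (intro exI[of _ "norm c"]) (simp add: norm_scaleC mult.commute)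
qed

text \<open>
  \<^typ>\<open>bergman \<Rightarrow>\<^sub>L bergman\<close> consists of the bounded real-linear operators, with the operator norm;
  \<open>bounded_ops\<close> singles out the complex-linear ones.
\<close>

definition bounded_ops :: "(bergman \<Rightarrow>\<^sub>L bergman) set"
  where "bounded_ops = {S. \<forall>c f. blinfun_apply S (scaleC c f) = scaleC c (blinfun_apply S f)}"

definition op_scaleC :: "complex \<Rightarrow> (bergman \<Rightarrow>\<^sub>L bergman) \<Rightarrow> (bergman \<Rightarrow>\<^sub>L bergman)"
  where "op_scaleC c S = Blinfun (scaleC c) o\<^sub>L S"

lemma op_scaleC_apply: "blinfun_apply (op_scaleC c S) f = scaleC c (blinfun_apply S f)"
  by (simp add: op_scaleC_def bounded_linear_Blinfun_apply bounded_linear_scaleC)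

definition is_adjoint :: "(bergman \<Rightarrow>\<^sub>L bergman) \<Rightarrow> (bergman \<Rightarrow>\<^sub>L bergman) \<Rightarrow> bool"
  where "is_adjoint S R \<longleftrightarrow>
    (\<forall>f g. cinner (blinfun_apply S f) g = cinner f (blinfun_apply R g))"

definition complex_subspace :: "(bergman \<Rightarrow>\<^sub>L bergman) set \<Rightarrow> bool"
  where "complex_subspace A \<longleftrightarrow>
    0 \<in> A \<and> (\<forall>S\<in>A. \<forall>R\<in>A. S + R \<in> A) \<and> (\<forall>c. \<forall>S\<in>A. op_scaleC c S \<in> A)"

definition C_star_subalgebra :: "(bergman \<Rightarrow>\<^sub>L bergman) set \<Rightarrow> bool"
  where "C_star_subalgebra A \<longleftrightarrow>
    A \<subseteq> bounded_ops \<and> closed A \<and> complex_subspace A \<and>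
    (\<forall>S\<in>A. \<forall>R\<in>A. S o\<^sub>L R \<in> A) \<and> (\<forall>S\<in>A. \<forall>R. is_adjoint S R \<longrightarrow> R \<in> A)"

definition generated_C_star_subalgebra :: "(bergman \<Rightarrow>\<^sub>L bergman) set \<Rightarrow> (bergman \<Rightarrow>\<^sub>L bergman) set"
  where "generated_C_star_subalgebra X = \<Inter>{A. C_star_subalgebra A \<and> X \<subseteq> A}"

definition closed_ideal :: "(bergman \<Rightarrow>\<^sub>L bergman) set \<Rightarrow> (bergman \<Rightarrow>\<^sub>L bergman) set \<Rightarrow> bool"
  where "closed_ideal A I \<longleftrightarrow>
    I \<subseteq> A \<and> closed I \<and> complex_subspace I \<and> (\<forall>S\<in>A. \<forall>R\<in>I. S o\<^sub>L R \<in> I \<and> R o\<^sub>L S \<in> I)"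

definition commutator_ideal :: "(bergman \<Rightarrow>\<^sub>L bergman) set \<Rightarrow> (bergman \<Rightarrow>\<^sub>L bergman) set"
  where "commutator_ideal A =
    \<Inter>{I. closed_ideal A I \<and> (\<forall>R\<in>A. \<forall>S\<in>A. (R o\<^sub>L S) - (S o\<^sub>L R) \<in> I)}"

text \<open>
  The orthogonal projection \<open>bergman_proj h\<close> of \<open>h\<close> onto the Bergman space is meaningful for
  square-integrable \<open>h\<close>: it is the unique \<open>g\<close> with \<open>h - g\<close> orthogonal to that (closed) subspace.
  Consequently \<open>toeplitz u\<close> is meaningful for essentially bounded measurable \<open>u\<close> on the disk.
\<close>

definition bergman_proj :: "(complex \<Rightarrow> complex) \<Rightarrow> bergman"
  where "bergman_proj h =
    (THE g. \<forall>f. L2_inner (\<lambda>w. h w - Rep_bergman g w) (Rep_bergman f) = 0)"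

definition toeplitz :: "(complex \<Rightarrow> complex) \<Rightarrow> (bergman \<Rightarrow>\<^sub>L bergman)"
  where "toeplitz u = Blinfun (\<lambda>f. bergman_proj (\<lambda>w. u w * Rep_bergman f w))"

definition H_infinity :: "(complex \<Rightarrow> complex) set"
  where "H_infinity = {g. g holomorphic_on unit_disk \<and> bounded (g ` unit_disk)}"

definition toeplitz_algebra :: "(bergman \<Rightarrow>\<^sub>L bergman) set"
  where "toeplitz_algebra = generated_C_star_subalgebra (toeplitz ` H_infinity)"

definition normalized_kernel_fun :: "complex \<Rightarrow> complex \<Rightarrow> complex"
  where "normalized_kernel_fun z w =
    (if w \<in> unit_disk then of_real (1 - (norm z)\<^sup>2) / (1 - cnj z * w)\<^sup>2 else 0)"

lemma normalized_kernel_in_bergman: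
  assumes "z \<in> unit_disk"
  shows "normalized_kernel_fun z \<in> bergman_set"
proof -
  have z: "norm z < 1"
    using assms by simp
  then have sq: "0 \<le> 1 - (norm z)\<^sup>2"
    by (simp add: power_le_one)
  have lower: "1 - norm z \<le> norm (1 - cnj z * w)" if "w \<in> unit_disk" for w
  proof -
    have "norm (cnj z * w) \<le> norm z"
      using that by (simp add: norm_mult mult_left_le)
    then show ?thesis
      using norm_triangle_ineq2[of 1 "cnj z * w"] by simp
  qed
  then have nz: "1 - cnj z * w \<noteq> 0" if "w \<in> unit_disk" for w
    using that z by fastforce
  have "(\<lambda>w. of_real (1 - (norm z)\<^sup>2) / (1 - cnj z * w)\<^sup>2) holomorphic_on unit_disk"
    using nz by (intro holomorphic_intros) auto
  then have hol: "normalized_kernel_fun z holomorphic_on unit_disk"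
    by (rule holomorphic_transform) (simp add: normalized_kernel_fun_def)
  have bound: "norm (normalized_kernel_fun z w) \<le> (1 - (norm z)\<^sup>2) / (1 - norm z)\<^sup>2"
    if "w \<in> unit_disk" for w
  proof -
    have "norm (normalized_kernel_fun z w) = (1 - (norm z)\<^sup>2) / (norm (1 - cnj z * w))\<^sup>2"
      using that sq by (simp only: normalized_kernel_fun_def if_True norm_divide norm_power norm_of_real
          abs_of_nonneg)
    also have "\<dots> \<le> (1 - (norm z)\<^sup>2) / (1 - norm z)\<^sup>2"
      using lower[OF that] z sq nz[OF that]
      by (intro divide_left_mono power_mono mult_pos_pos zero_less_power) simp_all
    finally show ?thesis .
  qed
  interpret finite_measure dA
    by (rule finite_measure_dA)
  have [measurable]: "normalized_kernel_fun z \<in> borel_measurable dA"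
    by (rule holomorphic_measurable_dA[OF hol])
  have "integrable dA (\<lambda>w. (norm (normalized_kernel_fun z w))\<^sup>2)"
  proof (rule integrable_const_bound)
    show "AE w in dA. norm ((norm (normalized_kernel_fun z w))\<^sup>2)
        \<le> ((1 - (norm z)\<^sup>2) / (1 - norm z)\<^sup>2)\<^sup>2"
      using bound by (intro AE_I2) (auto intro!: power_mono)
  qed measurable
  then show ?thesis
    using hol by (simp add: bergman_set_def) (simp add: normalized_kernel_fun_def)
qed

text \<open>Only the values at points \<open>z\<close> of the disk are meaningful in the next two definitions.\<close>

definition normalized_kernel :: "complex \<Rightarrow> bergman"
  where "normalized_kernel z = Abs_bergman (normalized_kernel_fun z)"

definition berezin :: "(bergman \<Rightarrow>\<^sub>L bergman) \<Rightarrow> complex \<Rightarrow> complex"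
  where "berezin S z = cinner (blinfun_apply S (normalized_kernel z)) (normalized_kernel z)"

end

theory Submission
  imports Defs "HOL-Real_Asymp.Real_Asymp"
begin

text \<open>
  The map taking \<open>R\<close> to the Toeplitz operator of its Berezin transform carries the commutator ideal into itself.
  As a closed ideal, the commutator ideal is generated by the commutators \<open>D\<close> of the Toeplitz operators with
  symbols \<open>f\<close> and \<open>cnj g\<close>, where \<open>f\<close> and \<open>g\<close> are bounded and analytic, so it is enough to treat \<open>X = A D B\<close> with
  \<open>A\<close>, \<open>B\<close> in the algebra. The conjugates of any operator of the algebra by the unitaries induced by the
  disk automorphisms \<open>moebius z\<close> have precompact orbits on every vector. Hence \<open>berezin X z\<close> is small wherever
  \<open>f \<circ> moebius z\<close> is nearly constant near \<open>0\<close>, that is, where the local Dirichlet energy of \<open>f\<close> at \<open>z\<close> is small.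
  By the Littlewood-Paley identity, a pseudohyperbolically separated set of points of energy at least \<open>d\<close>
  has bounded Blaschke sums, so it is the zero set of a Blaschke product whose Toeplitz operator is bounded
  below; symbols supported where such a product is small have Toeplitz operators in the ideal.
  As \<open>berezin X\<close> is Lipschitz for the pseudohyperbolic distance, it is a uniform limit of sums of such symbols.

  Finally, the Berezin transform of the product of the Toeplitz operators of \<open>f\<close> and \<open>cnj g\<close> is \<open>f * cnj g\<close>, whose
  Toeplitz operator is the product in the opposite order. So the theorem holds for these products, and modulo
  the ideal they span a dense subspace of the algebra.
\<close>

unbundle no fps_syntax

section \<open>Area measure and automorphisms of the disk\<close>

text \<open>The obstacle is that the Berezin transform is not multiplicative. The claim cannot be
  verified on generators alone; the class of operators satisfying it has to be enlarged until it is
  stable under products, and for this the effect of \<open>berezin\<close> on the ideal must be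
  known. For \<open>X\<close> in the ideal, \<open>berezin X\<close> need not vanish at the
  boundary; it is small only where a symbol is locally almost constant.

  The energy serves both halves of that estimate. Where it tends to \<open>0\<close>, the bounded
  Taylor coefficients force \<open>f \<circ> moebius z - f z\<close> to \<open>0\<close> on the
  whole disk; where it is bounded below, separated points are sparse. Blaschke products with sparse
  zeros are bounded below as multipliers because an analytic function carries at most
  \<open>(r / R)\<^sup>2\<close> of its mass on a disk of radius \<open>R\<close> inside radius
  \<open>r\<close>; this takes the place of interpolation theory.

  A maximal separated set comes only within \<open>1 / 2\<close> of the points of high energy, while
  a Blaschke product is known to be small only very close to its zeros. Hence the zeros are moved by
  the points of a finite net and sorted by the value of the symbol there.\<close>

definition complex_of_vec :: "real^2 \<Rightarrow> complex"
  where "complex_of_vec x = Complex (x $ 1) (x $ 2)"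

definition vec_of_complex :: "complex \<Rightarrow> real^2"
  where "vec_of_complex z = (\<chi> i. if i = 1 then Re z else Im z)"

lemma vec_of_complex_nth [simp]:
  "vec_of_complex z $ 1 = Re z" "vec_of_complex z $ 2 = Im z"
  by (simp_all add: vec_of_complex_def)

lemma complex_of_vec_inverse [simp]: "complex_of_vec (vec_of_complex z) = z"
  by (simp add: complex_of_vec_def complex_eq_iff)

lemma vec_of_complex_inverse [simp]: "vec_of_complex (complex_of_vec x) = x"
  by (simp add: complex_of_vec_def vec_eq_iff forall_2)

lemma linear_complex_of_vec: "bounded_linear complex_of_vec"
proof -
  have "linear complex_of_vec"
    by (rule linearI) (simp_all add: complex_of_vec_def complex_eq_iff)
  then show ?thesis by (simp add: linear_linear)
qed

lemma linear_vec_of_complex: "bounded_linear vec_of_complex"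
proof -
  have "linear vec_of_complex"
    by (rule linearI) (simp_all add: vec_of_complex_def vec_eq_iff)
  then show ?thesis by (simp add: linear_conv_bounded_linear)
qed

lemma measurable_complex_of_vec [measurable]: "complex_of_vec \<in> borel_measurable borel"
  by (intro borel_measurable_continuous_onI linear_continuous_on linear_complex_of_vec)

text \<open>Boxes determine \<open>lborel\<close>, and the linear identification with
  \<open>real^2\<close> maps boxes to boxes with the same side lengths.\<close>

lemma lborel_complex_eq_distr: "(lborel :: complex measure) = distr lborel borel complex_of_vec"
proof (rule lborel_eqI)
  fix l u :: complex
  assume le: "\<And>b. b \<in> Basis \<Longrightarrow> l \<bullet> b \<le> u \<bullet> b"
  have "complex_of_vec -` box l u = box (vec_of_complex l) (vec_of_complex u)"
    by (auto simp: complex_of_vec_def box_def Basis_complex_def Basis_vec_def inner_axis forall_2)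
  then have "emeasure (distr lborel borel complex_of_vec) (box l u)
      = emeasure lborel (box (vec_of_complex l) (vec_of_complex u))"
    by (subst emeasure_distr) (auto simp: space_borel)
  also have "\<dots> = (\<Prod>b\<in>Basis. (vec_of_complex u - vec_of_complex l) \<bullet> b)"
    using le by (intro emeasure_lborel_box)
      (use le[of 1] le[of \<i>] in \<open>auto simp: Basis_vec_def inner_axis Basis_complex_def vec_of_complex_def\<close>)
  also have "(\<Prod>b\<in>Basis. (vec_of_complex u - vec_of_complex l) \<bullet> b) = (Re u - Re l) * (Im u - Im l)"
  proof -
    have B: "(Basis :: (real^2) set) = {axis 1 1, axis 2 1}"
      by (auto simp: Basis_vec_def UNIV_2)
    have "axis 1 (1::real) \<noteq> (axis 2 1 :: real^2)"
      by (simp add: axis_eq_axis)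
    then show ?thesis
      unfolding B by (simp add: inner_axis)
  qed
  also have "\<dots> = (\<Prod>b\<in>Basis. (u - l) \<bullet> b)"
    by (simp add: Basis_complex_def)
  finally show "emeasure (distr lborel borel complex_of_vec) (box l u) = (\<Prod>b\<in>Basis. (u - l) \<bullet> b)" .
qed simp

text \<open>On \<open>real^2\<close>, multiplication by \<open>d\<close> is a rotation composed with
  scaling by \<open>cmod d\<close>. Hence the Jacobian of a holomorphic map is the squared modulus
  of its derivative.\<close>

lemma det_complex_mult:
  "det (matrix (\<lambda>x. vec_of_complex (d * complex_of_vec x))) = (cmod d)\<^sup>2"
proof -
  have "matrix (\<lambda>x. vec_of_complex (d * complex_of_vec x)) $ i $ j
      = vec_of_complex (d * complex_of_vec (axis j 1)) $ i" for i j
    by (simp add: matrix_def)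
  then show ?thesis
    by (simp add: det_2 complex_of_vec_def axis_def cmod_def power2_eq_square)
qed

text \<open>Change of variables on \<open>real^2\<close>, with the Jacobian from
  \<open>det_complex_mult\<close>. Boundedness of the image makes its measure finite, so that the
  measure can be inserted as the known value of the integral.\<close>

lemma nn_integral_norm_deriv_eq_emeasure_image:
  fixes \<phi> :: "complex \<Rightarrow> complex"
  assumes S: "open S" "\<phi> holomorphic_on S" "inj_on \<phi> S"
    and A: "A \<in> sets borel" "A \<subseteq> S" "\<phi> ` A \<in> sets borel" "bounded (\<phi> ` A)"
  shows "(\<integral>\<^sup>+w. indicator A w * ennreal ((cmod (deriv \<phi> w))\<^sup>2) \<partial>lborel) = emeasure lborel (\<phi> ` A)"
proof -
  let ?S = "complex_of_vec -` A"
  let ?f = "vec_of_complex \<circ> \<phi> \<circ> complex_of_vec"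
  let ?d = "\<lambda>x. deriv \<phi> (complex_of_vec x)"
  have Sb: "?S \<in> sets borel"
    using measurable_sets[OF measurable_complex_of_vec A(1)] by (simp add: space_borel)
  have contd: "continuous_on S (deriv \<phi>)"
    using S by (intro holomorphic_on_imp_continuous_on holomorphic_deriv)
  have inj: "inj_on ?f ?S"
  proof (rule inj_onI)
    fix x y assume x: "x \<in> ?S" and y: "y \<in> ?S" and e: "?f x = ?f y"
    then have "\<phi> (complex_of_vec x) = \<phi> (complex_of_vec y)"
      by (metis comp_apply complex_of_vec_inverse)
    then have "complex_of_vec x = complex_of_vec y"
      using x y A(2) S(3) by (auto dest: inj_onD)
    then show "x = y"
      by (metis vec_of_complex_inverse)
  qed
  have der: "(?f has_derivative (\<lambda>h. vec_of_complex (?d x * complex_of_vec h))) (at x within ?S)"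
    if "x \<in> ?S" for x
  proof -
    have "(\<phi> has_derivative (*) (?d x)) (at (complex_of_vec x))"
      using that A(2) S holomorphic_derivI[of \<phi> S "complex_of_vec x"]
      by (auto simp: has_field_derivative_def)
    moreover have c: "(complex_of_vec has_derivative complex_of_vec) (at x)"
      by (rule bounded_linear_imp_has_derivative[OF linear_complex_of_vec])
    ultimately have "(\<phi> \<circ> complex_of_vec has_derivative (*) (?d x) \<circ> complex_of_vec) (at x)"
      by (intro diff_chain_at) auto
    moreover have "(vec_of_complex has_derivative vec_of_complex) (at ((\<phi> \<circ> complex_of_vec) x))"
      by (rule bounded_linear_imp_has_derivative[OF linear_vec_of_complex])
    ultimately have "(vec_of_complex \<circ> (\<phi> \<circ> complex_of_vec) has_derivative
        vec_of_complex \<circ> ((*) (?d x) \<circ> complex_of_vec)) (at x)"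
      by (rule diff_chain_at)
    then show ?thesis
      by (auto simp: o_def intro: has_derivative_at_withinI)
  qed
  have img: "?f ` ?S = complex_of_vec -` (\<phi> ` A)"
  proof
    show "?f ` ?S \<subseteq> complex_of_vec -` (\<phi> ` A)"
      by auto
    show "complex_of_vec -` (\<phi> ` A) \<subseteq> ?f ` ?S"
    proof
      fix y assume "y \<in> complex_of_vec -` (\<phi> ` A)"
      then obtain a where a: "a \<in> A" "complex_of_vec y = \<phi> a" by auto
      then have "y = ?f (vec_of_complex a)"
        by (simp flip: a(2))
      then show "y \<in> ?f ` ?S"
        using a by (auto simp del: comp_apply intro!: image_eqI[of _ _ "vec_of_complex a"])
    qed
  qed
  have imgb: "?f ` ?S \<in> sets borel"
    unfolding img using measurable_sets[OF measurable_complex_of_vec A(3)] by (simp add: space_borel)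
  have "bounded (vec_of_complex ` \<phi> ` A)"
    by (rule bounded_linear_image[OF A(4) linear_vec_of_complex])
  moreover have "vec_of_complex ` \<phi> ` A = ?f ` ?S"
    unfolding img by (metis bijI' bij_vimage_eq_inv_image complex_of_vec_inverse inv_equality vec_of_complex_inverse)
  ultimately have bd: "bounded (?f ` ?S)" by simp
  then have lm: "?f ` ?S \<in> lmeasurable"
    using imgb by (intro bounded_set_imp_lmeasurable) auto
  have em: "emeasure lborel (?f ` ?S) = ennreal (measure lebesgue (?f ` ?S))"
    using lm imgb by (simp add: fmeasurable_def emeasure_eq_ennreal_measure less_top)
  have hi: "((\<lambda>x. \<bar>det (matrix (\<lambda>h. vec_of_complex (?d x * complex_of_vec h)))\<bar>) has_integral
      measure lebesgue (?f ` ?S)) ?S"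
    using has_measure_differentiable_image[OF _ der inj, of "measure lebesgue (?f ` ?S)"] Sb lm by auto
  then have hi2: "((\<lambda>x. indicator ?S x * (cmod (?d x))\<^sup>2) has_integral measure lebesgue (?f ` ?S)) UNIV"
  proof -
    have "(\<lambda>x. if x \<in> ?S then (cmod (?d x))\<^sup>2 else 0) = (\<lambda>x. indicator ?S x * (cmod (?d x))\<^sup>2)"
      by (auto simp: indicator_def)
    then show ?thesis
      using hi by (simp only: has_integral_restrict_UNIV[symmetric, of _ _ ?S] det_complex_mult abs_power2)
  qed
  have meas: "(\<lambda>w. indicator A w * (cmod (deriv \<phi> w))\<^sup>2) \<in> borel_measurable borel"
  proof -
    have "(\<lambda>w. (cmod (deriv \<phi> w))\<^sup>2) \<in> borel_measurable (restrict_space borel A)"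
      using continuous_on_subset[OF contd A(2)]
      by (intro borel_measurable_continuous_on_restrict continuous_intros)
    then show ?thesis
      using A(1) by (subst (asm) borel_measurable_restrict_space_iff) (auto simp: mult.commute)
  qed
  have meas2: "(\<lambda>x. indicator ?S x * (cmod (?d x))\<^sup>2) \<in> borel_measurable borel"
    using measurable_compose[OF measurable_complex_of_vec meas]
    by (simp add: indicator_def)
  have "(\<integral>\<^sup>+x. ennreal (indicator ?S x * (cmod (?d x))\<^sup>2) \<partial>lborel) = ennreal (measure lebesgue (?f ` ?S))"
    by (rule nn_integral_has_integral_lborel[OF meas2 _ hi2]) simp
  moreover have "(\<integral>\<^sup>+w. indicator A w * ennreal ((cmod (deriv \<phi> w))\<^sup>2) \<partial>lborel)
      = (\<integral>\<^sup>+w. ennreal (indicator A w * (cmod (deriv \<phi> w))\<^sup>2) \<partial>distr lborel borel complex_of_vec)"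
    by (subst lborel_complex_eq_distr[symmetric])
      (auto intro!: nn_integral_cong simp: indicator_def)
  moreover have "\<dots> = (\<integral>\<^sup>+x. ennreal (indicator ?S x * (cmod (?d x))\<^sup>2) \<partial>lborel)"
    using meas by (subst nn_integral_distr) (auto simp: indicator_def)
  moreover have "emeasure lborel (\<phi> ` A) = emeasure lborel (?f ` ?S)"
    unfolding img using A(3)
    by (subst lborel_complex_eq_distr) (simp add: emeasure_distr)
  ultimately show ?thesis
    using em by simp
qed

section \<open>Disk automorphisms and the pseudohyperbolic distance
  \<open>cmod (moebius a w)\<close>\<close>

definition moebius :: "complex \<Rightarrow> complex \<Rightarrow> complex"
  where "moebius a w = (a - w) / (1 - cnj a * w)"

lemma moebius_denom_nonzero:
  assumes "cmod a < 1" "cmod w < 1"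
  shows "1 - cnj a * w \<noteq> 0"
proof
  assume "1 - cnj a * w = 0"
  then have "cmod (cnj a * w) = 1"
    by (metis norm_one right_minus_eq)
  moreover have "cmod (cnj a * w) < 1"
    using assms mult_strict_mono'[of "cmod a" 1 "cmod w" 1] by (simp add: norm_mult)
  ultimately show False by simp
qed

lemma one_minus_norm_moebius:
  assumes "cmod a < 1" "cmod w < 1"
  shows "1 - (cmod (moebius a w))\<^sup>2
    = (1 - (cmod a)\<^sup>2) * (1 - (cmod w)\<^sup>2) / (cmod (1 - cnj a * w))\<^sup>2"
proof -
  have nz: "1 - cnj a * w \<noteq> 0" using moebius_denom_nonzero assms by blast
  have "(cmod (1 - cnj a * w))\<^sup>2 - (cmod (a - w))\<^sup>2 = (1 - (cmod a)\<^sup>2) * (1 - (cmod w)\<^sup>2)"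
    by (simp only: cmod_power2) (simp add: algebra_simps power2_eq_square)
  then show ?thesis
    using nz by (simp add: moebius_def norm_divide power_divide field_simps)
qed

lemma moebius_in_disk:
  assumes "cmod a < 1" "cmod w < 1"
  shows "cmod (moebius a w) < 1"
proof -
  have "0 < (1 - (cmod a)\<^sup>2) * (1 - (cmod w)\<^sup>2) / (cmod (1 - cnj a * w))\<^sup>2"
    using assms moebius_denom_nonzero[OF assms]
    by (intro divide_pos_pos mult_pos_pos) (auto simp: power_less_one_iff abs_square_less_1)
  then have "(cmod (moebius a w))\<^sup>2 < 1"
    using one_minus_norm_moebius[OF assms] by linarith
  then show ?thesis
    by (simp add: abs_square_less_1)
qed

lemma one_minus_cnj_mult_moebius:
  assumes "cmod a < 1" "cmod w < 1"
  shows "1 - cnj a * moebius a w = of_real (1 - (cmod a)\<^sup>2) / (1 - cnj a * w)"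
proof -
  have nz: "1 - cnj a * w \<noteq> 0" using moebius_denom_nonzero assms by blast
  have "1 - cnj a * moebius a w = (1 - cnj a * a) / (1 - cnj a * w)"
    using nz by (simp add: moebius_def field_simps)
  also have "1 - cnj a * a = of_real (1 - (cmod a)\<^sup>2)"
    using complex_norm_square[of a] by (simp add: mult.commute)
  finally show ?thesis .
qed

lemma moebius_moebius:
  assumes "cmod a < 1" "cmod w < 1"
  shows "moebius a (moebius a w) = w"
proof -
  have nz: "1 - cnj a * w \<noteq> 0" using moebius_denom_nonzero assms by blast
  have "(cmod a)\<^sup>2 \<noteq> 1" using assms by (auto simp: abs_square_eq_1)
  then have nz2: "complex_of_real (1 - (cmod a)\<^sup>2) \<noteq> 0"
    by (metis of_real_eq_0_iff right_minus_eq)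
  have "a - moebius a w = w * of_real (1 - (cmod a)\<^sup>2) / (1 - cnj a * w)"
    using nz complex_norm_square[of a] by (simp add: moebius_def field_simps)
  then show ?thesis
    using nz nz2 by (simp add: moebius_def[of a "moebius a w"] one_minus_cnj_mult_moebius[OF assms])
qed

lemma holomorphic_moebius: "cmod a < 1 \<Longrightarrow> moebius a holomorphic_on unit_disk"
  unfolding moebius_def using moebius_denom_nonzero by (intro holomorphic_intros) auto

text \<open>Up to sign the normalized kernel is the derivative of the automorphism, so its squared
  modulus is the Jacobian. This is why weighting a composition with \<open>moebius a\<close> by the
  kernel gives a unitary operator.\<close>

lemma deriv_moebius:
  assumes "cmod a < 1" "cmod w < 1"
  shows "deriv (moebius a) w = - normalized_kernel_fun a w"
proof -
  have nz: "1 - cnj a * w \<noteq> 0" using moebius_denom_nonzero assms by blast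
  have "((\<lambda>w. (a - w) / (1 - cnj a * w)) has_field_derivative
      ((0 - 1) * (1 - cnj a * w) - (a - w) * (0 - cnj a * 1)) / ((1 - cnj a * w) * (1 - cnj a * w))) (at w)"
    using nz by (intro derivative_eq_intros refl) auto
  then have "deriv (moebius a) w
      = ((0 - 1) * (1 - cnj a * w) - (a - w) * (0 - cnj a * 1)) / ((1 - cnj a * w) * (1 - cnj a * w))"
    unfolding moebius_def[abs_def] by (rule DERIV_imp_deriv)
  also have "(0 - 1) * (1 - cnj a * w) - (a - w) * (0 - cnj a * 1) = - of_real (1 - (cmod a)\<^sup>2)"
    using complex_norm_square[of a] by (simp add: algebra_simps)
  finally show ?thesis
    using assms by (simp add: normalized_kernel_fun_def power2_eq_square minus_divide_left)
qed

section \<open>Invariance of the area integral under disk automorphisms\<close>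

lemma measurable_borel_dA:
  assumes "f \<in> borel_measurable borel"
  shows "f \<in> borel_measurable dA"
proof -
  have "f \<in> borel_measurable (completion lborel)"
    using assms by (intro measurable_completion) simp
  then have "f \<in> borel_measurable (lebesgue_on unit_disk)"
    by (rule measurable_restrict_space1)
  then show ?thesis
    by (simp add: measurable_def)
qed

lemma nn_integral_dA:
  assumes f: "f \<in> borel_measurable borel"
  shows "(\<integral>\<^sup>+w. f w \<partial>dA) = (\<integral>\<^sup>+w. f w * indicator unit_disk w \<partial>lborel) / ennreal pi"
proof -
  have "f \<in> borel_measurable (completion lborel)"
    using f by (intro measurable_completion) simp
  then have m: "f \<in> borel_measurable (lebesgue_on unit_disk)"
    by (rule measurable_restrict_space1)
  have D: "unit_disk \<in> sets (lebesgue_on unit_disk)"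
    using sets.top[of "lebesgue_on unit_disk"] by simp
  have "emeasure (lebesgue_on unit_disk) unit_disk = emeasure lborel unit_disk"
    by (simp add: emeasure_restrict_space)
  also have "\<dots> = ennreal pi"
    using unit_ball_vol_2 by (simp add: emeasure_ball)
  finally have e: "emeasure (lebesgue_on unit_disk) unit_disk = ennreal pi" .
  have "(\<integral>\<^sup>+w. f w \<partial>dA) = (\<integral>\<^sup>+w. f w * indicator unit_disk w \<partial>lebesgue_on unit_disk) / ennreal pi"
    unfolding dA_def by (subst nn_integral_uniform_measure[OF m D]) (simp only: e)
  also have "(\<integral>\<^sup>+w. f w * indicator unit_disk w \<partial>lebesgue_on unit_disk)
      = (\<integral>\<^sup>+w. f w * indicator unit_disk w \<partial>lborel)"
    by (subst nn_integral_restrict_space)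
      (simp_all add: nn_integral_completion mult.assoc flip: indicator_inter_arith)
  finally show ?thesis .
qed

context
  fixes \<phi> :: "complex \<Rightarrow> complex"
  assumes hol: "\<phi> holomorphic_on unit_disk" and bij: "bij_betw \<phi> unit_disk unit_disk"
begin

lemma measurable_disk_automorphism:
  "(\<lambda>w. if w \<in> unit_disk then \<phi> w else 0) \<in> borel_measurable borel"
proof -
  have "continuous_on unit_disk \<phi>"
    by (intro holomorphic_on_imp_continuous_on hol)
  then show ?thesis
    by (intro borel_measurable_continuous_on_if) auto
qed

lemma measurable_deriv_disk_automorphism:
  "(\<lambda>w. indicator unit_disk w * (cmod (deriv \<phi> w))\<^sup>2) \<in> borel_measurable borel"
proof -
  have "continuous_on unit_disk (\<lambda>w. (cmod (deriv \<phi> w))\<^sup>2)"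
    using hol by (intro continuous_intros holomorphic_on_imp_continuous_on holomorphic_deriv) auto
  then have "(\<lambda>w. indicator unit_disk w *\<^sub>R (cmod (deriv \<phi> w))\<^sup>2) \<in> borel_measurable borel"
    by (intro borel_measurable_continuous_on_indicator) auto
  then show ?thesis by simp
qed

text \<open>The area formula, applied to the preimage of each Borel set. Invariance is put as an
  equality of image measures so that it serves both the nonnegative and the Bochner integral. The
  identity map on the right only moves \<open>dA\<close> to the Borel sets, and the value
  \<open>0\<close> off the disk makes the automorphism Borel on the plane.\<close>

lemma distr_disk_automorphism:
  "distr (density dA (\<lambda>w. ennreal (indicator unit_disk w * (cmod (deriv \<phi> w))\<^sup>2))) borel
      (\<lambda>w. if w \<in> unit_disk then \<phi> w else 0) = distr dA borel (\<lambda>w. w)"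
    (is "distr (density dA (\<lambda>w. ennreal (?k w))) _ ?m = _")
proof (rule measure_eqI)
  note m = measurable_disk_automorphism and k = measurable_deriv_disk_automorphism
  fix A assume "A \<in> sets (distr (density dA ?k) borel ?m)"
  then have A: "A \<in> sets borel" by simp
  let ?A = "{w \<in> unit_disk. \<phi> w \<in> A}"
  have A': "?A \<in> sets borel"
  proof -
    have "?A = unit_disk \<inter> (?m -` A \<inter> space borel)" by auto
    also have "\<dots> \<in> sets borel"
      by (intro sets.Int measurable_sets[OF m A]) auto
    finally show ?thesis .
  qed
  have img: "\<phi> ` ?A = A \<inter> unit_disk"
  proof
    show "\<phi> ` ?A \<subseteq> A \<inter> unit_disk"
      using bij_betwE[OF bij] by blast
    show "A \<inter> unit_disk \<subseteq> \<phi> ` ?A"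
    proof
      fix y assume y: "y \<in> A \<inter> unit_disk"
      then have "y \<in> \<phi> ` unit_disk"
        using bij_betw_imp_surj_on[OF bij] by (simp only: Int_iff)
      then show "y \<in> \<phi> ` ?A"
        using y by blast
    qed
  qed
  have ind: "(\<lambda>w. indicator A (?m w) :: ennreal) \<in> borel_measurable borel"
    using A by (intro measurable_compose[OF m] borel_measurable_indicator)
  have i: "(\<lambda>w. w) \<in> borel_measurable dA"
    by (rule measurable_borel_dA) simp
  have md: "?m \<in> density dA ?k \<rightarrow>\<^sub>M borel"
    using measurable_borel_dA[OF m] by simp
  have "emeasure (distr (density dA ?k) borel ?m) A
      = (\<integral>\<^sup>+w. indicator A w \<partial>distr (density dA ?k) borel ?m)"
    using A by simp
  also have "\<dots> = (\<integral>\<^sup>+w. indicator A (?m w) \<partial>density dA ?k)"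
    using A by (intro nn_integral_distr[OF md]) auto
  also have "\<dots> = (\<integral>\<^sup>+w. ennreal (?k w) * indicator A (?m w) \<partial>dA)"
  proof (rule nn_integral_density)
    show "(\<lambda>w. ennreal (?k w)) \<in> borel_measurable dA"
      using measurable_borel_dA[OF k] by simp
  qed (rule measurable_borel_dA[OF ind])
  also have "\<dots> = (\<integral>\<^sup>+w. ennreal (?k w) * indicator A (?m w) * indicator unit_disk w \<partial>lborel) / ennreal pi"
    using k ind by (intro nn_integral_dA borel_measurable_times_ennreal) simp_all
  also have "(\<integral>\<^sup>+w. ennreal (?k w) * indicator A (?m w) * indicator unit_disk w \<partial>lborel)
      = (\<integral>\<^sup>+w. indicator ?A w * ennreal ((cmod (deriv \<phi> w))\<^sup>2) \<partial>lborel)"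
    by (intro nn_integral_cong) (auto simp: indicator_def)
  also have "\<dots> = emeasure lborel (\<phi> ` ?A)"
  proof (rule nn_integral_norm_deriv_eq_emeasure_image[OF _ hol _ A'])
    show "\<phi> ` ?A \<in> sets borel" "bounded (\<phi> ` ?A)"
      unfolding img using A by (auto intro: bounded_Int)
    show "inj_on \<phi> unit_disk"
      using bij by (simp add: bij_betw_def)
  qed auto
  also have "\<dots> = (\<integral>\<^sup>+w. indicator (A \<inter> unit_disk) w \<partial>lborel)"
    unfolding img using A by (intro nn_integral_indicator[symmetric]) simp
  also have "\<dots> = (\<integral>\<^sup>+w. indicator A w * indicator unit_disk w \<partial>lborel)"
    by (intro nn_integral_cong) (auto simp: indicator_def)
  also have "\<dots> / ennreal pi = (\<integral>\<^sup>+w. indicator A w \<partial>dA)"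
    using A by (intro nn_integral_dA[symmetric] borel_measurable_indicator)
  also have "\<dots> = (\<integral>\<^sup>+w. indicator A w \<partial>distr dA borel (\<lambda>w. w))"
    using A by (intro nn_integral_distr[symmetric, OF i]) auto
  also have "\<dots> = emeasure (distr dA borel (\<lambda>w. w)) A"
    using A by simp
  finally show "emeasure (distr (density dA ?k) borel ?m) A = emeasure (distr dA borel (\<lambda>w. w)) A" .
qed simp

lemma nn_integral_disk_automorphism:
  assumes f: "f \<in> borel_measurable borel"
  shows "(\<integral>\<^sup>+w. ennreal ((cmod (deriv \<phi> w))\<^sup>2) * f (\<phi> w) \<partial>dA) = (\<integral>\<^sup>+w. f w \<partial>dA)"
proof -
  let ?k = "\<lambda>w. indicator unit_disk w * (cmod (deriv \<phi> w))\<^sup>2"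
  let ?m = "\<lambda>w. if w \<in> unit_disk then \<phi> w else 0"
  note m = measurable_disk_automorphism
  have i: "(\<lambda>w. w) \<in> borel_measurable dA"
    by (rule measurable_borel_dA) simp
  have md: "?m \<in> density dA ?k \<rightarrow>\<^sub>M borel"
    using measurable_borel_dA[OF m] by simp
  have "(\<integral>\<^sup>+w. f w \<partial>dA) = (\<integral>\<^sup>+w. f w \<partial>distr dA borel (\<lambda>w. w))"
    using f by (intro nn_integral_distr[symmetric, OF i]) simp
  also have "\<dots> = (\<integral>\<^sup>+w. f (?m w) \<partial>density dA ?k)"
    unfolding distr_disk_automorphism[symmetric] using f by (intro nn_integral_distr[OF md]) simp
  also have "\<dots> = (\<integral>\<^sup>+w. ennreal (?k w) * f (?m w) \<partial>dA)"
  proof (rule nn_integral_density)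
    show "(\<lambda>w. ennreal (?k w)) \<in> borel_measurable dA"
      using measurable_borel_dA[OF measurable_deriv_disk_automorphism] by simp
  qed (rule measurable_borel_dA[OF measurable_compose[OF m f]])
  also have "\<dots> = (\<integral>\<^sup>+w. ennreal ((cmod (deriv \<phi> w))\<^sup>2) * f (\<phi> w) \<partial>dA)"
    by (intro nn_integral_cong) simp
  finally show ?thesis by simp
qed

lemma
  fixes f :: "complex \<Rightarrow> 'b::{banach, second_countable_topology}"
  assumes f: "f \<in> borel_measurable borel"
  shows integrable_disk_automorphism: "integrable dA (\<lambda>w. (cmod (deriv \<phi> w))\<^sup>2 *\<^sub>R f (\<phi> w)) \<longleftrightarrow> integrable dA f"
      (is ?int)
    and integral_disk_automorphism: "(\<integral>w. (cmod (deriv \<phi> w))\<^sup>2 *\<^sub>R f (\<phi> w) \<partial>dA) = integral\<^sup>L dA f"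
      (is ?eq)
proof -
  let ?k = "\<lambda>w. indicator unit_disk w * (cmod (deriv \<phi> w))\<^sup>2"
  let ?m = "\<lambda>w. if w \<in> unit_disk then \<phi> w else 0"
  note m = measurable_disk_automorphism
  have k: "?k \<in> borel_measurable dA"
    by (rule measurable_borel_dA[OF measurable_deriv_disk_automorphism])
  have md: "?m \<in> density dA ?k \<rightarrow>\<^sub>M borel"
    using measurable_borel_dA[OF m] by simp
  have fm: "(\<lambda>w. f (?m w)) \<in> borel_measurable dA"
    by (rule measurable_borel_dA[OF measurable_compose[OF m f]])
  have i: "(\<lambda>w. w) \<in> borel_measurable dA"
    by (rule measurable_borel_dA) simp
  have k0: "AE w in dA. 0 \<le> ?k w" by simp
  have "integrable dA f \<longleftrightarrow> integrable (distr dA borel (\<lambda>w. w)) f"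
    using integrable_distr_eq[OF i f] by simp
  also have "\<dots> \<longleftrightarrow> integrable dA (\<lambda>w. ?k w *\<^sub>R f (?m w))"
    unfolding distr_disk_automorphism[symmetric] integrable_distr_eq[OF md f]
    by (rule integrable_density[OF fm k k0])
  also have "\<dots> \<longleftrightarrow> integrable dA (\<lambda>w. (cmod (deriv \<phi> w))\<^sup>2 *\<^sub>R f (\<phi> w))"
    by (intro Bochner_Integration.integrable_cong) auto
  finally show ?int by simp
  have "integral\<^sup>L dA f = integral\<^sup>L (distr dA borel (\<lambda>w. w)) f"
    using integral_distr[OF i f] by simp
  also have "\<dots> = (\<integral>w. ?k w *\<^sub>R f (?m w) \<partial>dA)"
    unfolding distr_disk_automorphism[symmetric] integral_distr[OF md f]
    by (rule integral_density[OF fm k k0])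
  also have "\<dots> = (\<integral>w. (cmod (deriv \<phi> w))\<^sup>2 *\<^sub>R f (\<phi> w) \<partial>dA)"
    by (intro Bochner_Integration.integral_cong) auto
  finally show ?eq by simp
qed

end

lemma bij_betw_moebius: "cmod a < 1 \<Longrightarrow> bij_betw (moebius a) unit_disk unit_disk"
  by (rule bij_betwI[of _ _ _ "moebius a"]) (auto simp: moebius_in_disk moebius_moebius)

lemma nn_integral_moebius:
  assumes a: "cmod a < 1" and f: "f \<in> borel_measurable borel"
  shows "(\<integral>\<^sup>+w. ennreal ((cmod (normalized_kernel_fun a w))\<^sup>2) * f (moebius a w) \<partial>dA) = (\<integral>\<^sup>+w. f w \<partial>dA)"
  unfolding nn_integral_disk_automorphism[OF holomorphic_moebius[OF a] bij_betw_moebius[OF a] f, symmetric]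
  by (intro nn_integral_cong) (simp add: deriv_moebius a)

lemma
  fixes f :: "complex \<Rightarrow> 'b::{banach, second_countable_topology}"
  assumes a: "cmod a < 1" and f: "f \<in> borel_measurable borel"
  shows integrable_moebius: "integrable dA (\<lambda>w. (cmod (normalized_kernel_fun a w))\<^sup>2 *\<^sub>R f (moebius a w)) \<longleftrightarrow> integrable dA f"
    and integral_moebius: "(\<integral>w. (cmod (normalized_kernel_fun a w))\<^sup>2 *\<^sub>R f (moebius a w) \<partial>dA) = integral\<^sup>L dA f"
proof -
  note rules = holomorphic_moebius[OF a] bij_betw_moebius[OF a] f
  show "integrable dA (\<lambda>w. (cmod (normalized_kernel_fun a w))\<^sup>2 *\<^sub>R f (moebius a w)) \<longleftrightarrow> integrable dA f"
    by (subst integrable_disk_automorphism[OF rules, symmetric])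
      (intro Bochner_Integration.integrable_cong, simp_all add: deriv_moebius a)
  show "(\<integral>w. (cmod (normalized_kernel_fun a w))\<^sup>2 *\<^sub>R f (moebius a w) \<partial>dA) = integral\<^sup>L dA f"
    by (subst integral_disk_automorphism[OF rules, symmetric])
      (intro Bochner_Integration.integral_cong, simp_all add: deriv_moebius a)
qed

lemma integral_rotation:
  fixes f :: "complex \<Rightarrow> 'b::{banach, second_countable_topology}"
  assumes c: "cmod c = 1" and f: "f \<in> borel_measurable borel"
  shows "(\<integral>w. f (c * w) \<partial>dA) = integral\<^sup>L dA f"
proof -
  have "c \<noteq> 0" using c by auto
  then have "bij_betw ((*) c) unit_disk unit_disk"
    using c by (intro bij_betwI[of _ _ _ "\<lambda>w. w / c"]) (auto simp: norm_mult norm_divide)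
  moreover have "((*) c) holomorphic_on unit_disk"
    by (intro holomorphic_intros)
  ultimately have "(\<integral>w. (cmod (deriv ((*) c) w))\<^sup>2 *\<^sub>R f (c * w) \<partial>dA) = integral\<^sup>L dA f"
    using f by (intro integral_disk_automorphism)
  moreover have "deriv ((*) c) w = c" for w
    using DERIV_cmult_Id[of c w UNIV] by (rule DERIV_imp_deriv)
  ultimately show ?thesis
    by (simp add: c)
qed

section \<open>Power series and the Littlewood-Paley identity\<close>

lemma integrable_bounded_dA:
  fixes f :: "complex \<Rightarrow> 'b::{banach, second_countable_topology}"
  assumes "f \<in> borel_measurable dA" "\<And>w. cmod w < 1 \<Longrightarrow> norm (f w) \<le> K"
  shows "integrable dA f"
proof -
  interpret finite_measure dA by (rule finite_measure_dA)
  show ?thesis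
    using assms by (intro integrable_const_bound[of _ K] AE_I2) auto
qed

lemma measure_dA_disk [simp]: "measure dA unit_disk = 1"
  using emeasure_dA_disk by (simp add: measure_def)

lemma sets_dA_borel: "A \<in> sets borel \<Longrightarrow> A \<subseteq> unit_disk \<Longrightarrow> A \<in> sets dA"
proof -
  assume A: "A \<in> sets borel" "A \<subseteq> unit_disk"
  then have "A \<in> sets lebesgue" by simp
  then have "A \<inter> unit_disk \<in> sets (lebesgue_on unit_disk)"
    by (subst sets_restrict_space) (metis Int_commute image_eqI)
  then show ?thesis using A by (simp add: Int_absorb2)
qed

lemma emeasure_dA_cball:
  assumes "0 \<le> r" "r < 1"
  shows "emeasure dA (cball 0 r) = ennreal (r\<^sup>2)"
proof -
  have sub: "cball 0 r \<subseteq> unit_disk" using assms by auto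
  then have "cball 0 r \<in> sets dA" by (intro sets_dA_borel) auto
  then have "emeasure dA (cball 0 r) = (\<integral>\<^sup>+w. indicator (cball 0 r) w \<partial>dA)"
    by simp
  also have "\<dots> = (\<integral>\<^sup>+w. indicator (cball 0 r) w * indicator unit_disk w \<partial>lborel) / ennreal pi"
    by (intro nn_integral_dA borel_measurable_indicator) auto
  also have "(\<integral>\<^sup>+w. indicator (cball 0 r) w * indicator unit_disk w \<partial>lborel)
      = (\<integral>\<^sup>+w. indicator (cball (0::complex) r) w \<partial>lborel)"
    using sub by (intro nn_integral_cong) (auto simp: indicator_def)
  also have "\<dots> = ennreal (pi * r\<^sup>2)"
    using assms by (subst nn_integral_indicator) (simp_all add: emeasure_cball unit_ball_vol_2)
  also have "\<dots> / ennreal pi = ennreal (r\<^sup>2)"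
    by (subst divide_ennreal) simp_all
  finally show ?thesis .
qed

text \<open>A substitute for polar coordinates: the disk of radius \<open>r\<close> has normalized
  area \<open>r\<^sup>2\<close>, so the squared modulus is uniformly distributed on the unit
  interval, and integrals of radial functions become integrals over an interval.\<close>

lemma distr_norm_square_dA:
  "distr dA borel (\<lambda>w. (cmod w)\<^sup>2) = density lborel (\<lambda>x. ennreal (indicator {0..1} x))"
    (is "?M = ?N")
proof (rule measure_eqI_lessThan)
  interpret finite_measure dA by (rule finite_measure_dA)
  have m[measurable]: "(\<lambda>w. (cmod w)\<^sup>2) \<in> borel_measurable dA"
    by (rule measurable_borel_dA) simp
  have N: "emeasure ?N {x<..} = emeasure lborel ({0..1} \<inter> {x<..})" for x
    by (subst emeasure_density) (auto simp: indicator_inter_arith[symmetric] ennreal_indicator)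
  fix x :: real
  have M: "emeasure ?M {x<..} = emeasure dA ((\<lambda>w. (cmod w)\<^sup>2) -` {x<..} \<inter> unit_disk)"
    by (subst emeasure_distr) auto
  show "emeasure ?M {x<..} < \<infinity>"
    unfolding M using emeasure_finite by (simp add: less_top[symmetric])
  show "emeasure ?M {x<..} = emeasure ?N {x<..}"
  proof (cases "x < 0")
    case True
    then have "(\<lambda>w. (cmod w)\<^sup>2) -` {x<..} \<inter> unit_disk = unit_disk"
      by (auto intro: less_le_trans[OF _ zero_le_power2])
    moreover have "{0..1} \<inter> {x<..} = {0..1}" using True by auto
    ultimately show ?thesis
      unfolding M N by (simp add: emeasure_dA_disk)
  next
    case x0: False
    show ?thesis
    proof (cases "x < 1")
      case True
      have eq: "(\<lambda>w. (cmod w)\<^sup>2) -` {x<..} \<inter> unit_disk = unit_disk - cball 0 (sqrt x)"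
        using x0 by (auto simp: real_le_rsqrt real_less_rsqrt) (metis not_less real_sqrt_le_iff real_sqrt_abs abs_norm_cancel)+
      have i: "{0..1} \<inter> {x<..} = {x<..1}" using x0 by auto
      have sq: "sqrt x < 1" using True by simp
      have "cball 0 (sqrt x) \<in> sets dA"
        using sq by (intro sets_dA_borel) (auto intro: order_le_less_trans[OF _ sq])
      moreover have "unit_disk \<in> sets dA"
        using sets.top[of dA] by simp
      ultimately have "emeasure dA (unit_disk - cball 0 (sqrt x)) = emeasure dA unit_disk - emeasure dA (cball 0 (sqrt x))"
        using sq by (intro emeasure_Diff) (auto simp: emeasure_finite intro: order_le_less_trans[OF _ sq])
      also have "\<dots> = ennreal (1 - x)"
        using x0 sq by (simp add: emeasure_dA_disk emeasure_dA_cball flip: ennreal_1 ennreal_minus)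
      finally show ?thesis
        using True x0 by (simp add: M N eq i)
    next
      case False
      then have "(\<lambda>w. (cmod w)\<^sup>2) -` {x<..} \<inter> unit_disk = {}"
        using power_le_one[OF norm_ge_zero less_imp_le, of _ 2] by (fastforce simp: not_less)
      moreover have "{0..1} \<inter> {x<..} = {}" using False by auto
      ultimately show ?thesis unfolding M N by simp
    qed
  qed
qed simp_all

lemma integral_norm_power:
  assumes "0 \<le> r" "r \<le> 1"
  shows "(\<integral>w. indicat_real (ball 0 r) w * (cmod w) ^ (2 * n) \<partial>dA) = r ^ (2 * n + 2) / real (n + 1)"
proof -
  let ?f = "\<lambda>t. indicat_real {..<r\<^sup>2} t * t ^ n"
  have m: "(\<lambda>w. (cmod w)\<^sup>2) \<in> borel_measurable dA"
    by (rule measurable_borel_dA) simp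
  have "(\<integral>w. indicat_real (ball 0 r) w * (cmod w) ^ (2 * n) \<partial>dA) = (\<integral>w. ?f ((cmod w)\<^sup>2) \<partial>dA)"
  proof (intro Bochner_Integration.integral_cong refl)
    fix w :: complex
    have "cmod w < r \<longleftrightarrow> (cmod w)\<^sup>2 < r\<^sup>2"
      using assms by (metis norm_ge_zero power_less_imp_less_base power_strict_mono zero_less_numeral)
    then show "indicat_real (ball 0 r) w * (cmod w) ^ (2 * n) = ?f ((cmod w)\<^sup>2)"
      by (simp add: indicator_def power_mult)
  qed
  also have "\<dots> = integral\<^sup>L (distr dA borel (\<lambda>w. (cmod w)\<^sup>2)) ?f"
    by (rule integral_distr[OF m, symmetric]) measurable
  also have "\<dots> = (\<integral>t. indicator {0..1} t *\<^sub>R ?f t \<partial>lborel)"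
    unfolding distr_norm_square_dA by (rule integral_density) auto
  also have "\<dots> = (\<integral>t. t ^ n * indicator {0..r\<^sup>2} t \<partial>lborel)"
  proof (rule integral_cong_AE)
    have "r\<^sup>2 \<le> 1" using assms by (simp add: power_le_one)
    with AE_lborel_singleton[of "r\<^sup>2"] show "AE t in lborel. indicator {0..1} t *\<^sub>R ?f t = t ^ n * indicator {0..r\<^sup>2} t"
      by (auto simp: indicator_def elim!: eventually_mono)
  qed measurable
  also have "\<dots> = r ^ (2 * n + 2) / real (n + 1)"
    by (subst integral_power) (simp_all add: power_mult power_mult_distrib power2_eq_square)
  finally show ?thesis .
qed

lemma integral_monomials:
  assumes "0 \<le> r" "r \<le> 1"
  shows "(\<integral>w. indicat_real (ball 0 r) w *\<^sub>R (w ^ m * cnj w ^ n) \<partial>dA)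
    = (if m = n then of_real (r ^ (2 * n + 2) / real (n + 1)) else 0)"
proof (cases "m = n")
  case True
  have "(\<integral>w. indicat_real (ball 0 r) w *\<^sub>R (w ^ n * cnj w ^ n) \<partial>dA)
      = (\<integral>w. complex_of_real (indicat_real (ball 0 r) w * (cmod w) ^ (2 * n)) \<partial>dA)"
  proof (intro Bochner_Integration.integral_cong refl)
    fix w :: complex
    have "w ^ n * cnj w ^ n = (w * cnj w) ^ n"
      by (simp add: power_mult_distrib)
    also have "\<dots> = (of_real ((cmod w)\<^sup>2)) ^ n"
      by (simp only: complex_norm_square)
    also have "\<dots> = of_real ((cmod w) ^ (2 * n))"
      by (simp add: power_mult)
    finally show "indicat_real (ball 0 r) w *\<^sub>R (w ^ n * cnj w ^ n)
        = complex_of_real (indicat_real (ball 0 r) w * (cmod w) ^ (2 * n))"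
      by (simp add: scaleR_conv_of_real)
  qed
  then show ?thesis
    using True by (simp only: integral_complex_of_real integral_norm_power[OF assms] if_True simp_thms)
next
  case False
  let ?f = "\<lambda>w. indicat_real (ball 0 r) w *\<^sub>R (w ^ m * cnj w ^ n)"
  \<comment> \<open>Rotation by this angle multiplies the integrand by \<open>cis pi = -1\<close>
    while preserving the measure and the ball, so the integral equals its own negative.\<close>
  let ?t = "pi / (real m - real n)"
  have [measurable]: "(\<lambda>w. cnj w) \<in> borel_measurable borel"
    by (intro borel_measurable_continuous_onI continuous_intros)
  have [measurable]: "indicat_real (ball (0::complex) r) \<in> borel_measurable borel"
    by (intro borel_measurable_indicator) simp
  have f: "?f \<in> borel_measurable borel"
    by measurable
  have "cis ?t ^ m * cnj (cis ?t) ^ n = cis (real m * ?t - real n * ?t)"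
    by (simp only: cis_cnj Complex.DeMoivre cis_mult) (simp add: field_simps)
  also have "real m * ?t - real n * ?t = pi"
    unfolding left_diff_distrib[symmetric] using False by simp
  finally have c: "cis ?t ^ m * cnj (cis ?t) ^ n = -1"
    by simp
  have "integral\<^sup>L dA ?f = (\<integral>w. ?f (cis ?t * w) \<partial>dA)"
    using f by (intro integral_rotation[symmetric]) simp_all
  also have "\<dots> = (\<integral>w. (cis ?t ^ m * cnj (cis ?t) ^ n) * ?f w \<partial>dA)"
    by (intro Bochner_Integration.integral_cong refl)
      (simp add: indicator_def norm_mult power_mult_distrib)
  also have "\<dots> = - integral\<^sup>L dA ?f"
    unfolding c by simp
  finally have "integral\<^sup>L dA ?f = 0"
    by simp
  then show ?thesis using False by simp
qed

lemma indicator_ball_measurable [measurable]: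
  "indicat_real (ball (0::complex) r) \<in> borel_measurable dA"
  by (intro measurable_borel_dA borel_measurable_indicator) simp

lemma measurable_cnj [measurable]: "cnj \<in> borel_measurable borel"
  by (intro borel_measurable_continuous_onI continuous_intros)

section \<open>Parseval's identity on concentric balls\<close>

context
  fixes a :: "nat \<Rightarrow> complex" and f :: "complex \<Rightarrow> complex"
  assumes sums: "\<And>w. cmod w < 1 \<Longrightarrow> (\<lambda>n. a n * w ^ n) sums f w"
begin

lemma power_series_holomorphic_disk: "f holomorphic_on unit_disk"
  by (rule power_series_holomorphic[where a = a]) (use sums in simp)

lemma power_series_summable_norm:
  assumes "0 \<le> r" "r < 1"
  shows "summable (\<lambda>n. cmod (a n) * r ^ n)"
proof -
  define s :: complex where "s = of_real ((r + 1) / 2)"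
  have s: "cmod s = (r + 1) / 2" using assms by (simp add: s_def del: of_real_divide of_real_add)
  then have "summable (\<lambda>n. a n * s ^ n)"
    using sums[of s] assms by (auto simp: sums_iff)
  from powser_insidea[OF this, of "of_real r"] show ?thesis
    using assms s by (simp add: norm_mult norm_power)
qed

lemma power_series_measurable [measurable]: "f \<in> borel_measurable dA"
  by (rule holomorphic_measurable_dA[OF power_series_holomorphic_disk])

lemma power_series_norm_le:
  assumes "0 \<le> r" "r < 1" "cmod w \<le> r"
  shows "cmod (f w) \<le> (\<Sum>n. cmod (a n) * r ^ n)"
proof -
  have s: "(\<lambda>n. a n * w ^ n) sums f w" using sums assms by simp
  have le: "cmod (a n * w ^ n) \<le> cmod (a n) * r ^ n" for n
    using assms by (auto simp: norm_mult norm_power intro!: mult_left_mono power_mono)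
  have "summable (\<lambda>n. cmod (a n * w ^ n))"
    by (rule summable_comparison_test'[OF power_series_summable_norm[OF assms(1,2)], of 0]) (use le in auto)
  then have "cmod (f w) \<le> (\<Sum>n. cmod (a n * w ^ n))"
    using summable_norm[of "\<lambda>n. a n * w ^ n"] s by (simp add: sums_iff)
  also have "\<dots> \<le> (\<Sum>n. cmod (a n) * r ^ n)"
    by (rule suminf_le[OF le \<open>summable (\<lambda>n. cmod (a n * w ^ n))\<close> power_series_summable_norm[OF assms(1,2)]])
  finally show ?thesis .
qed

lemma integral_power_series_sums:
  assumes r: "0 \<le> r" "r < 1" and g[measurable]: "g \<in> borel_measurable dA"
    and K: "\<And>w. cmod w < r \<Longrightarrow> cmod (g w) \<le> K"
  shows "(\<lambda>n. a n * (\<integral>w. indicat_real (ball 0 r) w *\<^sub>R (w ^ n * g w) \<partial>dA))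
    sums (\<integral>w. indicat_real (ball 0 r) w *\<^sub>R (f w * g w) \<partial>dA)"
proof -
  let ?f = "\<lambda>n w. indicat_real (ball 0 r) w *\<^sub>R (a n * w ^ n * g w)"
  have idm[measurable]: "(\<lambda>w. w) \<in> borel_measurable dA"
    by (rule measurable_borel_dA) simp
  have K0: "\<bar>K\<bar> \<ge> 0" by simp
  have b: "cmod (?f n w) \<le> cmod (a n) * r ^ n * \<bar>K\<bar>" for n w
  proof (cases "cmod w < r")
    case True
    then have "cmod (g w) \<le> \<bar>K\<bar>" using K[of w] by simp
    moreover have "cmod w ^ n \<le> r ^ n" using True by (intro power_mono) auto
    ultimately have "cmod (a n) * cmod w ^ n * cmod (g w) \<le> cmod (a n) * r ^ n * \<bar>K\<bar>"
      using r by (intro mult_mono[of "cmod (a n) * cmod w ^ n"] mult_left_mono) auto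
    then show ?thesis
      using True by (simp add: norm_mult norm_power)
  qed (use r in simp)
  have i: "integrable dA (?f n)" for n
    by (rule integrable_bounded_dA[of _ "cmod (a n) * r ^ n * \<bar>K\<bar>"]) (measurable, use b in blast)
  have sK: "summable (\<lambda>n. cmod (a n) * r ^ n * \<bar>K\<bar>)"
    by (intro summable_mult2 power_series_summable_norm r)
  have "(\<lambda>n. integral\<^sup>L dA (?f n)) sums (\<integral>w. (\<Sum>n. ?f n w) \<partial>dA)"
  proof (rule sums_integral[OF i])
    show "AE w in dA. summable (\<lambda>n. norm (?f n w))"
      by (intro AE_I2 summable_comparison_test'[OF sK, of 0]) (use b in auto)
    show "summable (\<lambda>n. \<integral>w. norm (?f n w) \<partial>dA)"
    proof (rule summable_comparison_test'[OF sK, of 0])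
      fix n
      have "(\<integral>w. norm (?f n w) \<partial>dA) \<le> (\<integral>w. cmod (a n) * r ^ n * \<bar>K\<bar> \<partial>dA)"
        by (intro integral_mono integrable_norm i b integrable_bounded_dA[of _ "cmod (a n) * r ^ n * \<bar>K\<bar>"])
          (use r in auto)
      then show "norm (\<integral>w. norm (?f n w) \<partial>dA) \<le> cmod (a n) * r ^ n * \<bar>K\<bar>"
        by simp
    qed
  qed
  moreover have "(\<integral>w. (\<Sum>n. ?f n w) \<partial>dA) = (\<integral>w. indicat_real (ball 0 r) w *\<^sub>R (f w * g w) \<partial>dA)"
  proof (intro Bochner_Integration.integral_cong refl)
    fix w assume "w \<in> space dA"
    then have "(\<lambda>n. indicat_real (ball 0 r) w *\<^sub>R (a n * w ^ n * g w)) sums (indicat_real (ball 0 r) w *\<^sub>R (f w * g w))"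
      by (intro sums_scaleR_right sums_mult2 sums) simp
    then show "(\<Sum>n. ?f n w) = indicat_real (ball 0 r) w *\<^sub>R (f w * g w)"
      by (simp add: sums_iff)
  qed
  moreover have "integral\<^sup>L dA (?f n) = a n * (\<integral>w. indicat_real (ball 0 r) w *\<^sub>R (w ^ n * g w) \<partial>dA)" for n
    by (subst integral_mult_right_zero[symmetric]) (simp add: mult.assoc)
  ultimately show ?thesis by simp
qed

lemma integral_power_series_cnj_power:
  assumes r: "0 \<le> r" "r < 1"
  shows "(\<integral>w. indicat_real (ball 0 r) w *\<^sub>R (f w * cnj w ^ n) \<partial>dA) = a n * of_real (r ^ (2 * n + 2) / real (n + 1))"
proof -
  have [measurable]: "(\<lambda>w. cnj w ^ n) \<in> borel_measurable dA"
    by (rule measurable_borel_dA) measurable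
  have "(\<lambda>m. a m * (\<integral>w. indicat_real (ball 0 r) w *\<^sub>R (w ^ m * cnj w ^ n) \<partial>dA))
    sums (\<integral>w. indicat_real (ball 0 r) w *\<^sub>R (f w * cnj w ^ n) \<partial>dA)"
    by (rule integral_power_series_sums[OF r, of _ 1])
      (use r in \<open>auto simp: norm_power intro!: power_le_one\<close>)
  moreover have "a m * (\<integral>w. indicat_real (ball 0 r) w *\<^sub>R (w ^ m * cnj w ^ n) \<partial>dA)
      = (if m = n then a m * of_real (r ^ (2 * m + 2) / real (m + 1)) else 0)" for m
    using r by (simp add: integral_monomials)
  ultimately have "(\<lambda>m. if m = n then a m * of_real (r ^ (2 * m + 2) / real (m + 1)) else 0)
      sums (\<integral>w. indicat_real (ball 0 r) w *\<^sub>R (f w * cnj w ^ n) \<partial>dA)"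
    by (simp only:)
  then show ?thesis
    by (rule sums_unique2[OF _ sums_single])
qed

lemma parseval_ball:
  assumes r: "0 \<le> r" "r < 1"
  shows "(\<lambda>n. (cmod (a n))\<^sup>2 * r ^ (2 * n + 2) / real (n + 1))
    sums (\<integral>w. indicat_real (ball 0 r) w * (cmod (f w))\<^sup>2 \<partial>dA)"
proof -
  have [measurable]: "(\<lambda>w. cnj (f w)) \<in> borel_measurable dA"
    by (rule measurable_compose[OF power_series_measurable measurable_cnj])
  have "(\<lambda>n. a n * (\<integral>w. indicat_real (ball 0 r) w *\<^sub>R (w ^ n * cnj (f w)) \<partial>dA))
    sums (\<integral>w. indicat_real (ball 0 r) w *\<^sub>R (f w * cnj (f w)) \<partial>dA)"
    by (rule integral_power_series_sums[OF r, of _ "\<Sum>n. cmod (a n) * r ^ n"])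
      (use power_series_norm_le[OF r] in auto)
  moreover have "a n * (\<integral>w. indicat_real (ball 0 r) w *\<^sub>R (w ^ n * cnj (f w)) \<partial>dA)
      = of_real ((cmod (a n))\<^sup>2 * r ^ (2 * n + 2) / real (n + 1))" for n
  proof -
    have "(\<integral>w. indicat_real (ball 0 r) w *\<^sub>R (w ^ n * cnj (f w)) \<partial>dA)
        = cnj (\<integral>w. indicat_real (ball 0 r) w *\<^sub>R (f w * cnj w ^ n) \<partial>dA)"
      by (subst Bochner_Integration.integral_cnj[symmetric]) (simp add: mult.commute scaleR_conv_of_real)
    also have "\<dots> = cnj (a n) * of_real (r ^ (2 * n + 2) / real (n + 1))"
      by (simp add: integral_power_series_cnj_power[OF r])
    finally have "a n * (\<integral>w. indicat_real (ball 0 r) w *\<^sub>R (w ^ n * cnj (f w)) \<partial>dA)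
        = (a n * cnj (a n)) * of_real (r ^ (2 * n + 2) / real (n + 1))"
      by simp
    then show ?thesis
      by (simp only: complex_norm_square[symmetric] of_real_mult[symmetric] times_divide_eq_right)
  qed
  moreover have "(\<integral>w. indicat_real (ball 0 r) w *\<^sub>R (f w * cnj (f w)) \<partial>dA)
      = of_real (\<integral>w. indicat_real (ball 0 r) w * (cmod (f w))\<^sup>2 \<partial>dA)"
    by (simp only: scaleR_conv_of_real complex_norm_square[symmetric] of_real_mult[symmetric] integral_complex_of_real)
  ultimately show ?thesis
    by (simp only: sums_of_real_iff)
qed

end

lemma holomorphic_sums:
  assumes "f holomorphic_on unit_disk" "cmod w < 1"
  shows "(\<lambda>n. (deriv ^^ n) f 0 / fact n * w ^ n) sums f w"
  using holomorphic_power_series[OF assms(1), of w] assms(2) by simp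

lemma radii_tendsto_1: "(\<lambda>k. 1 - 1 / (real k + 2)) \<longlonglongrightarrow> 1"
  by real_asymp

text \<open>Integrating the power series over \<open>ball 0 r\<close> leaves
  \<open>f 0 * r\<^sup>2\<close>; dominated convergence then lets \<open>r\<close> tend to
  \<open>1\<close>.\<close>

lemma mean_value_dA:
  assumes f: "f holomorphic_on unit_disk" and i: "integrable dA f"
  shows "integral\<^sup>L dA f = f 0"
proof -
  let ?r = "\<lambda>k. 1 - 1 / (real k + 2)"
  have m[measurable]: "f \<in> borel_measurable dA"
    by (rule holomorphic_measurable_dA[OF f])
  have "(\<lambda>k. \<integral>w. indicat_real (ball 0 (?r k)) w *\<^sub>R f w \<partial>dA) \<longlonglongrightarrow> integral\<^sup>L dA f"
  proof (rule integral_dominated_convergence[where w = "\<lambda>w. norm (f w)"])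
    show "AE w in dA. (\<lambda>k. indicat_real (ball 0 (?r k)) w *\<^sub>R f w) \<longlonglongrightarrow> f w"
    proof (rule AE_I2)
      fix w assume "w \<in> space dA"
      then have "\<forall>\<^sub>F k in sequentially. cmod w < ?r k"
        by (intro order_tendstoD(1)[OF radii_tendsto_1]) simp
      then have "\<forall>\<^sub>F k in sequentially. indicat_real (ball 0 (?r k)) w *\<^sub>R f w = f w"
        by eventually_elim simp
      then show "(\<lambda>k. indicat_real (ball 0 (?r k)) w *\<^sub>R f w) \<longlonglongrightarrow> f w"
        by (rule tendsto_eventually)
    qed
    show "(\<lambda>w. indicat_real (ball 0 (?r k)) w *\<^sub>R f w) \<in> borel_measurable dA" for k
      by measurable
    show "integrable dA (\<lambda>w. norm (f w))"
      using i by (rule integrable_norm)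
  qed (use m in \<open>auto simp: indicator_def\<close>)
  moreover have "(\<integral>w. indicat_real (ball 0 (?r k)) w *\<^sub>R f w \<partial>dA) = f 0 * of_real ((?r k)\<^sup>2)" for k
    using integral_power_series_cnj_power[OF holomorphic_sums[OF f], of "?r k" 0]
    by (simp add: power2_eq_square)
  moreover have "(\<lambda>k. f 0 * of_real ((?r k)\<^sup>2)) \<longlonglongrightarrow> f 0 * of_real (1\<^sup>2)"
    by (intro tendsto_intros radii_tendsto_1)
  ultimately show ?thesis
    using LIMSEQ_unique by fastforce
qed

text \<open>In Parseval's identity the coefficient of index \<open>n\<close> contributes in
  proportion to \<open>r ^ (2 * n + 2)\<close>, so every term loses at least the factor
  \<open>(r / R)\<^sup>2\<close>. An analytic function therefore cannot concentrate its mass near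
  the center, which is what makes Blaschke multipliers bounded below.\<close>

lemma integral_ball_le:
  assumes f: "f holomorphic_on unit_disk" and r: "0 \<le> r" "r \<le> R" "0 < R" "R < 1"
  shows "(\<integral>w. indicat_real (ball 0 r) w * (cmod (f w))\<^sup>2 \<partial>dA)
    \<le> (r / R)\<^sup>2 * (\<integral>w. indicat_real (ball 0 R) w * (cmod (f w))\<^sup>2 \<partial>dA)"
proof -
  let ?a = "\<lambda>n. (deriv ^^ n) f 0 / fact n"
  have R: "(\<lambda>n. (r / R)\<^sup>2 * ((cmod (?a n))\<^sup>2 * R ^ (2 * n + 2) / real (n + 1)))
      sums ((r / R)\<^sup>2 * (\<integral>w. indicat_real (ball 0 R) w * (cmod (f w))\<^sup>2 \<partial>dA))"
    using r by (intro sums_mult parseval_ball[OF holomorphic_sums[OF f]]) auto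
  have r': "(\<lambda>n. (cmod (?a n))\<^sup>2 * r ^ (2 * n + 2) / real (n + 1))
      sums (\<integral>w. indicat_real (ball 0 r) w * (cmod (f w))\<^sup>2 \<partial>dA)"
    using r by (intro parseval_ball[OF holomorphic_sums[OF f]]) auto
  show ?thesis
  proof (rule sums_le[OF _ r' R])
    fix n
    have "r ^ (2 * n) \<le> R ^ (2 * n)"
      using r by (intro power_mono) auto
    then have "r\<^sup>2 * r ^ (2 * n) \<le> r\<^sup>2 * R ^ (2 * n)"
      by (rule mult_left_mono) simp
    also have "r\<^sup>2 * R ^ (2 * n) = (r / R)\<^sup>2 * R ^ (2 * n + 2)"
      using r by (simp add: power_divide power_add power2_eq_square)
    finally have "r ^ (2 * n + 2) \<le> (r / R)\<^sup>2 * R ^ (2 * n + 2)"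
      by (simp add: power_add power2_eq_square mult_ac)
    then have "(cmod (?a n))\<^sup>2 * r ^ (2 * n + 2) / real (n + 1)
        \<le> (cmod (?a n))\<^sup>2 * ((r / R)\<^sup>2 * R ^ (2 * n + 2)) / real (n + 1)"
      by (intro divide_right_mono mult_left_mono) auto
    then show "(cmod (?a n))\<^sup>2 * r ^ (2 * n + 2) / real (n + 1)
        \<le> (r / R)\<^sup>2 * ((cmod (?a n))\<^sup>2 * R ^ (2 * n + 2) / real (n + 1))"
      by (simp only: mult_ac times_divide_eq_right)
  qed
qed

lemma power_series_shift_sums:
  fixes a :: "nat \<Rightarrow> complex"
  assumes "(\<lambda>n. a n * w ^ n) sums s"
  shows "(\<lambda>n. (if n < N then 0 else a (n - N)) * w ^ n) sums (w ^ N * s)"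
proof -
  have "(\<lambda>n. w ^ N * (a n * w ^ n)) sums (w ^ N * s)"
    by (rule sums_mult[OF assms])
  then have "(\<lambda>n. (if n + N < N then 0 else a (n + N - N)) * w ^ (n + N)) sums (w ^ N * s)"
    by (simp add: power_add mult_ac)
  from sums_iff_shift'[of "\<lambda>n. (if n < N then 0 else a (n - N)) * w ^ n" N, THEN iffD1] this
  show ?thesis
    using sums_iff_shift'[of "\<lambda>n. (if n < N then 0 else a (n - N)) * w ^ n" N "w ^ N * s"] by simp
qed

text \<open>
  Parseval on balls, applied to \<open>w\<^sup>N f\<close> with \<open>N\<close> tending to infinity, replaces integration over circles.
\<close>

lemma sum_coeff_square_le:
  assumes f: "\<And>w. cmod w < 1 \<Longrightarrow> (\<lambda>n. a n * w ^ n) sums f w"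
    and K: "\<And>w. cmod w < 1 \<Longrightarrow> cmod (f w) \<le> K" and r: "0 < r" "r < 1"
  shows "(\<Sum>n<M. (cmod (a n))\<^sup>2 * r ^ (2 * n)) \<le> K\<^sup>2"
proof -
  have K0: "0 \<le> K" using K[of 0] by (auto intro: order_trans[OF norm_ge_zero])
  have m: "f \<in> borel_measurable dA"
    by (rule power_series_measurable[OF f])
  \<comment> \<open>Parseval for \<open>w ^ N * f w\<close> is compared with
    \<open>K\<^sup>2\<close> times the integral of \<open>cmod w ^ (2 * N)\<close>. Dividing by that
    integral leaves the weight \<open>(N + 1) / (n + N + 1)\<close>, which tends to \<open>1\<close>
    as \<open>N\<close> grows with \<open>n\<close> fixed.\<close>
  have bound: "(\<Sum>n<M. (cmod (a n))\<^sup>2 * r ^ (2 * n) * (real (N + 1) / real (n + N + 1))) \<le> K\<^sup>2" for N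
  proof -
    let ?b = "\<lambda>n. if n < N then 0 else a (n - N)"
    let ?t = "\<lambda>n. (cmod (?b n))\<^sup>2 * r ^ (2 * n + 2) / real (n + 1)"
    have "?t sums (\<integral>w. indicat_real (ball 0 r) w * (cmod (w ^ N * f w))\<^sup>2 \<partial>dA)"
      using r by (intro parseval_ball power_series_shift_sums f) auto
    then have s: "(\<lambda>n. ?t (n + N)) sums (\<integral>w. indicat_real (ball 0 r) w * (cmod (w ^ N * f w))\<^sup>2 \<partial>dA)"
      by (subst sums_iff_shift) simp
    have [measurable]: "f \<in> borel_measurable dA" "(\<lambda>w. w) \<in> borel_measurable dA"
      using m by (auto intro: measurable_borel_dA)
    have "(\<Sum>n<M. ?t (n + N)) \<le> (\<integral>w. indicat_real (ball 0 r) w * (cmod (w ^ N * f w))\<^sup>2 \<partial>dA)"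
      unfolding sums_unique[OF s] using sums_summable[OF s] r by (intro sum_le_suminf) auto
    also have "\<dots> \<le> (\<integral>w. K\<^sup>2 * (indicat_real (ball 0 r) w * (cmod w) ^ (2 * N)) \<partial>dA)"
    proof (rule integral_mono)
      have le: "(cmod (w ^ N * f w))\<^sup>2 \<le> K\<^sup>2 * (cmod w) ^ (2 * N)" if "cmod w < 1" for w
      proof -
        have "(cmod (w ^ N * f w))\<^sup>2 = (cmod w) ^ (2 * N) * (cmod (f w))\<^sup>2"
          by (simp add: norm_mult norm_power power_mult_distrib power_mult mult.commute flip: power_mult)
        also have "\<dots> \<le> (cmod w) ^ (2 * N) * K\<^sup>2"
          using K[OF that] by (intro mult_left_mono power_mono) auto
        finally show ?thesis by (simp add: mult.commute)
      qed
      have le1: "(cmod w) ^ (2 * N) \<le> 1" if "cmod w < 1" for w :: complex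
        using that by (intro power_le_one) auto
      show "indicat_real (ball 0 r) w * (cmod (w ^ N * f w))\<^sup>2 \<le> K\<^sup>2 * (indicat_real (ball 0 r) w * (cmod w) ^ (2 * N))"
        if "w \<in> space dA" for w
        using le[of w] that by (auto simp: indicator_def)
      show "integrable dA (\<lambda>w. K\<^sup>2 * (indicat_real (ball 0 r) w * (cmod w) ^ (2 * N)))"
        using le1 by (intro integrable_bounded_dA[of _ "K\<^sup>2"]) (auto simp: indicator_def mult_left_le)
      show "integrable dA (\<lambda>w. indicat_real (ball 0 r) w * (cmod (w ^ N * f w))\<^sup>2)"
      proof (rule integrable_bounded_dA[of _ "K\<^sup>2"])
        fix w :: complex assume w: "cmod w < 1"
        have "K\<^sup>2 * (cmod w) ^ (2 * N) \<le> K\<^sup>2"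
          using le1[OF w] by (simp add: mult_left_le)
        then show "norm (indicat_real (ball 0 r) w * (cmod (w ^ N * f w))\<^sup>2) \<le> K\<^sup>2"
          using le[OF w] by (auto simp: indicator_def)
      qed measurable
    qed
    also have "\<dots> = K\<^sup>2 * (r ^ (2 * N + 2) / real (N + 1))"
      using r by (simp add: integral_norm_power)
    finally have "(\<Sum>n<M. (cmod (a n))\<^sup>2 * r ^ (2 * (n + N) + 2) / real (n + N + 1)) \<le> K\<^sup>2 * (r ^ (2 * N + 2) / real (N + 1))"
      by simp
    then have "(\<Sum>n<M. (cmod (a n))\<^sup>2 * r ^ (2 * (n + N) + 2) / real (n + N + 1)) * (real (N + 1) / r ^ (2 * N + 2))
        \<le> K\<^sup>2 * (r ^ (2 * N + 2) / real (N + 1)) * (real (N + 1) / r ^ (2 * N + 2))"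
      using r by (intro mult_right_mono) auto
    also have "\<dots> = K\<^sup>2" using r by simp
    finally have le: "(\<Sum>n<M. (cmod (a n))\<^sup>2 * r ^ (2 * (n + N) + 2) / real (n + N + 1) * (real (N + 1) / r ^ (2 * N + 2))) \<le> K\<^sup>2"
      by (simp only: sum_distrib_right)
    have "x * r ^ (2 * (n + N) + 2) / y * (z / r ^ (2 * N + 2)) = x * r ^ (2 * n) * (z / y)" for n x y z
    proof -
      have "r ^ (2 * (n + N) + 2) = r ^ (2 * n) * r ^ (2 * N + 2)"
        by (simp add: power_add[symmetric] algebra_simps)
      then show ?thesis using r by simp
    qed
    with le show ?thesis
      by (simp only:)
  qed
  have "(\<lambda>N. \<Sum>n<M. (cmod (a n))\<^sup>2 * r ^ (2 * n) * (real (N + 1) / real (n + N + 1)))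
      \<longlonglongrightarrow> (\<Sum>n<M. (cmod (a n))\<^sup>2 * r ^ (2 * n) * 1)"
  proof (intro tendsto_sum tendsto_mult tendsto_const)
    fix n :: nat
    show "(\<lambda>N. real (N + 1) / real (n + N + 1)) \<longlonglongrightarrow> 1"
      by real_asymp
  qed
  then have "(\<Sum>n<M. (cmod (a n))\<^sup>2 * r ^ (2 * n) * 1) \<le> K\<^sup>2"
    by (rule LIMSEQ_le_const2) (use bound in blast)
  then show ?thesis by simp
qed

text \<open>The integrals of \<open>r\<^sup>2 |f'|\<^sup>2\<close> and \<open>|w f'|\<^sup>2\<close>
  both follow from Parseval. Since the weight vanishes on the circle of radius \<open>r\<close>, the
  factor \<open>n + 1\<close> produced by differentiation cancels up to the quotient
  \<open>(n + 1) / (n + 2)\<close>, and the difference is dominated by the coefficient sum.\<close>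

lemma littlewood_paley_ball:
  assumes f: "f holomorphic_on unit_disk" and K: "\<And>w. cmod w < 1 \<Longrightarrow> cmod (f w) \<le> K" and r: "0 < r" "r < 1"
  shows "(\<integral>w. indicat_real (ball 0 r) w * ((cmod (deriv f w))\<^sup>2 * (r\<^sup>2 - (cmod w)\<^sup>2)) \<partial>dA) \<le> K\<^sup>2"
proof -
  let ?a = "\<lambda>n. (deriv ^^ n) f 0 / fact n"
  let ?b = "\<lambda>n. of_nat (Suc n) * ?a (Suc n)"
  let ?c = "\<lambda>n. if n < 1 then 0 else ?b (n - 1)"
  have f': "deriv f holomorphic_on unit_disk"
    using f by (intro holomorphic_deriv) auto
  have b: "(\<lambda>n. ?b n * w ^ n) sums deriv f w" if "cmod w < 1" for w
  proof -
    have "(deriv ^^ n) (deriv f) 0 / fact n = ?b n" for n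
      by (simp only: funpow_Suc_right[symmetric] comp_apply[symmetric, of "deriv ^^ n" deriv] fact_Suc)
        (simp add: divide_simps del: of_nat_Suc)
    then show ?thesis
      using holomorphic_sums[OF f' that] by simp
  qed
  have c: "(\<lambda>n. ?c n * w ^ n) sums (w * deriv f w)" if "cmod w < 1" for w
    using power_series_shift_sums[OF b[OF that], of 1] by simp
  have [measurable]: "deriv f \<in> borel_measurable dA" "(\<lambda>w. w) \<in> borel_measurable dA"
    by (auto intro: measurable_borel_dA holomorphic_measurable_dA[OF f'])
  have int1: "integrable dA (\<lambda>w. indicat_real (ball 0 r) w * (cmod (deriv f w))\<^sup>2)"
  proof (rule integrable_bounded_dA)
    fix w :: complex assume "cmod w < 1"
    show "norm (indicat_real (ball 0 r) w * (cmod (deriv f w))\<^sup>2) \<le> (\<Sum>n. cmod (?b n) * r ^ n)\<^sup>2"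
      using power_series_norm_le[OF b, of r w] r by (auto simp: indicator_def intro!: power_mono)
  qed measurable
  have int2: "integrable dA (\<lambda>w. indicat_real (ball 0 r) w * (cmod (w * deriv f w))\<^sup>2)"
  proof (rule Bochner_Integration.integrable_bound[OF int1])
    have "(cmod (w * deriv f w))\<^sup>2 \<le> (cmod (deriv f w))\<^sup>2" if "cmod w < 1" for w
      using that by (intro power_mono) (auto simp: norm_mult mult_left_le_one_le)
    then show "AE w in dA. norm (indicat_real (ball 0 r) w * (cmod (w * deriv f w))\<^sup>2)
        \<le> norm (indicat_real (ball 0 r) w * (cmod (deriv f w))\<^sup>2)"
      by (intro AE_I2) (auto simp: indicator_def)
  qed measurable
  let ?t = "\<lambda>n. (cmod (?b n))\<^sup>2 * r ^ (2 * n + 2) / real (n + 1)"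
  let ?s = "\<lambda>n. (cmod (?c n))\<^sup>2 * r ^ (2 * n + 2) / real (n + 1)"
  have t: "?t sums (\<integral>w. indicat_real (ball 0 r) w * (cmod (deriv f w))\<^sup>2 \<partial>dA)"
    using r by (intro parseval_ball b) auto
  have "?s sums (\<integral>w. indicat_real (ball 0 r) w * (cmod (w * deriv f w))\<^sup>2 \<partial>dA)"
    using r by (intro parseval_ball c) auto
  then have s: "(\<lambda>n. ?s (n + 1)) sums (\<integral>w. indicat_real (ball 0 r) w * (cmod (w * deriv f w))\<^sup>2 \<partial>dA)"
    by (subst sums_iff_shift) simp
  have eq: "r\<^sup>2 * ?t n - ?s (n + 1) = (cmod (?a (Suc n)))\<^sup>2 * r ^ (2 * Suc n) * (r\<^sup>2 * (real (n + 1) / real (n + 2)))" for n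
  proof -
    have alg: "r\<^sup>2 * (x\<^sup>2 * A * p / x) - x\<^sup>2 * A * (p * r\<^sup>2) / (x + 1) = A * p * (r\<^sup>2 * (x / (x + 1)))"
      if "x > 0" for x A p :: real
      using that by (simp add: power2_eq_square field_simps)
    have B: "(cmod (?b n))\<^sup>2 = (real (Suc n))\<^sup>2 * (cmod (?a (Suc n)))\<^sup>2"
      by (simp only: norm_mult norm_of_nat power_mult_distrib)
    have p: "r ^ (2 * (n + 1) + 2) = r ^ (2 * n + 2) * r\<^sup>2" "r ^ (2 * Suc n) = r ^ (2 * n + 2)"
      by (simp_all flip: power_add)
    have n: "real (n + 1) = real (Suc n)" "real (n + 1 + 1) = real (Suc n) + 1" "real (n + 2) = real (Suc n) + 1"
      by simp_all
    have c: "?c (n + 1) = ?b n" by simp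
    show ?thesis
      unfolding c B p n by (rule alg) simp
  qed
  have "(\<integral>w. indicat_real (ball 0 r) w * ((cmod (deriv f w))\<^sup>2 * (r\<^sup>2 - (cmod w)\<^sup>2)) \<partial>dA)
      = (\<integral>w. r\<^sup>2 * (indicat_real (ball 0 r) w * (cmod (deriv f w))\<^sup>2) - indicat_real (ball 0 r) w * (cmod (w * deriv f w))\<^sup>2 \<partial>dA)"
    by (intro Bochner_Integration.integral_cong refl) (simp add: norm_mult power_mult_distrib algebra_simps)
  also have "\<dots> = r\<^sup>2 * (\<integral>w. indicat_real (ball 0 r) w * (cmod (deriv f w))\<^sup>2 \<partial>dA)
      - (\<integral>w. indicat_real (ball 0 r) w * (cmod (w * deriv f w))\<^sup>2 \<partial>dA)"
    using int1 int2 by simp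
  finally have I: "(\<lambda>n. r\<^sup>2 * ?t n - ?s (n + 1)) sums
      (\<integral>w. indicat_real (ball 0 r) w * ((cmod (deriv f w))\<^sup>2 * (r\<^sup>2 - (cmod w)\<^sup>2)) \<partial>dA)"
    using sums_diff[OF sums_mult[OF t, of "r\<^sup>2"] s] by simp
  have "(\<Sum>n<M. r\<^sup>2 * ?t n - ?s (n + 1)) \<le> K\<^sup>2" for M
  proof -
    have "(\<Sum>n<M. r\<^sup>2 * ?t n - ?s (n + 1)) \<le> (\<Sum>n<M. (cmod (?a (Suc n)))\<^sup>2 * r ^ (2 * Suc n))"
    proof (rule sum_mono)
      fix n
      have "r\<^sup>2 * (real (n + 1) / real (n + 2)) \<le> 1 * 1"
        using r by (intro mult_mono) (auto simp: power_le_one)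
      then show "r\<^sup>2 * ?t n - ?s (n + 1) \<le> (cmod (?a (Suc n)))\<^sup>2 * r ^ (2 * Suc n)"
        unfolding eq using r by (intro mult_right_le_one_le) auto
    qed
    also have "\<dots> = (\<Sum>n\<in>{1..<Suc M}. (cmod (?a n))\<^sup>2 * r ^ (2 * n))"
      by (rule sum.reindex_bij_witness[of _ "\<lambda>n. n - 1" Suc]) auto
    also have "\<dots> \<le> (\<Sum>n<Suc M. (cmod (?a n))\<^sup>2 * r ^ (2 * n))"
      using r by (intro sum_mono2) auto
    also have "\<dots> \<le> K\<^sup>2"
      by (rule sum_coeff_square_le[OF holomorphic_sums[OF f] K r])
    finally show ?thesis .
  qed
  then show ?thesis
    using I by (intro LIMSEQ_le_const2[of "\<lambda>M. \<Sum>n<M. r\<^sup>2 * ?t n - ?s (n + 1)"]) (auto simp: sums_def)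
qed

text \<open>Fatou's lemma along radii tending to \<open>1\<close>. The classical identity carries
  the logarithmic weight \<open>ln (1 / |w|\<^sup>2)\<close>; the smaller weight
  \<open>1 - |w|\<^sup>2\<close> turns it into the inequality that suffices here.\<close>

lemma littlewood_paley:
  assumes f: "f holomorphic_on unit_disk" and K: "\<And>w. cmod w < 1 \<Longrightarrow> cmod (f w) \<le> K"
  shows "(\<integral>\<^sup>+w. ennreal ((cmod (deriv f w))\<^sup>2 * (1 - (cmod w)\<^sup>2)) \<partial>dA) \<le> ennreal (K\<^sup>2)"
proof -
  let ?r = "\<lambda>k. 1 - 1 / (real k + 2)"
  let ?u = "\<lambda>k w. indicat_real (ball 0 (?r k)) w * ((cmod (deriv f w))\<^sup>2 * ((?r k)\<^sup>2 - (cmod w)\<^sup>2))"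
  have f': "deriv f holomorphic_on unit_disk"
    using f by (intro holomorphic_deriv) auto
  have [measurable]: "deriv f \<in> borel_measurable dA" "(\<lambda>w. w) \<in> borel_measurable dA"
    by (auto intro: measurable_borel_dA holomorphic_measurable_dA[OF f'])
  have r: "0 < ?r k" "?r k < 1" for k by (auto simp: field_simps)
  have nn: "0 \<le> ?u k w" for k w
    using r[of k] by (auto simp: indicator_def intro!: mult_nonneg_nonneg power_mono)
  have "(\<integral>\<^sup>+w. ennreal ((cmod (deriv f w))\<^sup>2 * (1 - (cmod w)\<^sup>2)) \<partial>dA)
      = (\<integral>\<^sup>+w. liminf (\<lambda>k. ennreal (?u k w)) \<partial>dA)"
  proof (intro nn_integral_cong)
    fix w assume "w \<in> space dA"
    then have "\<forall>\<^sub>F k in sequentially. cmod w < ?r k"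
      by (intro order_tendstoD(1)[OF radii_tendsto_1]) simp
    then have ev: "\<forall>\<^sub>F k in sequentially. (cmod (deriv f w))\<^sup>2 * ((?r k)\<^sup>2 - (cmod w)\<^sup>2) = ?u k w"
      by eventually_elim simp
    have "(\<lambda>k. (cmod (deriv f w))\<^sup>2 * ((?r k)\<^sup>2 - (cmod w)\<^sup>2)) \<longlonglongrightarrow> (cmod (deriv f w))\<^sup>2 * (1\<^sup>2 - (cmod w)\<^sup>2)"
      by (intro tendsto_intros radii_tendsto_1)
    then have "(\<lambda>k. ?u k w) \<longlonglongrightarrow> (cmod (deriv f w))\<^sup>2 * (1 - (cmod w)\<^sup>2)"
      using Lim_transform_eventually[OF _ ev] by simp
    then have "(\<lambda>k. ennreal (?u k w)) \<longlonglongrightarrow> ennreal ((cmod (deriv f w))\<^sup>2 * (1 - (cmod w)\<^sup>2))"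
      by (rule tendsto_ennrealI)
    then show "ennreal ((cmod (deriv f w))\<^sup>2 * (1 - (cmod w)\<^sup>2)) = liminf (\<lambda>k. ennreal (?u k w))"
      by (simp add: lim_imp_Liminf)
  qed
  also have "\<dots> \<le> liminf (\<lambda>k. \<integral>\<^sup>+w. ennreal (?u k w) \<partial>dA)"
    by (intro nn_integral_liminf) measurable
  also have "\<dots> \<le> ennreal (K\<^sup>2)"
  proof (rule Liminf_le)
    show "\<forall>\<^sub>F k in sequentially. (\<integral>\<^sup>+w. ennreal (?u k w) \<partial>dA) \<le> ennreal (K\<^sup>2)"
    proof (rule always_eventually, rule allI)
      fix k
      have "integrable dA (?u k)"
      proof (rule integrable_bounded_dA)
        let ?b = "\<lambda>n. (deriv ^^ n) (deriv f) 0 / fact n"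
        fix w :: complex assume w: "cmod w < 1"
        show "norm (?u k w) \<le> (\<Sum>n. cmod (?b n) * ?r k ^ n)\<^sup>2 * 1"
        proof (cases "cmod w < ?r k")
          case True
          then have "(cmod (deriv f w))\<^sup>2 \<le> (\<Sum>n. cmod (?b n) * ?r k ^ n)\<^sup>2"
            using power_series_norm_le[OF holomorphic_sums[OF f'], of "?r k" w] r[of k]
            by (intro power_mono) auto
          moreover have "(?r k)\<^sup>2 - (cmod w)\<^sup>2 \<le> 1 - 0"
            using r[of k] by (intro diff_mono) (auto simp: power_le_one)
          moreover have "(cmod w)\<^sup>2 \<le> (?r k)\<^sup>2"
            using True by (intro power_mono) auto
          ultimately have "(cmod (deriv f w))\<^sup>2 * ((?r k)\<^sup>2 - (cmod w)\<^sup>2) \<le> (\<Sum>n. cmod (?b n) * ?r k ^ n)\<^sup>2 * 1"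
            by (intro mult_mono) auto
          then show ?thesis
            using nn[of k w] True by simp
        qed simp
      qed measurable
      then have "(\<integral>\<^sup>+w. ennreal (?u k w) \<partial>dA) = ennreal (integral\<^sup>L dA (?u k))"
        using nn by (intro nn_integral_eq_integral) auto
      also have "\<dots> \<le> ennreal (K\<^sup>2)"
        using littlewood_paley_ball[OF f K r[of k]] by (intro ennreal_leI)
      finally show "(\<integral>\<^sup>+w. ennreal (?u k w) \<partial>dA) \<le> ennreal (K\<^sup>2)" .
    qed
  qed simp
  finally show ?thesis .
qed

section \<open>The Bergman space and its bounded operators\<close>

lemma Rep_bergman_holomorphic: "Rep_bergman f holomorphic_on unit_disk"
  using Rep_bergman[of f] by (simp add: bergman_set_def)

lemma Rep_bergman_integrable: "integrable dA (\<lambda>w. (cmod (Rep_bergman f w))\<^sup>2)"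
  using Rep_bergman[of f] by (simp add: bergman_set_def)

lemma Rep_bergman_outside: "1 \<le> cmod w \<Longrightarrow> Rep_bergman f w = 0"
  using Rep_bergman[of f] by (simp add: bergman_set_def)

lemma Rep_bergman_borel [measurable]: "Rep_bergman f \<in> borel_measurable borel"
proof -
  have "continuous_on unit_disk (Rep_bergman f)"
    by (intro holomorphic_on_imp_continuous_on Rep_bergman_holomorphic)
  then have "(\<lambda>w. if w \<in> unit_disk then Rep_bergman f w else 0) \<in> borel_measurable borel"
    by (intro borel_measurable_continuous_on_if) auto
  moreover have "(\<lambda>w. if w \<in> unit_disk then Rep_bergman f w else 0) = Rep_bergman f"
    by (auto simp: Rep_bergman_outside)
  ultimately show ?thesis by simp
qed

lemma Rep_bergman_measurable [measurable]: "Rep_bergman f \<in> borel_measurable dA"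
  by (rule measurable_borel_dA) measurable

lemma bergman_eqI: "(\<And>w. cmod w < 1 \<Longrightarrow> Rep_bergman f w = Rep_bergman g w) \<Longrightarrow> f = g"
  by (metis Rep_bergman_inject Rep_bergman_outside ext not_less)

lemmas Rep_bergman_simps = zero_bergman.rep_eq plus_bergman.rep_eq minus_bergman.rep_eq
  uminus_bergman.rep_eq scaleR_bergman.rep_eq scaleC.rep_eq

definition to_bergman :: "(complex \<Rightarrow> complex) \<Rightarrow> bergman"
  where "to_bergman h = Abs_bergman (\<lambda>w. if w \<in> unit_disk then h w else 0)"

lemma Rep_to_bergman:
  assumes "h holomorphic_on unit_disk" "integrable dA (\<lambda>w. (cmod (h w))\<^sup>2)" "cmod w < 1"
  shows "Rep_bergman (to_bergman h) w = h w"
proof -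
  let ?h = "\<lambda>w. if w \<in> unit_disk then h w else 0"
  have "?h holomorphic_on unit_disk"
    using assms(1) by (rule holomorphic_transform) simp
  moreover have "integrable dA (\<lambda>w. (cmod (?h w))\<^sup>2)"
    using assms(2) by (subst Bochner_Integration.integrable_cong[OF refl, where g = "\<lambda>w. (cmod (h w))\<^sup>2"]) auto
  ultimately have "?h \<in> bergman_set"
    unfolding bergman_set_def by simp
  then show ?thesis
    using assms(3) by (simp add: to_bergman_def Abs_bergman_inverse)
qed

lemma cinner_integrable: "integrable dA (\<lambda>w. Rep_bergman f w * cnj (Rep_bergman g w))"
  by (rule bergman_set_integrable_inner) (rule Rep_bergman)+

lemma cinner_commute: "cinner g f = cnj (cinner f g)"
  unfolding cinner_def by (rule L2_inner_commute)

lemma cinner_add_left: "cinner (f + g) h = cinner f h + cinner g h"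
  by (simp add: cinner_def L2_inner_def Rep_bergman_simps distrib_right cinner_integrable)

lemma cinner_diff_left: "cinner (f - g) h = cinner f h - cinner g h"
  by (simp add: cinner_def L2_inner_def Rep_bergman_simps left_diff_distrib cinner_integrable)

lemma cinner_scaleC_left: "cinner (scaleC c f) h = c * cinner f h"
  by (simp add: cinner_def L2_inner_def Rep_bergman_simps mult.assoc)

lemma cinner_zero_left [simp]: "cinner 0 h = 0"
  by (simp add: cinner_def L2_inner_def Rep_bergman_simps)

lemma cinner_add_right: "cinner h (f + g) = cinner h f + cinner h g"
  by (metis cinner_add_left cinner_commute complex_cnj_add)

lemma cinner_diff_right: "cinner h (f - g) = cinner h f - cinner h g"
  by (metis cinner_diff_left cinner_commute complex_cnj_diff)

lemma cinner_scaleC_right: "cinner h (scaleC c f) = cnj c * cinner h f"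
  by (metis cinner_scaleC_left cinner_commute complex_cnj_mult)

lemma cinner_zero_right [simp]: "cinner h 0 = 0"
  using cinner_commute[of h 0] by simp

lemma Re_cinner: "Re (cinner f g) = inner f g"
  unfolding cinner_def by (simp add: inner_bergman.rep_eq)

lemma norm_bergman_square: "(norm f)\<^sup>2 = (\<integral>w. (cmod (Rep_bergman f w))\<^sup>2 \<partial>dA)"
  by (simp add: power2_norm_eq_inner[of f] inner_bergman.rep_eq L2_inner_self)

lemma cinner_self: "cinner f f = of_real ((norm f)\<^sup>2)"
  unfolding cinner_def L2_inner_self norm_bergman_square ..

lemma norm_cinner_le: "cmod (cinner f g) \<le> norm f * norm g"
proof (cases "cinner f g = 0")
  case False
  define z where "z = cinner f g"
  define c where "c = cnj z / of_real (cmod z)"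
  have z: "cmod z \<noteq> 0" using False by (simp add: z_def)
  have "c * z = (z * cnj z) / of_real (cmod z)"
    by (simp add: c_def)
  also have "\<dots> = of_real (cmod z)"
    using z by (simp only: complex_norm_square[symmetric] of_real_divide[symmetric])
      (simp add: power2_eq_square)
  finally have "cinner (scaleC c f) g = of_real (cmod (cinner f g))"
    by (simp add: cinner_scaleC_left z_def)
  then have "cmod (cinner f g) = inner (scaleC c f) g"
    by (metis Re_cinner Re_complex_of_real)
  also have "\<dots> \<le> norm (scaleC c f) * norm g"
    by (rule norm_cauchy_schwarz)
  also have "norm (scaleC c f) = norm f"
    using z by (simp add: norm_scaleC c_def norm_divide z)
  finally show ?thesis .
qed simp

lemma bergman_eqI_cinner: "(\<And>h. cinner f h = cinner g h) \<Longrightarrow> f = g"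
proof -
  assume "\<And>h. cinner f h = cinner g h"
  then have "cinner (f - g) (f - g) = 0"
    by (simp add: cinner_diff_left)
  then show "f = g"
    by (simp add: cinner_self)
qed

lemma scaleR_eq_scaleC: "r *\<^sub>R f = scaleC (of_real r) f"
  by (rule bergman_eqI) (simp add: Rep_bergman_simps)

section \<open>The unitaries of the automorphisms and the reproducing kernels\<close>

definition moebius_op :: "complex \<Rightarrow> bergman \<Rightarrow> bergman"
  where "moebius_op a f = to_bergman (\<lambda>w. normalized_kernel_fun a w * Rep_bergman f (moebius a w))"

context
  fixes a :: complex
  assumes a: "cmod a < 1"
begin

lemma normalized_kernel_fun_holomorphic: "normalized_kernel_fun a holomorphic_on unit_disk"
  using normalized_kernel_in_bergman[of a] a by (simp add: bergman_set_def)

lemma Rep_normalized_kernel: "Rep_bergman (normalized_kernel a) = normalized_kernel_fun a"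
  using normalized_kernel_in_bergman[of a] a by (simp add: normalized_kernel_def Abs_bergman_inverse)

lemma compose_moebius_holomorphic:
  "f holomorphic_on unit_disk \<Longrightarrow> (\<lambda>w. f (moebius a w)) holomorphic_on unit_disk"
  using holomorphic_on_compose_gen[OF holomorphic_moebius[OF a], of f unit_disk] bij_betw_moebius[OF a]
  by (simp add: o_def bij_betw_def)

lemma Rep_moebius_op:
  assumes "cmod w < 1"
  shows "Rep_bergman (moebius_op a f) w = normalized_kernel_fun a w * Rep_bergman f (moebius a w)"
  unfolding moebius_op_def
proof (rule Rep_to_bergman[OF _ _ assms])
  show "(\<lambda>w. normalized_kernel_fun a w * Rep_bergman f (moebius a w)) holomorphic_on unit_disk"
    by (intro holomorphic_intros normalized_kernel_fun_holomorphic compose_moebius_holomorphic Rep_bergman_holomorphic)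
  have "integrable dA (\<lambda>w. (cmod (normalized_kernel_fun a w))\<^sup>2 *\<^sub>R (cmod (Rep_bergman f (moebius a w)))\<^sup>2)"
    by (subst integrable_moebius[OF a]) (auto simp: Rep_bergman_integrable)
  then show "integrable dA (\<lambda>w. (cmod (normalized_kernel_fun a w * Rep_bergman f (moebius a w)))\<^sup>2)"
    by (simp add: norm_mult power_mult_distrib)
qed

lemma normalized_kernel_fun_moebius:
  assumes "cmod w < 1"
  shows "normalized_kernel_fun a w * normalized_kernel_fun a (moebius a w) = 1"
proof -
  have nz: "1 - cnj a * w \<noteq> 0" using moebius_denom_nonzero a assms by blast
  have "(cmod a)\<^sup>2 \<noteq> 1" using a by (auto simp: abs_square_eq_1)
  then have nz2: "complex_of_real (1 - (cmod a)\<^sup>2) \<noteq> 0"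
    by (metis of_real_eq_0_iff right_minus_eq)
  show ?thesis
    using assms moebius_in_disk[OF a assms] nz nz2
    by (simp add: normalized_kernel_fun_def one_minus_cnj_mult_moebius[OF a assms] power_divide
        del: of_real_diff) (simp add: power2_eq_square)
qed

lemma moebius_op_moebius_op [simp]: "moebius_op a (moebius_op a f) = f"
  by (rule bergman_eqI)
    (simp add: Rep_moebius_op moebius_in_disk a moebius_moebius mult.assoc[symmetric] normalized_kernel_fun_moebius)

lemma moebius_op_add: "moebius_op a (f + g) = moebius_op a f + moebius_op a g"
  by (rule bergman_eqI) (simp add: Rep_moebius_op Rep_bergman_simps distrib_left)

lemma moebius_op_diff: "moebius_op a (f - g) = moebius_op a f - moebius_op a g"
  by (rule bergman_eqI) (simp add: Rep_moebius_op Rep_bergman_simps right_diff_distrib)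

lemma moebius_op_scaleC: "moebius_op a (scaleC c f) = scaleC c (moebius_op a f)"
  by (rule bergman_eqI) (simp add: Rep_moebius_op Rep_bergman_simps)

text \<open>The weight of \<open>moebius_op\<close> is the derivative of the automorphism up to
  sign, so this is the change of variables. Dropping the sign leaves an involution and makes the
  constant function \<open>normalized_kernel 0\<close> go to
  \<open>normalized_kernel a\<close>.\<close>

lemma cinner_moebius_op [simp]: "cinner (moebius_op a f) (moebius_op a g) = cinner f g"
proof -
  have "cinner (moebius_op a f) (moebius_op a g)
      = (\<integral>w. (cmod (normalized_kernel_fun a w))\<^sup>2 *\<^sub>R
          (Rep_bergman f (moebius a w) * cnj (Rep_bergman g (moebius a w))) \<partial>dA)"
    unfolding cinner_def L2_inner_def
  proof (rule Bochner_Integration.integral_cong[OF refl])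
    fix w assume "w \<in> space dA"
    then have w: "cmod w < 1" by simp
    show "Rep_bergman (moebius_op a f) w * cnj (Rep_bergman (moebius_op a g) w)
        = (cmod (normalized_kernel_fun a w))\<^sup>2 *\<^sub>R
          (Rep_bergman f (moebius a w) * cnj (Rep_bergman g (moebius a w)))"
      unfolding scaleR_conv_of_real complex_norm_square by (simp add: Rep_moebius_op[OF w])
  qed
  also have "\<dots> = cinner f g"
    unfolding cinner_def L2_inner_def by (rule integral_moebius[OF a]) measurable
  finally show ?thesis .
qed

lemma norm_moebius_op [simp]: "norm (moebius_op a f) = norm f"
proof -
  have "(norm (moebius_op a f))\<^sup>2 = (norm f)\<^sup>2"
    by (metis cinner_moebius_op cinner_self of_real_eq_iff)
  then show ?thesis by simp
qed

lemma cinner_moebius_op_left: "cinner (moebius_op a f) g = cinner f (moebius_op a g)"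
  by (metis cinner_moebius_op moebius_op_moebius_op)

end

lemma cinner_normalized_kernel_0: "cinner f (normalized_kernel 0) = Rep_bergman f 0"
proof -
  have "cinner f (normalized_kernel 0) = (\<integral>w. Rep_bergman f w \<partial>dA)"
    unfolding cinner_def L2_inner_def
    by (intro Bochner_Integration.integral_cong refl) (simp add: Rep_normalized_kernel normalized_kernel_fun_def)
  also have "\<dots> = Rep_bergman f 0"
  proof (rule mean_value_dA[OF Rep_bergman_holomorphic])
    have "integrable dA (\<lambda>w. Rep_bergman f w * cnj (Rep_bergman (normalized_kernel 0) w))"
      by (rule cinner_integrable)
    then show "integrable dA (Rep_bergman f)"
      by (rule Bochner_Integration.integrable_cong[OF refl, THEN iffD1, rotated])
        (simp add: Rep_normalized_kernel normalized_kernel_fun_def)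
  qed
  finally show ?thesis .
qed

lemma moebius_op_normalized_kernel_0:
  assumes "cmod a < 1"
  shows "moebius_op a (normalized_kernel 0) = normalized_kernel a"
  using assms by (intro bergman_eqI)
    (simp add: Rep_moebius_op Rep_normalized_kernel moebius_in_disk normalized_kernel_fun_def[of 0])

text \<open>The reproducing property is the mean value property at the origin, carried to
  \<open>a\<close> by the unitary.\<close>

lemma cinner_normalized_kernel:
  assumes "cmod a < 1"
  shows "cinner f (normalized_kernel a) = of_real (1 - (cmod a)\<^sup>2) * Rep_bergman f a"
proof -
  have "cinner f (normalized_kernel a) = cinner (moebius_op a f) (normalized_kernel 0)"
    by (simp add: cinner_moebius_op_left assms moebius_op_normalized_kernel_0)
  also have "\<dots> = normalized_kernel_fun a 0 * Rep_bergman f (moebius a 0)"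
    using assms by (simp add: cinner_normalized_kernel_0 Rep_moebius_op)
  finally show ?thesis
    by (simp add: normalized_kernel_fun_def moebius_def)
qed

lemma norm_normalized_kernel:
  assumes "cmod a < 1"
  shows "norm (normalized_kernel a) = 1"
proof -
  have "cinner (normalized_kernel 0) (normalized_kernel 0) = 1"
    by (simp add: cinner_normalized_kernel_0 Rep_normalized_kernel normalized_kernel_fun_def)
  then have "(norm (normalized_kernel 0))\<^sup>2 = 1"
    by (metis cinner_self of_real_eq_1_iff)
  then have "norm (normalized_kernel 0) = 1"
    by (simp add: power2_eq_1_iff) (metis norm_ge_zero neg_0_le_iff_le not_one_le_zero)
  then show ?thesis
    using norm_moebius_op[OF assms] moebius_op_normalized_kernel_0[OF assms] by metis
qed

lemma norm_Rep_bergman_le: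
  assumes "cmod a < 1"
  shows "cmod (Rep_bergman f a) * (1 - (cmod a)\<^sup>2) \<le> norm f"
proof -
  have "0 \<le> 1 - (cmod a)\<^sup>2" using assms by (simp add: power_le_one)
  then have "cmod (Rep_bergman f a) * (1 - (cmod a)\<^sup>2) = cmod (cinner f (normalized_kernel a))"
    by (simp add: cinner_normalized_kernel[OF assms] norm_mult mult.commute del: of_real_diff)
  also have "\<dots> \<le> norm f"
    using norm_cinner_le[of f "normalized_kernel a"] by (simp add: norm_normalized_kernel assms)
  finally show ?thesis .
qed

text \<open>The norm controls point values locally uniformly, so a Cauchy sequence has a holomorphic
  locally uniform limit. Fatou's lemma, with one index sent to infinity, puts the limit in the space
  and gives convergence in norm.\<close>

lemma bergman_cauchy_convergent:
  fixes X :: "nat \<Rightarrow> bergman"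
  assumes X: "Cauchy X"
  shows "convergent X"
proof -
  let ?X = "\<lambda>n. Rep_bergman (X n)"
  have unif: "\<exists>N. \<forall>m\<ge>N. \<forall>n\<ge>N. \<forall>w\<in>cball 0 r. cmod (?X m w - ?X n w) < e"
    if "r < 1" "0 < e" for r e
  proof (cases "0 \<le> r")
    case True
    have r2: "0 < 1 - r\<^sup>2" using True that by (simp add: abs_square_less_1)
    then obtain N where N: "\<And>m n. m \<ge> N \<Longrightarrow> n \<ge> N \<Longrightarrow> norm (X m - X n) < e * (1 - r\<^sup>2)"
      using CauchyD[OF X mult_pos_pos[OF \<open>0 < e\<close> r2]] by blast
    have "cmod (?X m w - ?X n w) < e" if mn: "m \<ge> N" "n \<ge> N" and w: "cmod w \<le> r" for m n w
    proof -
      have w1: "cmod w < 1" using w \<open>r < 1\<close> by simp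
      have "(cmod w)\<^sup>2 \<le> r\<^sup>2" using w by (intro power_mono) auto
      then have "cmod (?X m w - ?X n w) * (1 - r\<^sup>2) \<le> cmod (?X m w - ?X n w) * (1 - (cmod w)\<^sup>2)"
        by (intro mult_left_mono) auto
      also have "\<dots> \<le> norm (X m - X n)"
        using norm_Rep_bergman_le[OF w1, of "X m - X n"] by (simp add: Rep_bergman_simps)
      also have "\<dots> < e * (1 - r\<^sup>2)" by (rule N[OF mn])
      finally show ?thesis using r2 by simp
    qed
    then show ?thesis by (intro exI[of _ N]) simp
  next
    case False
    then show ?thesis by (intro exI[of _ 0]) auto
  qed
  define f where "f w = lim (\<lambda>n. ?X n w)" for w
  have conv: "(\<lambda>n. ?X n w) \<longlonglongrightarrow> f w" if "cmod w < 1" for w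
  proof -
    have "Cauchy (\<lambda>n. ?X n w)"
      unfolding Cauchy_def dist_norm using unif[of "cmod w"] that by (force simp: mem_cball_0)
    then show ?thesis
      unfolding f_def using Cauchy_convergent convergent_LIMSEQ_iff by blast
  qed
  have ul: "uniform_limit (cball 0 r) ?X f sequentially" if "r < 1" for r
  proof (rule uniform_limitI)
    fix e :: real assume e: "0 < e"
    obtain N where N: "\<And>m n w. m \<ge> N \<Longrightarrow> n \<ge> N \<Longrightarrow> w \<in> cball 0 r \<Longrightarrow> cmod (?X m w - ?X n w) < e / 2"
      using unif[OF \<open>r < 1\<close>, of "e / 2"] e by force
    show "\<forall>\<^sub>F n in sequentially. \<forall>w\<in>cball 0 r. dist (?X n w) (f w) < e"
    proof (rule eventually_sequentiallyI[of N], rule ballI)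
      fix n and w :: complex assume n: "N \<le> n" and w: "w \<in> cball 0 r"
      have "(\<lambda>m. cmod (?X n w - ?X m w)) \<longlonglongrightarrow> cmod (?X n w - f w)"
        using w that by (intro tendsto_intros conv) auto
      then have "cmod (?X n w - f w) \<le> e / 2"
        by (rule LIMSEQ_le_const2) (use N[OF n _ w] in \<open>auto intro!: exI[of _ N] less_imp_le\<close>)
      then show "dist (?X n w) (f w) < e"
        using e by (simp add: dist_norm)
    qed
  qed
  have hol: "f holomorphic_on unit_disk"
  proof (rule holomorphic_uniform_sequence[of _ ?X])
    show "?X n holomorphic_on unit_disk" for n by (rule Rep_bergman_holomorphic)
    fix x :: complex assume x: "x \<in> unit_disk"
    let ?d = "(1 - cmod x) / 2"
    have "cball x ?d \<subseteq> cball 0 ((1 + cmod x) / 2)"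
    proof
      fix y assume "y \<in> cball x ?d"
      then have "cmod (y - x) \<le> ?d" by (simp add: dist_norm norm_minus_commute)
      then show "y \<in> cball 0 ((1 + cmod x) / 2)"
        using norm_triangle_ineq[of x "y - x"] by (simp add: field_simps)
    qed
    moreover have "(1 + cmod x) / 2 < 1" using x by simp
    ultimately have "cball x ?d \<subseteq> unit_disk" "uniform_limit (cball x ?d) ?X f sequentially"
      using ul[of "(1 + cmod x) / 2"] by (auto intro: uniform_limit_on_subset)
    then show "\<exists>d>0. cball x d \<subseteq> unit_disk \<and> uniform_limit (cball x d) ?X f sequentially"
      using x by (intro exI[of _ ?d]) auto
  qed simp
  have fm[measurable]: "f \<in> borel_measurable dA" by (rule holomorphic_measurable_dA[OF hol])
  have est: "\<exists>N. \<forall>n\<ge>N. (\<integral>\<^sup>+w. ennreal ((cmod (f w - ?X n w))\<^sup>2) \<partial>dA) \<le> ennreal (e\<^sup>2)" if e: "0 < e" for e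
  proof -
    obtain N where N: "\<And>m n. m \<ge> N \<Longrightarrow> n \<ge> N \<Longrightarrow> norm (X m - X n) < e"
      using CauchyD[OF X e] by auto
    have "(\<integral>\<^sup>+w. ennreal ((cmod (f w - ?X n w))\<^sup>2) \<partial>dA) \<le> ennreal (e\<^sup>2)" if n: "n \<ge> N" for n
    proof -
      have "(\<integral>\<^sup>+w. ennreal ((cmod (f w - ?X n w))\<^sup>2) \<partial>dA)
          = (\<integral>\<^sup>+w. liminf (\<lambda>m. ennreal ((cmod (?X m w - ?X n w))\<^sup>2)) \<partial>dA)"
      proof (intro nn_integral_cong)
        fix w assume "w \<in> space dA"
        then have "(\<lambda>m. ennreal ((cmod (?X m w - ?X n w))\<^sup>2)) \<longlonglongrightarrow> ennreal ((cmod (f w - ?X n w))\<^sup>2)"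
          by (intro tendsto_ennrealI tendsto_intros conv) simp
        then show "ennreal ((cmod (f w - ?X n w))\<^sup>2) = liminf (\<lambda>m. ennreal ((cmod (?X m w - ?X n w))\<^sup>2))"
          by (rule lim_imp_Liminf[OF sequentially_bot, symmetric])
      qed
      also have "\<dots> \<le> liminf (\<lambda>m. \<integral>\<^sup>+w. ennreal ((cmod (?X m w - ?X n w))\<^sup>2) \<partial>dA)"
        by (intro nn_integral_liminf) measurable
      also have "\<dots> \<le> ennreal (e\<^sup>2)"
      proof (rule Liminf_le)
        show "\<forall>\<^sub>F m in sequentially. (\<integral>\<^sup>+w. ennreal ((cmod (?X m w - ?X n w))\<^sup>2) \<partial>dA) \<le> ennreal (e\<^sup>2)"
        proof (rule eventually_sequentiallyI[of N])
          fix m assume m: "N \<le> m"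
          have "(\<integral>\<^sup>+w. ennreal ((cmod (?X m w - ?X n w))\<^sup>2) \<partial>dA) = ennreal ((norm (X m - X n))\<^sup>2)"
            unfolding norm_bergman_square using Rep_bergman_integrable[of "X m - X n"]
            by (subst nn_integral_eq_integral[symmetric]) (auto simp: Rep_bergman_simps)
          also have "\<dots> \<le> ennreal (e\<^sup>2)"
            using N[OF m n] by (intro ennreal_leI power_mono) auto
          finally show "(\<integral>\<^sup>+w. ennreal ((cmod (?X m w - ?X n w))\<^sup>2) \<partial>dA) \<le> ennreal (e\<^sup>2)" .
        qed
      qed simp
      finally show ?thesis .
    qed
    then show ?thesis by (intro exI[of _ N]) simp
  qed
  have intd: "integrable dA (\<lambda>w. (cmod (f w - ?X n w))\<^sup>2)"
    if "(\<integral>\<^sup>+w. ennreal ((cmod (f w - ?X n w))\<^sup>2) \<partial>dA) \<le> ennreal (e\<^sup>2)" for n e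
  proof (rule integrableI_bounded)
    show "(\<integral>\<^sup>+w. ennreal (norm ((cmod (f w - ?X n w))\<^sup>2)) \<partial>dA) < \<infinity>"
      using le_less_trans[OF that ennreal_less_top] by simp
  qed measurable
  have inf: "integrable dA (\<lambda>w. (cmod (f w))\<^sup>2)"
  proof -
    from est[OF zero_less_one] obtain N
      where "\<forall>n\<ge>N. (\<integral>\<^sup>+w. ennreal ((cmod (f w - ?X n w))\<^sup>2) \<partial>dA) \<le> ennreal (1\<^sup>2)" ..
    then have N: "(\<integral>\<^sup>+w. ennreal ((cmod (f w - ?X N w))\<^sup>2) \<partial>dA) \<le> ennreal (1\<^sup>2)" by simp
    have "integrable dA (\<lambda>w. 2 * (cmod (f w - ?X N w))\<^sup>2 + 2 * (cmod (?X N w))\<^sup>2)"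
      by (intro Bochner_Integration.integrable_add integrable_mult_right intd[OF N] Rep_bergman_integrable)
    then show ?thesis
    proof (rule Bochner_Integration.integrable_bound)
      have "(cmod (f w))\<^sup>2 \<le> 2 * (cmod (f w - ?X N w))\<^sup>2 + 2 * (cmod (?X N w))\<^sup>2" for w
      proof -
        have "(cmod (f w))\<^sup>2 \<le> (cmod (f w - ?X N w) + cmod (?X N w))\<^sup>2"
          using norm_triangle_ineq[of "f w - ?X N w" "?X N w"] by (intro power_mono) auto
        also have "\<dots> \<le> 2 * (cmod (f w - ?X N w))\<^sup>2 + 2 * (cmod (?X N w))\<^sup>2"
          using sum_squares_bound[of "cmod (f w - ?X N w)" "cmod (?X N w)"] by (simp add: power2_sum)
        finally show ?thesis .
      qed
      then show "AE w in dA. norm ((cmod (f w))\<^sup>2) \<le> norm (2 * (cmod (f w - ?X N w))\<^sup>2 + 2 * (cmod (?X N w))\<^sup>2)"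
        by simp
    qed measurable
  qed
  define F where "F = to_bergman f"
  have F: "Rep_bergman F w = f w" if "cmod w < 1" for w
    unfolding F_def by (rule Rep_to_bergman[OF hol inf that])
  have "X \<longlonglongrightarrow> F"
  proof (rule LIMSEQ_I)
    fix e :: real assume e: "0 < e"
    from est[OF half_gt_zero[OF e]] obtain N
      where N: "\<forall>n\<ge>N. (\<integral>\<^sup>+w. ennreal ((cmod (f w - ?X n w))\<^sup>2) \<partial>dA) \<le> ennreal ((e / 2)\<^sup>2)" ..
    have "norm (X n - F) < e" if "n \<ge> N" for n
    proof -
      have "ennreal ((norm (X n - F))\<^sup>2) = (\<integral>\<^sup>+w. ennreal ((cmod (Rep_bergman (X n - F) w))\<^sup>2) \<partial>dA)"
        unfolding norm_bergman_square
        by (rule nn_integral_eq_integral[OF Rep_bergman_integrable, symmetric]) simp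
      also have "\<dots> = (\<integral>\<^sup>+w. ennreal ((cmod (f w - ?X n w))\<^sup>2) \<partial>dA)"
      proof (intro nn_integral_cong)
        fix w assume "w \<in> space dA"
        then have "Rep_bergman (X n - F) w = - (f w - ?X n w)"
          by (simp add: Rep_bergman_simps F)
        then show "ennreal ((cmod (Rep_bergman (X n - F) w))\<^sup>2) = ennreal ((cmod (f w - ?X n w))\<^sup>2)"
          by (simp only: norm_minus_cancel)
      qed
      also have "\<dots> \<le> ennreal ((e / 2)\<^sup>2)"
        by (rule N[rule_format, OF that])
      finally have "ennreal ((norm (X n - F))\<^sup>2) \<le> ennreal ((e / 2)\<^sup>2)" .
      then have "(norm (X n - F))\<^sup>2 \<le> (e / 2)\<^sup>2"
        by (simp only: ennreal_le_iff zero_le_power2)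
      then have "norm (X n - F) \<le> e / 2"
        by (rule power2_le_imp_le) (use e in simp)
      then show ?thesis using e by simp
    qed
    then show "\<exists>no. \<forall>n\<ge>no. norm (X n - F) < e"
      by (intro exI[of _ N]) simp
  qed
  then show ?thesis by (rule convergentI)
qed

instance bergman :: banach
  by standard (rule bergman_cauchy_convergent)

section \<open>Riesz representation and adjoints\<close>

lemma riesz_representation:
  fixes l :: "'a::{real_inner, banach} \<Rightarrow> real"
  assumes "bounded_linear l"
  obtains g where "\<And>f. l f = inner g f"
proof -
  interpret l: bounded_linear l by fact
  \<comment> \<open>The representing vector is the minimizer of this functional, whose derivative at
    \<open>g\<close> in direction \<open>f\<close> is \<open>inner g f - l f\<close>.\<close>
  define J where "J f = (norm f)\<^sup>2 / 2 - l f" for f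
  obtain K where K: "\<And>f. norm (l f) \<le> norm f * K" using l.bounded by blast
  have J_ge: "- (K\<^sup>2 / 2) \<le> J f" for f
  proof -
    have "l f \<le> norm f * K" using K[of f] by simp
    moreover have "0 \<le> (norm f - K)\<^sup>2" by simp
    ultimately show ?thesis
      by (simp add: J_def power2_diff field_simps)
  qed
  define m where "m = Inf (range J)"
  have bdd: "bdd_below (range J)" using J_ge by (intro bdd_belowI) auto
  have m_le: "m \<le> J f" for f
    unfolding m_def by (rule cINF_lower[OF bdd]) simp
  have "\<exists>f. J f < m + 1 / (real n + 1)" for n
    using cInf_lessD[of "range J" "m + 1 / (real n + 1)"] by (auto simp: m_def)
  then obtain x where x: "\<And>n. J (x n) < m + 1 / (real n + 1)" by metis
  \<comment> \<open>The parallelogram law: the linear part of \<open>J\<close> cancels at the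
    midpoint, so two near-minimizers are close and minimizing sequences are Cauchy.\<close>
  have par: "(norm (f - g))\<^sup>2 \<le> 4 * (J f + J g - 2 * m)" for f g
  proof -
    have "(norm (f - g))\<^sup>2 = 4 * (J f + J g - 2 * J ((1 / 2) *\<^sub>R (f + g)))"
      by (simp only: J_def l.scaleR l.add power2_norm_eq_inner inner_simps) (simp add: inner_commute[of g f] field_simps)
    then show ?thesis using m_le[of "(1 / 2) *\<^sub>R (f + g)"] by simp
  qed
  have "Cauchy x"
  proof (rule CauchyI)
    fix e :: real assume e: "0 < e"
    obtain N where N: "8 / e\<^sup>2 < real N" using reals_Archimedean2 by blast
    have "norm (x i - x j) < e" if ij: "N \<le> i" "N \<le> j" for i j
    proof -
      have N': "1 / (real k + 1) < e\<^sup>2 / 8" if "N \<le> k" for k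
      proof -
        have "8 / e\<^sup>2 < real k + 1" using N that by simp
        then show ?thesis using e by (simp add: field_simps)
      qed
      have "J (x k) < m + e\<^sup>2 / 8" if "N \<le> k" for k
        using less_trans[OF x add_strict_left_mono[OF N'[OF that]]] .
      from this[OF ij(1)] this[OF ij(2)] have "(norm (x i - x j))\<^sup>2 < e\<^sup>2"
        using par[of "x i" "x j"] by simp
      then show ?thesis using e by (simp add: power_less_imp_less_base)
    qed
    then show "\<exists>M. \<forall>i\<ge>M. \<forall>j\<ge>M. norm (x i - x j) < e" by (intro exI[of _ N]) simp
  qed
  then obtain g where g: "x \<longlonglongrightarrow> g"
    using Cauchy_convergent convergent_def by blast
  have "(\<lambda>n. J (x n)) \<longlonglongrightarrow> J g"
    unfolding J_def by (intro tendsto_intros l.tendsto g) simp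
  moreover have "(\<lambda>n. m + 1 / (real n + 1)) \<longlonglongrightarrow> m"
    by real_asymp
  ultimately have Jg: "J g \<le> m"
    by (rule LIMSEQ_le) (use x in \<open>auto intro!: exI[of _ 0] less_imp_le\<close>)
  have "l f = inner g f" for f
  proof (rule ccontr)
    assume ne: "l f \<noteq> inner g f"
    define d where "d = inner g f - l f"
    have d: "d \<noteq> 0" using ne by (simp add: d_def)
    have f0: "norm f > 0" using ne l.zero by (cases "f = 0") auto
    \<comment> \<open>The minimizer of \<open>J\<close> on the line through \<open>g\<close> in
      direction \<open>f\<close>; it would lower \<open>J\<close> by
      \<open>d\<^sup>2 / (2 * (norm f)\<^sup>2)\<close>.\<close>
    define t where "t = - d / (norm f)\<^sup>2"
    have "J (g + t *\<^sub>R f) = J g + t * d + t\<^sup>2 * (norm f)\<^sup>2 / 2"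
      by (simp add: J_def d_def l.scaleR l.add power2_norm_eq_inner inner_simps inner_commute[of f g])
        (simp add: field_simps power2_eq_square)
    also have "\<dots> = J g - d\<^sup>2 / (2 * (norm f)\<^sup>2)"
      using f0 by (simp add: t_def field_simps power2_eq_square)
    finally have "J (g + t *\<^sub>R f) < J g"
      using d f0 by simp
    then show False using m_le[of "g + t *\<^sub>R f"] Jg by linarith
  qed
  then show ?thesis by (rule that)
qed

lemma riesz_bergman:
  assumes add: "\<And>f g. \<phi> (f + g) = \<phi> f + \<phi> g" and scale: "\<And>c f. \<phi> (scaleC c f) = c * \<phi> f"
    and bound: "\<And>f. cmod (\<phi> f) \<le> K * norm f"
  obtains g where "\<And>f. \<phi> f = cinner f g"
proof -
  have "bounded_linear (\<lambda>f. Re (\<phi> f))"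
  proof (rule bounded_linear_intro[where K = K])
    fix f show "norm (Re (\<phi> f)) \<le> norm f * K"
      using abs_Re_le_cmod[of "\<phi> f"] bound[of f] by (simp add: mult.commute)
  qed (simp_all add: add scale scaleR_eq_scaleC)
  then obtain g where g: "\<And>f. Re (\<phi> f) = inner g f"
    using riesz_representation by blast
  have "\<phi> f = cinner f g" for f
  proof (rule complex_eqI)
    show "Re (\<phi> f) = Re (cinner f g)" for f by (simp add: g Re_cinner inner_commute)
    \<comment> \<open>Complex linearity recovers the imaginary part of the functional from its real
      part, since \<open>Re (- \<i> * x) = Im x\<close>.\<close>
    from this[of "scaleC (- \<i>) f"] show "Im (\<phi> f) = Im (cinner f g)"
      by (simp add: scale cinner_scaleC_left)
  qed
  then show ?thesis by (rule that)
qed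

lemma blinfun_bounded_opsI:
  assumes add: "\<And>f g. F (f + g) = F f + F g" and scale: "\<And>c f. F (scaleC c f) = scaleC c (F f)"
    and bound: "\<And>f. norm (F f) \<le> K * norm f" and K: "0 \<le> K"
  shows "blinfun_apply (Blinfun F) = F" "Blinfun F \<in> bounded_ops" "norm (Blinfun F) \<le> K"
proof -
  have "bounded_linear F"
    by (rule bounded_linear_intro[where K = K]) (simp_all add: add scale scaleR_eq_scaleC bound mult.commute)
  then show F: "blinfun_apply (Blinfun F) = F"
    by (rule bounded_linear_Blinfun_apply)
  show "Blinfun F \<in> bounded_ops"
    by (simp add: bounded_ops_def F scale)
  show "norm (Blinfun F) \<le> K"
    by (rule norm_blinfun_bound[OF K]) (simp add: F bound)
qed

lemma bounded_ops_scaleC: "S \<in> bounded_ops \<Longrightarrow> S (scaleC c f) = scaleC c (S f)"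
  by (simp add: bounded_ops_def)

lemma norm_le_of_cinner_le:
  assumes "\<And>g. cmod (cinner f g) \<le> K * norm g"
  shows "norm f \<le> K"
proof (cases "norm f = 0")
  case True
  \<comment> \<open>For \<open>f = 0\<close> the claim is \<open>0 \<le> K\<close>, which is read
    off from a unit vector.\<close>
  have "0 \<le> K * norm (normalized_kernel 0)"
    by (rule order_trans[OF norm_ge_zero assms])
  then show ?thesis
    using True by (simp add: norm_normalized_kernel)
next
  case False
  have "cmod (cinner f f) = norm f * norm f"
    by (simp only: cinner_self norm_of_real) (simp add: power2_eq_square)
  then have "norm f * norm f \<le> K * norm f"
    using assms[of f] by simp
  then show ?thesis using False by simp
qed

definition adj :: "(bergman \<Rightarrow>\<^sub>L bergman) \<Rightarrow> (bergman \<Rightarrow>\<^sub>L bergman)"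
  where "adj S = Blinfun (\<lambda>g. SOME h. \<forall>f. cinner (S f) g = cinner f h)"

lemma
  assumes S: "S \<in> bounded_ops"
  shows cinner_adj: "cinner (S f) g = cinner f (adj S g)"
    and adj_bounded_ops: "adj S \<in> bounded_ops"
    and norm_adj_le: "norm (adj S) \<le> norm S"
proof -
  define F where "F g = (SOME h. \<forall>f. cinner (S f) g = cinner f h)" for g
  have F: "cinner (S f) g = cinner f (F g)" for f g
  proof -
    obtain h where "\<And>f. cinner (S f) g = cinner f h"
    proof (rule riesz_bergman[where \<phi> = "\<lambda>f. cinner (S f) g" and K = "norm S * norm g"])
      show "cinner (S (f + h)) g = cinner (S f) g + cinner (S h) g" for f h
        by (simp add: blinfun.add_right cinner_add_left)
      show "cinner (S (scaleC c f)) g = c * cinner (S f) g" for c f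
        by (simp add: bounded_ops_scaleC[OF S] cinner_scaleC_left)
      show "cmod (cinner (S f) g) \<le> norm S * norm g * norm f" for f
        using norm_cinner_le[of "S f" g] mult_right_mono[OF norm_blinfun[of S f] norm_ge_zero[of g]]
        by (simp add: mult_ac)
    qed blast
    then have "\<exists>h. \<forall>f. cinner (S f) g = cinner f h" by blast
    then have "\<forall>f. cinner (S f) g = cinner f (F g)" unfolding F_def by (rule someI_ex)
    then show ?thesis by blast
  qed
  have F': "cinner (F g) f = cinner g (S f)" for f g
    by (metis F cinner_commute)
  have bound: "norm (F g) \<le> norm S * norm g" for g
  proof (rule norm_le_of_cinner_le)
    fix f
    show "cmod (cinner (F g) f) \<le> norm S * norm g * norm f"
      using norm_cinner_le[of g "S f"] mult_left_mono[OF norm_blinfun[of S f] norm_ge_zero[of g]]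
      by (simp add: F' mult_ac)
  qed
  have add: "F (f + g) = F f + F g" for f g
    by (rule bergman_eqI_cinner) (simp add: F' cinner_add_left)
  have scale: "F (scaleC c f) = scaleC c (F f)" for c f
    by (rule bergman_eqI_cinner) (simp add: F' cinner_scaleC_left)
  note B = blinfun_bounded_opsI[of F "norm S", OF add scale bound norm_ge_zero]
  have adj: "adj S = Blinfun F" unfolding adj_def F_def ..
  show "cinner (S f) g = cinner f (adj S g)" by (simp add: adj B(1) F)
  show "adj S \<in> bounded_ops" "norm (adj S) \<le> norm S" using B by (simp_all add: adj)
qed

lemma cinner_adj_left: "S \<in> bounded_ops \<Longrightarrow> cinner (adj S f) g = cinner f (S g)"
  by (metis cinner_adj cinner_commute)

lemma adj_eqI:
  fixes R :: "bergman \<Rightarrow>\<^sub>L bergman"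
  assumes "S \<in> bounded_ops" "\<And>f g. cinner (S f) g = cinner f (R g)"
  shows "adj S = R"
proof (rule blinfun_eqI)
  fix g show "adj S g = R g"
    using assms by (intro bergman_eqI_cinner) (metis cinner_adj cinner_commute)
qed

lemma is_adjoint_iff: "S \<in> bounded_ops \<Longrightarrow> is_adjoint S R \<longleftrightarrow> R = adj S"
  by (auto simp: is_adjoint_def cinner_adj intro: adj_eqI[symmetric])

lemma scaleC_add_right: "scaleC c (f + g) = scaleC c f + scaleC c g"
  by (rule bergman_eqI) (simp add: Rep_bergman_simps distrib_left)

lemma scaleC_diff_right: "scaleC c (f - g) = scaleC c f - scaleC c g"
  by (rule bergman_eqI) (simp add: Rep_bergman_simps right_diff_distrib)

lemma scaleC_zero_right [simp]: "scaleC c 0 = 0"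
  by (rule bergman_eqI) (simp add: Rep_bergman_simps)

lemma bounded_ops_add: "S \<in> bounded_ops \<Longrightarrow> R \<in> bounded_ops \<Longrightarrow> S + R \<in> bounded_ops"
  by (simp add: bounded_ops_def blinfun.add_left scaleC_add_right)

lemma bounded_ops_diff: "S \<in> bounded_ops \<Longrightarrow> R \<in> bounded_ops \<Longrightarrow> S - R \<in> bounded_ops"
  by (simp add: bounded_ops_def blinfun.diff_left scaleC_diff_right)

lemma bounded_ops_zero: "0 \<in> bounded_ops"
  by (simp add: bounded_ops_def)

lemma bounded_ops_compose: "S \<in> bounded_ops \<Longrightarrow> R \<in> bounded_ops \<Longrightarrow> S o\<^sub>L R \<in> bounded_ops"
  by (simp add: bounded_ops_def)

lemma scaleC_scaleC: "scaleC c (scaleC d f) = scaleC (c * d) f"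
  by (rule bergman_eqI) (simp add: Rep_bergman_simps)

lemma bounded_ops_op_scaleC: "S \<in> bounded_ops \<Longrightarrow> op_scaleC c S \<in> bounded_ops"
  by (simp add: bounded_ops_def op_scaleC_apply scaleC_scaleC mult.commute)

lemma closed_bounded_ops: "closed bounded_ops"
proof -
  have eq: "bounded_ops = (\<Inter>c. \<Inter>f. {S. blinfun_apply S (scaleC c f) = scaleC c (blinfun_apply S f)})"
    by (auto simp: bounded_ops_def)
  have "closed {S. blinfun_apply S (scaleC c f) = scaleC c (blinfun_apply S f)}" for c f
    by (intro closed_Collect_eq continuous_intros bounded_linear.continuous_on[OF bounded_linear_scaleC])
  then show ?thesis
    unfolding eq by blast
qed

lemma op_scaleC_minus_one: "op_scaleC (- 1) S = - S"
  by (rule blinfun_eqI, rule bergman_eqI) (simp add: op_scaleC_apply Rep_bergman_simps blinfun.minus_left)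

lemma complex_subspace_diff:
  assumes "complex_subspace A" "S \<in> A" "R \<in> A"
  shows "S - R \<in> A"
proof -
  have "S + op_scaleC (- 1) R \<in> A" using assms by (simp add: complex_subspace_def)
  then show ?thesis by (simp add: op_scaleC_minus_one)
qed

lemma adj_adj: "S \<in> bounded_ops \<Longrightarrow> adj (adj S) = S"
  by (intro adj_eqI adj_bounded_ops cinner_adj_left)

lemma adj_add: "S \<in> bounded_ops \<Longrightarrow> R \<in> bounded_ops \<Longrightarrow> adj (S + R) = adj S + adj R"
  by (intro adj_eqI bounded_ops_add) (simp_all add: blinfun.add_left cinner_add_left cinner_add_right cinner_adj)

lemma adj_diff: "S \<in> bounded_ops \<Longrightarrow> R \<in> bounded_ops \<Longrightarrow> adj (S - R) = adj S - adj R"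
  by (intro adj_eqI bounded_ops_diff) (simp_all add: blinfun.diff_left cinner_diff_left cinner_diff_right cinner_adj)

lemma adj_op_scaleC: "S \<in> bounded_ops \<Longrightarrow> adj (op_scaleC c S) = op_scaleC (cnj c) (adj S)"
  by (intro adj_eqI bounded_ops_op_scaleC) (simp_all add: op_scaleC_apply cinner_scaleC_left cinner_scaleC_right cinner_adj)

lemma adj_compose: "S \<in> bounded_ops \<Longrightarrow> R \<in> bounded_ops \<Longrightarrow> adj (S o\<^sub>L R) = adj R o\<^sub>L adj S"
  by (intro adj_eqI bounded_ops_compose) (simp_all add: cinner_adj)

lemma adj_zero [simp]: "adj 0 = 0"
  by (rule adj_eqI[OF bounded_ops_zero]) simp

lemma tendsto_adj:
  assumes S: "\<And>n. S n \<in> bounded_ops" and lim: "S \<longlonglongrightarrow> R"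
  shows "(\<lambda>n. adj (S n)) \<longlonglongrightarrow> adj R"
proof -
  have R: "R \<in> bounded_ops"
    by (rule closed_sequentially[OF closed_bounded_ops S lim])
  have "(\<lambda>n. norm (S n - R)) \<longlonglongrightarrow> 0"
    by (intro tendsto_norm_zero LIM_zero lim)
  moreover have le: "norm (adj (S n) - adj R) \<le> norm (S n - R)" for n
    using norm_adj_le[OF bounded_ops_diff[OF S R]] by (simp add: adj_diff S R)
  ultimately have "(\<lambda>n. adj (S n) - adj R) \<longlonglongrightarrow> 0"
    by (intro Lim_null_comparison[OF always_eventually[OF allI[OF le]]])
  then show ?thesis
    by (rule LIM_zero_cancel)
qed

section \<open>Toeplitz operators and the commutator ideal\<close>

definition bounded_symbol :: "(complex \<Rightarrow> complex) \<Rightarrow> bool"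
  where "bounded_symbol u \<longleftrightarrow> u \<in> borel_measurable dA \<and> (\<exists>M. \<forall>w. cmod w < 1 \<longrightarrow> cmod (u w) \<le> M)"

lemma bounded_symbolI:
  "u \<in> borel_measurable dA \<Longrightarrow> (\<And>w. cmod w < 1 \<Longrightarrow> cmod (u w) \<le> M) \<Longrightarrow> bounded_symbol u"
  unfolding bounded_symbol_def by blast

lemma bounded_symbol_measurable [measurable_dest]: "bounded_symbol u \<Longrightarrow> u \<in> borel_measurable dA"
  by (simp add: bounded_symbol_def)

lemma bounded_symbol_bound:
  assumes "bounded_symbol u"
  obtains M where "0 \<le> M" "\<And>w. cmod w < 1 \<Longrightarrow> cmod (u w) \<le> M"
proof -
  obtain M where M: "\<And>w. cmod w < 1 \<Longrightarrow> cmod (u w) \<le> M"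
    using assms unfolding bounded_symbol_def by blast
  moreover have "0 \<le> M" using M[of 0] by (simp add: order_trans[OF norm_ge_zero])
  ultimately show ?thesis by (rule that[rotated])
qed

lemma bounded_symbol_const [intro]: "bounded_symbol (\<lambda>_. c)"
  by (rule bounded_symbolI[of _ "cmod c"]) auto

lemma bounded_symbol_add [intro]:
  assumes "bounded_symbol u" "bounded_symbol v"
  shows "bounded_symbol (\<lambda>w. u w + v w)"
proof -
  obtain M N where "\<And>w. cmod w < 1 \<Longrightarrow> cmod (u w) \<le> M" "\<And>w. cmod w < 1 \<Longrightarrow> cmod (v w) \<le> N"
    using assms by (metis bounded_symbol_bound)
  then show ?thesis
    using assms by (intro bounded_symbolI[of _ "M + N"]) (auto intro!: norm_triangle_mono borel_measurable_add bounded_symbol_measurable)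
qed

lemma bounded_symbol_mult [intro]:
  assumes "bounded_symbol u" "bounded_symbol v"
  shows "bounded_symbol (\<lambda>w. u w * v w)"
proof -
  obtain M N where "0 \<le> M" "\<And>w. cmod w < 1 \<Longrightarrow> cmod (u w) \<le> M" "\<And>w. cmod w < 1 \<Longrightarrow> cmod (v w) \<le> N"
    using assms by (metis bounded_symbol_bound)
  then show ?thesis
    using assms by (intro bounded_symbolI[of _ "M * N"])
      (auto simp: norm_mult intro!: mult_mono borel_measurable_times bounded_symbol_measurable)
qed

lemma bounded_symbol_cnj [intro]:
  assumes "bounded_symbol u"
  shows "bounded_symbol (\<lambda>w. cnj (u w))"
proof -
  obtain M where "\<And>w. cmod w < 1 \<Longrightarrow> cmod (u w) \<le> M"
    using assms by (metis bounded_symbol_bound)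
  then show ?thesis
    using assms by (intro bounded_symbolI[of _ M])
      (auto intro: measurable_compose[OF bounded_symbol_measurable measurable_cnj])
qed

lemma bounded_symbol_diff [intro]:
  assumes "bounded_symbol u" "bounded_symbol v"
  shows "bounded_symbol (\<lambda>w. u w - v w)"
  using bounded_symbol_add[OF assms(1) bounded_symbol_mult[OF bounded_symbol_const[of "-1"] assms(2)]] by simp

lemma H_infinity_iff:
  "h \<in> H_infinity \<longleftrightarrow> h holomorphic_on unit_disk \<and> (\<exists>M. \<forall>w. cmod w < 1 \<longrightarrow> cmod (h w) \<le> M)"
  unfolding H_infinity_def bounded_iff ball_simps mem_Collect_eq
  by (simp add: Ball_def del: mem_ball)

lemma bounded_symbol_holomorphic: "h \<in> H_infinity \<Longrightarrow> bounded_symbol h"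
  unfolding H_infinity_iff bounded_symbol_def using holomorphic_measurable_dA by blast

lemma H_infinityI:
  "h holomorphic_on unit_disk \<Longrightarrow> (\<And>w. cmod w < 1 \<Longrightarrow> cmod (h w) \<le> M) \<Longrightarrow> h \<in> H_infinity"
  unfolding H_infinity_iff by blast

lemma H_infinity_holomorphic: "h \<in> H_infinity \<Longrightarrow> h holomorphic_on unit_disk"
  by (simp add: H_infinity_def)

lemma bounded_symbol_integrable:
  assumes "bounded_symbol u"
  shows "integrable dA (\<lambda>w. u w * (Rep_bergman f w * cnj (Rep_bergman g w)))"
proof -
  obtain M where M: "\<And>w. cmod w < 1 \<Longrightarrow> cmod (u w) \<le> M"
    using assms by (metis bounded_symbol_bound)
  have [measurable]: "u \<in> borel_measurable dA" using assms by (rule bounded_symbol_measurable)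
  have "integrable dA (\<lambda>w. of_real M * (Rep_bergman f w * cnj (Rep_bergman g w)))"
    by (intro integrable_mult_right cinner_integrable)
  then show ?thesis
  proof (rule Bochner_Integration.integrable_bound)
    show "AE w in dA. norm (u w * (Rep_bergman f w * cnj (Rep_bergman g w)))
        \<le> norm (complex_of_real M * (Rep_bergman f w * cnj (Rep_bergman g w)))"
      using M by (intro AE_I2) (auto simp: norm_mult intro!: mult_right_mono order_trans[OF M])
  qed measurable
qed

text \<open>For unit vectors, the inequality of arithmetic and geometric means bounds the bilinear
  integral by the mean of two quadratic ones; scaling gives the rest. A bound on the quadratic form
  of a symbol thus becomes an operator norm bound with the same constant.\<close>

lemma weighted_cauchy_schwarz:
  assumes q: "q \<in> borel_measurable dA" "\<And>w. cmod w < 1 \<Longrightarrow> 0 \<le> q w" "\<And>w. cmod w < 1 \<Longrightarrow> q w \<le> K"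
    and k: "\<And>f. (\<integral>w. q w * (cmod (Rep_bergman f w))\<^sup>2 \<partial>dA) \<le> k * (norm f)\<^sup>2"
  shows "(\<integral>w. q w * (cmod (Rep_bergman f w) * cmod (Rep_bergman g w)) \<partial>dA) \<le> k * norm f * norm g"
proof -
  have [measurable]: "q \<in> borel_measurable dA" by fact
  have K0: "0 \<le> K" using q(2,3)[of 0] by simp
  have int: "integrable dA (\<lambda>w. q w * (cmod (Rep_bergman f w))\<^sup>2)" for f
  proof (rule Bochner_Integration.integrable_bound[OF integrable_mult_right[OF Rep_bergman_integrable[of f], of K]])
    show "AE w in dA. norm (q w * (cmod (Rep_bergman f w))\<^sup>2) \<le> norm (K * (cmod (Rep_bergman f w))\<^sup>2)"
      using q K0 by (intro AE_I2) (auto simp: abs_mult intro!: mult_right_mono)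
  qed measurable
  have am: "(\<integral>w. q w * (cmod (Rep_bergman f w) * cmod (Rep_bergman g w)) \<partial>dA) \<le> k" if "norm f = 1" "norm g = 1" for f g
  proof -
    have "(\<integral>w. q w * (cmod (Rep_bergman f w) * cmod (Rep_bergman g w)) \<partial>dA)
        \<le> (\<integral>w. (1 / 2) * (q w * (cmod (Rep_bergman f w))\<^sup>2 + q w * (cmod (Rep_bergman g w))\<^sup>2) \<partial>dA)"
    proof (rule integral_mono)
      have le: "q w * (cmod (Rep_bergman f w) * cmod (Rep_bergman g w))
          \<le> (1 / 2) * (q w * (cmod (Rep_bergman f w))\<^sup>2 + q w * (cmod (Rep_bergman g w))\<^sup>2)" if "cmod w < 1" for w
        using mult_left_mono[OF sum_squares_bound[of "cmod (Rep_bergman f w)" "cmod (Rep_bergman g w)"] q(2)[OF that]]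
        by (simp add: algebra_simps)
      then show "w \<in> space dA \<Longrightarrow> q w * (cmod (Rep_bergman f w) * cmod (Rep_bergman g w))
          \<le> (1 / 2) * (q w * (cmod (Rep_bergman f w))\<^sup>2 + q w * (cmod (Rep_bergman g w))\<^sup>2)" for w
        by simp
      show i: "integrable dA (\<lambda>w. (1 / 2) * (q w * (cmod (Rep_bergman f w))\<^sup>2 + q w * (cmod (Rep_bergman g w))\<^sup>2))"
        by (intro integrable_mult_right Bochner_Integration.integrable_add int)
      show "integrable dA (\<lambda>w. q w * (cmod (Rep_bergman f w) * cmod (Rep_bergman g w)))"
      proof (rule Bochner_Integration.integrable_bound[OF i])
        show "AE w in dA. norm (q w * (cmod (Rep_bergman f w) * cmod (Rep_bergman g w)))
            \<le> norm ((1 / 2) * (q w * (cmod (Rep_bergman f w))\<^sup>2 + q w * (cmod (Rep_bergman g w))\<^sup>2))"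
          using le q by (intro AE_I2) (simp add: abs_mult)
      qed measurable
    qed
    also have "\<dots> = (1 / 2) * ((\<integral>w. q w * (cmod (Rep_bergman f w))\<^sup>2 \<partial>dA) + (\<integral>w. q w * (cmod (Rep_bergman g w))\<^sup>2 \<partial>dA))"
      by (simp add: int)
    also have "\<dots> \<le> k"
      using k[of f] k[of g] that by simp
    finally show ?thesis .
  qed
  show ?thesis
  proof (cases "f = 0 \<or> g = 0")
    case True
    then show ?thesis by (auto simp: Rep_bergman_simps)
  next
    case False
    then have n: "norm f \<noteq> 0" "norm g \<noteq> 0" by auto
    have "(\<integral>w. q w * (cmod (Rep_bergman (sgn f) w) * cmod (Rep_bergman (sgn g) w)) \<partial>dA) \<le> k"
      using False by (intro am) (simp_all add: norm_sgn)
    moreover have "(\<integral>w. q w * (cmod (Rep_bergman (sgn f) w) * cmod (Rep_bergman (sgn g) w)) \<partial>dA)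
        = (\<integral>w. q w * (cmod (Rep_bergman f w) * cmod (Rep_bergman g w)) \<partial>dA) * (inverse (norm f) * inverse (norm g))"
      by (subst integral_mult_left_zero[symmetric])
        (simp add: sgn_div_norm Rep_bergman_simps norm_mult norm_inverse mult_ac)
    ultimately show ?thesis
      using n by (simp add: field_simps)
  qed
qed

lemma norm_integral_bounded_symbol_le:
  assumes u: "bounded_symbol u" and M: "\<And>w. cmod w < 1 \<Longrightarrow> cmod (u w) \<le> M"
  shows "cmod (\<integral>w. u w * (Rep_bergman f w * cnj (Rep_bergman g w)) \<partial>dA) \<le> M * norm f * norm g"
proof -
  have M0: "0 \<le> M" using M[of 0] by (simp add: order_trans[OF norm_ge_zero])
  have "cmod (\<integral>w. u w * (Rep_bergman f w * cnj (Rep_bergman g w)) \<partial>dA)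
      \<le> (\<integral>w. cmod (u w * (Rep_bergman f w * cnj (Rep_bergman g w))) \<partial>dA)"
    by (rule integral_norm_bound)
  also have "\<dots> = (\<integral>w. cmod (u w) * (cmod (Rep_bergman f w) * cmod (Rep_bergman g w)) \<partial>dA)"
    by (simp add: norm_mult)
  also have "\<dots> \<le> M * norm f * norm g"
  proof (rule weighted_cauchy_schwarz[where K = M])
    show "(\<lambda>w. cmod (u w)) \<in> borel_measurable dA"
      using bounded_symbol_measurable[OF u] by measurable
    fix f
    have "(\<integral>w. cmod (u w) * (cmod (Rep_bergman f w))\<^sup>2 \<partial>dA) \<le> (\<integral>w. M * (cmod (Rep_bergman f w))\<^sup>2 \<partial>dA)"
    proof (rule integral_mono)
      have "integrable dA (\<lambda>w. cmod (u w * (Rep_bergman f w * cnj (Rep_bergman f w))))"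
        by (intro integrable_norm bounded_symbol_integrable u)
      then show "integrable dA (\<lambda>w. cmod (u w) * (cmod (Rep_bergman f w))\<^sup>2)"
        by (simp add: norm_mult power2_eq_square)
    qed (use M in \<open>auto intro: integrable_mult_right Rep_bergman_integrable mult_right_mono\<close>)
    then show "(\<integral>w. cmod (u w) * (cmod (Rep_bergman f w))\<^sup>2 \<partial>dA) \<le> M * (norm f)\<^sup>2"
      by (simp add: norm_bergman_square)
  qed (use M in auto)
  finally show ?thesis .
qed

text \<open>The Riesz representative of the pairing with \<open>h\<close> satisfies the condition
  under the definite description, and nondegeneracy of the inner product makes it unique. The
  hypotheses say that \<open>h\<close> pairs boundedly with the space, which is what is available
  for a bounded symbol times a Bergman function.\<close>

lemma cinner_bergman_proj:
  assumes int: "\<And>f. integrable dA (\<lambda>w. h w * cnj (Rep_bergman f w))"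
    and K: "\<And>f. cmod (L2_inner h (Rep_bergman f)) \<le> K * norm f"
  shows "cinner (bergman_proj h) f = L2_inner h (Rep_bergman f)"
proof -
  obtain g where g: "\<And>f. cnj (L2_inner h (Rep_bergman f)) = cinner f g"
  proof (rule riesz_bergman[where \<phi> = "\<lambda>f. cnj (L2_inner h (Rep_bergman f))" and K = K])
    show "cnj (L2_inner h (Rep_bergman (f + g))) = cnj (L2_inner h (Rep_bergman f)) + cnj (L2_inner h (Rep_bergman g))" for f g
      by (simp add: L2_inner_def Rep_bergman_simps distrib_left int)
    show "cnj (L2_inner h (Rep_bergman (scaleC c f))) = c * cnj (L2_inner h (Rep_bergman f))" for c f
    proof -
      have "L2_inner h (Rep_bergman (scaleC c f)) = (\<integral>w. cnj c * (h w * cnj (Rep_bergman f w)) \<partial>dA)"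
        unfolding L2_inner_def by (simp add: Rep_bergman_simps mult_ac)
      also have "\<dots> = cnj c * L2_inner h (Rep_bergman f)"
        unfolding L2_inner_def by (rule integral_mult_right_zero)
      finally show ?thesis by simp
    qed
    show "cmod (cnj (L2_inner h (Rep_bergman f))) \<le> K * norm f" for f
      using K[of f] by simp
  qed blast
  have split: "L2_inner (\<lambda>w. h w - Rep_bergman g w) (Rep_bergman f) = L2_inner h (Rep_bergman f) - cinner g f" for f g
    unfolding cinner_def L2_inner_def by (simp add: left_diff_distrib int cinner_integrable)
  have eq: "L2_inner h (Rep_bergman f) = cinner g f" for f
    using g[of f] by (metis cinner_commute complex_cnj_cnj)
  have "bergman_proj h = g"
    unfolding bergman_proj_def split
    by (rule the_equality) (auto simp: eq intro: bergman_eqI_cinner)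
  then show ?thesis by (simp add: eq)
qed

lemma
  assumes u: "bounded_symbol u"
  shows cinner_toeplitz: "cinner (toeplitz u f) g = (\<integral>w. u w * (Rep_bergman f w * cnj (Rep_bergman g w)) \<partial>dA)"
    and toeplitz_bounded_ops: "toeplitz u \<in> bounded_ops"
    and norm_toeplitz_le: "(\<And>w. cmod w < 1 \<Longrightarrow> cmod (u w) \<le> M) \<Longrightarrow> norm (toeplitz u) \<le> M"
proof -
  define F where "F f = bergman_proj (\<lambda>w. u w * Rep_bergman f w)" for f
  obtain N where N: "0 \<le> N" "\<And>w. cmod w < 1 \<Longrightarrow> cmod (u w) \<le> N"
    using bounded_symbol_bound[OF u] by blast
  have F: "cinner (F f) g = (\<integral>w. u w * (Rep_bergman f w * cnj (Rep_bergman g w)) \<partial>dA)" for f g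
  proof -
    have "cinner (F f) g = L2_inner (\<lambda>w. u w * Rep_bergman f w) (Rep_bergman g)"
      unfolding F_def
    proof (rule cinner_bergman_proj)
      show "integrable dA (\<lambda>w. u w * Rep_bergman f w * cnj (Rep_bergman g w))" for g
        using bounded_symbol_integrable[OF u, of f g] by (simp add: mult.assoc)
      show "cmod (L2_inner (\<lambda>w. u w * Rep_bergman f w) (Rep_bergman g)) \<le> N * norm f * norm g" for g
        using norm_integral_bounded_symbol_le[OF u N(2), of f g] by (simp add: L2_inner_def mult.assoc)
    qed
    then show ?thesis by (simp add: L2_inner_def mult.assoc)
  qed
  have add: "F (f + g) = F f + F g" for f g
    by (rule bergman_eqI_cinner)
      (simp add: F cinner_add_left Rep_bergman_simps distrib_left distrib_right bounded_symbol_integrable[OF u])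
  have scale: "F (scaleC c f) = scaleC c (F f)" for c f
  proof (rule bergman_eqI_cinner)
    fix h
    have "cinner (F (scaleC c f)) h = (\<integral>w. c * (u w * (Rep_bergman f w * cnj (Rep_bergman h w))) \<partial>dA)"
      by (simp add: F Rep_bergman_simps mult_ac)
    then show "cinner (F (scaleC c f)) h = cinner (scaleC c (F f)) h"
      by (simp add: F cinner_scaleC_left)
  qed
  have bound: "norm (F f) \<le> M * norm f" if "\<And>w. cmod w < 1 \<Longrightarrow> cmod (u w) \<le> M" for f M
    by (rule norm_le_of_cinner_le) (use norm_integral_bounded_symbol_le[OF u that] in \<open>simp add: F\<close>)
  note B = blinfun_bounded_opsI[of F N, OF add scale bound[OF N(2)] N(1)]
  have t: "toeplitz u = Blinfun F" unfolding toeplitz_def F_def ..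
  show "cinner (toeplitz u f) g = (\<integral>w. u w * (Rep_bergman f w * cnj (Rep_bergman g w)) \<partial>dA)"
    by (simp add: t B(1) F)
  show "toeplitz u \<in> bounded_ops" by (simp add: t B(2))
  show "norm (toeplitz u) \<le> M" if M: "\<And>w. cmod w < 1 \<Longrightarrow> cmod (u w) \<le> M"
  proof -
    have "0 \<le> M" using M[of 0] by (simp add: order_trans[OF norm_ge_zero])
    from blinfun_bounded_opsI(3)[of F M, OF add scale bound[OF M] this]
    show ?thesis by (simp add: t)
  qed
qed

lemma toeplitz_cong:
  assumes "\<And>w. cmod w < 1 \<Longrightarrow> u w = v w"
  shows "toeplitz u = toeplitz v"
proof -
  have "L2_inner (\<lambda>w. u w * Rep_bergman f w - g w) h = L2_inner (\<lambda>w. v w * Rep_bergman f w - g w) h" for f g h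
    unfolding L2_inner_def using assms by (intro Bochner_Integration.integral_cong) auto
  then show ?thesis unfolding toeplitz_def bergman_proj_def by simp
qed

lemma blinfun_eqI_cinner: "(\<And>f g. cinner (blinfun_apply S f) g = cinner (blinfun_apply R f) g) \<Longrightarrow> S = R"
  by (intro blinfun_eqI bergman_eqI_cinner)

lemma toeplitz_add:
  assumes "bounded_symbol u" "bounded_symbol v"
  shows "toeplitz (\<lambda>w. u w + v w) = toeplitz u + toeplitz v"
  using assms by (intro blinfun_eqI_cinner)
    (simp add: cinner_toeplitz bounded_symbol_add blinfun.add_left cinner_add_left distrib_right bounded_symbol_integrable)

lemma toeplitz_diff:
  assumes "bounded_symbol u" "bounded_symbol v"
  shows "toeplitz (\<lambda>w. u w - v w) = toeplitz u - toeplitz v"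
  using assms by (intro blinfun_eqI_cinner)
    (simp add: cinner_toeplitz bounded_symbol_diff blinfun.diff_left cinner_diff_left left_diff_distrib bounded_symbol_integrable)

lemma toeplitz_scale:
  assumes "bounded_symbol u"
  shows "toeplitz (\<lambda>w. c * u w) = op_scaleC c (toeplitz u)"
  using assms bounded_symbol_mult[OF bounded_symbol_const assms] by (intro blinfun_eqI_cinner)
    (simp add: cinner_toeplitz op_scaleC_apply cinner_scaleC_left mult.assoc)

lemma toeplitz_one: "toeplitz (\<lambda>_. 1) = id_blinfun"
  by (intro blinfun_eqI_cinner)
    (simp add: cinner_toeplitz[OF bounded_symbol_const], simp add: cinner_def L2_inner_def)

lemma adj_toeplitz:
  assumes u: "bounded_symbol u"
  shows "adj (toeplitz u) = toeplitz (\<lambda>w. cnj (u w))"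
proof (rule adj_eqI[OF toeplitz_bounded_ops[OF u]])
  fix f g
  have "cinner f (toeplitz (\<lambda>w. cnj (u w)) g) = cnj (cinner (toeplitz (\<lambda>w. cnj (u w)) g) f)"
    by (rule cinner_commute)
  also have "\<dots> = (\<integral>w. cnj (cnj (u w) * (Rep_bergman g w * cnj (Rep_bergman f w))) \<partial>dA)"
    unfolding cinner_toeplitz[OF bounded_symbol_cnj[OF u]] by (rule Bochner_Integration.integral_cnj[symmetric])
  also have "\<dots> = cinner (toeplitz u f) g"
    by (simp add: cinner_toeplitz u mult_ac)
  finally show "cinner (toeplitz u f) g = cinner f (toeplitz (\<lambda>w. cnj (u w)) g)" ..
qed

lemma Rep_toeplitz_holomorphic:
  assumes h: "h \<in> H_infinity" and w: "cmod w < 1"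
  shows "Rep_bergman (toeplitz h f) w = h w * Rep_bergman f w"
proof -
  have u: "bounded_symbol h" using h by (rule bounded_symbol_holomorphic)
  define g where "g = to_bergman (\<lambda>w. h w * Rep_bergman f w)"
  have g: "Rep_bergman g w = h w * Rep_bergman f w" if "cmod w < 1" for w
    unfolding g_def
  proof (rule Rep_to_bergman[OF _ _ that])
    show "(\<lambda>w. h w * Rep_bergman f w) holomorphic_on unit_disk"
      using h by (intro holomorphic_intros Rep_bergman_holomorphic) (simp add: H_infinity_def)
    obtain M where M: "\<And>w. cmod w < 1 \<Longrightarrow> cmod (h w) \<le> M"
      using bounded_symbol_bound[OF u] by metis
    have [measurable]: "h \<in> borel_measurable dA" using u by (rule bounded_symbol_measurable)
    have "integrable dA (\<lambda>w. M\<^sup>2 * (cmod (Rep_bergman f w))\<^sup>2)"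
      by (intro integrable_mult_right Rep_bergman_integrable)
    then show "integrable dA (\<lambda>w. (cmod (h w * Rep_bergman f w))\<^sup>2)"
    proof (rule Bochner_Integration.integrable_bound)
      show "AE w in dA. norm ((cmod (h w * Rep_bergman f w))\<^sup>2) \<le> norm (M\<^sup>2 * (cmod (Rep_bergman f w))\<^sup>2)"
        using M by (intro AE_I2) (auto simp: norm_mult power_mult_distrib intro!: mult_right_mono power_mono)
    qed measurable
  qed
  have "toeplitz h f = g"
  proof (rule bergman_eqI_cinner)
    fix k
    show "cinner (toeplitz h f) k = cinner g k"
      unfolding cinner_toeplitz[OF u] unfolding cinner_def L2_inner_def
      by (intro Bochner_Integration.integral_cong refl) (simp add: g mult.assoc)
  qed
  then show ?thesis using g[OF w] by simp
qed

text \<open>The operator of a holomorphic symbol is plain multiplication, with no projection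
  involved. In the opposite order the product is in general not a Toeplitz operator, and this
  asymmetry is the source of the commutators.\<close>

lemma toeplitz_compose_holomorphic:
  assumes h: "h \<in> H_infinity" and v: "bounded_symbol v"
  shows "toeplitz v o\<^sub>L toeplitz h = toeplitz (\<lambda>w. v w * h w)"
proof (rule blinfun_eqI_cinner)
  fix f g
  have u: "bounded_symbol h" using h by (rule bounded_symbol_holomorphic)
  show "cinner ((toeplitz v o\<^sub>L toeplitz h) f) g = cinner (toeplitz (\<lambda>w. v w * h w) f) g"
    unfolding blinfun_apply_blinfun_compose cinner_toeplitz[OF v] cinner_toeplitz[OF bounded_symbol_mult[OF v u]]
    by (intro Bochner_Integration.integral_cong refl) (simp add: Rep_toeplitz_holomorphic[OF h] mult.assoc)
qed

lemma toeplitz_cnj_holomorphic_compose: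
  assumes h: "h \<in> H_infinity" and v: "bounded_symbol v"
  shows "toeplitz (\<lambda>w. cnj (h w)) o\<^sub>L toeplitz v = toeplitz (\<lambda>w. cnj (h w) * v w)"
proof -
  have u: "bounded_symbol h" using h by (rule bounded_symbol_holomorphic)
  have "toeplitz (\<lambda>w. cnj (h w)) o\<^sub>L toeplitz v = adj (toeplitz (\<lambda>w. cnj (v w)) o\<^sub>L toeplitz h)"
    using u v by (simp add: adj_compose toeplitz_bounded_ops adj_toeplitz bounded_symbol_cnj)
  also have "\<dots> = toeplitz (\<lambda>w. cnj (h w) * v w)"
    unfolding toeplitz_compose_holomorphic[OF h bounded_symbol_cnj[OF v]]
    using u v by (subst adj_toeplitz) (auto simp: mult.commute)
  finally show ?thesis .
qed

lemma H_infinity_mult: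
  assumes "g \<in> H_infinity" "h \<in> H_infinity"
  shows "(\<lambda>w. g w * h w) \<in> H_infinity"
proof -
  obtain M N where "0 \<le> M" "\<And>w. cmod w < 1 \<Longrightarrow> cmod (g w) \<le> M" "\<And>w. cmod w < 1 \<Longrightarrow> cmod (h w) \<le> N"
    using assms[THEN bounded_symbol_holomorphic] by (metis bounded_symbol_bound)
  then have le: "cmod (g w * h w) \<le> M * N" if "cmod w < 1" for w
    using that by (auto simp: norm_mult intro!: mult_mono)
  show ?thesis
    by (rule H_infinityI[OF holomorphic_on_mult[OF assms[THEN H_infinity_holomorphic]] le])
qed

lemma H_infinity_const: "(\<lambda>_. c) \<in> H_infinity"
  by (rule H_infinityI[of _ "cmod c"]) auto

lemma H_infinity_diff_const:
  assumes "h \<in> H_infinity"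
  shows "(\<lambda>w. h w - c) \<in> H_infinity"
proof -
  obtain M where "\<And>w. cmod w < 1 \<Longrightarrow> cmod (h w) \<le> M"
    using bounded_symbol_holomorphic[OF assms] by (metis bounded_symbol_bound)
  then show ?thesis
    by (intro H_infinityI[OF holomorphic_on_diff[OF H_infinity_holomorphic[OF assms] holomorphic_on_const], of _ "M + cmod c"])
      (auto intro!: order_trans[OF norm_triangle_ineq4])
qed

section \<open>The Toeplitz algebra and its commutator ideal\<close>

lemma C_star_subalgebra_bounded_ops: "C_star_subalgebra bounded_ops"
  unfolding C_star_subalgebra_def complex_subspace_def
  by (auto simp: closed_bounded_ops bounded_ops_zero bounded_ops_add bounded_ops_op_scaleC bounded_ops_compose
      is_adjoint_iff adj_bounded_ops)

lemma toeplitz_algebra_subset_bounded_ops: "toeplitz_algebra \<subseteq> bounded_ops"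
  unfolding toeplitz_algebra_def generated_C_star_subalgebra_def
  using C_star_subalgebra_bounded_ops by (auto simp: toeplitz_bounded_ops bounded_symbol_holomorphic)

lemma toeplitz_algebra_bounded_ops: "S \<in> toeplitz_algebra \<Longrightarrow> S \<in> bounded_ops"
  using toeplitz_algebra_subset_bounded_ops by blast

lemma C_star_subalgebra_toeplitz_algebra: "C_star_subalgebra toeplitz_algebra"
proof -
  let ?F = "{A. C_star_subalgebra A \<and> toeplitz ` H_infinity \<subseteq> A}"
  have T: "toeplitz_algebra = \<Inter>?F"
    unfolding toeplitz_algebra_def generated_C_star_subalgebra_def ..
  have "closed (\<Inter>?F)"
    by (rule closed_Inter) (auto simp: C_star_subalgebra_def)
  then show ?thesis
    using toeplitz_algebra_subset_bounded_ops
    unfolding C_star_subalgebra_def complex_subspace_def T by blast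
qed

lemma
  shows closed_toeplitz_algebra: "closed toeplitz_algebra"
    and complex_subspace_toeplitz_algebra: "complex_subspace toeplitz_algebra"
    and toeplitz_algebra_compose: "S \<in> toeplitz_algebra \<Longrightarrow> R \<in> toeplitz_algebra \<Longrightarrow> S o\<^sub>L R \<in> toeplitz_algebra"
  using C_star_subalgebra_toeplitz_algebra by (simp_all add: C_star_subalgebra_def)

lemma toeplitz_algebra_adj: "S \<in> toeplitz_algebra \<Longrightarrow> adj S \<in> toeplitz_algebra"
  using C_star_subalgebra_toeplitz_algebra is_adjoint_iff[OF toeplitz_algebra_bounded_ops]
  unfolding C_star_subalgebra_def by blast

lemma toeplitz_algebra_add: "S \<in> toeplitz_algebra \<Longrightarrow> R \<in> toeplitz_algebra \<Longrightarrow> S + R \<in> toeplitz_algebra"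
  using complex_subspace_toeplitz_algebra by (simp add: complex_subspace_def)

lemmas toeplitz_algebra_diff = complex_subspace_diff[OF complex_subspace_toeplitz_algebra]

lemma toeplitz_holomorphic_in_algebra: "h \<in> H_infinity \<Longrightarrow> toeplitz h \<in> toeplitz_algebra"
  unfolding toeplitz_algebra_def generated_C_star_subalgebra_def by blast

lemma toeplitz_cnj_holomorphic_in_algebra:
  assumes "h \<in> H_infinity"
  shows "toeplitz (\<lambda>w. cnj (h w)) \<in> toeplitz_algebra"
  using toeplitz_algebra_adj[OF toeplitz_holomorphic_in_algebra[OF assms]]
  by (simp add: adj_toeplitz bounded_symbol_holomorphic assms)

text \<open>An induction principle that does not ask \<open>G\<close> to be self-adjoint: the
  operators of the algebra lying in \<open>G\<close> together with their adjoints form a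
  C*-subalgebra, and the antiholomorphic generators place the holomorphic ones in it.\<close>

lemma toeplitz_algebra_subsetI:
  assumes closed: "closed G" and sub: "complex_subspace G"
    and comp: "\<And>S R. S \<in> G \<Longrightarrow> R \<in> G \<Longrightarrow> S o\<^sub>L R \<in> G"
    and gen: "\<And>h. h \<in> H_infinity \<Longrightarrow> toeplitz h \<in> G" "\<And>h. h \<in> H_infinity \<Longrightarrow> toeplitz (\<lambda>w. cnj (h w)) \<in> G"
  shows "toeplitz_algebra \<subseteq> G"
proof -
  let ?A = "{S \<in> toeplitz_algebra. S \<in> G \<and> adj S \<in> G}"
  note T = toeplitz_algebra_bounded_ops
  have "closed ?A"
    unfolding closed_sequential_limits
  proof (intro allI impI, elim conjE)
    fix X S assume X: "\<forall>n. X n \<in> ?A" and lim: "X \<longlonglongrightarrow> S"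
    have "S \<in> toeplitz_algebra" "S \<in> G"
      using X closed_sequentially[OF closed_toeplitz_algebra _ lim] closed_sequentially[OF closed _ lim] by blast+
    moreover have "(\<lambda>n. adj (X n)) \<longlonglongrightarrow> adj S"
      using X by (intro tendsto_adj lim) (simp add: T)
    then have "adj S \<in> G"
      using X closed_sequentially[OF closed, of "\<lambda>n. adj (X n)"] by blast
    ultimately show "S \<in> ?A" by blast
  qed
  moreover have "complex_subspace ?A"
    using sub complex_subspace_toeplitz_algebra
    by (auto simp: complex_subspace_def adj_add adj_op_scaleC T)
  moreover have "S o\<^sub>L R \<in> ?A" if "S \<in> ?A" "R \<in> ?A" for S R
    using that by (auto simp: toeplitz_algebra_compose comp adj_compose T)
  moreover have "R \<in> ?A" if "S \<in> ?A" "is_adjoint S R" for S R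
    using that by (auto simp: is_adjoint_iff T toeplitz_algebra_adj adj_adj)
  ultimately have "C_star_subalgebra ?A"
    unfolding C_star_subalgebra_def using toeplitz_algebra_subset_bounded_ops by blast
  moreover have "toeplitz ` H_infinity \<subseteq> ?A"
    using gen toeplitz_holomorphic_in_algebra by (auto simp: adj_toeplitz bounded_symbol_holomorphic)
  ultimately have "toeplitz_algebra \<subseteq> ?A"
    unfolding toeplitz_algebra_def generated_C_star_subalgebra_def by blast
  then show ?thesis by blast
qed

abbreviation (input) toeplitz_ideal :: "(bergman \<Rightarrow>\<^sub>L bergman) set"
  where "toeplitz_ideal \<equiv> commutator_ideal toeplitz_algebra"

lemma closed_ideal_toeplitz_ideal: "closed_ideal toeplitz_algebra toeplitz_ideal"
proof -
  let ?F = "{I. closed_ideal toeplitz_algebra I \<and> (\<forall>R\<in>toeplitz_algebra. \<forall>S\<in>toeplitz_algebra. (R o\<^sub>L S) - (S o\<^sub>L R) \<in> I)}"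
  have C: "toeplitz_ideal = \<Inter>?F" unfolding commutator_ideal_def ..
  have "closed_ideal toeplitz_algebra toeplitz_algebra"
    unfolding closed_ideal_def
    using closed_toeplitz_algebra complex_subspace_toeplitz_algebra toeplitz_algebra_compose by blast
  then have T: "toeplitz_algebra \<in> ?F"
    by (blast intro: toeplitz_algebra_diff toeplitz_algebra_compose)
  have "closed (\<Inter>?F)"
    by (rule closed_Inter) (simp add: closed_ideal_def)
  moreover have "\<Inter>?F \<subseteq> toeplitz_algebra" using T by (rule Inter_lower)
  ultimately show ?thesis
    unfolding C closed_ideal_def complex_subspace_def by blast
qed

lemma
  shows toeplitz_ideal_subset: "toeplitz_ideal \<subseteq> toeplitz_algebra"
    and closed_toeplitz_ideal: "closed toeplitz_ideal"
    and complex_subspace_toeplitz_ideal: "complex_subspace toeplitz_ideal"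
    and toeplitz_ideal_compose_left: "S \<in> toeplitz_algebra \<Longrightarrow> R \<in> toeplitz_ideal \<Longrightarrow> S o\<^sub>L R \<in> toeplitz_ideal"
    and toeplitz_ideal_compose_right: "S \<in> toeplitz_algebra \<Longrightarrow> R \<in> toeplitz_ideal \<Longrightarrow> R o\<^sub>L S \<in> toeplitz_ideal"
  using closed_ideal_toeplitz_ideal by (simp_all add: closed_ideal_def)

lemma
  shows toeplitz_ideal_zero: "0 \<in> toeplitz_ideal"
    and toeplitz_ideal_add: "S \<in> toeplitz_ideal \<Longrightarrow> R \<in> toeplitz_ideal \<Longrightarrow> S + R \<in> toeplitz_ideal"
  using complex_subspace_toeplitz_ideal by (simp_all add: complex_subspace_def)

lemmas toeplitz_ideal_diff = complex_subspace_diff[OF complex_subspace_toeplitz_ideal]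

lemma commutator_in_toeplitz_ideal:
  "R \<in> toeplitz_algebra \<Longrightarrow> S \<in> toeplitz_algebra \<Longrightarrow> (R o\<^sub>L S) - (S o\<^sub>L R) \<in> toeplitz_ideal"
  unfolding commutator_ideal_def by blast

lemma toeplitz_ideal_subsetI:
  "closed_ideal toeplitz_algebra I \<Longrightarrow>
    (\<And>R S. R \<in> toeplitz_algebra \<Longrightarrow> S \<in> toeplitz_algebra \<Longrightarrow> (R o\<^sub>L S) - (S o\<^sub>L R) \<in> I) \<Longrightarrow> toeplitz_ideal \<subseteq> I"
  unfolding commutator_ideal_def by blast

section \<open>Symbols that multiply modulo the commutator ideal\<close>

definition good_symbol :: "(complex \<Rightarrow> complex) \<Rightarrow> bool"
  where "good_symbol u \<longleftrightarrow> bounded_symbol u \<and> toeplitz u \<in> toeplitz_algebra \<and>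
    (\<forall>v. bounded_symbol v \<longrightarrow> toeplitz v \<in> toeplitz_algebra \<longrightarrow>
      toeplitz (\<lambda>w. u w * v w) - (toeplitz u o\<^sub>L toeplitz v) \<in> toeplitz_ideal)"

lemma good_symbol_bounded: "good_symbol u \<Longrightarrow> bounded_symbol u"
  by (simp add: good_symbol_def)

lemma good_symbol_toeplitz: "good_symbol u \<Longrightarrow> toeplitz u \<in> toeplitz_algebra"
  by (simp add: good_symbol_def)

lemma good_symbol_mult_ideal:
  "good_symbol u \<Longrightarrow> bounded_symbol v \<Longrightarrow> toeplitz v \<in> toeplitz_algebra \<Longrightarrow>
    toeplitz (\<lambda>w. u w * v w) - (toeplitz u o\<^sub>L toeplitz v) \<in> toeplitz_ideal"
  by (simp add: good_symbol_def)

lemma toeplitz_mult_in_algebra: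
  assumes "good_symbol u" "bounded_symbol v" "toeplitz v \<in> toeplitz_algebra"
  shows "toeplitz (\<lambda>w. u w * v w) \<in> toeplitz_algebra"
proof -
  have "toeplitz (\<lambda>w. u w * v w) - (toeplitz u o\<^sub>L toeplitz v) \<in> toeplitz_algebra"
    using good_symbol_mult_ideal[OF assms] toeplitz_ideal_subset by blast
  from toeplitz_algebra_add[OF this toeplitz_algebra_compose[OF good_symbol_toeplitz[OF assms(1)] assms(3)]]
  show ?thesis by simp
qed

text \<open>The operator of the product symbol is exactly the composition in the reverse order, so
  the defect is a commutator. For antiholomorphic symbols the order is already right and the defect
  vanishes.\<close>

lemma good_symbol_holomorphic:
  assumes h: "h \<in> H_infinity"
  shows "good_symbol h"
  unfolding good_symbol_def
proof (intro conjI allI impI)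
  show "bounded_symbol h" "toeplitz h \<in> toeplitz_algebra"
    using h by (auto intro: bounded_symbol_holomorphic toeplitz_holomorphic_in_algebra)
  fix v assume v: "bounded_symbol v" "toeplitz v \<in> toeplitz_algebra"
  have "(toeplitz v o\<^sub>L toeplitz h) - (toeplitz h o\<^sub>L toeplitz v) \<in> toeplitz_ideal"
    by (rule commutator_in_toeplitz_ideal[OF v(2) toeplitz_holomorphic_in_algebra[OF h]])
  then show "toeplitz (\<lambda>w. h w * v w) - (toeplitz h o\<^sub>L toeplitz v) \<in> toeplitz_ideal"
    by (simp add: toeplitz_compose_holomorphic h v mult.commute)
qed

lemma good_symbol_cnj_holomorphic:
  assumes h: "h \<in> H_infinity"
  shows "good_symbol (\<lambda>w. cnj (h w))"
  unfolding good_symbol_def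
  using h by (simp add: bounded_symbol_cnj bounded_symbol_holomorphic toeplitz_cnj_holomorphic_in_algebra
    toeplitz_cnj_holomorphic_compose toeplitz_ideal_zero)

lemma good_symbol_const: "good_symbol (\<lambda>_. c)"
  by (rule good_symbol_holomorphic[OF H_infinity_const])

lemma good_symbol_add:
  assumes u: "good_symbol u" and u': "good_symbol u'"
  shows "good_symbol (\<lambda>w. u w + u' w)"
  unfolding good_symbol_def
proof (intro conjI allI impI)
  note b = good_symbol_bounded[OF u] good_symbol_bounded[OF u']
  show "bounded_symbol (\<lambda>w. u w + u' w)" using b by blast
  show "toeplitz (\<lambda>w. u w + u' w) \<in> toeplitz_algebra"
    unfolding toeplitz_add[OF b] by (intro toeplitz_algebra_add good_symbol_toeplitz u u')
  fix v assume v: "bounded_symbol v" "toeplitz v \<in> toeplitz_algebra"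
  have "toeplitz (\<lambda>w. (u w + u' w) * v w) = toeplitz (\<lambda>w. u w * v w) + toeplitz (\<lambda>w. u' w * v w)"
    unfolding distrib_right using b v by (intro toeplitz_add) auto
  moreover have "toeplitz (\<lambda>w. u w + u' w) o\<^sub>L toeplitz v = (toeplitz u o\<^sub>L toeplitz v) + (toeplitz u' o\<^sub>L toeplitz v)"
    unfolding toeplitz_add[OF b] by (rule blinfun_eqI) (simp add: blinfun.add_left)
  ultimately show "toeplitz (\<lambda>w. (u w + u' w) * v w) - (toeplitz (\<lambda>w. u w + u' w) o\<^sub>L toeplitz v) \<in> toeplitz_ideal"
    using toeplitz_ideal_add[OF good_symbol_mult_ideal[OF u v] good_symbol_mult_ideal[OF u' v]]
    by (simp add: algebra_simps)
qed

text \<open>The definition of \<open>good_symbol\<close> tests against every bounded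
  \<open>v\<close> with operator in the algebra. That range contains \<open>u' * v\<close>, so the
  property of \<open>u\<close> applies to it; a test against good symbols only would be circular
  here.\<close>

lemma good_symbol_mult:
  assumes u: "good_symbol u" and u': "good_symbol u'"
  shows "good_symbol (\<lambda>w. u w * u' w)"
  unfolding good_symbol_def
proof (intro conjI allI impI)
  note b = good_symbol_bounded[OF u] good_symbol_bounded[OF u']
  show "bounded_symbol (\<lambda>w. u w * u' w)" using b by blast
  show "toeplitz (\<lambda>w. u w * u' w) \<in> toeplitz_algebra"
    by (intro toeplitz_mult_in_algebra u b good_symbol_toeplitz u')
  fix v assume v: "bounded_symbol v" "toeplitz v \<in> toeplitz_algebra"
  let ?u = "toeplitz u" and ?u' = "toeplitz u'" and ?v = "toeplitz v"
  let ?u'v = "toeplitz (\<lambda>w. u' w * v w)"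
  have 1: "toeplitz (\<lambda>w. u w * (u' w * v w)) - (?u o\<^sub>L ?u'v) \<in> toeplitz_ideal"
    using b v by (intro good_symbol_mult_ideal u toeplitz_mult_in_algebra u' bounded_symbol_mult)
  have 2: "?u o\<^sub>L (?u'v - (?u' o\<^sub>L ?v)) \<in> toeplitz_ideal"
    by (intro toeplitz_ideal_compose_left good_symbol_toeplitz u good_symbol_mult_ideal u' v)
  have 3: "(toeplitz (\<lambda>w. u w * u' w) - (?u o\<^sub>L ?u')) o\<^sub>L ?v \<in> toeplitz_ideal"
    by (intro toeplitz_ideal_compose_right v good_symbol_mult_ideal u b good_symbol_toeplitz u')
  have "toeplitz (\<lambda>w. u w * u' w * v w) - (toeplitz (\<lambda>w. u w * u' w) o\<^sub>L ?v)
      = (toeplitz (\<lambda>w. u w * (u' w * v w)) - (?u o\<^sub>L ?u'v)) + (?u o\<^sub>L (?u'v - (?u' o\<^sub>L ?v)))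
        - ((toeplitz (\<lambda>w. u w * u' w) - (?u o\<^sub>L ?u')) o\<^sub>L ?v)"
    by (rule blinfun_eqI) (simp add: blinfun.diff_left blinfun.diff_right blinfun.add_left mult.assoc)
  then show "toeplitz (\<lambda>w. u w * u' w * v w) - (toeplitz (\<lambda>w. u w * u' w) o\<^sub>L ?v) \<in> toeplitz_ideal"
    using toeplitz_ideal_diff[OF toeplitz_ideal_add[OF 1 2] 3] by simp
qed

lemma good_symbol_sum:
  "finite A \<Longrightarrow> (\<And>i. i \<in> A \<Longrightarrow> good_symbol (u i)) \<Longrightarrow> good_symbol (\<lambda>w. \<Sum>i\<in>A. u i w)"
  by (induction A rule: finite_induct) (auto intro: good_symbol_add good_symbol_const)

lemma closed_approximableI:
  fixes A :: "'a::real_normed_vector set"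
  assumes "closed A" "\<And>e. 0 < e \<Longrightarrow> \<exists>y\<in>A. norm (x - y) \<le> e"
  shows "x \<in> A"
proof -
  have "x \<in> closure A"
    unfolding closure_approachable
  proof (intro allI impI)
    fix e :: real assume "0 < e"
    then obtain y where "y \<in> A" "norm (x - y) \<le> e / 2" using assms(2)[of "e / 2"] by auto
    then show "\<exists>y\<in>A. dist y x < e" using \<open>0 < e\<close> by (intro bexI[of _ y]) (auto simp: dist_norm norm_minus_commute)
  qed
  then show ?thesis using assms(1) by simp
qed

lemma norm_toeplitz_diff_le:
  assumes "bounded_symbol u" "bounded_symbol v" "\<And>w. cmod w < 1 \<Longrightarrow> cmod (u w - v w) \<le> e"
  shows "norm (toeplitz u - toeplitz v) \<le> e"
  using norm_toeplitz_le[OF bounded_symbol_diff[OF assms(1,2)] assms(3)] by (simp add: toeplitz_diff assms)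

lemma good_symbol_uniform_limit:
  assumes u: "bounded_symbol u"
    and approx: "\<And>e. 0 < e \<Longrightarrow> \<exists>v. good_symbol v \<and> (\<forall>w. cmod w < 1 \<longrightarrow> cmod (u w - v w) \<le> e)"
  shows "good_symbol u"
  unfolding good_symbol_def
proof (intro conjI allI impI u)
  show "toeplitz u \<in> toeplitz_algebra"
  proof (rule closed_approximableI[OF closed_toeplitz_algebra])
    fix e :: real assume "0 < e"
    then obtain v where v: "good_symbol v" "\<And>w. cmod w < 1 \<Longrightarrow> cmod (u w - v w) \<le> e" using approx by blast
    then show "\<exists>y\<in>toeplitz_algebra. norm (toeplitz u - y) \<le> e"
      by (intro bexI[of _ "toeplitz v"] norm_toeplitz_diff_le u good_symbol_bounded good_symbol_toeplitz)
  qed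
  fix x assume x: "bounded_symbol x" "toeplitz x \<in> toeplitz_algebra"
  obtain M where M: "0 \<le> M" "\<And>w. cmod w < 1 \<Longrightarrow> cmod (x w) \<le> M" using bounded_symbol_bound[OF x(1)] by blast
  show "toeplitz (\<lambda>w. u w * x w) - (toeplitz u o\<^sub>L toeplitz x) \<in> toeplitz_ideal"
  proof (rule closed_approximableI[OF closed_toeplitz_ideal])
    fix e :: real assume e: "0 < e"
    \<comment> \<open>Replacing \<open>u\<close> by \<open>v\<close> changes both the operator of
      the product symbol and the composition by at most \<open>d * M\<close>; the \<open>+ 1\<close>
      covers \<open>M = 0\<close>.\<close>
    define d where "d = e / (2 * (M + 1))"
    have d: "0 < d" using e M(1) by (simp add: d_def)
    obtain v where v: "good_symbol v" and uv: "\<And>w. cmod w < 1 \<Longrightarrow> cmod (u w - v w) \<le> d" using approx[OF d] by blast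
    note bv = good_symbol_bounded[OF v]
    have dM: "d * M \<le> e / 2"
      using e M(1) by (simp add: d_def field_simps)
    have 1: "norm (toeplitz (\<lambda>w. u w * x w) - toeplitz (\<lambda>w. v w * x w)) \<le> d * M"
    proof (rule norm_toeplitz_diff_le)
      fix w :: complex assume w: "cmod w < 1"
      have "cmod (u w * x w - v w * x w) = cmod (u w - v w) * cmod (x w)"
        by (simp add: norm_mult flip: left_diff_distrib)
      then show "cmod (u w * x w - v w * x w) \<le> d * M"
        using uv[OF w] M(2)[OF w] d by (auto intro: mult_mono)
    qed (use u x bv in auto)
    have 2: "norm ((toeplitz u o\<^sub>L toeplitz x) - (toeplitz v o\<^sub>L toeplitz x)) \<le> d * M"
    proof -
      have "(toeplitz u o\<^sub>L toeplitz x) - (toeplitz v o\<^sub>L toeplitz x) = (toeplitz u - toeplitz v) o\<^sub>L toeplitz x"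
        by (rule blinfun_eqI) (simp add: blinfun.diff_left)
      also have "norm \<dots> \<le> norm (toeplitz u - toeplitz v) * norm (toeplitz x)"
        by (rule norm_blinfun_compose)
      also have "\<dots> \<le> d * M"
        using norm_toeplitz_diff_le[OF u bv uv] norm_toeplitz_le[OF x(1) M(2)] d by (intro mult_mono) auto
      finally show ?thesis .
    qed
    have "norm ((toeplitz (\<lambda>w. u w * x w) - toeplitz (\<lambda>w. v w * x w))
        - ((toeplitz u o\<^sub>L toeplitz x) - (toeplitz v o\<^sub>L toeplitz x))) \<le> d * M + d * M"
      by (rule order_trans[OF norm_triangle_ineq4 add_mono[OF 1 2]])
    then have "norm ((toeplitz (\<lambda>w. u w * x w) - (toeplitz u o\<^sub>L toeplitz x))
        - (toeplitz (\<lambda>w. v w * x w) - (toeplitz v o\<^sub>L toeplitz x))) \<le> e"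
      using dM by (simp add: algebra_simps)
    then show "\<exists>y\<in>toeplitz_ideal. norm (toeplitz (\<lambda>w. u w * x w) - (toeplitz u o\<^sub>L toeplitz x) - y) \<le> e"
      using good_symbol_mult_ideal[OF v x] by blast
  qed
qed

lemma good_symbol_real_polynomial:
  assumes "real_polynomial_function p" and u: "good_symbol (\<lambda>w. complex_of_real (r w))"
  shows "good_symbol (\<lambda>w. complex_of_real (p (r w)))"
  using assms(1)
proof induction
  case (linear f)
  then have "f x = x * f 1" for x
    using linear_cmul[OF bounded_linear.linear, of f x 1] by simp
  then have "(\<lambda>w. complex_of_real (f (r w))) = (\<lambda>w. complex_of_real (r w) * complex_of_real (f 1))"
    by (intro ext) (metis of_real_mult)
  then show ?case
    using good_symbol_mult[OF u good_symbol_const] by simp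
next
  case (const c)
  then show ?case by (rule good_symbol_const)
next
  case (add f g)
  then show ?case using good_symbol_add by simp
next
  case (mult f g)
  then show ?case using good_symbol_mult by simp
qed

text \<open>Functional calculus for real good symbols: polynomials stay good, and Weierstrass
  approximation passes to continuous functions on the range.\<close>

lemma good_symbol_continuous:
  assumes u: "good_symbol (\<lambda>w. complex_of_real (r w))"
    and r: "\<And>w. cmod w < 1 \<Longrightarrow> r w \<in> {a..b}" and \<psi>: "continuous_on {a..b} \<psi>"
  shows "good_symbol (\<lambda>w. complex_of_real (\<psi> (r w)))"
proof (rule good_symbol_uniform_limit)
  have "(\<lambda>w. Re (complex_of_real (r w))) \<in> borel_measurable dA"
    by (rule measurable_compose[OF bounded_symbol_measurable[OF good_symbol_bounded[OF u]] borel_measurable_Re])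
  then have rm: "r \<in> borel_measurable dA" by simp
  have "(\<lambda>x. if x \<in> {a..b} then \<psi> x else 0) \<in> borel_measurable borel"
    using \<psi> by (intro borel_measurable_continuous_on_if) auto
  from measurable_compose[OF rm this]
  have "(\<lambda>w. if r w \<in> {a..b} then \<psi> (r w) else 0) \<in> borel_measurable dA" .
  then have "(\<lambda>w. \<psi> (r w)) \<in> borel_measurable dA"
    by (rule measurable_cong[THEN iffD1, rotated]) (use r in auto)
  then have m: "(\<lambda>w. complex_of_real (\<psi> (r w))) \<in> borel_measurable dA"
    by measurable
  have "bounded (\<psi> ` {a..b})"
    by (intro compact_imp_bounded compact_continuous_image \<psi> compact_Icc)
  then obtain M where "\<And>x. x \<in> {a..b} \<Longrightarrow> \<bar>\<psi> x\<bar> \<le> M"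
    unfolding bounded_iff ball_simps real_norm_def by blast
  then show "bounded_symbol (\<lambda>w. complex_of_real (\<psi> (r w)))"
    using r by (intro bounded_symbolI[OF m, of M]) simp
  fix e :: real assume e: "0 < e"
  obtain p where p: "real_polynomial_function p" "\<And>x. x \<in> {a..b} \<Longrightarrow> \<bar>\<psi> x - p x\<bar> < e"
    using Stone_Weierstrass_real_polynomial_function[OF compact_Icc \<psi> e] by metis
  have "cmod (complex_of_real (\<psi> (r w)) - complex_of_real (p (r w))) \<le> e" if "cmod w < 1" for w
    unfolding of_real_diff[symmetric] norm_of_real using p(2)[OF r[OF that]] by simp
  then show "\<exists>v. good_symbol v \<and> (\<forall>w. cmod w < 1 \<longrightarrow> cmod (complex_of_real (\<psi> (r w)) - v w) \<le> e)"
    using good_symbol_real_polynomial[OF p(1) u] by blast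
qed

text \<open>Goodness of the product is carried along in the induction because the next step uses the
  operator of \<open>q ^ k * x\<close> as an element of the algebra. The power of the operator is
  written as iterated left composition.\<close>

lemma toeplitz_power_ideal:
  assumes q: "good_symbol q" and x: "good_symbol x"
  shows "toeplitz (\<lambda>w. q w ^ k * x w) - ((\<lambda>R. toeplitz q o\<^sub>L R) ^^ k) (toeplitz x) \<in> toeplitz_ideal
    \<and> good_symbol (\<lambda>w. q w ^ k * x w)"
proof (induction k)
  case 0
  then show ?case using x by (simp add: toeplitz_ideal_zero)
next
  case (Suc k)
  let ?y = "\<lambda>w. q w ^ k * x w" and ?R = "((\<lambda>R. toeplitz q o\<^sub>L R) ^^ k) (toeplitz x)"
  have y: "good_symbol ?y" using Suc by blast
  have 1: "toeplitz (\<lambda>w. q w * ?y w) - (toeplitz q o\<^sub>L toeplitz ?y) \<in> toeplitz_ideal"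
    by (intro good_symbol_mult_ideal q good_symbol_bounded[OF y] good_symbol_toeplitz[OF y])
  have 2: "toeplitz q o\<^sub>L (toeplitz ?y - ?R) \<in> toeplitz_ideal"
    using Suc by (intro toeplitz_ideal_compose_left good_symbol_toeplitz q) blast
  have eq: "toeplitz (\<lambda>w. q w * ?y w) - (toeplitz q o\<^sub>L toeplitz ?y) + (toeplitz q o\<^sub>L (toeplitz ?y - ?R))
      = toeplitz (\<lambda>w. q w * ?y w) - (toeplitz q o\<^sub>L ?R)"
    by (rule blinfun_eqI) (simp add: blinfun.diff_left blinfun.diff_right blinfun.add_left)
  show ?case
    using toeplitz_ideal_add[OF 1 2, unfolded eq] good_symbol_mult[OF q y] by (simp add: mult.assoc)
qed

text \<open>
  Write \<open>v = |B|\<^sup>2\<close>. Modulo the ideal, the operator is the product of the \<open>k\<close>-th power of the Toeplitz operator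
  of \<open>1 - v\<close>, which has norm at most \<open>1 - c\<close>, and the Toeplitz operator of \<open>\<psi>(v)\<close> divided by the \<open>k\<close>-th
  power of \<open>1 - v\<close>, where \<open>1 - v \<ge> 1 - c/2\<close> on the support.
\<close>

lemma toeplitz_localized_in_ideal:
  assumes B: "B \<in> H_infinity" "\<And>w. cmod w < 1 \<Longrightarrow> cmod (B w) \<le> 1"
    and c: "0 < c" "c \<le> 1"
    and below: "\<And>f. c * (norm f)\<^sup>2 \<le> (\<integral>w. (cmod (B w))\<^sup>2 * (cmod (Rep_bergman f w))\<^sup>2 \<partial>dA)"
    and \<psi>: "continuous_on {0..1} \<psi>" "\<And>t. c / 2 \<le> t \<Longrightarrow> t \<le> 1 \<Longrightarrow> \<psi> t = 0"
  shows "toeplitz (\<lambda>w. complex_of_real (\<psi> ((cmod (B w))\<^sup>2))) \<in> toeplitz_ideal"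
    and "good_symbol (\<lambda>w. complex_of_real (\<psi> ((cmod (B w))\<^sup>2)))"
proof -
  let ?v = "\<lambda>w. (cmod (B w))\<^sup>2" and ?q = "\<lambda>w. complex_of_real (1 - (cmod (B w))\<^sup>2)"
  have v01: "?v w \<in> {0..1}" if "cmod w < 1" for w
    using B(2)[OF that] by (simp add: power_le_one)
  have v: "good_symbol (\<lambda>w. complex_of_real (?v w))"
    unfolding complex_norm_square
    by (intro good_symbol_mult good_symbol_holomorphic good_symbol_cnj_holomorphic B)
  have cont: "good_symbol (\<lambda>w. complex_of_real (\<gamma> (?v w)))" if "continuous_on {0..1} \<gamma>" for \<gamma>
    by (rule good_symbol_continuous[OF v v01 that])
  show gw: "good_symbol (\<lambda>w. complex_of_real (\<psi> (?v w)))"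
    by (rule cont[OF \<psi>(1)])
  have q: "good_symbol ?q"
    by (rule cont[of "\<lambda>t. 1 - t"]) (intro continuous_intros)
  have [measurable]: "B \<in> borel_measurable dA"
    by (intro bounded_symbol_measurable bounded_symbol_holomorphic B)
  \<comment> \<open>The lower bound \<open>below\<close> for the form of \<open>|B|\<^sup>2\<close>
    is an upper bound \<open>1 - c\<close> for that of \<open>1 - |B|\<^sup>2\<close>, and
    \<open>weighted_cauchy_schwarz\<close> turns it into a norm bound.\<close>
  have normq: "norm (toeplitz ?q) \<le> 1 - c"
  proof (rule norm_blinfun_bound)
    fix f
    show "norm (toeplitz ?q f) \<le> (1 - c) * norm f"
    proof (rule norm_le_of_cinner_le)
      fix g
      have "cmod (cinner (toeplitz ?q f) g) \<le> (\<integral>w. cmod (?q w * (Rep_bergman f w * cnj (Rep_bergman g w))) \<partial>dA)"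
        unfolding cinner_toeplitz[OF good_symbol_bounded[OF q]] by (rule integral_norm_bound)
      also have "\<dots> = (\<integral>w. (1 - ?v w) * (cmod (Rep_bergman f w) * cmod (Rep_bergman g w)) \<partial>dA)"
        using v01 by (intro Bochner_Integration.integral_cong refl) (simp add: norm_mult del: of_real_diff)
      also have "\<dots> \<le> (1 - c) * norm f * norm g"
      proof (rule weighted_cauchy_schwarz[where K = 1])
        show "(\<lambda>w. 1 - ?v w) \<in> borel_measurable dA" by measurable
        show "0 \<le> 1 - ?v w" "1 - ?v w \<le> 1" if "cmod w < 1" for w
          using v01[OF that] by auto
        fix f
        have i: "integrable dA (\<lambda>w. ?v w * (cmod (Rep_bergman f w))\<^sup>2)"
        proof (rule Bochner_Integration.integrable_bound[OF Rep_bergman_integrable[of f]])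
          show "AE w in dA. norm (?v w * (cmod (Rep_bergman f w))\<^sup>2) \<le> norm ((cmod (Rep_bergman f w))\<^sup>2)"
            using v01 by (intro AE_I2) (auto simp: abs_mult mult_left_le_one_le)
        qed measurable
        have "(\<integral>w. (1 - ?v w) * (cmod (Rep_bergman f w))\<^sup>2 \<partial>dA)
            = (norm f)\<^sup>2 - (\<integral>w. ?v w * (cmod (Rep_bergman f w))\<^sup>2 \<partial>dA)"
          unfolding left_diff_distrib norm_bergman_square
          by (simp add: i Rep_bergman_integrable)
        then show "(\<integral>w. (1 - ?v w) * (cmod (Rep_bergman f w))\<^sup>2 \<partial>dA) \<le> (1 - c) * (norm f)\<^sup>2"
          using below[of f] by (simp add: left_diff_distrib)
      qed
      finally show "cmod (cinner (toeplitz ?q f) g) \<le> (1 - c) * norm f * norm g" .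
    qed
  qed (use c in simp)
  obtain M where M: "\<And>t. t \<in> {0..1} \<Longrightarrow> \<bar>\<psi> t\<bar> \<le> M"
    using compact_imp_bounded[OF compact_continuous_image[OF \<psi>(1) compact_Icc]]
    unfolding bounded_iff ball_simps real_norm_def by blast
  have M0: "0 \<le> M" using M[of 0] by simp
  \<comment> \<open>The maximum keeps the denominator away from \<open>0\<close> on the whole
    interval; it agrees with \<open>1 - t\<close> for \<open>t < c / 2\<close>, the only place where
    \<open>\<psi> t\<close> can be nonzero.\<close>
  define \<gamma> where "\<gamma> k t = \<psi> t / (max (1 - c / 2) (1 - t)) ^ k" for k t
  let ?x = "\<lambda>k w. complex_of_real (\<gamma> k (?v w))"
  have c2: "0 < 1 - c / 2" using c by simp
  have pos: "0 < max (1 - c / 2) (1 - t)" for t using c2 by simp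
  have x: "good_symbol (?x k)" for k
    unfolding \<gamma>_def by (rule cont) (use pos in \<open>intro continuous_intros \<psi>; simp add: less_imp_neq[symmetric]\<close>)
  have qx: "?q w ^ k * ?x k w = complex_of_real (\<psi> (?v w))" if w: "cmod w < 1" for w k
  proof (cases "c / 2 \<le> ?v w")
    case True
    then have "\<psi> (?v w) = 0" using \<psi>(2) v01[OF w] by simp
    then show ?thesis by (simp add: \<gamma>_def)
  next
    case False
    then have "max (1 - c / 2) (1 - ?v w) = 1 - ?v w" "1 - ?v w \<noteq> 0" using c by auto
    then have "(1 - ?v w) ^ k * \<gamma> k (?v w) = \<psi> (?v w)" by (simp add: \<gamma>_def)
    then show ?thesis by (metis of_real_mult of_real_power)
  qed
  let ?R = "\<lambda>k. ((\<lambda>R. toeplitz ?q o\<^sub>L R) ^^ k) (toeplitz (?x k))"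
  have normx: "norm (toeplitz (?x k)) \<le> M / (1 - c / 2) ^ k" for k
  proof (rule norm_toeplitz_le[OF good_symbol_bounded[OF x]])
    fix w :: complex assume w: "cmod w < 1"
    have "cmod (?x k w) = \<bar>\<psi> (?v w)\<bar> / (max (1 - c / 2) (1 - ?v w)) ^ k"
      unfolding norm_of_real \<gamma>_def using pos[of "?v w"] by (simp add: abs_divide power_abs)
    also have "\<dots> \<le> M / (1 - c / 2) ^ k"
      using M[OF v01[OF w]] M0 c2 by (intro frac_le power_mono zero_less_power) auto
    finally show "cmod (?x k w) \<le> M / (1 - c / 2) ^ k" .
  qed
  have normit: "norm (((\<lambda>R. toeplitz ?q o\<^sub>L R) ^^ k) S) \<le> (1 - c) ^ k * norm S" for k S
  proof (induction k)
    case (Suc k)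
    have "norm (toeplitz ?q o\<^sub>L ((\<lambda>R. toeplitz ?q o\<^sub>L R) ^^ k) S)
        \<le> norm (toeplitz ?q) * norm (((\<lambda>R. toeplitz ?q o\<^sub>L R) ^^ k) S)"
      by (rule norm_blinfun_compose)
    also have "\<dots> \<le> (1 - c) * ((1 - c) ^ k * norm S)"
      using normq Suc c by (intro mult_mono) auto
    finally show ?case by (simp add: mult.assoc)
  qed simp
  \<comment> \<open>The gap between \<open>c\<close> in the norm bound and \<open>c / 2\<close> in
    the support condition makes the ratio less than \<open>1\<close>.\<close>
  have "(\<lambda>k. M * ((1 - c) / (1 - c / 2)) ^ k) \<longlonglongrightarrow> M * 0"
    using c by (intro tendsto_mult tendsto_const LIMSEQ_realpow_zero) (auto simp: field_simps)
  moreover have "norm (?R k) \<le> M * ((1 - c) / (1 - c / 2)) ^ k" for k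
  proof -
    have "norm (?R k) \<le> (1 - c) ^ k * norm (toeplitz (?x k))" by (rule normit)
    also have "\<dots> \<le> (1 - c) ^ k * (M / (1 - c / 2) ^ k)"
      using c by (intro mult_left_mono normx) auto
    finally show ?thesis by (simp only: power_divide mult_ac times_divide_eq_right)
  qed
  ultimately have small: "\<exists>k. norm (?R k) \<le> e" if "0 < e" for e
  proof -
    assume t: "(\<lambda>k. M * ((1 - c) / (1 - c / 2)) ^ k) \<longlonglongrightarrow> M * 0"
      and le: "\<And>k. norm (?R k) \<le> M * ((1 - c) / (1 - c / 2)) ^ k"
    have "\<exists>k. M * ((1 - c) / (1 - c / 2)) ^ k < e"
      using eventually_happens[OF order_tendstoD(2)[OF t, of e]] that by simp
    then obtain k where k: "M * ((1 - c) / (1 - c / 2)) ^ k < e" ..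
    then show ?thesis
      using le[of k] by (intro exI[of _ k]) linarith
  qed
  show "toeplitz (\<lambda>w. complex_of_real (\<psi> (?v w))) \<in> toeplitz_ideal"
  proof (rule closed_approximableI[OF closed_toeplitz_ideal])
    fix e :: real assume "0 < e"
    then obtain k where k: "norm (?R k) \<le> e" using small by blast
    have "toeplitz (\<lambda>w. complex_of_real (\<psi> (?v w))) = toeplitz (\<lambda>w. ?q w ^ k * ?x k w)"
      by (rule toeplitz_cong) (rule qx[symmetric])
    then show "\<exists>y\<in>toeplitz_ideal. norm (toeplitz (\<lambda>w. complex_of_real (\<psi> (?v w))) - y) \<le> e"
      using toeplitz_power_ideal[OF q x, of k k] k
      by (intro bexI[of _ "toeplitz (\<lambda>w. ?q w ^ k * ?x k w) - ?R k"]) auto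
  qed
qed

section \<open>The Berezin transform of a commutator\<close>

text \<open>The projection is a contraction: with \<open>g\<close> the image of \<open>p\<close>,
  the squared norm \<open>\<langle>g, g\<rangle>\<close> equals the pairing of \<open>u p\<close>
  with \<open>g\<close>, which is at most half the sum of the squared norms of \<open>u p\<close>
  and \<open>g\<close>; the term in \<open>g\<close> is absorbed.\<close>

lemma norm_toeplitz_apply_square_le:
  assumes u: "bounded_symbol u"
  shows "(norm (toeplitz u p))\<^sup>2 \<le> (\<integral>w. (cmod (u w * Rep_bergman p w))\<^sup>2 \<partial>dA)"
proof -
  let ?g = "toeplitz u p"
  obtain M where M: "\<And>w. cmod w < 1 \<Longrightarrow> cmod (u w) \<le> M" using bounded_symbol_bound[OF u] by blast
  have [measurable]: "u \<in> borel_measurable dA" using u by (rule bounded_symbol_measurable)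
  have i1: "integrable dA (\<lambda>w. (cmod (u w * Rep_bergman p w))\<^sup>2)"
  proof (rule Bochner_Integration.integrable_bound[OF integrable_mult_right[OF Rep_bergman_integrable[of p], of "M\<^sup>2"]])
    show "AE w in dA. norm ((cmod (u w * Rep_bergman p w))\<^sup>2) \<le> norm (M\<^sup>2 * (cmod (Rep_bergman p w))\<^sup>2)"
      using M by (intro AE_I2) (auto simp: norm_mult power_mult_distrib intro!: mult_right_mono power_mono)
  qed measurable
  have "(norm ?g)\<^sup>2 = cmod (cinner ?g ?g)"
    by (simp only: cinner_self norm_of_real) simp
  also have "\<dots> \<le> (\<integral>w. cmod (u w * (Rep_bergman p w * cnj (Rep_bergman ?g w))) \<partial>dA)"
    unfolding cinner_toeplitz[OF u] by (rule integral_norm_bound)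
  also have "\<dots> \<le> (\<integral>w. (1 / 2) * (cmod (u w * Rep_bergman p w))\<^sup>2 + (1 / 2) * (cmod (Rep_bergman ?g w))\<^sup>2 \<partial>dA)"
  proof (rule integral_mono)
    show "integrable dA (\<lambda>w. cmod (u w * (Rep_bergman p w * cnj (Rep_bergman ?g w))))"
      by (intro integrable_norm bounded_symbol_integrable u)
    show "integrable dA (\<lambda>w. (1 / 2) * (cmod (u w * Rep_bergman p w))\<^sup>2 + (1 / 2) * (cmod (Rep_bergman ?g w))\<^sup>2)"
      by (intro Bochner_Integration.integrable_add integrable_mult_right i1 Rep_bergman_integrable)
    show "cmod (u w * (Rep_bergman p w * cnj (Rep_bergman ?g w)))
        \<le> (1 / 2) * (cmod (u w * Rep_bergman p w))\<^sup>2 + (1 / 2) * (cmod (Rep_bergman ?g w))\<^sup>2" for w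
      using sum_squares_bound[of "cmod (u w * Rep_bergman p w)" "cmod (Rep_bergman ?g w)"]
      by (simp add: norm_mult mult.assoc)
  qed
  also have "\<dots> = (1 / 2) * (\<integral>w. (cmod (u w * Rep_bergman p w))\<^sup>2 \<partial>dA) + (1 / 2) * (norm ?g)\<^sup>2"
    using i1 Rep_bergman_integrable[of ?g] by (simp add: norm_bergman_square)
  finally show ?thesis by simp
qed

text \<open>Bounded pointwise convergence of symbols gives only strong convergence of operators, by
  dominated convergence. This is why the compactness of orbits of vectors is needed later.\<close>

lemma toeplitz_tendsto_zero:
  fixes u :: "nat \<Rightarrow> complex \<Rightarrow> complex"
  assumes u: "\<And>n. bounded_symbol (u n)" "\<And>n w. cmod w < 1 \<Longrightarrow> cmod (u n w) \<le> M"
    and lim: "\<And>w. cmod w < 1 \<Longrightarrow> (\<lambda>n. u n w) \<longlonglongrightarrow> 0"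
  shows "(\<lambda>n. norm (toeplitz (u n) p)) \<longlonglongrightarrow> 0"
proof -
  have [measurable]: "u n \<in> borel_measurable dA" for n using u by (intro bounded_symbol_measurable)
  have "(\<lambda>n. \<integral>w. (cmod (u n w * Rep_bergman p w))\<^sup>2 \<partial>dA) \<longlonglongrightarrow> (\<integral>w. 0 \<partial>dA)"
  proof (rule integral_dominated_convergence[where w = "\<lambda>w. M\<^sup>2 * (cmod (Rep_bergman p w))\<^sup>2"])
    show "AE w in dA. (\<lambda>n. (cmod (u n w * Rep_bergman p w))\<^sup>2) \<longlonglongrightarrow> 0"
    proof (rule AE_I2)
      fix w assume "w \<in> space dA"
      then have "(\<lambda>n. (cmod (u n w * Rep_bergman p w))\<^sup>2) \<longlonglongrightarrow> (cmod (0 * Rep_bergman p w))\<^sup>2"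
        by (intro tendsto_intros lim) simp
      then show "(\<lambda>n. (cmod (u n w * Rep_bergman p w))\<^sup>2) \<longlonglongrightarrow> 0" by simp
    qed
    show "AE w in dA. norm ((cmod (u n w * Rep_bergman p w))\<^sup>2) \<le> M\<^sup>2 * (cmod (Rep_bergman p w))\<^sup>2" for n
      using u(2)[of _ n] by (intro AE_I2) (auto simp: norm_mult power_mult_distrib intro!: mult_right_mono power_mono)
    show "integrable dA (\<lambda>w. M\<^sup>2 * (cmod (Rep_bergman p w))\<^sup>2)"
      by (intro integrable_mult_right Rep_bergman_integrable)
  qed measurable
  then have lim: "(\<lambda>n. sqrt (\<integral>w. (cmod (u n w * Rep_bergman p w))\<^sup>2 \<partial>dA)) \<longlonglongrightarrow> sqrt (\<integral>w. 0 \<partial>dA)"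
    by (rule tendsto_real_sqrt)
  have le: "norm (norm (toeplitz (u n) p)) \<le> sqrt (\<integral>w. (cmod (u n w * Rep_bergman p w))\<^sup>2 \<partial>dA)" for n
    unfolding real_norm_def abs_norm_cancel by (rule real_le_rsqrt[OF norm_toeplitz_apply_square_le[OF u(1)]])
  show ?thesis
    by (rule Lim_null_comparison[OF always_eventually[OF allI[OF le]]]) (use lim in simp)
qed

section \<open>Conjugation by the unitaries of the automorphisms\<close>

definition conj_moebius :: "complex \<Rightarrow> (bergman \<Rightarrow>\<^sub>L bergman) \<Rightarrow> bergman \<Rightarrow> bergman"
  where "conj_moebius a S p = moebius_op a (S (moebius_op a p))"

context
  fixes a :: complex
  assumes a: "cmod a < 1"
begin

lemma conj_moebius_compose: "conj_moebius a (S o\<^sub>L R) p = conj_moebius a S (conj_moebius a R p)"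
  by (simp add: conj_moebius_def a)

lemma conj_moebius_add_left: "conj_moebius a (S + R) p = conj_moebius a S p + conj_moebius a R p"
  by (simp add: conj_moebius_def moebius_op_add[OF a] blinfun.add_left)

lemma conj_moebius_diff_left: "conj_moebius a (S - R) p = conj_moebius a S p - conj_moebius a R p"
  by (simp add: conj_moebius_def moebius_op_diff[OF a] blinfun.diff_left)

lemma conj_moebius_op_scaleC: "conj_moebius a (op_scaleC c S) p = scaleC c (conj_moebius a S p)"
  by (simp add: conj_moebius_def moebius_op_scaleC[OF a] op_scaleC_apply)

lemma conj_moebius_diff: "conj_moebius a S (p - q) = conj_moebius a S p - conj_moebius a S q"
  by (simp add: conj_moebius_def moebius_op_diff[OF a] blinfun.diff_right)

lemma norm_conj_moebius_le: "norm (conj_moebius a S p) \<le> norm S * norm p"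
  using norm_blinfun[of S "moebius_op a p"] by (simp add: conj_moebius_def a)

lemma H_infinity_moebius:
  assumes h: "h \<in> H_infinity"
  shows "(\<lambda>w. h (moebius a w)) \<in> H_infinity"
proof -
  obtain M where M: "\<And>w. cmod w < 1 \<Longrightarrow> cmod (h w) \<le> M"
    using bounded_symbol_bound[OF bounded_symbol_holomorphic[OF h]] by blast
  show ?thesis
    by (rule H_infinityI[OF compose_moebius_holomorphic[OF a H_infinity_holomorphic[OF h]] M[OF moebius_in_disk[OF a]]])
qed

lemma conj_moebius_toeplitz:
  assumes h: "h \<in> H_infinity"
  shows "conj_moebius a (toeplitz h) p = toeplitz (\<lambda>w. h (moebius a w)) p"
proof (rule bergman_eqI)
  fix w :: complex assume w: "cmod w < 1"
  have "normalized_kernel_fun a w * (normalized_kernel_fun a (moebius a w) * x) = x" for x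
    using normalized_kernel_fun_moebius[OF a w] by (simp add: mult.assoc[symmetric])
  then show "Rep_bergman (conj_moebius a (toeplitz h) p) w = Rep_bergman (toeplitz (\<lambda>w. h (moebius a w)) p) w"
    using w by (simp add: conj_moebius_def Rep_moebius_op[OF a] Rep_toeplitz_holomorphic[OF h] moebius_in_disk[OF a]
      Rep_toeplitz_holomorphic[OF H_infinity_moebius[OF h]] moebius_moebius[OF a] mult.left_commute[of _ "h _"])
qed

lemma conj_moebius_toeplitz_cnj:
  assumes h: "h \<in> H_infinity"
  shows "conj_moebius a (toeplitz (\<lambda>w. cnj (h w))) p = toeplitz (\<lambda>w. cnj (h (moebius a w))) p"
proof (rule bergman_eqI_cinner)
  fix q
  note b = bounded_symbol_holomorphic[OF h] bounded_symbol_holomorphic[OF H_infinity_moebius[OF h]]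
  have "cinner (conj_moebius a (toeplitz (\<lambda>w. cnj (h w))) p) q
      = cinner (moebius_op a p) (toeplitz h (moebius_op a q))"
    unfolding conj_moebius_def cinner_moebius_op_left[OF a, of "toeplitz (\<lambda>w. cnj (h w)) (moebius_op a p)"]
    by (simp add: adj_toeplitz[OF b(1), symmetric] cinner_adj_left toeplitz_bounded_ops b)
  also have "\<dots> = cinner p (conj_moebius a (toeplitz h) q)"
    unfolding conj_moebius_def by (rule cinner_moebius_op_left[OF a])
  also have "\<dots> = cinner (toeplitz (\<lambda>w. cnj (h (moebius a w))) p) q"
    unfolding conj_moebius_toeplitz[OF h]
    by (simp add: adj_toeplitz[OF b(2), symmetric] cinner_adj_left toeplitz_bounded_ops b)
  finally show "cinner (conj_moebius a (toeplitz (\<lambda>w. cnj (h w))) p) q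
      = cinner (toeplitz (\<lambda>w. cnj (h (moebius a w))) p) q" .
qed

text \<open>The unitary takes \<open>normalized_kernel 0\<close> to the kernel at \<open>a\<close>,
  so moving the point of evaluation amounts to conjugating the operator with the vector
  fixed.\<close>

lemma berezin_conj_moebius:
  "berezin S a = cinner (conj_moebius a S (normalized_kernel 0)) (normalized_kernel 0)"
  unfolding berezin_def conj_moebius_def
  by (simp add: moebius_op_normalized_kernel_0[OF a] cinner_moebius_op_left[OF a])

lemma norm_berezin_le: "cmod (berezin S a) \<le> norm S"
  using norm_cinner_le[of "S (normalized_kernel a)" "normalized_kernel a"] norm_blinfun[of S "normalized_kernel a"]
  by (simp add: berezin_def norm_normalized_kernel[OF a])

lemma cmod_cinner_normalized_kernel:
  assumes b: "cmod b < 1"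
  shows "cmod (cinner (normalized_kernel a) (normalized_kernel b)) = 1 - (cmod (moebius a b))\<^sup>2"
proof -
  have p: "0 \<le> 1 - (cmod b)\<^sup>2" "0 \<le> 1 - (cmod a)\<^sup>2"
    using a b by (simp_all add: power_le_one)
  have "cmod (cinner (normalized_kernel a) (normalized_kernel b)) = (1 - (cmod b)\<^sup>2) * cmod (normalized_kernel_fun a b)"
    unfolding cinner_normalized_kernel[OF b] norm_mult norm_of_real Rep_normalized_kernel[OF a] using p by simp
  also have "cmod (normalized_kernel_fun a b) = (1 - (cmod a)\<^sup>2) / (cmod (1 - cnj a * b))\<^sup>2"
    using b p by (simp add: normalized_kernel_fun_def norm_divide norm_power del: of_real_diff)
  finally show ?thesis
    unfolding one_minus_norm_moebius[OF a b] by simp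
qed

text \<open>A unimodular factor on a kernel does not change the Berezin transform. The factor
  \<open>c\<close> makes the inner product of the two kernels nonnegative, hence equal to
  \<open>1 - \<rho>\<^sup>2\<close> with \<open>\<rho>\<close> the distance, so the vectors differ
  by \<open>sqrt 2 * \<rho> \<le> 2 * \<rho>\<close>. Changing them in the two slots one after the
  other gives the constant \<open>4\<close>.\<close>

lemma berezin_lipschitz:
  assumes b: "cmod b < 1" and S: "S \<in> bounded_ops"
  shows "cmod (berezin S a - berezin S b) \<le> 4 * norm S * cmod (moebius a b)"
proof -
  let ?k = "normalized_kernel a" and ?l = "normalized_kernel b"
  define z where "z = cinner ?k ?l"
  define c where "c = (if z = 0 then 1 else z / of_real (cmod z))"
  have c: "cmod c = 1" by (auto simp: c_def norm_divide)
  have cz: "cnj c * z = of_real (cmod z)"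
  proof (cases "z = 0")
    case False
    then have "cnj c * z = (z * cnj z) / of_real (cmod z)" by (simp add: c_def mult.commute)
    also have "\<dots> = of_real (cmod z)"
      using False by (simp only: complex_norm_square[symmetric] of_real_divide[symmetric])
        (simp add: power2_eq_square)
    finally show ?thesis .
  qed simp
  define m where "m = scaleC c ?l"
  have nk: "norm ?k = 1" "norm m = 1"
    by (simp_all add: m_def norm_scaleC c norm_normalized_kernel a b)
  have "(norm (?k - m))\<^sup>2 = (norm ?k)\<^sup>2 + (norm m)\<^sup>2 - 2 * inner ?k m"
    by (simp add: power2_norm_eq_inner inner_diff_left inner_diff_right inner_commute)
  also have "inner ?k m = cmod z"
    using cz by (simp add: Re_cinner[symmetric] m_def cinner_scaleC_right z_def)
  also have "cmod z = 1 - (cmod (moebius a b))\<^sup>2"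
    unfolding z_def by (rule cmod_cinner_normalized_kernel[OF b])
  finally have "(norm (?k - m))\<^sup>2 = 2 * (cmod (moebius a b))\<^sup>2" by (simp add: nk)
  also have "\<dots> \<le> (2 * cmod (moebius a b))\<^sup>2" by (simp add: power_mult_distrib)
  finally have d: "norm (?k - m) \<le> 2 * cmod (moebius a b)"
    by (rule power2_le_imp_le) simp
  have "cnj c * c = 1" using c complex_norm_square[of c] by (simp add: mult.commute)
  then have bb: "berezin S b = cinner (S m) m"
    unfolding berezin_def m_def by (simp add: bounded_ops_scaleC[OF S] cinner_scaleC_left cinner_scaleC_right mult.assoc[symmetric])
  have "berezin S a - berezin S b = cinner (S (?k - m)) ?k + cinner (S m) (?k - m)"
    unfolding bb unfolding berezin_def by (simp add: blinfun.diff_right cinner_diff_left cinner_diff_right)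
  also have "cmod \<dots> \<le> norm S * norm (?k - m) + norm S * norm (?k - m)"
  proof (rule order_trans[OF norm_triangle_ineq add_mono])
    show "cmod (cinner (S (?k - m)) ?k) \<le> norm S * norm (?k - m)"
      using norm_cinner_le[of "S (?k - m)" ?k] norm_blinfun[of S "?k - m"] by (simp add: nk)
    have "cmod (cinner (S m) (?k - m)) \<le> norm (S m) * norm (?k - m)" by (rule norm_cinner_le)
    also have "\<dots> \<le> norm S * norm (?k - m)"
      using norm_blinfun[of S m] by (intro mult_right_mono) (simp_all add: nk)
    finally show "cmod (cinner (S m) (?k - m)) \<le> norm S * norm (?k - m)" .
  qed
  also have "\<dots> \<le> 4 * norm S * cmod (moebius a b)"
    using mult_left_mono[OF d norm_ge_zero[of S]] by simp
  finally show ?thesis .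
qed

end

lemma berezin_add: "berezin (S + R) z = berezin S z + berezin R z"
  by (simp add: berezin_def blinfun.add_left cinner_add_left)

lemma berezin_op_scaleC: "berezin (op_scaleC c S) z = c * berezin S z"
  by (simp add: berezin_def op_scaleC_apply cinner_scaleC_left)

lemma moebius_tendsto_zero:
  assumes "cmod a < 1"
  shows "((\<lambda>w. cmod (moebius a w)) \<longlongrightarrow> 0) (at a within unit_disk)"
proof -
  have "continuous_on unit_disk (moebius a)"
    by (intro holomorphic_on_imp_continuous_on holomorphic_moebius assms)
  then have "((\<lambda>w. moebius a w) \<longlongrightarrow> moebius a a) (at a within unit_disk)"
    using assms by (simp add: continuous_on_def)
  then show ?thesis
    by (intro tendsto_norm_zero) (simp add: moebius_def)
qed

lemma bounded_symbol_berezin: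
  assumes S: "S \<in> bounded_ops"
  shows "bounded_symbol (berezin S)"
proof (rule bounded_symbolI[where M = "norm S"])
  have "continuous_on unit_disk (berezin S)"
    unfolding continuous_on_def
  proof
    fix a :: complex assume a: "a \<in> unit_disk"
    have "((\<lambda>w. 4 * norm S * cmod (moebius a w)) \<longlongrightarrow> 4 * norm S * 0) (at a within unit_disk)"
      using a by (intro tendsto_intros moebius_tendsto_zero) simp
    moreover have "\<forall>\<^sub>F w in at a within unit_disk. norm (berezin S w - berezin S a) \<le> 4 * norm S * cmod (moebius a w)"
      unfolding eventually_at_filter
    proof (rule always_eventually, intro allI impI)
      fix w assume "w \<in> unit_disk"
      then have "cmod (berezin S a - berezin S w) \<le> 4 * norm S * cmod (moebius a w)"
        using a by (intro berezin_lipschitz S) simp_all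
      then show "norm (berezin S w - berezin S a) \<le> 4 * norm S * cmod (moebius a w)"
        by (simp only: norm_minus_commute)
    qed
    ultimately have "((\<lambda>w. berezin S w - berezin S a) \<longlongrightarrow> 0) (at a within unit_disk)"
      unfolding mult_zero_right by (rule Lim_null_comparison[rotated])
    then show "(berezin S \<longlongrightarrow> berezin S a) (at a within unit_disk)" by (rule LIM_zero_cancel)
  qed
  then have "berezin S \<in> borel_measurable (lebesgue_on unit_disk)"
    by (intro continuous_imp_measurable_on_sets_lebesgue) auto
  then show "berezin S \<in> borel_measurable dA" by (simp add: measurable_def)
  show "\<And>w. cmod w < 1 \<Longrightarrow> cmod (berezin S w) \<le> norm S" by (rule norm_berezin_le)
qed

section \<open>Precompact orbits and commutators along a sequence\<close>

text \<open>Sequential total boundedness of the orbit of each vector, with the tolerance fixed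
  before the subsequence. This avoids diagonal arguments, and no limit operator has to be
  constructed.\<close>

definition precompact_orbits :: "(bergman \<Rightarrow>\<^sub>L bergman) \<Rightarrow> bool"
  where "precompact_orbits S \<longleftrightarrow> (\<forall>z p e. (\<forall>n. cmod (z n) < 1) \<longrightarrow> 0 < e \<longrightarrow>
    (\<exists>r::nat \<Rightarrow> nat. strict_mono r \<and>
      (\<forall>i j. norm (conj_moebius (z (r i)) S p - conj_moebius (z (r j)) S p) \<le> e)))"

lemma precompact_orbitsD:
  fixes z :: "nat \<Rightarrow> complex"
  assumes "precompact_orbits S" "\<forall>n. cmod (z n) < 1" "0 < e"
  shows "\<exists>r::nat \<Rightarrow> nat. strict_mono r \<and>
    (\<forall>i j. norm (conj_moebius (z (r i)) S p - conj_moebius (z (r j)) S p) \<le> e)"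
  using assms unfolding precompact_orbits_def by blast

lemma precompact_orbits_zero: "precompact_orbits 0"
  unfolding precompact_orbits_def
proof (intro allI impI exI conjI)
  fix z :: "nat \<Rightarrow> complex" and p :: bergman and e :: real and i j :: nat
  assume "\<forall>n. cmod (z n) < 1" "0 < e"
  then have "conj_moebius (z (id k)) 0 p = 0" for k
    using norm_conj_moebius_le[of "z k" 0 p] by simp
  then show "norm (conj_moebius (z (id i)) 0 p - conj_moebius (z (id j)) 0 p) \<le> e"
    using \<open>0 < e\<close> by simp
qed (rule strict_mono_id)

lemma precompact_orbits_add:
  assumes S: "precompact_orbits S" and R: "precompact_orbits R"
  shows "precompact_orbits (S + R)"
  unfolding precompact_orbits_def
proof (intro allI impI)
  fix z :: "nat \<Rightarrow> complex" and p :: bergman and e :: real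
  assume z: "\<forall>n. cmod (z n) < 1" and e: "0 < e"
  then have z': "cmod (z n) < 1" for n by blast
  have e2: "0 < e / 2" using e by simp
  from precompact_orbitsD[OF S z e2, of p]
  obtain r :: "nat \<Rightarrow> nat" where r: "strict_mono r \<and> (\<forall>i j. norm (conj_moebius (z (r i)) S p - conj_moebius (z (r j)) S p) \<le> e / 2)" ..
  note r = conjunct1[OF r] conjunct2[OF r, rule_format]
  from precompact_orbitsD[OF R allI[of "\<lambda>n. cmod (z (r n)) < 1", OF z'] e2, of p]
  obtain s :: "nat \<Rightarrow> nat" where s: "strict_mono s \<and> (\<forall>i j. norm (conj_moebius (z (r (s i))) R p - conj_moebius (z (r (s j))) R p) \<le> e / 2)" ..
  note s = conjunct1[OF s] conjunct2[OF s, rule_format]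
  have "norm (conj_moebius (z ((r \<circ> s) i)) (S + R) p - conj_moebius (z ((r \<circ> s) j)) (S + R) p) \<le> e" for i j
  proof -
    let ?d = "\<lambda>T. conj_moebius (z (r (s i))) T p - conj_moebius (z (r (s j))) T p"
    have "?d (S + R) = ?d S + ?d R" by (simp add: conj_moebius_add_left z')
    also have "norm \<dots> \<le> e / 2 + e / 2"
      by (rule order_trans[OF norm_triangle_ineq add_mono[OF r(2) s(2)]])
    finally show ?thesis by simp
  qed
  then show "\<exists>r::nat \<Rightarrow> nat. strict_mono r \<and> (\<forall>i j. norm (conj_moebius (z (r i)) (S + R) p - conj_moebius (z (r j)) (S + R) p) \<le> e)"
    using strict_mono_o[OF r(1) s(1)] by (intro exI[of _ "r \<circ> s"]) blast
qed

lemma precompact_orbits_scale: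
  assumes S: "precompact_orbits S"
  shows "precompact_orbits (op_scaleC c S)"
  unfolding precompact_orbits_def
proof (intro allI impI)
  fix z :: "nat \<Rightarrow> complex" and p :: bergman and e :: real
  assume z: "\<forall>n. cmod (z n) < 1" and e: "0 < e"
  then have z': "cmod (z n) < 1" for n by blast
  have e2: "0 < e / (cmod c + 1)" using e by (intro divide_pos_pos) (auto intro: add_nonneg_pos)
  from precompact_orbitsD[OF S z e2, of p]
  obtain r :: "nat \<Rightarrow> nat" where r: "strict_mono r \<and> (\<forall>i j. norm (conj_moebius (z (r i)) S p - conj_moebius (z (r j)) S p) \<le> e / (cmod c + 1))" ..
  note r = conjunct1[OF r] conjunct2[OF r, rule_format]
  have "norm (conj_moebius (z (r i)) (op_scaleC c S) p - conj_moebius (z (r j)) (op_scaleC c S) p) \<le> e" for i j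
  proof -
    have "norm (conj_moebius (z (r i)) (op_scaleC c S) p - conj_moebius (z (r j)) (op_scaleC c S) p)
        = cmod c * norm (conj_moebius (z (r i)) S p - conj_moebius (z (r j)) S p)"
      by (simp add: conj_moebius_op_scaleC z' scaleC_diff_right[symmetric] norm_scaleC)
    also have "\<dots> \<le> (cmod c + 1) * (e / (cmod c + 1))"
      by (intro mult_mono r) auto
    also have "\<dots> = e"
      using norm_ge_zero[of c] by (simp add: add_nonneg_eq_0_iff)
    finally show ?thesis .
  qed
  then show "\<exists>r::nat \<Rightarrow> nat. strict_mono r \<and> (\<forall>i j. norm (conj_moebius (z (r i)) (op_scaleC c S) p - conj_moebius (z (r j)) (op_scaleC c S) p) \<le> e)"
    using r(1) by (intro exI[of _ r]) blast
qed

lemma precompact_orbits_compose: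
  assumes S: "precompact_orbits S" and R: "precompact_orbits R"
  shows "precompact_orbits (S o\<^sub>L R)"
  unfolding precompact_orbits_def
proof (intro allI impI)
  fix z :: "nat \<Rightarrow> complex" and p :: bergman and e :: real
  assume z: "\<forall>n. cmod (z n) < 1" and e: "0 < e"
  then have z': "cmod (z n) < 1" for n by blast
  define d where "d = e / (3 * (norm S + 1))"
  have S1: "0 < norm S + 1" by (intro add_nonneg_pos) auto
  have d: "0 < d" using e S1 by (simp add: d_def)
  have third: "x * (e / (3 * x)) = e / 3" if "0 < x" for x :: real using that by simp
  have Sd: "norm S * d \<le> e / 3"
  proof -
    have "norm S * d \<le> (norm S + 1) * d" using d by (intro mult_right_mono) auto
    also have "\<dots> = e / 3" unfolding d_def by (rule third[OF S1])
    finally show ?thesis .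
  qed
  from precompact_orbitsD[OF R z d, of p]
  obtain r :: "nat \<Rightarrow> nat" where r: "strict_mono r \<and> (\<forall>i j. norm (conj_moebius (z (r i)) R p - conj_moebius (z (r j)) R p) \<le> d)" ..
  note r = conjunct1[OF r] conjunct2[OF r, rule_format]
  \<comment> \<open>All vectors produced by \<open>R\<close> along \<open>r\<close> lie within
    \<open>d\<close> of this single one, so \<open>S\<close> has to be tested on a fixed vector
    only.\<close>
  define q where "q = conj_moebius (z (r 0)) R p"
  from precompact_orbitsD[OF S allI[of "\<lambda>n. cmod (z (r n)) < 1", OF z'] divide_pos_pos[OF e zero_less_numeral], of q]
  obtain s :: "nat \<Rightarrow> nat" where s: "strict_mono s \<and> (\<forall>i j. norm (conj_moebius (z (r (s i))) S q - conj_moebius (z (r (s j))) S q) \<le> e / 3)" ..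
  note s = conjunct1[OF s] conjunct2[OF s, rule_format]
  have near: "norm (conj_moebius (z (r k)) (S o\<^sub>L R) p - conj_moebius (z (r k)) S q) \<le> e / 3" for k
  proof -
    have "norm (conj_moebius (z (r k)) (S o\<^sub>L R) p - conj_moebius (z (r k)) S q)
        = norm (conj_moebius (z (r k)) S (conj_moebius (z (r k)) R p - q))"
      by (simp add: conj_moebius_compose conj_moebius_diff z')
    also have "\<dots> \<le> norm S * norm (conj_moebius (z (r k)) R p - q)"
      by (rule norm_conj_moebius_le[OF z'])
    also have "\<dots> \<le> norm S * d"
      unfolding q_def by (intro mult_left_mono r) simp
    finally show ?thesis using Sd by simp
  qed
  have "norm (conj_moebius (z ((r \<circ> s) i)) (S o\<^sub>L R) p - conj_moebius (z ((r \<circ> s) j)) (S o\<^sub>L R) p) \<le> e" for i j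
  proof -
    let ?X = "\<lambda>i. conj_moebius (z (r (s i))) (S o\<^sub>L R) p" and ?Y = "\<lambda>i. conj_moebius (z (r (s i))) S q"
    have "norm (?X i - ?X j) = norm ((?X i - ?Y i) + (?Y i - ?Y j) - (?X j - ?Y j))" by simp
    also have "\<dots> \<le> (e / 3 + e / 3) + e / 3"
      by (intro order_trans[OF norm_triangle_ineq4] add_mono order_trans[OF norm_triangle_ineq] near s)
    finally show ?thesis by simp
  qed
  then show "\<exists>r::nat \<Rightarrow> nat. strict_mono r \<and> (\<forall>i j. norm (conj_moebius (z (r i)) (S o\<^sub>L R) p - conj_moebius (z (r j)) (S o\<^sub>L R) p) \<le> e)"
    using strict_mono_o[OF r(1) s(1)] by (intro exI[of _ "r \<circ> s"]) blast
qed

lemma precompact_orbits_limit: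
  assumes approx: "\<And>e. 0 < e \<Longrightarrow> \<exists>R. precompact_orbits R \<and> norm (S - R) \<le> e"
  shows "precompact_orbits S"
  unfolding precompact_orbits_def
proof (intro allI impI)
  fix z :: "nat \<Rightarrow> complex" and p :: bergman and e :: real
  assume z: "\<forall>n. cmod (z n) < 1" and e: "0 < e"
  then have z': "cmod (z n) < 1" for n by blast
  define d where "d = e / (3 * (norm p + 1))"
  have p1: "0 < norm p + 1" by (intro add_nonneg_pos) auto
  have d: "0 < d" using e p1 by (simp add: d_def)
  have third: "x * (e / (3 * x)) = e / 3" if "0 < x" for x :: real using that by simp
  have dp: "d * norm p \<le> e / 3"
  proof -
    have "d * norm p \<le> d * (norm p + 1)" using d by (intro mult_left_mono) auto
    also have "\<dots> = e / 3" unfolding d_def using third[OF p1] by (simp only: mult.commute)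
    finally show ?thesis .
  qed
  obtain R where R: "precompact_orbits R" "norm (S - R) \<le> d" using approx[OF d] by blast
  from precompact_orbitsD[OF R(1) z divide_pos_pos[OF e zero_less_numeral], of p]
  obtain r :: "nat \<Rightarrow> nat" where r: "strict_mono r \<and> (\<forall>i j. norm (conj_moebius (z (r i)) R p - conj_moebius (z (r j)) R p) \<le> e / 3)" ..
  note r = conjunct1[OF r] conjunct2[OF r, rule_format]
  have near: "norm (conj_moebius (z k) S p - conj_moebius (z k) R p) \<le> e / 3" for k
  proof -
    have "norm (conj_moebius (z k) S p - conj_moebius (z k) R p) \<le> norm (S - R) * norm p"
      unfolding conj_moebius_diff_left[OF z', symmetric] by (rule norm_conj_moebius_le[OF z'])
    also have "\<dots> \<le> d * norm p" by (intro mult_right_mono R) simp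
    finally show ?thesis using dp by simp
  qed
  have "norm (conj_moebius (z (r i)) S p - conj_moebius (z (r j)) S p) \<le> e" for i j
  proof -
    let ?X = "\<lambda>i. conj_moebius (z (r i)) S p" and ?Y = "\<lambda>i. conj_moebius (z (r i)) R p"
    have "norm (?X i - ?X j) = norm ((?X i - ?Y i) + (?Y i - ?Y j) - (?X j - ?Y j))" by simp
    also have "\<dots> \<le> (e / 3 + e / 3) + e / 3"
      by (intro order_trans[OF norm_triangle_ineq4] add_mono order_trans[OF norm_triangle_ineq] near r)
    finally show ?thesis by simp
  qed
  then show "\<exists>r::nat \<Rightarrow> nat. strict_mono r \<and> (\<forall>i j. norm (conj_moebius (z (r i)) S p - conj_moebius (z (r j)) S p) \<le> e)"
    using r(1) by (intro exI[of _ r]) blast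
qed

lemma montel_bounded:
  fixes F :: "nat \<Rightarrow> complex \<Rightarrow> complex"
  assumes "\<And>n. F n holomorphic_on unit_disk" "\<And>n w. cmod w < 1 \<Longrightarrow> cmod (F n w) \<le> M"
  obtains g r where "g holomorphic_on unit_disk" "strict_mono (r :: nat \<Rightarrow> nat)"
    "\<And>w. cmod w < 1 \<Longrightarrow> (\<lambda>n. F (r n) w) \<longlonglongrightarrow> g w"
    "\<And>w. cmod w < 1 \<Longrightarrow> cmod (g w) \<le> M"
proof -
  obtain g r where g: "g holomorphic_on unit_disk" "strict_mono (r :: nat \<Rightarrow> nat)"
    "\<And>w. w \<in> unit_disk \<Longrightarrow> (\<lambda>n. F (r n) w) \<longlonglongrightarrow> g w"
  proof (rule Montel[of unit_disk "range F" F])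
    show "\<exists>B. \<forall>h\<in>range F. \<forall>z\<in>K. cmod (h z) \<le> B" if "compact K" "K \<subseteq> unit_disk" for K
      using assms(2) that by (intro exI[of _ M]) auto
  qed (use assms(1) in auto)
  have lim: "(\<lambda>n. F (r n) w) \<longlonglongrightarrow> g w" if "cmod w < 1" for w
    using g(3)[of w] that by simp
  have "cmod (g w) \<le> M" if "cmod w < 1" for w
    by (rule LIMSEQ_le_const2[OF tendsto_norm[OF lim[OF that]]]) (use assms(2)[OF that] in blast)
  with g(1,2) lim show ?thesis by (rule that)
qed

text \<open>The map \<open>s\<close> stands for the identity or for complex conjugation of symbols,
  so both families of generators share one argument. Conjugation replaces \<open>h\<close> by
  \<open>h \<circ> moebius z\<close>; Montel's theorem gives a bounded pointwise convergent
  subsequence, which is all that \<open>toeplitz_tendsto_zero\<close> asks for.\<close>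

lemma precompact_orbits_toeplitz_aux:
  assumes h: "h \<in> H_infinity"
    and T: "\<And>u. u \<in> H_infinity \<Longrightarrow> bounded_symbol (s u)" "\<And>u v w. s (\<lambda>w. u w - v w) w = s u w - s v w"
      "\<And>u w. cmod (s u w) = cmod (u w)"
    and conj: "\<And>a p. cmod a < 1 \<Longrightarrow> conj_moebius a (toeplitz (s h)) p = toeplitz (s (\<lambda>w. h (moebius a w))) p"
  shows "precompact_orbits (toeplitz (s h))"
  unfolding precompact_orbits_def
proof (intro allI impI)
  fix z :: "nat \<Rightarrow> complex" and p :: bergman and e :: real
  assume z: "\<forall>n. cmod (z n) < 1" and e: "0 < e"
  then have z': "cmod (z n) < 1" for n by blast
  let ?F = "\<lambda>n w. h (moebius (z n) w)"
  obtain M where M: "\<And>w. cmod w < 1 \<Longrightarrow> cmod (h w) \<le> M"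
    using bounded_symbol_bound[OF bounded_symbol_holomorphic[OF h]] by blast
  have F: "?F n \<in> H_infinity" for n by (rule H_infinity_moebius[OF z' h])
  have FM: "cmod (?F n w) \<le> M" if "cmod w < 1" for n w by (rule M[OF moebius_in_disk[OF z' that]])
  obtain g r where g: "g holomorphic_on unit_disk" "strict_mono (r :: nat \<Rightarrow> nat)"
    "\<And>w. cmod w < 1 \<Longrightarrow> (\<lambda>n. ?F (r n) w) \<longlonglongrightarrow> g w" "\<And>w. cmod w < 1 \<Longrightarrow> cmod (g w) \<le> M"
    using montel_bounded[of ?F M, OF H_infinity_holomorphic[OF F] FM] by blast
  have gH: "g \<in> H_infinity" by (rule H_infinityI[OF g(1,4)])
  have lim: "(\<lambda>n. norm (toeplitz (\<lambda>w. s (?F (r n)) w - s g w) p)) \<longlonglongrightarrow> 0"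
  proof (rule toeplitz_tendsto_zero)
    show "bounded_symbol (\<lambda>w. s (?F (r n)) w - s g w)" for n
      by (intro bounded_symbol_diff T(1) F gH)
    fix w :: complex assume w: "cmod w < 1"
    show "cmod (s (?F (r n)) w - s g w) \<le> M + M" for n
      using FM[OF w, of "r n"] g(4)[OF w] norm_triangle_ineq4[of "s (?F (r n)) w" "s g w"] by (simp add: T(3))
    have "(\<lambda>n. cmod (?F (r n) w - g w)) \<longlonglongrightarrow> 0"
      by (rule tendsto_norm_zero[OF LIM_zero[OF g(3)[OF w]]])
    then show "(\<lambda>n. s (?F (r n)) w - s g w) \<longlonglongrightarrow> 0"
      unfolding T(2)[symmetric] by - (rule tendsto_norm_zero_cancel, simp only: T(3))
  qed
  then obtain N where N: "\<And>n. n \<ge> N \<Longrightarrow> norm (toeplitz (\<lambda>w. s (?F (r n)) w - s g w) p) < e / 2"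
    using order_tendstoD(2)[OF lim half_gt_zero[OF e]] unfolding eventually_sequentially by blast
  have near: "norm (conj_moebius (z (r n)) (toeplitz (s h)) p - toeplitz (s g) p) \<le> e / 2" if "n \<ge> N" for n
    using N[OF that] by (simp add: conj[OF z'] toeplitz_diff T(1) F gH blinfun.diff_left)
  define t where "t n = r (n + N)" for n
  have "strict_mono t"
    unfolding t_def using g(2) by (auto simp: strict_mono_def)
  moreover have "norm (conj_moebius (z (t i)) (toeplitz (s h)) p - conj_moebius (z (t j)) (toeplitz (s h)) p) \<le> e" for i j
  proof -
    let ?X = "\<lambda>i. conj_moebius (z (t i)) (toeplitz (s h)) p" and ?Y = "toeplitz (s g) p"
    have "norm (?X i - ?X j) = norm ((?X i - ?Y) - (?X j - ?Y))" by simp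
    also have "\<dots> \<le> e / 2 + e / 2"
      unfolding t_def by (intro order_trans[OF norm_triangle_ineq4] add_mono near) auto
    finally show ?thesis by simp
  qed
  ultimately show "\<exists>r::nat \<Rightarrow> nat. strict_mono r \<and>
      (\<forall>i j. norm (conj_moebius (z (r i)) (toeplitz (s h)) p - conj_moebius (z (r j)) (toeplitz (s h)) p) \<le> e)"
    by (intro exI[of _ t]) blast
qed

lemma precompact_orbits_toeplitz_algebra:
  assumes "S \<in> toeplitz_algebra"
  shows "precompact_orbits S"
proof -
  let ?G = "{S. precompact_orbits S}"
  have "toeplitz_algebra \<subseteq> ?G"
  proof (rule toeplitz_algebra_subsetI)
    show "closed ?G"
      unfolding closed_limpt islimpt_approachable_le
    proof (intro allI impI)
      fix S assume "\<forall>e>0. \<exists>R\<in>?G. R \<noteq> S \<and> dist R S \<le> e"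
      then have "\<exists>R. precompact_orbits R \<and> norm (S - R) \<le> e" if "0 < e" for e
        using that by (auto simp: dist_norm norm_minus_commute)
      then show "S \<in> ?G" using precompact_orbits_limit by blast
    qed
    show "complex_subspace ?G"
      by (simp add: complex_subspace_def precompact_orbits_zero precompact_orbits_add precompact_orbits_scale)
    show "S o\<^sub>L R \<in> ?G" if "S \<in> ?G" "R \<in> ?G" for S R
      using that by (simp add: precompact_orbits_compose)
    fix h assume h: "h \<in> H_infinity"
    show "toeplitz h \<in> ?G"
      using precompact_orbits_toeplitz_aux[OF h, of "\<lambda>u. u"] h
      by (simp add: bounded_symbol_holomorphic conj_moebius_toeplitz)
    show "toeplitz (\<lambda>w. cnj (h w)) \<in> ?G"
      using precompact_orbits_toeplitz_aux[OF h, of "\<lambda>u w. cnj (u w)"] h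
      by (simp add: bounded_symbol_holomorphic bounded_symbol_cnj conj_moebius_toeplitz_cnj)
  qed
  then show ?thesis using assms by blast
qed

text \<open>A constant symbol commutes with everything complex-linear, so \<open>f a\<close> can be
  subtracted from the conjugated symbol without changing the commutator. In the first term the
  conjugate of the antiholomorphic operator is left unevaluated, so that its orbit on a further
  operator can be treated as a whole.\<close>

lemma conj_moebius_commutator:
  assumes a: "cmod a < 1" and f: "f \<in> H_infinity" and g: "g \<in> H_infinity"
  defines "h \<equiv> \<lambda>w. f (moebius a w) - f a"
  shows "conj_moebius a ((toeplitz f o\<^sub>L toeplitz (\<lambda>w. cnj (g w))) - (toeplitz (\<lambda>w. cnj (g w)) o\<^sub>L toeplitz f)) p
    = toeplitz h (conj_moebius a (toeplitz (\<lambda>w. cnj (g w))) p)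
      - toeplitz (\<lambda>w. cnj (g (moebius a w))) (toeplitz h p)"
proof -
  let ?f = "\<lambda>w. f (moebius a w)"
  let ?G = "toeplitz (\<lambda>w. cnj (g (moebius a w)))"
  have fH: "?f \<in> H_infinity" by (rule H_infinity_moebius[OF a f])
  have th: "toeplitz h = toeplitz ?f - op_scaleC (f a) id_blinfun"
    unfolding h_def toeplitz_one[symmetric]
    by (subst toeplitz_scale[symmetric]) (auto simp: toeplitz_diff bounded_symbol_holomorphic fH bounded_symbol_const)
  have G: "?G \<in> bounded_ops"
    by (intro toeplitz_bounded_ops bounded_symbol_cnj bounded_symbol_holomorphic H_infinity_moebius a g)
  show ?thesis
    unfolding conj_moebius_diff_left[OF a] conj_moebius_compose[OF a]
      conj_moebius_toeplitz[OF a f] conj_moebius_toeplitz_cnj[OF a g] th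
    by (simp add: blinfun.diff_left blinfun.diff_right op_scaleC_apply bounded_ops_scaleC[OF G])
qed

text \<open>The differences \<open>f \<circ> moebius (z n) - f (z n)\<close> give operators tending
  to \<open>0\<close> strongly but not in norm, and the vectors to which they are applied vary with
  \<open>n\<close>. These vectors lie on the orbits of \<open>B\<close> and of the antiholomorphic
  operator composed with \<open>B\<close>; precompactness replaces them, up to \<open>d\<close>, by
  two fixed vectors \<open>b\<close> and \<open>c\<close>.\<close>

lemma berezin_commutator_small_sequence:
  assumes A: "A \<in> toeplitz_algebra" and B: "B \<in> toeplitz_algebra"
    and f: "f \<in> H_infinity" and g: "g \<in> H_infinity"
    and z: "\<And>n. cmod (z n) < 1"
    and lim: "\<And>w. cmod w < 1 \<Longrightarrow> (\<lambda>n. f (moebius (z n) w) - f (z n)) \<longlonglongrightarrow> 0" and e: "0 < e"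
  defines "D \<equiv> (toeplitz f o\<^sub>L toeplitz (\<lambda>w. cnj (g w))) - (toeplitz (\<lambda>w. cnj (g w)) o\<^sub>L toeplitz f)"
  shows "\<exists>n. cmod (berezin (A o\<^sub>L D o\<^sub>L B) (z n)) \<le> e"
proof -
  let ?g = "toeplitz (\<lambda>w. cnj (g w))" and ?p = "normalized_kernel 0"
  obtain M where M0: "0 \<le> M" and M: "\<And>w. cmod w < 1 \<Longrightarrow> cmod (f w) \<le> M"
    using bounded_symbol_bound[OF bounded_symbol_holomorphic[OF f]] by blast
  obtain G where G0: "0 \<le> G" and G: "\<And>w. cmod w < 1 \<Longrightarrow> cmod (g w) \<le> G"
    using bounded_symbol_bound[OF bounded_symbol_holomorphic[OF g]] by blast
  define K where "K = norm A + 1"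
  have K: "0 < K" "norm A \<le> K" by (auto simp: K_def intro: add_nonneg_pos)
  \<comment> \<open>Here \<open>2 * M\<close> bounds the operator of the difference symbol,
    \<open>G\<close> the antiholomorphic operator and \<open>K\<close> the norm of \<open>A\<close>;
    each of the two terms is at most \<open>2 * M * d + d\<close> before the factors
    \<open>G\<close> and \<open>K\<close>.\<close>
  define d where "d = e / (K * (1 + G) * (2 * M + 1))"
  have d: "0 < d" using e K M0 G0 by (simp add: d_def)
  have dK: "K * ((1 + G) * (2 * M * d + d)) = e"
  proof -
    have "K * ((1 + G) * (2 * M * d + d)) = (K * (1 + G) * (2 * M + 1)) * d" by (simp add: algebra_simps)
    also have "\<dots> = e" unfolding d_def using K M0 G0 by simp
    finally show ?thesis .
  qed
  have gB: "?g o\<^sub>L B \<in> toeplitz_algebra"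
    by (intro toeplitz_algebra_compose toeplitz_cnj_holomorphic_in_algebra g B)
  from precompact_orbitsD[OF precompact_orbits_toeplitz_algebra[OF B] allI[of "\<lambda>n. cmod (z n) < 1", OF z] d, of ?p]
  obtain r :: "nat \<Rightarrow> nat" where r: "strict_mono r \<and> (\<forall>i j. norm (conj_moebius (z (r i)) B ?p - conj_moebius (z (r j)) B ?p) \<le> d)" ..
  note r = conjunct1[OF r] conjunct2[OF r, rule_format]
  from precompact_orbitsD[OF precompact_orbits_toeplitz_algebra[OF gB] allI[of "\<lambda>n. cmod (z (r n)) < 1", OF z] d, of ?p]
  obtain s :: "nat \<Rightarrow> nat" where s: "strict_mono s \<and> (\<forall>i j. norm (conj_moebius (z (r (s i))) (?g o\<^sub>L B) ?p - conj_moebius (z (r (s j))) (?g o\<^sub>L B) ?p) \<le> d)" ..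
  note s = conjunct1[OF s] conjunct2[OF s, rule_format]
  define t where "t = r \<circ> s"
  have t: "strict_mono t" unfolding t_def by (rule strict_mono_o[OF r(1) s(1)])
  define b where "b = conj_moebius (z (t 0)) B ?p"
  define c where "c = conj_moebius (z (t 0)) (?g o\<^sub>L B) ?p"
  let ?h = "\<lambda>n w. f (moebius (z n) w) - f (z n)"
  have h: "?h n \<in> H_infinity" for n
    by (intro H_infinity_diff_const H_infinity_moebius z f)
  have hM: "cmod (?h n w) \<le> 2 * M" if "cmod w < 1" for n w
    using norm_triangle_ineq4[of "f (moebius (z n) w)" "f (z n)"] M[OF moebius_in_disk[OF z that], of n] M[OF z, of n] by simp
  have normh: "norm (toeplitz (?h n)) \<le> 2 * M" for n
    by (intro norm_toeplitz_le bounded_symbol_holomorphic h hM)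
  have limh: "(\<lambda>n. norm (toeplitz (?h (t n)) q)) \<longlonglongrightarrow> 0" for q
  proof (rule toeplitz_tendsto_zero)
    show "bounded_symbol (?h (t n))" for n by (intro bounded_symbol_holomorphic h)
    show "cmod w < 1 \<Longrightarrow> cmod (?h (t n) w) \<le> 2 * M" for n w by (rule hM)
    show "(\<lambda>n. ?h (t n) w) \<longlonglongrightarrow> 0" if "cmod w < 1" for w
      using LIMSEQ_subseq_LIMSEQ[OF lim[OF that] t] by (simp add: o_def)
  qed
  have ev: "\<forall>\<^sub>F n in sequentially. norm (toeplitz (?h (t n)) b) < d \<and> norm (toeplitz (?h (t n)) c) < d"
    by (intro eventually_conj order_tendstoD(2)[OF limh d])
  from eventually_happens'[OF sequentially_bot ev]
  obtain n where n: "norm (toeplitz (?h (t n)) b) < d \<and> norm (toeplitz (?h (t n)) c) < d" ..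
  note n = conjunct1[OF n] conjunct2[OF n]
  let ?a = "z (t n)"
  let ?b = "conj_moebius ?a B ?p" and ?c = "conj_moebius ?a (?g o\<^sub>L B) ?p"
  have near: "norm (toeplitz (?h (t n)) y) \<le> 2 * M * d + d"
    if y: "norm (y - x) \<le> d" and x: "norm (toeplitz (?h (t n)) x) < d" for x y
  proof -
    have "toeplitz (?h (t n)) y = toeplitz (?h (t n)) (y - x) + toeplitz (?h (t n)) x"
      by (simp add: blinfun.diff_right)
    also have "norm \<dots> \<le> 2 * M * d + d"
    proof (rule order_trans[OF norm_triangle_ineq add_mono])
      have "norm (toeplitz (?h (t n)) (y - x)) \<le> norm (toeplitz (?h (t n))) * norm (y - x)" by (rule norm_blinfun)
      also have "\<dots> \<le> 2 * M * d" using normh M0 y by (intro mult_mono) auto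
      finally show "norm (toeplitz (?h (t n)) (y - x)) \<le> 2 * M * d" .
    qed (use x in simp)
    finally show ?thesis .
  qed
  have nb: "norm (toeplitz (?h (t n)) ?b) \<le> 2 * M * d + d"
    by (rule near[OF _ n(1)]) (simp add: b_def t_def r)
  have nc: "norm (toeplitz (?h (t n)) ?c) \<le> 2 * M * d + d"
    by (rule near[OF _ n(2)]) (simp add: c_def t_def s)
  have normG: "norm (toeplitz (\<lambda>w. cnj (g (moebius ?a w)))) \<le> G"
    by (intro norm_toeplitz_le bounded_symbol_cnj bounded_symbol_holomorphic H_infinity_moebius z g)
      (simp add: G moebius_in_disk z)
  have "conj_moebius ?a (A o\<^sub>L D o\<^sub>L B) ?p = conj_moebius ?a A (conj_moebius ?a D ?b)"
    by (simp add: conj_moebius_compose z)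
  also have "conj_moebius ?a D ?b = toeplitz (?h (t n)) ?c - toeplitz (\<lambda>w. cnj (g (moebius ?a w))) (toeplitz (?h (t n)) ?b)"
    unfolding D_def conj_moebius_commutator[OF z f g] by (simp add: conj_moebius_compose z)
  finally have eq: "conj_moebius ?a (A o\<^sub>L D o\<^sub>L B) ?p
      = conj_moebius ?a A (toeplitz (?h (t n)) ?c - toeplitz (\<lambda>w. cnj (g (moebius ?a w))) (toeplitz (?h (t n)) ?b))" .
  have "cmod (berezin (A o\<^sub>L D o\<^sub>L B) ?a) \<le> norm (conj_moebius ?a (A o\<^sub>L D o\<^sub>L B) ?p) * norm ?p"
    unfolding berezin_conj_moebius[OF z] by (rule norm_cinner_le)
  also have "\<dots> = norm (conj_moebius ?a (A o\<^sub>L D o\<^sub>L B) ?p)" by (simp add: norm_normalized_kernel)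
  also have "\<dots> \<le> norm A * norm (toeplitz (?h (t n)) ?c - toeplitz (\<lambda>w. cnj (g (moebius ?a w))) (toeplitz (?h (t n)) ?b))"
    unfolding eq by (rule norm_conj_moebius_le[OF z])
  also have "\<dots> \<le> K * ((2 * M * d + d) + G * (2 * M * d + d))"
  proof (intro mult_mono K order_trans[OF norm_triangle_ineq4] add_mono nc)
    have "norm (toeplitz (\<lambda>w. cnj (g (moebius ?a w))) (toeplitz (?h (t n)) ?b))
        \<le> norm (toeplitz (\<lambda>w. cnj (g (moebius ?a w)))) * norm (toeplitz (?h (t n)) ?b)" by (rule norm_blinfun)
    also have "\<dots> \<le> G * (2 * M * d + d)" using normG G0 nb by (intro mult_mono) auto
    finally show "norm (toeplitz (\<lambda>w. cnj (g (moebius ?a w))) (toeplitz (?h (t n)) ?b)) \<le> G * (2 * M * d + d)" .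
  qed (use K in auto)
  also have "\<dots> = e" using dK by (simp add: algebra_simps)
  finally show ?thesis by blast
qed

section \<open>The pseudohyperbolic metric\<close>

lemma norm_moebius_commute: "cmod (moebius a b) = cmod (moebius b a)"
proof -
  have "cmod (1 - cnj a * b) = cmod (cnj (1 - cnj a * b))" by (rule complex_mod_cnj[symmetric])
  also have "cnj (1 - cnj a * b) = 1 - cnj b * a" by (simp add: mult.commute)
  finally show ?thesis by (simp add: moebius_def norm_divide norm_minus_commute)
qed

text \<open>Compared through \<open>1 - \<rho>\<^sup>2\<close>, where
  \<open>one_minus_norm_moebius\<close> is a quotient of products and all factors belonging to
  \<open>c\<close> cancel.\<close>

lemma norm_moebius_moebius:
  assumes c: "cmod c < 1" and a: "cmod a < 1" and b: "cmod b < 1"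
  shows "cmod (moebius (moebius c a) (moebius c b)) = cmod (moebius a b)"
proof -
  note nz = moebius_denom_nonzero[OF c a] moebius_denom_nonzero[OF c b] moebius_denom_nonzero[OF a b]
  have sq: "1 - (cmod (moebius (moebius c a) (moebius c b)))\<^sup>2 = 1 - (cmod (moebius a b))\<^sup>2"
  proof -
    define C where "C = 1 - (cmod c)\<^sup>2"
    have C: "C \<noteq> 0" using c by (auto simp: C_def abs_square_eq_1)
    have nz': "1 - c * cnj a \<noteq> 0"
      using nz(1) by (metis complex_cnj_cnj complex_cnj_diff complex_cnj_mult complex_cnj_one complex_cnj_zero_iff)
    have "1 - cnj (moebius c a) * moebius c b = of_real C * (1 - cnj a * b) / ((1 - c * cnj a) * (1 - cnj c * b))"
    proof -
      have "1 - cnj (moebius c a) * moebius c b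
          = ((1 - c * cnj a) * (1 - cnj c * b) - (cnj c - cnj a) * (c - b)) / ((1 - c * cnj a) * (1 - cnj c * b))"
      proof -
        have alg: "1 - p / x * (q / y) = (x * y - p * q) / (x * y)" if "x \<noteq> 0" "y \<noteq> 0" for p q x y :: complex
          using that by (simp add: divide_simps)
        show ?thesis
          using alg[OF nz' nz(2)] by (simp add: moebius_def)
      qed
      also have "(1 - c * cnj a) * (1 - cnj c * b) - (cnj c - cnj a) * (c - b) = (1 - c * cnj c) * (1 - cnj a * b)"
        by (simp add: algebra_simps)
      also have "1 - c * cnj c = of_real C" unfolding C_def using complex_norm_square[of c] by simp
      finally show ?thesis .
    qed
    then have "(cmod (1 - cnj (moebius c a) * moebius c b))\<^sup>2
        = C\<^sup>2 * (cmod (1 - cnj a * b))\<^sup>2 / ((cmod (1 - cnj c * a))\<^sup>2 * (cmod (1 - cnj c * b))\<^sup>2)"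
      using complex_mod_cnj[of "1 - cnj c * a"]
      by (simp add: norm_mult norm_divide power_mult_distrib power_divide)
    moreover have "1 - (cmod (moebius c a))\<^sup>2 = C * (1 - (cmod a)\<^sup>2) / (cmod (1 - cnj c * a))\<^sup>2"
      "1 - (cmod (moebius c b))\<^sup>2 = C * (1 - (cmod b)\<^sup>2) / (cmod (1 - cnj c * b))\<^sup>2"
      by (simp_all add: C_def one_minus_norm_moebius c a b)
    ultimately show ?thesis
      unfolding one_minus_norm_moebius[OF moebius_in_disk[OF c a] moebius_in_disk[OF c b]] one_minus_norm_moebius[OF a b]
      using C nz by (simp add: power2_eq_square)
  qed
  then have "(cmod (moebius (moebius c a) (moebius c b)))\<^sup>2 = (cmod (moebius a b))\<^sup>2" by simp
  then show ?thesis by simp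
qed

text \<open>The triangle inequality with middle vertex \<open>0\<close>. The sharp bound
  \<open>(s + t) / (1 + s * t)\<close> follows from
  \<open>cmod (1 - cnj x * y) \<le> 1 + s * t\<close>; invariance then moves the middle vertex
  anywhere.\<close>

lemma norm_moebius_le:
  assumes x: "cmod x < 1" and y: "cmod y < 1"
  shows "cmod (moebius x y) \<le> cmod x + cmod y"
proof -
  let ?s = "cmod x" and ?t = "cmod y"
  have nz: "0 < cmod (1 - cnj x * y)" using moebius_denom_nonzero[OF x y] by simp
  have p: "0 < 1 + ?s * ?t" by (intro add_pos_nonneg mult_nonneg_nonneg) auto
  have le: "cmod (1 - cnj x * y) \<le> 1 + ?s * ?t"
    using norm_triangle_ineq4[of 1 "cnj x * y"] by (simp add: norm_mult)
  have nn: "0 \<le> (1 - ?s\<^sup>2) * (1 - ?t\<^sup>2)"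
    using x y by (intro mult_nonneg_nonneg) (auto simp: power_le_one)
  have "1 - ((?s + ?t) / (1 + ?s * ?t))\<^sup>2 = (1 - ?s\<^sup>2) * (1 - ?t\<^sup>2) / (1 + ?s * ?t)\<^sup>2"
  proof -
    have "(1 + ?s * ?t)\<^sup>2 - (?s + ?t)\<^sup>2 = (1 - ?s\<^sup>2) * (1 - ?t\<^sup>2)"
      by (simp add: power2_eq_square algebra_simps)
    then show ?thesis using p by (simp add: power_divide field_simps)
  qed
  also have "\<dots> \<le> (1 - ?s\<^sup>2) * (1 - ?t\<^sup>2) / (cmod (1 - cnj x * y))\<^sup>2"
    using nz le p nn by (intro divide_left_mono power_mono mult_pos_pos zero_less_power) auto
  also have "\<dots> = 1 - (cmod (moebius x y))\<^sup>2"
    by (rule one_minus_norm_moebius[OF x y, symmetric])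
  finally have "(cmod (moebius x y))\<^sup>2 \<le> ((?s + ?t) / (1 + ?s * ?t))\<^sup>2" by simp
  then have "cmod (moebius x y) \<le> (?s + ?t) / (1 + ?s * ?t)"
    by (rule power2_le_imp_le) (use p in simp)
  also have "\<dots> \<le> (?s + ?t) / 1"
    using p by (intro divide_left_mono) auto
  also have "\<dots> = ?s + ?t" by simp
  finally show ?thesis .
qed

lemma norm_moebius_triangle:
  assumes a: "cmod a < 1" and w: "cmod w < 1" and b: "cmod b < 1"
  shows "cmod (moebius a b) \<le> cmod (moebius a w) + cmod (moebius w b)"
proof -
  have "cmod (moebius a b) = cmod (moebius (moebius w a) (moebius w b))"
    by (rule norm_moebius_moebius[OF w a b, symmetric])
  also have "\<dots> \<le> cmod (moebius w a) + cmod (moebius w b)"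
    by (intro norm_moebius_le moebius_in_disk w a b)
  finally show ?thesis by (simp only: norm_moebius_commute[of w a])
qed

text \<open>A Harnack-type comparison at bounded distance: writing \<open>w = moebius a x\<close>
  with \<open>cmod x \<le> r\<close>, the identity for \<open>1 - |w|\<^sup>2\<close> has a
  denominator of at most \<open>2\<^sup>2\<close>, which is the \<open>4\<close> in the
  constant.\<close>

lemma one_minus_norm_near:
  assumes a: "cmod a < 1" and w: "cmod w < 1" and r: "cmod (moebius a w) \<le> r" "r < 1"
  shows "(1 - (cmod a)\<^sup>2) * ((1 - r\<^sup>2) / 4) \<le> 1 - (cmod w)\<^sup>2"
proof -
  define x where "x = moebius a w"
  have x: "cmod x < 1" "cmod x \<le> r" using moebius_in_disk[OF a w] r by (auto simp: x_def)
  have "w = moebius a x" by (simp add: x_def moebius_moebius[OF a w])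
  then have eq: "1 - (cmod w)\<^sup>2 = (1 - (cmod a)\<^sup>2) * (1 - (cmod x)\<^sup>2) / (cmod (1 - cnj a * x))\<^sup>2"
    using one_minus_norm_moebius[OF a x(1)] by simp
  have nz: "0 < cmod (1 - cnj a * x)" using moebius_denom_nonzero[OF a x(1)] by simp
  have "cmod (1 - cnj a * x) \<le> 1 + cmod a * cmod x"
    using norm_triangle_ineq4[of 1 "cnj a * x"] by (simp add: norm_mult)
  also have "\<dots> \<le> 2" using a x(1) by (simp add: mult_le_one)
  finally have "(cmod (1 - cnj a * x))\<^sup>2 \<le> 2\<^sup>2" by (intro power_mono) auto
  moreover have "(cmod x)\<^sup>2 \<le> r\<^sup>2" using x by (intro power_mono) auto
  moreover have "0 \<le> 1 - (cmod a)\<^sup>2" "0 \<le> 1 - r\<^sup>2"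
    using a r order_trans[OF norm_ge_zero r(1)] by (auto simp: power_le_one)
  ultimately have "(1 - (cmod a)\<^sup>2) * (1 - r\<^sup>2) / 2\<^sup>2 \<le> (1 - (cmod a)\<^sup>2) * (1 - (cmod x)\<^sup>2) / (cmod (1 - cnj a * x))\<^sup>2"
    using nz by (intro frac_le mult_left_mono mult_nonneg_nonneg) auto
  then show ?thesis unfolding eq by simp
qed

lemma one_minus_norm_moebius_near:
  assumes z: "cmod z < 1" and a: "cmod a < 1" and w: "cmod w < 1"
    and r: "cmod (moebius a w) \<le> r" "r < 1"
  shows "(1 - (cmod (moebius z a))\<^sup>2) * ((1 - r\<^sup>2) / 4) \<le> 1 - (cmod (moebius z w))\<^sup>2"
  using one_minus_norm_near[OF moebius_in_disk[OF z a] moebius_in_disk[OF z w], of r] r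
  by (simp add: norm_moebius_moebius z a w)

section \<open>Local Dirichlet energy\<close>

text \<open>By conformal invariance, this is the Dirichlet integral of
  \<open>f \<circ> moebius z\<close> over the disk of radius \<open>1 / 4\<close> about
  \<open>0\<close>. The radius is half of the separation \<open>1 / 2\<close> used later, so that
  the regions of separated points are disjoint.\<close>

definition energy :: "(complex \<Rightarrow> complex) \<Rightarrow> complex \<Rightarrow> ennreal"
  where "energy f z = (\<integral>\<^sup>+w. indicator {w. cmod (moebius z w) < 1 / 4} w * ennreal ((cmod (deriv f w))\<^sup>2) \<partial>dA)"

lemma nn_integral_moebius_continuous:
  assumes a: "cmod a < 1" and h: "continuous_on unit_disk h" and P: "P \<in> sets borel"
  shows "(\<integral>\<^sup>+w. ennreal ((cmod (normalized_kernel_fun a w))\<^sup>2) * (indicator P (moebius a w) * ennreal (h (moebius a w))) \<partial>dA)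
    = (\<integral>\<^sup>+w. indicator P w * ennreal (h w) \<partial>dA)"
proof -
  let ?h = "\<lambda>w. if w \<in> unit_disk then h w else 0"
  have "?h \<in> borel_measurable borel"
    using h by (intro borel_measurable_continuous_on_if) auto
  then have "(\<lambda>w. indicator P w * ennreal (?h w)) \<in> borel_measurable borel"
    using P by (intro borel_measurable_times_ennreal borel_measurable_indicator measurable_compose[OF _ measurable_ennreal])
  note nn_integral_moebius[OF a this]
  moreover have "(\<integral>\<^sup>+w. indicator P w * ennreal (?h w) \<partial>dA) = (\<integral>\<^sup>+w. indicator P w * ennreal (h w) \<partial>dA)"
    by (intro nn_integral_cong) auto
  moreover have "(\<integral>\<^sup>+w. ennreal ((cmod (normalized_kernel_fun a w))\<^sup>2) * (indicator P (moebius a w) * ennreal (?h (moebius a w))) \<partial>dA)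
      = (\<integral>\<^sup>+w. ennreal ((cmod (normalized_kernel_fun a w))\<^sup>2) * (indicator P (moebius a w) * ennreal (h (moebius a w))) \<partial>dA)"
    using moebius_in_disk[OF a] by (intro nn_integral_cong) auto
  ultimately show ?thesis by simp
qed

lemma deriv_compose_moebius:
  assumes a: "cmod a < 1" and w: "cmod w < 1" and f: "f holomorphic_on unit_disk"
  shows "deriv (\<lambda>w. f (moebius a w)) w = - deriv f (moebius a w) * normalized_kernel_fun a w"
proof -
  have "f field_differentiable at (moebius a w)" "moebius a field_differentiable at w"
    using holomorphic_on_imp_differentiable_at[OF f] holomorphic_on_imp_differentiable_at[OF holomorphic_moebius[OF a]]
      moebius_in_disk[OF a w] w by auto
  then have "deriv (f \<circ> moebius a) w = deriv f (moebius a w) * deriv (moebius a) w"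
    by (intro deriv_chain)
  then show ?thesis by (simp add: o_def deriv_moebius[OF a w])
qed

lemma borel_pseudohyperbolic_ball:
  assumes "cmod a < 1"
  shows "{w. cmod w < 1 \<and> cmod (moebius a w) < r} \<in> sets borel"
proof -
  have "continuous_on unit_disk (\<lambda>w. cmod (moebius a w))"
    by (intro continuous_intros holomorphic_on_imp_continuous_on holomorphic_moebius assms)
  then have "open (unit_disk \<inter> (\<lambda>w. cmod (moebius a w)) -` {..<r})"
    by (rule continuous_open_preimage) auto
  moreover have "unit_disk \<inter> (\<lambda>w. cmod (moebius a w)) -` {..<r} = {w. cmod w < 1 \<and> cmod (moebius a w) < r}"
    by auto
  ultimately show ?thesis by (metis borel_open)
qed

lemma energy_eq:
  assumes z: "cmod z < 1" and f: "f holomorphic_on unit_disk"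
  shows "energy f z = (\<integral>\<^sup>+w. indicator (ball 0 (1 / 4)) w * ennreal ((cmod (deriv (\<lambda>w. f (moebius z w)) w))\<^sup>2) \<partial>dA)"
proof -
  let ?P = "{w. cmod w < 1 \<and> cmod (moebius z w) < 1 / 4}"
  have c: "continuous_on unit_disk (\<lambda>w. (cmod (deriv f w))\<^sup>2)"
    using f by (intro continuous_intros holomorphic_on_imp_continuous_on holomorphic_deriv) auto
  have "energy f z = (\<integral>\<^sup>+w. indicator ?P w * ennreal ((cmod (deriv f w))\<^sup>2) \<partial>dA)"
    unfolding energy_def by (intro nn_integral_cong) (auto simp: indicator_def)
  also have "\<dots> = (\<integral>\<^sup>+w. ennreal ((cmod (normalized_kernel_fun z w))\<^sup>2) *
      (indicator ?P (moebius z w) * ennreal ((cmod (deriv f (moebius z w)))\<^sup>2)) \<partial>dA)"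
    by (rule nn_integral_moebius_continuous[OF z c borel_pseudohyperbolic_ball[OF z], symmetric])
  also have "\<dots> = (\<integral>\<^sup>+w. indicator (ball 0 (1 / 4)) w * ennreal ((cmod (deriv (\<lambda>w. f (moebius z w)) w))\<^sup>2) \<partial>dA)"
  proof (intro nn_integral_cong)
    fix w assume "w \<in> space dA"
    then have w: "cmod w < 1" by simp
    show "ennreal ((cmod (normalized_kernel_fun z w))\<^sup>2) *
        (indicator ?P (moebius z w) * ennreal ((cmod (deriv f (moebius z w)))\<^sup>2))
        = indicator (ball 0 (1 / 4)) w * ennreal ((cmod (deriv (\<lambda>w. f (moebius z w)) w))\<^sup>2)"
      using w by (simp add: deriv_compose_moebius[OF z w f] norm_mult power_mult_distrib ennreal_mult'
          moebius_moebius[OF z w] moebius_in_disk[OF z w] indicator_def mult.commute)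
  qed
  finally show ?thesis .
qed

lemma coeff_le:
  assumes f: "f holomorphic_on unit_disk" and K: "\<And>w. cmod w < 1 \<Longrightarrow> cmod (f w) \<le> K"
  shows "cmod ((deriv ^^ n) f 0 / fact n) \<le> K"
proof -
  let ?a = "\<lambda>n. (deriv ^^ n) f 0 / fact n"
  have K0: "0 \<le> K" using K[of 0] by (simp add: order_trans[OF norm_ge_zero])
  have le: "(cmod (?a n))\<^sup>2 * (1 - 1 / (real k + 2)) ^ (2 * n) \<le> K\<^sup>2" for k
  proof -
    have r: "0 < 1 - 1 / (real k + 2)" "1 - 1 / (real k + 2) < 1" by (auto simp: field_simps)
    have "(cmod (?a n))\<^sup>2 * (1 - 1 / (real k + 2)) ^ (2 * n)
        \<le> (\<Sum>n<Suc n. (cmod (?a n))\<^sup>2 * (1 - 1 / (real k + 2)) ^ (2 * n))"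
      using r by (intro member_le_sum[of n _ "\<lambda>n. (cmod (?a n))\<^sup>2 * (1 - 1 / (real k + 2)) ^ (2 * n)"]) auto
    also have "\<dots> \<le> K\<^sup>2"
      by (rule sum_coeff_square_le[OF holomorphic_sums[OF f] K r])
    finally show ?thesis .
  qed
  have "(\<lambda>k. (cmod (?a n))\<^sup>2 * (1 - 1 / (real k + 2)) ^ (2 * n)) \<longlonglongrightarrow> (cmod (?a n))\<^sup>2 * 1 ^ (2 * n)"
    by (intro tendsto_intros radii_tendsto_1)
  then have "(cmod (?a n))\<^sup>2 * 1 ^ (2 * n) \<le> K\<^sup>2"
    by (rule LIMSEQ_le_const2) (use le in blast)
  then have "(cmod (?a n))\<^sup>2 \<le> K\<^sup>2" by simp
  then show ?thesis by (rule power2_le_imp_le[OF _ K0])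
qed

text \<open>A single term of Parseval's identity for the derivative on the disk of radius
  \<open>1 / 4\<close>; \<open>16 ^ (n + 1)\<close> is the reciprocal of
  \<open>(1 / 4) ^ (2 * n + 2)\<close>. Integrating the derivative divides the squared coefficient
  by \<open>(n + 1)\<^sup>2\<close>, which absorbs the factor \<open>n + 1\<close> from
  Parseval.\<close>

lemma coeff_le_energy:
  assumes z: "cmod z < 1" and f: "f holomorphic_on unit_disk" and d: "0 \<le> d" "energy f z \<le> ennreal d"
  shows "(cmod ((deriv ^^ Suc n) (\<lambda>w. f (moebius z w)) 0 / fact (Suc n)))\<^sup>2 \<le> 16 ^ (n + 1) * d"
proof -
  let ?g = "\<lambda>w. f (moebius z w)"
  let ?b = "\<lambda>n. (deriv ^^ n) (deriv ?g) 0 / fact n"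
  have g: "?g holomorphic_on unit_disk" by (rule compose_moebius_holomorphic[OF z f])
  have g': "deriv ?g holomorphic_on unit_disk" using g by (intro holomorphic_deriv) auto
  have [measurable]: "deriv ?g \<in> borel_measurable dA" by (rule holomorphic_measurable_dA[OF g'])
  have s: "(\<lambda>n. (cmod (?b n))\<^sup>2 * (1 / 4) ^ (2 * n + 2) / real (n + 1))
      sums (\<integral>w. indicat_real (ball 0 (1 / 4)) w * (cmod (deriv ?g w))\<^sup>2 \<partial>dA)"
    by (intro parseval_ball holomorphic_sums g') auto
  have "(\<Sum>k<Suc n. (cmod (?b k))\<^sup>2 * (1 / 4) ^ (2 * k + 2) / real (k + 1))
      \<le> (\<integral>w. indicat_real (ball 0 (1 / 4)) w * (cmod (deriv ?g w))\<^sup>2 \<partial>dA)"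
    unfolding sums_unique[OF s] using sums_summable[OF s] by (intro sum_le_suminf) auto
  moreover have "(cmod (?b n))\<^sup>2 * (1 / 4) ^ (2 * n + 2) / real (n + 1)
      \<le> (\<Sum>k<Suc n. (cmod (?b k))\<^sup>2 * (1 / 4) ^ (2 * k + 2) / real (k + 1))"
    by (intro member_le_sum[of n _ "\<lambda>k. (cmod (?b k))\<^sup>2 * (1 / 4) ^ (2 * k + 2) / real (k + 1)"]) auto
  moreover have "(\<integral>w. indicat_real (ball 0 (1 / 4)) w * (cmod (deriv ?g w))\<^sup>2 \<partial>dA) \<le> d"
  proof -
    have "integrable dA (\<lambda>w. indicat_real (ball 0 (1 / 4)) w * (cmod (deriv ?g w))\<^sup>2)"
    proof (rule integrable_bounded_dA)
      fix w :: complex assume "cmod w < 1"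
      show "norm (indicat_real (ball 0 (1 / 4)) w * (cmod (deriv ?g w))\<^sup>2) \<le> (\<Sum>n. cmod (?b n) * (1 / 4) ^ n)\<^sup>2"
        using power_series_norm_le[OF holomorphic_sums[OF g'], of "1 / 4" w] by (auto simp: indicator_def intro!: power_mono)
    qed measurable
    then have "ennreal (\<integral>w. indicat_real (ball 0 (1 / 4)) w * (cmod (deriv ?g w))\<^sup>2 \<partial>dA)
        = (\<integral>\<^sup>+w. ennreal (indicat_real (ball 0 (1 / 4)) w * (cmod (deriv ?g w))\<^sup>2) \<partial>dA)"
      by (intro nn_integral_eq_integral[symmetric]) auto
    also have "\<dots> = energy f z"
      unfolding energy_eq[OF z f] by (intro nn_integral_cong) (auto simp: indicator_def)
    finally have "ennreal (\<integral>w. indicat_real (ball 0 (1 / 4)) w * (cmod (deriv ?g w))\<^sup>2 \<partial>dA) \<le> ennreal d"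
      using d(2) by simp
    then show ?thesis by (simp only: ennreal_le_iff d(1))
  qed
  ultimately have "(cmod (?b n))\<^sup>2 * (1 / 4) ^ (2 * n + 2) / real (n + 1) \<le> d" by linarith
  then have "(cmod (?b n))\<^sup>2 * (1 / 16) ^ (n + 1) \<le> d * real (n + 1)"
  proof -
    have "(1 / 4) ^ (2 * n + 2) = ((1 / 4)\<^sup>2 :: real) ^ (n + 1)" by (subst power_mult[symmetric]) simp
    also have "\<dots> = (1 / 16) ^ (n + 1)" by (simp add: power2_eq_square)
    finally show ?thesis
      using \<open>(cmod (?b n))\<^sup>2 * (1 / 4) ^ (2 * n + 2) / real (n + 1) \<le> d\<close> by (simp only: pos_divide_le_eq of_nat_0_less_iff)
  qed
  then have b: "(cmod (?b n))\<^sup>2 \<le> 16 ^ (n + 1) * d * real (n + 1)"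
    by (simp only: power_one_over divide_le_eq times_divide_eq_right mult_1_right) (simp add: mult_ac)
  have "(deriv ^^ Suc n) ?g 0 / fact (Suc n) = ?b n / of_nat (Suc n)"
    by (simp only: funpow_Suc_right comp_apply fact_Suc) (simp add: divide_simps del: of_nat_Suc)
  then have "(cmod ((deriv ^^ Suc n) ?g 0 / fact (Suc n)))\<^sup>2 = (cmod (?b n))\<^sup>2 / (real (Suc n))\<^sup>2"
    by (simp only: norm_divide power_divide norm_of_nat)
  also have "\<dots> \<le> 16 ^ (n + 1) * d * real (n + 1) / (real (Suc n))\<^sup>2"
    by (intro divide_right_mono b) simp
  also have "\<dots> \<le> 16 ^ (n + 1) * d"
  proof -
    have "0 \<le> 16 ^ (n + 1) * d" using d(1) by simp
    then have "(16 ^ (n + 1) * d) * (real (Suc n) / (real (Suc n))\<^sup>2) \<le> (16 ^ (n + 1) * d) * 1"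
      by (intro mult_left_mono) (auto simp: power2_eq_square)
    then show ?thesis by simp
  qed
  finally show ?thesis .
qed

text \<open>The energy sees only the disk of radius \<open>1 / 4\<close>, and its bounds on the
  coefficients deteriorate with the index. It does force each coefficient to \<open>0\<close>; the
  uniform bound \<open>K\<close> on all coefficients dominates the series at any \<open>w\<close> of
  the disk, and Tannery's theorem exchanges limit and sum.\<close>

lemma compose_moebius_tendsto_const:
  assumes z: "\<And>n. cmod (z n) < 1" and f: "f \<in> H_infinity"
    and d: "\<And>n. 0 \<le> d n" "\<And>n. energy f (z n) \<le> ennreal (d n)" "d \<longlonglongrightarrow> 0" and w: "cmod w < 1"
  shows "(\<lambda>n. f (moebius (z n) w) - f (z n)) \<longlonglongrightarrow> 0"
proof -
  let ?g = "\<lambda>n w. f (moebius (z n) w)"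
  let ?a = "\<lambda>k n. (deriv ^^ Suc k) (?g n) 0 / fact (Suc k)"
  obtain K where K0: "0 \<le> K" and K: "\<And>w. cmod w < 1 \<Longrightarrow> cmod (f w) \<le> K"
    using bounded_symbol_bound[OF bounded_symbol_holomorphic[OF f]] by blast
  note fh = H_infinity_holomorphic[OF f]
  have g: "?g n holomorphic_on unit_disk" for n by (rule compose_moebius_holomorphic[OF z fh])
  have aK: "cmod (?a k n) \<le> K" for k n
    by (rule coeff_le[OF g K[OF moebius_in_disk[OF z]]])
  have lim: "(\<lambda>n. ?a k n * w ^ Suc k) \<longlonglongrightarrow> 0" for k
  proof -
    have le: "norm ((cmod (?a k n))\<^sup>2) \<le> 16 ^ (k + 1) * d n" for n
      unfolding real_norm_def abs_power2 by (rule coeff_le_energy[OF z fh d(1,2)])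
    have "(\<lambda>n. 16 ^ (k + 1) * d n) \<longlonglongrightarrow> 16 ^ (k + 1) * 0" by (intro tendsto_intros d)
    then have "(\<lambda>n. (cmod (?a k n))\<^sup>2) \<longlonglongrightarrow> 0"
      unfolding mult_zero_right by (rule Lim_null_comparison[OF always_eventually[OF allI[OF le]]])
    then have "(\<lambda>n. sqrt ((cmod (?a k n))\<^sup>2)) \<longlonglongrightarrow> sqrt 0" by (rule tendsto_real_sqrt)
    then have "(\<lambda>n. cmod (?a k n)) \<longlonglongrightarrow> 0" by (simp only: real_sqrt_abs abs_norm_cancel real_sqrt_zero)
    then have "(\<lambda>n. ?a k n) \<longlonglongrightarrow> 0" by (rule tendsto_norm_zero_cancel)
    then show ?thesis by (rule tendsto_mult_left_zero)
  qed
  have bound: "\<forall>\<^sub>F (k, n) in at_top \<times>\<^sub>F sequentially. norm (?a k n * w ^ Suc k) \<le> K * cmod w ^ Suc k"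
  proof (intro always_eventually allI, clarify)
    fix k n
    show "norm (?a k n * w ^ Suc k) \<le> K * cmod w ^ Suc k"
      unfolding norm_mult norm_power by (intro mult_right_mono aK) simp
  qed
  have summ: "summable (\<lambda>k. K * cmod w ^ Suc k)"
    using w by (intro summable_mult) (simp add: summable_Suc_iff)
  have "(\<lambda>n. \<Sum>k. ?a k n * w ^ Suc k) \<longlonglongrightarrow> (\<Sum>k. 0)"
    using tannerys_theorem[OF lim bound summ sequentially_bot] by blast
  moreover have "(\<Sum>k. ?a k n * w ^ Suc k) = f (moebius (z n) w) - f (z n)" for n
  proof -
    have "(\<lambda>k. (deriv ^^ k) (?g n) 0 / fact k * w ^ k) sums ?g n w"
      by (rule holomorphic_sums[OF g w])
    then have "(\<lambda>k. ?a k n * w ^ Suc k) sums (?g n w - (deriv ^^ 0) (?g n) 0 / fact 0 * w ^ 0)"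
      by (subst sums_Suc_iff[of "\<lambda>k. (deriv ^^ k) (?g n) 0 / fact k * w ^ k"]) simp
    then show ?thesis by (simp add: sums_iff moebius_def)
  qed
  ultimately show ?thesis by simp
qed

text \<open>Uniformity in \<open>z\<close> by contradiction: points violating it with energies below
  \<open>1 / (n + 1)\<close> form a sequence along which the translates of \<open>f\<close> become
  constant.\<close>

lemma berezin_commutator_small:
  assumes A: "A \<in> toeplitz_algebra" and B: "B \<in> toeplitz_algebra"
    and f: "f \<in> H_infinity" and g: "g \<in> H_infinity" and e: "0 < e"
  defines "X \<equiv> A o\<^sub>L ((toeplitz f o\<^sub>L toeplitz (\<lambda>w. cnj (g w))) - (toeplitz (\<lambda>w. cnj (g w)) o\<^sub>L toeplitz f)) o\<^sub>L B"
  shows "\<exists>d>0. \<forall>z. cmod z < 1 \<longrightarrow> energy f z < ennreal d \<longrightarrow> cmod (berezin X z) < e"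
proof (rule ccontr)
  assume "\<not> ?thesis"
  then have "\<exists>z. cmod z < 1 \<and> energy f z < ennreal (1 / (real n + 1)) \<and> e \<le> cmod (berezin X z)" for n
    by (metis add_pos_nonneg divide_pos_pos add.commute not_less of_nat_0_le_iff zero_less_one)
  then obtain z where z: "\<And>n. cmod (z n) < 1" "\<And>n. energy f (z n) < ennreal (1 / (real n + 1))"
    "\<And>n. e \<le> cmod (berezin X (z n))" by metis
  have "(\<lambda>n. f (moebius (z n) w) - f (z n)) \<longlonglongrightarrow> 0" if "cmod w < 1" for w
  proof (rule compose_moebius_tendsto_const[OF z(1) f _ less_imp_le[OF z(2)] _ that])
    show "(\<lambda>n. 1 / (real n + 1)) \<longlonglongrightarrow> 0" by real_asymp
  qed simp
  from berezin_commutator_small_sequence[OF A B f g z(1) this half_gt_zero[OF e]]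
  obtain n where "cmod (berezin X (z n)) \<le> e / 2" unfolding X_def by blast
  then show False using z(3)[of n] e by simp
qed

section \<open>Blaschke products\<close>

text \<open>The conformally invariant form of the Carleson condition for the measure with mass
  \<open>1 - |a|\<^sup>2\<close> at each \<open>a\<close> in \<open>Y\<close>. Finite subsets make
  it independent of any summability or enumeration.\<close>

definition carleson_bound :: "real \<Rightarrow> complex set \<Rightarrow> bool"
  where "carleson_bound M Y \<longleftrightarrow> Y \<subseteq> unit_disk \<and>
    (\<forall>F z. finite F \<longrightarrow> F \<subseteq> Y \<longrightarrow> cmod z < 1 \<longrightarrow> (\<Sum>a\<in>F. 1 - (cmod (moebius a z))\<^sup>2) \<le> M)"

lemma carleson_bound_subset: "carleson_bound M Y \<Longrightarrow> X \<subseteq> Y \<Longrightarrow> carleson_bound M X"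
  unfolding carleson_bound_def by blast

lemma one_minus_norm_moebius_nonneg:
  "cmod a < 1 \<Longrightarrow> cmod w < 1 \<Longrightarrow> 0 \<le> 1 - (cmod (moebius a w))\<^sup>2"
  using moebius_in_disk[of a w] by (simp add: power_le_one)

text \<open>The regions of radius \<open>1 / 4\<close> around points of \<open>Z\<close> are
  disjoint, and on each of them \<open>1 - |moebius z w|\<^sup>2\<close> is at least
  \<open>15 / 64 = (1 - (1 / 4)\<^sup>2) / 4\<close> of its value at the center. Summing energies
  therefore stays below the integral of \<open>|f'|\<^sup>2 (1 - |moebius z|\<^sup>2)\<close>, which
  is the Littlewood-Paley integral of \<open>f \<circ> moebius z\<close>.\<close>

lemma carleson_bound_energy:
  assumes f: "f holomorphic_on unit_disk" and K: "\<And>w. cmod w < 1 \<Longrightarrow> cmod (f w) \<le> K"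
    and d: "0 < d" and Z: "Z \<subseteq> unit_disk" "\<And>a. a \<in> Z \<Longrightarrow> ennreal d \<le> energy f a"
    and sep: "\<And>a b. a \<in> Z \<Longrightarrow> b \<in> Z \<Longrightarrow> a \<noteq> b \<Longrightarrow> 1 / 2 \<le> cmod (moebius a b)"
  shows "carleson_bound (64 / 15 * K\<^sup>2 / d) Z"
  unfolding carleson_bound_def
proof (intro conjI allI impI Z)
  fix F and z :: complex
  assume F: "finite F" "F \<subseteq> Z" and z: "cmod z < 1"
  have F1: "cmod a < 1" if "a \<in> F" for a using that F Z by auto
  let ?c = "\<lambda>a. (1 - (cmod (moebius a z))\<^sup>2) * (15 / 64)"
  let ?D = "\<lambda>a. {w. cmod (moebius a w) < 1 / 4}"
  let ?f = "\<lambda>w. ennreal ((cmod (deriv f w))\<^sup>2)"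
  have c0: "0 \<le> ?c a" if "a \<in> F" for a
    using one_minus_norm_moebius_nonneg[OF F1[OF that] z] by simp
  have f': "deriv f holomorphic_on unit_disk" using f by (intro holomorphic_deriv) auto
  have fm[measurable]: "deriv f \<in> borel_measurable dA" by (rule holomorphic_measurable_dA[OF f'])
  have m: "(\<lambda>w. indicator (?D a) w * ?f w) \<in> borel_measurable dA" if "a \<in> F" for a
  proof -
    have "indicator {w. cmod w < 1 \<and> cmod (moebius a w) < 1 / 4} \<in> borel_measurable dA"
      by (intro measurable_borel_dA borel_measurable_indicator borel_pseudohyperbolic_ball F1 that)
    then have "(\<lambda>w. indicator {w. cmod w < 1 \<and> cmod (moebius a w) < 1 / 4} w * ?f w) \<in> borel_measurable dA"
      by measurable
    then show ?thesis
      by (rule measurable_cong[THEN iffD1, rotated]) (auto simp: indicator_def)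
  qed
  have "(\<Sum>a\<in>F. ennreal (?c a) * energy f a) = (\<Sum>a\<in>F. \<integral>\<^sup>+w. ennreal (?c a) * (indicator (?D a) w * ?f w) \<partial>dA)"
    unfolding energy_def by (intro sum.cong refl nn_integral_cmult[symmetric] m)
  also have "\<dots> = (\<integral>\<^sup>+w. (\<Sum>a\<in>F. ennreal (?c a) * (indicator (?D a) w * ?f w)) \<partial>dA)"
    by (intro nn_integral_sum[symmetric] borel_measurable_times_ennreal m) auto
  also have "\<dots> \<le> (\<integral>\<^sup>+w. ennreal ((cmod (deriv f w))\<^sup>2 * (1 - (cmod (moebius z w))\<^sup>2)) \<partial>dA)"
  proof (intro nn_integral_mono)
    fix w assume "w \<in> space dA"
    then have w: "cmod w < 1" by simp
    show "(\<Sum>a\<in>F. ennreal (?c a) * (indicator (?D a) w * ?f w))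
        \<le> ennreal ((cmod (deriv f w))\<^sup>2 * (1 - (cmod (moebius z w))\<^sup>2))"
    proof (cases "\<exists>a\<in>F. w \<in> ?D a")
      case False
      then have "(\<Sum>a\<in>F. ennreal (?c a) * (indicator (?D a) w * ?f w)) = 0"
        by (intro sum.neutral) (auto simp: indicator_def)
      then show ?thesis by simp
    next
      case True
      then obtain a where a: "a \<in> F" "cmod (moebius a w) < 1 / 4" by auto
      have other: "w \<notin> ?D b" if "b \<in> F" "b \<noteq> a" for b
      proof
        assume b: "w \<in> ?D b"
        have "1 / 2 \<le> cmod (moebius a b)" using sep[of a b] that a F by auto
        also have "\<dots> \<le> cmod (moebius a w) + cmod (moebius w b)"
          by (rule norm_moebius_triangle[OF F1[OF a(1)] w F1[OF that(1)]])
        also have "\<dots> < 1 / 4 + 1 / 4" using a(2) b by (simp add: norm_moebius_commute[of w b])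
        finally show False by simp
      qed
      have "(\<Sum>b\<in>F. ennreal (?c b) * (indicator (?D b) w * ?f w)) = ennreal (?c a) * (indicator (?D a) w * ?f w)"
        using other by (subst sum.remove[OF F(1) a(1)]) (auto intro!: sum.neutral)
      also have "\<dots> = ennreal (?c a * (cmod (deriv f w))\<^sup>2)"
      proof -
        have "indicator (?D a) w = (1 :: ennreal)" using a by simp
        then show ?thesis by (simp only: mult_1_left ennreal_mult[OF c0[OF a(1)] zero_le_power2])
      qed
      also have "\<dots> \<le> ennreal ((cmod (deriv f w))\<^sup>2 * (1 - (cmod (moebius z w))\<^sup>2))"
      proof (intro ennreal_leI)
        have "?c a = (1 - (cmod (moebius z a))\<^sup>2) * ((1 - (1 / 4)\<^sup>2) / 4)"
          by (simp add: norm_moebius_commute[of a z] power2_eq_square)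
        also have "\<dots> \<le> 1 - (cmod (moebius z w))\<^sup>2"
          using a by (intro one_minus_norm_moebius_near z w F1) auto
        finally show "?c a * (cmod (deriv f w))\<^sup>2 \<le> (cmod (deriv f w))\<^sup>2 * (1 - (cmod (moebius z w))\<^sup>2)"
          by (subst mult.commute) (rule mult_left_mono, auto)
      qed
      finally show ?thesis .
    qed
  qed
  also have "\<dots> \<le> ennreal (K\<^sup>2)"
  proof -
    let ?h = "\<lambda>w. (cmod (deriv f w))\<^sup>2 * (1 - (cmod (moebius z w))\<^sup>2)"
    let ?g = "\<lambda>w. f (moebius z w)"
    have h: "continuous_on unit_disk ?h"
      using f' by (intro continuous_intros holomorphic_on_imp_continuous_on holomorphic_moebius z)
    have "(\<integral>\<^sup>+w. ennreal (?h w) \<partial>dA) = (\<integral>\<^sup>+w. indicator UNIV w * ennreal (?h w) \<partial>dA)" by simp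
    also have "\<dots> = (\<integral>\<^sup>+w. ennreal ((cmod (normalized_kernel_fun z w))\<^sup>2) * (indicator UNIV (moebius z w) * ennreal (?h (moebius z w))) \<partial>dA)"
      by (rule nn_integral_moebius_continuous[OF z h, symmetric]) simp
    also have "\<dots> = (\<integral>\<^sup>+w. ennreal ((cmod (deriv ?g w))\<^sup>2 * (1 - (cmod w)\<^sup>2)) \<partial>dA)"
    proof (intro nn_integral_cong)
      fix w assume "w \<in> space dA"
      then have w: "cmod w < 1" by simp
      have "(cmod (normalized_kernel_fun z w))\<^sup>2 * ?h (moebius z w) = (cmod (deriv ?g w))\<^sup>2 * (1 - (cmod w)\<^sup>2)"
        unfolding deriv_compose_moebius[OF z w f] moebius_moebius[OF z w]
        by (simp add: norm_mult power_mult_distrib mult_ac)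
      then show "ennreal ((cmod (normalized_kernel_fun z w))\<^sup>2) * (indicator UNIV (moebius z w) * ennreal (?h (moebius z w)))
          = ennreal ((cmod (deriv ?g w))\<^sup>2 * (1 - (cmod w)\<^sup>2))"
        by (simp add: ennreal_mult'[symmetric])
    qed
    also have "\<dots> \<le> ennreal (K\<^sup>2)"
      by (rule littlewood_paley[OF compose_moebius_holomorphic[OF z f] K[OF moebius_in_disk[OF z]]])
    finally show ?thesis .
  qed
  finally have "(\<Sum>a\<in>F. ennreal (?c a) * energy f a) \<le> ennreal (K\<^sup>2)" .
  moreover have "(\<Sum>a\<in>F. ennreal (?c a * d)) \<le> (\<Sum>a\<in>F. ennreal (?c a) * energy f a)"
  proof (rule sum_mono)
    fix a assume a: "a \<in> F"
    have "ennreal (?c a * d) = ennreal (?c a) * ennreal d"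
      using d by (intro ennreal_mult'') simp
    also have "\<dots> \<le> ennreal (?c a) * energy f a"
      using Z(2)[of a] a F by (intro mult_left_mono) auto
    finally show "ennreal (?c a * d) \<le> ennreal (?c a) * energy f a" .
  qed
  ultimately have "(\<Sum>a\<in>F. ennreal (?c a * d)) \<le> ennreal (K\<^sup>2)" by (rule order_trans[rotated])
  moreover have "(\<Sum>a\<in>F. ennreal (?c a * d)) = ennreal (\<Sum>a\<in>F. ?c a * d)"
    using c0 d by (intro sum_ennreal mult_nonneg_nonneg) auto
  ultimately have "(\<Sum>a\<in>F. ?c a * d) \<le> K\<^sup>2"
    by (simp only: ennreal_le_iff zero_le_power2)
  also have "(\<Sum>a\<in>F. ?c a * d) = (\<Sum>a\<in>F. 1 - (cmod (moebius a z))\<^sup>2) * (15 / 64 * d)"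
    unfolding sum_distrib_right by (simp only: mult.assoc)
  finally have le: "(\<Sum>a\<in>F. 1 - (cmod (moebius a z))\<^sup>2) * (15 / 64 * d) \<le> K\<^sup>2" .
  have "x \<le> 64 / 15 * K\<^sup>2 / d" if "x * (15 / 64 * d) \<le> K\<^sup>2" for x
    using that d by (simp add: field_simps)
  from this[OF le] show "(\<Sum>a\<in>F. 1 - (cmod (moebius a z))\<^sup>2) \<le> 64 / 15 * K\<^sup>2 / d" .
qed

text \<open>The case \<open>z = 0\<close> is the Blaschke condition, a summable family of positive
  numbers.\<close>

lemma carleson_bound_countable:
  assumes "carleson_bound M Y"
  shows "countable Y"
proof -
  let ?f = "\<lambda>a. 1 - (cmod a)\<^sup>2"
  have Y: "cmod a < 1" if "a \<in> Y" for a using assms that by (auto simp: carleson_bound_def)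
  have pos: "0 < ?f a" if "a \<in> Y" for a using Y[OF that] by (simp add: abs_square_less_1)
  have "?f summable_on Y"
  proof (rule nonneg_bdd_above_summable_on)
    show "bdd_above (sum ?f ` {F. F \<subseteq> Y \<and> finite F})"
    proof (rule bdd_aboveI[of _ M], clarify)
      fix F assume F: "F \<subseteq> Y" "finite F"
      then have "(\<Sum>a\<in>F. 1 - (cmod (moebius a 0))\<^sup>2) \<le> M"
        using assms unfolding carleson_bound_def by simp
      then show "sum ?f F \<le> M" by (simp add: moebius_def)
    qed
  qed (use pos in \<open>auto intro: less_imp_le\<close>)
  then have "countable {a \<in> Y. ?f a \<noteq> 0}" by (rule summable_countable_real)
  moreover have "{a \<in> Y. ?f a \<noteq> 0} = Y" using pos by force
  ultimately show ?thesis by simp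
qed

text \<open>The usual unimodular convergence factors are absent: infinite products arise as Montel
  limits of subsequences, and only moduli enter the estimates.\<close>

definition blaschke :: "complex set \<Rightarrow> complex \<Rightarrow> complex"
  where "blaschke F w = (\<Prod>a\<in>F. moebius a w)"

context
  fixes F :: "complex set"
  assumes fin: "finite F" and disk: "F \<subseteq> unit_disk"
begin

lemma blaschke_holomorphic: "blaschke F holomorphic_on unit_disk"
  unfolding blaschke_def using disk by (intro holomorphic_on_prod holomorphic_moebius) auto

lemma norm_blaschke_le_1: "cmod w < 1 \<Longrightarrow> cmod (blaschke F w) \<le> 1"
  unfolding blaschke_def prod_norm[symmetric] using disk
  by (intro prod_le_1 conjI norm_ge_zero less_imp_le[OF moebius_in_disk]) auto

lemma norm_blaschke_le:
  assumes a: "a \<in> F" and w: "cmod w < 1"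
  shows "cmod (blaschke F w) \<le> cmod (moebius a w)"
proof -
  have "cmod (blaschke F w) = cmod (moebius a w) * (\<Prod>b\<in>F - {a}. cmod (moebius b w))"
    unfolding blaschke_def prod_norm[symmetric] by (rule prod.remove[OF fin a])
  also have "\<dots> \<le> cmod (moebius a w) * 1"
    using disk w by (intro mult_left_mono prod_le_1 conjI norm_ge_zero less_imp_le[OF moebius_in_disk]) auto
  finally show ?thesis by simp
qed

text \<open>Each factor \<open>x = |moebius a w|\<^sup>2\<close> satisfies
  \<open>1 / x = 1 + (1 - x) / x \<le> exp ((1 - x) / \<eta>\<^sup>2)\<close>, so the product is
  controlled by the Carleson sum.\<close>

lemma norm_blaschke_ge:
  assumes w: "cmod w < 1" and M: "(\<Sum>a\<in>F. 1 - (cmod (moebius a w))\<^sup>2) \<le> M"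
    and \<eta>: "0 < \<eta>" "\<And>a. a \<in> F \<Longrightarrow> \<eta> \<le> cmod (moebius a w)"
  shows "exp (- M / \<eta>\<^sup>2) \<le> (cmod (blaschke F w))\<^sup>2"
proof -
  let ?x = "\<lambda>a. (cmod (moebius a w))\<^sup>2"
  have x: "exp (- (1 - ?x a) / \<eta>\<^sup>2) \<le> ?x a" if a: "a \<in> F" for a
  proof -
    have xe: "\<eta>\<^sup>2 \<le> ?x a" using \<eta> a by (intro power_mono) auto
    have x0: "0 < ?x a" using \<eta> by (intro less_le_trans[OF _ xe]) simp
    have x1: "0 \<le> 1 - ?x a"
      using disk a w by (intro one_minus_norm_moebius_nonneg) auto
    have "1 / ?x a = 1 + (1 - ?x a) / ?x a" using x0 by (simp add: field_simps)
    also have "\<dots> \<le> exp ((1 - ?x a) / ?x a)" by (rule exp_ge_add_one_self)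
    also have "\<dots> \<le> exp ((1 - ?x a) / \<eta>\<^sup>2)"
      using xe x0 x1 \<eta> by (simp add: divide_left_mono)
    finally have "1 / exp ((1 - ?x a) / \<eta>\<^sup>2) \<le> ?x a"
      using x0 by (simp add: field_simps)
    moreover have "exp (- t / h) = 1 / exp (t / h)" for t h :: real
      by (metis exp_minus inverse_eq_divide minus_divide_left)
    ultimately show ?thesis by (simp only:)
  qed
  have "exp (- M / \<eta>\<^sup>2) \<le> exp (\<Sum>a\<in>F. - (1 - ?x a) / \<eta>\<^sup>2)"
    using M by (simp add: sum_divide_distrib[symmetric] sum_negf divide_right_mono del: minus_diff_eq)
  also have "\<dots> = (\<Prod>a\<in>F. exp (- (1 - ?x a) / \<eta>\<^sup>2))"
    by (rule exp_sum[OF fin])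
  also have "\<dots> \<le> (\<Prod>a\<in>F. ?x a)"
    using x by (intro prod_mono) auto
  also have "\<dots> = (cmod (blaschke F w))\<^sup>2"
    unfolding blaschke_def prod_norm[symmetric] by (simp add: prod_power_distrib)
  finally show ?thesis .
qed

end

text \<open>The unitary at \<open>a\<close> moves the balls to the origin, where
  \<open>integral_ball_le\<close> applies to \<open>moebius_op a g\<close>.\<close>

lemma integral_pseudohyperbolic_ball_le:
  assumes a: "cmod a < 1" and r: "0 \<le> r" "r \<le> R" "0 < R" "R < 1"
  shows "(\<integral>w. indicat_real {w. cmod w < 1 \<and> cmod (moebius a w) < r} w * (cmod (Rep_bergman g w))\<^sup>2 \<partial>dA)
    \<le> (r / R)\<^sup>2 * (\<integral>w. indicat_real {w. cmod w < 1 \<and> cmod (moebius a w) < R} w * (cmod (Rep_bergman g w))\<^sup>2 \<partial>dA)"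
proof -
  have eq: "(\<integral>w. indicat_real {w. cmod w < 1 \<and> cmod (moebius a w) < r} w * (cmod (Rep_bergman g w))\<^sup>2 \<partial>dA)
      = (\<integral>w. indicat_real (ball 0 r) w * (cmod (Rep_bergman (moebius_op a g) w))\<^sup>2 \<partial>dA)" for r
  proof -
    let ?P = "{w. cmod w < 1 \<and> cmod (moebius a w) < r}"
    let ?H = "\<lambda>w. indicat_real ?P w * (cmod (Rep_bergman g w))\<^sup>2"
    have "indicat_real ?P \<in> borel_measurable borel"
      by (intro borel_measurable_indicator borel_pseudohyperbolic_ball a)
    then have "?H \<in> borel_measurable borel" by measurable
    from integral_moebius[OF a this]
    have "integral\<^sup>L dA ?H = (\<integral>w. (cmod (normalized_kernel_fun a w))\<^sup>2 *\<^sub>R ?H (moebius a w) \<partial>dA)" by simp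
    also have "\<dots> = (\<integral>w. indicat_real (ball 0 r) w * (cmod (Rep_bergman (moebius_op a g) w))\<^sup>2 \<partial>dA)"
    proof (intro Bochner_Integration.integral_cong refl)
      fix w assume "w \<in> space dA"
      then have w: "cmod w < 1" by simp
      show "(cmod (normalized_kernel_fun a w))\<^sup>2 *\<^sub>R ?H (moebius a w)
          = indicat_real (ball 0 r) w * (cmod (Rep_bergman (moebius_op a g) w))\<^sup>2"
        by (simp add: Rep_moebius_op[OF a w] norm_mult power_mult_distrib indicator_def
            moebius_moebius[OF a w] moebius_in_disk[OF a w])
    qed
    finally show ?thesis .
  qed
  show ?thesis unfolding eq by (rule integral_ball_le[OF Rep_bergman_holomorphic r])
qed

text \<open>Away from the balls of radius \<open>\<eta>\<close> about the zeros the product is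
  bounded below. These balls carry at most half the mass of \<open>g\<close>: each has at most
  \<open>(2 * \<eta>)\<^sup>2\<close> of the mass of its concentric ball of radius
  \<open>1 / 2\<close>, and the larger balls overlap at most \<open>4 / 3 * M\<close> times, whence
  the constant \<open>16 / 3\<close>. Bounded overlap takes the place of separation.\<close>

lemma norm_blaschke_mult_ge:
  assumes F: "finite F" and C: "carleson_bound M F" and \<eta>: "0 < \<eta>" "\<eta> \<le> 1 / 2" "16 / 3 * M * \<eta>\<^sup>2 \<le> 1 / 2"
  shows "exp (- M / \<eta>\<^sup>2) / 2 * (norm g)\<^sup>2 \<le> (\<integral>w. (cmod (blaschke F w))\<^sup>2 * (cmod (Rep_bergman g w))\<^sup>2 \<partial>dA)"
proof -
  let ?s = "exp (- M / \<eta>\<^sup>2)" and ?g = "\<lambda>w. (cmod (Rep_bergman g w))\<^sup>2"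
  let ?P = "\<lambda>r a. {w. cmod w < 1 \<and> cmod (moebius a w) < r}"
  have disk: "F \<subseteq> unit_disk" using C by (simp add: carleson_bound_def)
  have F1: "cmod a < 1" if "a \<in> F" for a using that disk by auto
  have M: "(\<Sum>a\<in>F. 1 - (cmod (moebius a w))\<^sup>2) \<le> M" if "cmod w < 1" for w
    using C F that by (simp add: carleson_bound_def)
  have [measurable]: "blaschke F \<in> borel_measurable dA"
    by (rule holomorphic_measurable_dA[OF blaschke_holomorphic[OF F disk]])
  have im: "indicat_real (?P r a) \<in> borel_measurable dA" if "a \<in> F" for r a
    by (intro measurable_borel_dA borel_measurable_indicator borel_pseudohyperbolic_ball F1 that)
  have ii: "integrable dA (\<lambda>w. indicat_real (?P r a) w * ?g w)" if "a \<in> F" for r a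
  proof (rule Bochner_Integration.integrable_bound[OF Rep_bergman_integrable[of g]])
    have [measurable]: "indicat_real (?P r a) \<in> borel_measurable dA" by (rule im[OF that])
    show "(\<lambda>w. indicat_real (?P r a) w * ?g w) \<in> borel_measurable dA" by measurable
  qed (auto simp: indicator_def)
  have isum: "integrable dA (\<lambda>w. (\<Sum>a\<in>F. indicat_real (?P r a) w) * ?g w)" for r
    unfolding sum_distrib_right by (intro Bochner_Integration.integrable_sum ii)
  have "(\<Sum>a\<in>F. \<integral>w. indicat_real (?P \<eta> a) w * ?g w \<partial>dA)
      \<le> (\<Sum>a\<in>F. (\<eta> / (1 / 2))\<^sup>2 * (\<integral>w. indicat_real (?P (1 / 2) a) w * ?g w \<partial>dA))"
    using \<eta> by (intro sum_mono integral_pseudohyperbolic_ball_le F1) auto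
  also have "\<dots> = 4 * \<eta>\<^sup>2 * (\<integral>w. (\<Sum>a\<in>F. indicat_real (?P (1 / 2) a) w) * ?g w \<partial>dA)"
    unfolding sum_distrib_right
    by (subst Bochner_Integration.integral_sum[OF ii]) (simp_all add: sum_distrib_left power_mult_distrib mult.commute)
  also have "\<dots> \<le> 4 * \<eta>\<^sup>2 * (\<integral>w. (4 / 3 * M) * ?g w \<partial>dA)"
  proof (intro mult_left_mono integral_mono isum integrable_mult_right Rep_bergman_integrable)
    fix w assume "w \<in> space dA"
    then have w: "cmod w < 1" by simp
    \<comment> \<open>Every ball of radius \<open>1 / 2\<close> that contains \<open>w\<close>
      contributes at least \<open>1 - 1 / 4\<close> to the Carleson sum at \<open>w\<close>.\<close>
    have "(\<Sum>a\<in>F. indicat_real (?P (1 / 2) a) w * (3 / 4)) \<le> (\<Sum>a\<in>F. 1 - (cmod (moebius a w))\<^sup>2)"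
    proof (rule sum_mono)
      fix a assume a: "a \<in> F"
      show "indicat_real (?P (1 / 2) a) w * (3 / 4) \<le> 1 - (cmod (moebius a w))\<^sup>2"
      proof (cases "cmod (moebius a w) < 1 / 2")
        case True
        then have "(cmod (moebius a w))\<^sup>2 \<le> (1 / 2)\<^sup>2" by (intro power_mono) auto
        then show ?thesis by (simp add: indicator_def power2_eq_square)
      next
        case False
        then show ?thesis using one_minus_norm_moebius_nonneg[OF F1[OF a] w] by simp
      qed
    qed
    then have "(\<Sum>a\<in>F. indicat_real (?P (1 / 2) a) w) \<le> 4 / 3 * M"
      using M[OF w] unfolding sum_distrib_right[symmetric] by linarith
    then show "(\<Sum>a\<in>F. indicat_real (?P (1 / 2) a) w) * ?g w \<le> 4 / 3 * M * ?g w"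
      by (rule mult_right_mono) simp
  qed simp_all
  also have "\<dots> = (16 / 3 * M * \<eta>\<^sup>2) * (norm g)\<^sup>2"
    by (simp add: norm_bergman_square)
  also have "\<dots> \<le> 1 / 2 * (norm g)\<^sup>2"
    using \<eta>(3) by (rule mult_right_mono) simp
  finally have half: "(\<Sum>a\<in>F. \<integral>w. indicat_real (?P \<eta> a) w * ?g w \<partial>dA) \<le> 1 / 2 * (norm g)\<^sup>2" .
  have "?s * (norm g)\<^sup>2 - ?s * (\<Sum>a\<in>F. \<integral>w. indicat_real (?P \<eta> a) w * ?g w \<partial>dA)
      = (\<integral>w. ?s * ?g w - ?s * ((\<Sum>a\<in>F. indicat_real (?P \<eta> a) w) * ?g w) \<partial>dA)"
    unfolding norm_bergman_square sum_distrib_right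
    using ii Rep_bergman_integrable[of g] by simp
  also have "\<dots> \<le> (\<integral>w. (cmod (blaschke F w))\<^sup>2 * ?g w \<partial>dA)"
  proof (intro integral_mono)
    show "integrable dA (\<lambda>w. ?s * ?g w - ?s * ((\<Sum>a\<in>F. indicat_real (?P \<eta> a) w) * ?g w))"
      by (intro Bochner_Integration.integrable_diff integrable_mult_right isum Rep_bergman_integrable)
    show "integrable dA (\<lambda>w. (cmod (blaschke F w))\<^sup>2 * ?g w)"
    proof (rule Bochner_Integration.integrable_bound[OF Rep_bergman_integrable[of g]])
      have "(cmod (blaschke F w))\<^sup>2 \<le> 1" if "cmod w < 1" for w
        using norm_blaschke_le_1[OF F disk that] by (simp add: power_le_one)
      then show "AE w in dA. norm ((cmod (blaschke F w))\<^sup>2 * ?g w) \<le> norm (?g w)"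
        by (intro AE_I2) (auto simp: abs_mult mult_left_le_one_le)
    qed measurable
    fix w assume "w \<in> space dA"
    then have w: "cmod w < 1" by simp
    \<comment> \<open>Inside at least one ball the left side is nonpositive, however many overlap;
      outside all of them it is the pointwise bound of \<open>norm_blaschke_ge\<close>.\<close>
    have "?s * (1 - (\<Sum>a\<in>F. indicat_real (?P \<eta> a) w)) \<le> (cmod (blaschke F w))\<^sup>2"
    proof (cases "\<exists>a\<in>F. w \<in> ?P \<eta> a")
      case True
      then obtain a where a: "a \<in> F" "w \<in> ?P \<eta> a" by blast
      have "1 = indicat_real (?P \<eta> a) w" using a by simp
      also have "\<dots> \<le> (\<Sum>a\<in>F. indicat_real (?P \<eta> a) w)"
        by (rule member_le_sum[OF a(1) _ F]) simp
      finally have "?s * (1 - (\<Sum>a\<in>F. indicat_real (?P \<eta> a) w)) \<le> 0"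
        by (intro mult_nonneg_nonpos) auto
      then show ?thesis by (rule order_trans) simp
    next
      case False
      then have "(\<Sum>a\<in>F. indicat_real (?P \<eta> a) w) = 0" by (intro sum.neutral) auto
      moreover have "?s \<le> (cmod (blaschke F w))\<^sup>2"
        using False w by (intro norm_blaschke_ge[OF F disk w M[OF w] \<eta>(1)]) (auto simp: not_less)
      ultimately show ?thesis by simp
    qed
    then have "?s * (1 - (\<Sum>a\<in>F. indicat_real (?P \<eta> a) w)) * ?g w \<le> (cmod (blaschke F w))\<^sup>2 * ?g w"
      by (rule mult_right_mono) simp
    then show "?s * ?g w - ?s * ((\<Sum>a\<in>F. indicat_real (?P \<eta> a) w) * ?g w) \<le> (cmod (blaschke F w))\<^sup>2 * ?g w"
      by (simp add: algebra_simps)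
  qed
  finally have "?s * (norm g)\<^sup>2 - ?s * (\<Sum>a\<in>F. \<integral>w. indicat_real (?P \<eta> a) w * ?g w \<partial>dA)
      \<le> (\<integral>w. (cmod (blaschke F w))\<^sup>2 * ?g w \<partial>dA)" .
  moreover have "?s * (\<Sum>a\<in>F. \<integral>w. indicat_real (?P \<eta> a) w * ?g w \<partial>dA) \<le> ?s * (1 / 2 * (norm g)\<^sup>2)"
    by (intro mult_left_mono half) simp
  ultimately show ?thesis by linarith
qed

text \<open>Infinite Blaschke products, obtained as Montel limits of the finite ones.\<close>

lemma blaschke_limit:
  assumes C: "carleson_bound M Y" and \<eta>: "0 < \<eta>" "\<eta> \<le> 1 / 2" "16 / 3 * M * \<eta>\<^sup>2 \<le> 1 / 2"
  shows "\<exists>B\<in>H_infinity. (\<forall>w. cmod w < 1 \<longrightarrow> cmod (B w) \<le> 1) \<and>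
    (\<forall>a\<in>Y. \<forall>w. cmod w < 1 \<longrightarrow> cmod (B w) \<le> cmod (moebius a w)) \<and>
    (\<forall>w. cmod w < 1 \<longrightarrow> (\<forall>a\<in>Y. \<eta> \<le> cmod (moebius a w)) \<longrightarrow> exp (- M / \<eta>\<^sup>2) \<le> (cmod (B w))\<^sup>2) \<and>
    (\<forall>g. exp (- M / \<eta>\<^sup>2) / 2 * (norm g)\<^sup>2 \<le> (\<integral>w. (cmod (B w))\<^sup>2 * (cmod (Rep_bergman g w))\<^sup>2 \<partial>dA))"
proof -
  have Y: "Y \<subseteq> unit_disk" using C by (simp add: carleson_bound_def)
  \<comment> \<open>A finite exhaustion of \<open>Y\<close>; the intersection with \<open>Y\<close>
    discards the arbitrary value of \<open>from_nat_into\<close> when \<open>Y\<close> is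
    empty.\<close>
  define F where "F n = Y \<inter> from_nat_into Y ` {..n}" for n
  have F: "finite (F n)" "F n \<subseteq> unit_disk" "carleson_bound M (F n)" for n
    using Y carleson_bound_subset[OF C, of "F n"] by (auto simp: F_def)
  have FY: "F n \<subseteq> Y" for n by (auto simp: F_def)
  have mem: "\<exists>N. \<forall>n\<ge>N. a \<in> F n" if a: "a \<in> Y" for a
  proof -
    obtain N where "from_nat_into Y N = a"
      using from_nat_into_surj[OF carleson_bound_countable[OF C] a] by blast
    then show ?thesis using a by (intro exI[of _ N]) (auto simp: F_def)
  qed
  obtain B r where B: "B holomorphic_on unit_disk" "strict_mono (r :: nat \<Rightarrow> nat)"
    "\<And>w. cmod w < 1 \<Longrightarrow> (\<lambda>n. blaschke (F (r n)) w) \<longlonglongrightarrow> B w" "\<And>w. cmod w < 1 \<Longrightarrow> cmod (B w) \<le> 1"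
    using montel_bounded[of "\<lambda>n. blaschke (F n)" 1, OF blaschke_holomorphic[OF F(1,2)] norm_blaschke_le_1[OF F(1,2)]]
    by blast
  have lim: "(\<lambda>n. (cmod (blaschke (F (r n)) w))\<^sup>2) \<longlonglongrightarrow> (cmod (B w))\<^sup>2" if "cmod w < 1" for w
    by (intro tendsto_intros B that)
  show ?thesis
  proof (rule bexI[of _ B], intro conjI allI ballI impI)
    show "B \<in> H_infinity" by (rule H_infinityI[OF B(1,4)])
    show "cmod (B w) \<le> 1" if "cmod w < 1" for w by (rule B(4)[OF that])
    show "cmod (B w) \<le> cmod (moebius a w)" if a: "a \<in> Y" and w: "cmod w < 1" for a w
    proof (rule LIMSEQ_le_const2[OF tendsto_norm[OF B(3)[OF w]]])
      obtain N where N: "\<And>n. n \<ge> N \<Longrightarrow> a \<in> F n" using mem[OF a] by blast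
      have "cmod (blaschke (F (r n)) w) \<le> cmod (moebius a w)" if "n \<ge> N" for n
        using order_trans[OF that seq_suble[OF B(2)]] by (intro norm_blaschke_le[OF F(1,2) N w])
      then show "\<exists>N. \<forall>n\<ge>N. cmod (blaschke (F (r n)) w) \<le> cmod (moebius a w)" by blast
    qed
    show "exp (- M / \<eta>\<^sup>2) \<le> (cmod (B w))\<^sup>2" if w: "cmod w < 1" and far: "\<forall>a\<in>Y. \<eta> \<le> cmod (moebius a w)" for w
    proof (rule LIMSEQ_le_const[OF lim[OF w]])
      have "exp (- M / \<eta>\<^sup>2) \<le> (cmod (blaschke (F (r n)) w))\<^sup>2" for n
      proof (rule norm_blaschke_ge[OF F(1,2) w _ \<eta>(1)])
        show "(\<Sum>a\<in>F (r n). 1 - (cmod (moebius a w))\<^sup>2) \<le> M"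
          using F(1,3)[of "r n"] w by (simp add: carleson_bound_def)
        show "\<And>a. a \<in> F (r n) \<Longrightarrow> \<eta> \<le> cmod (moebius a w)" using far FY by blast
      qed
      then show "\<exists>N. \<forall>n\<ge>N. exp (- M / \<eta>\<^sup>2) \<le> (cmod (blaschke (F (r n)) w))\<^sup>2" by blast
    qed
    fix g
    have m: "blaschke (F n) \<in> borel_measurable dA" "B \<in> borel_measurable dA" for n
      by (intro holomorphic_measurable_dA blaschke_holomorphic F B)+
    note [measurable] = m
    have "(\<lambda>n. \<integral>w. (cmod (blaschke (F (r n)) w))\<^sup>2 * (cmod (Rep_bergman g w))\<^sup>2 \<partial>dA)
        \<longlonglongrightarrow> (\<integral>w. (cmod (B w))\<^sup>2 * (cmod (Rep_bergman g w))\<^sup>2 \<partial>dA)"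
    proof (rule integral_dominated_convergence[where w = "\<lambda>w. (cmod (Rep_bergman g w))\<^sup>2"])
      show "AE w in dA. (\<lambda>n. (cmod (blaschke (F (r n)) w))\<^sup>2 * (cmod (Rep_bergman g w))\<^sup>2)
          \<longlonglongrightarrow> (cmod (B w))\<^sup>2 * (cmod (Rep_bergman g w))\<^sup>2"
        by (intro AE_I2 tendsto_mult tendsto_const lim) simp
      have "(cmod (blaschke (F n) w))\<^sup>2 \<le> 1" if "cmod w < 1" for w n
        using norm_blaschke_le_1[OF F(1,2) that] by (simp add: power_le_one)
      then show "AE w in dA. norm ((cmod (blaschke (F (r n)) w))\<^sup>2 * (cmod (Rep_bergman g w))\<^sup>2) \<le> (cmod (Rep_bergman g w))\<^sup>2" for n
        by (intro AE_I2) (auto simp: abs_mult mult_left_le_one_le)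
    qed (auto intro: Rep_bergman_integrable)
    then show "exp (- M / \<eta>\<^sup>2) / 2 * (norm g)\<^sup>2 \<le> (\<integral>w. (cmod (B w))\<^sup>2 * (cmod (Rep_bergman g w))\<^sup>2 \<partial>dA)"
      by (rule LIMSEQ_le_const) (use norm_blaschke_mult_ge[OF F(1,3) \<eta>] in blast)
  qed
qed

section \<open>Separated sets, nets and the ideal\<close>

lemma maximal_separated_subset:
  fixes \<rho> :: "'a \<Rightarrow> 'a \<Rightarrow> real"
  assumes sym: "\<And>a b. \<rho> a b = \<rho> b a"
  obtains Z where "Z \<subseteq> E" "\<And>a b. a \<in> Z \<Longrightarrow> b \<in> Z \<Longrightarrow> a \<noteq> b \<Longrightarrow> r \<le> \<rho> a b"
    "\<And>w. w \<in> E \<Longrightarrow> w \<in> Z \<or> (\<exists>a\<in>Z. \<rho> a w < r)"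
proof -
  let ?A = "{Z. Z \<subseteq> E \<and> (\<forall>a\<in>Z. \<forall>b\<in>Z. a \<noteq> b \<longrightarrow> r \<le> \<rho> a b)}"
  have "\<exists>Z\<in>?A. \<forall>X\<in>?A. Z \<subseteq> X \<longrightarrow> X = Z"
  proof (rule subset_Zorn')
    fix C assume "subset.chain ?A C"
    then have CA: "C \<subseteq> ?A" and tot: "\<forall>X\<in>C. \<forall>Y\<in>C. X \<subseteq> Y \<or> Y \<subseteq> X"
      unfolding subset_chain_def by (rule conjunct1, rule conjunct2)
    have sep: "\<And>X a b. X \<in> C \<Longrightarrow> a \<in> X \<Longrightarrow> b \<in> X \<Longrightarrow> a \<noteq> b \<Longrightarrow> r \<le> \<rho> a b"
      using CA by auto
    show "\<Union>C \<in> ?A"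
    proof (intro CollectI conjI ballI impI)
      show "\<Union>C \<subseteq> E" using CA by (intro Union_least) auto
      fix a b assume "a \<in> \<Union>C" "b \<in> \<Union>C" and ne: "a \<noteq> b"
      then obtain X Y where X: "X \<in> C" "a \<in> X" and Y: "Y \<in> C" "b \<in> Y" by (elim UnionE)
      consider "X \<subseteq> Y" | "Y \<subseteq> X" using bspec[OF bspec[OF tot X(1)] Y(1)] by (elim disjE)
      then show "r \<le> \<rho> a b"
      proof cases
        case 1 then show ?thesis by (intro sep[OF Y(1) subsetD[OF 1 X(2)] Y(2) ne])
      next
        case 2 then show ?thesis by (intro sep[OF X(1) X(2) subsetD[OF 2 Y(2)] ne])
      qed
    qed
  qed
  then obtain Z where Z: "Z \<in> ?A" and max: "\<forall>X\<in>?A. Z \<subseteq> X \<longrightarrow> X = Z" by (elim bexE)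
  have "w \<in> Z \<or> (\<exists>a\<in>Z. \<rho> a w < r)" if w: "w \<in> E" for w
  proof (rule ccontr)
    assume "\<not> ?thesis"
    then have nw: "w \<notin> Z" and far: "\<And>a. a \<in> Z \<Longrightarrow> r \<le> \<rho> a w" by force+
    have "insert w Z \<in> ?A"
      using Z w far sym by auto
    with max have "Z \<subseteq> insert w Z \<longrightarrow> insert w Z = Z" by (rule bspec)
    then have "insert w Z = Z" using subset_insertI by (rule mp)
    then show False using nw by blast
  qed
  then show ?thesis using Z by (intro that[of Z]) auto
qed

lemma pseudohyperbolic_net:
  assumes "0 < e"
  obtains N where "finite N" "\<And>x. x \<in> N \<Longrightarrow> cmod x \<le> 1 / 2"
    "\<And>y. cmod y \<le> 1 / 2 \<Longrightarrow> \<exists>x\<in>N. cmod (moebius x y) < e"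
proof -
  \<comment> \<open>For points of modulus at most \<open>1 / 2\<close> the denominator of
    \<open>moebius\<close> is at least \<open>1 - 1 / 4\<close>, so a Euclidean net of mesh
    \<open>e * (3 / 4)\<close> is pseudohyperbolically fine enough.\<close>
  have e: "0 < e * (3 / 4)" using assms by simp
  obtain N where N: "finite N" "N \<subseteq> cball 0 (1 / 2)" "cball (0::complex) (1 / 2) \<subseteq> (\<Union>x\<in>N. ball x (e * (3 / 4)))"
    using seq_compact_imp_totally_bounded[OF compact_imp_seq_compact[OF compact_cball[of "0::complex" "1 / 2"]]] e
    by (elim allE[of _ "e * (3 / 4)"] impE exE conjE)
  show ?thesis
  proof (rule that[OF N(1)])
    show "cmod x \<le> 1 / 2" if "x \<in> N" for x using N(2) that by auto
    show "\<exists>x\<in>N. cmod (moebius x y) < e" if y: "cmod y \<le> 1 / 2" for y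
    proof -
      obtain x where x: "x \<in> N" "cmod (x - y) < e * (3 / 4)"
        using subsetD[OF N(3), of y] y by (auto simp: dist_norm)
      have "cmod x \<le> 1 / 2" using N(2) x(1) by auto
      then have "cmod (cnj x * y) \<le> 1 / 2 * (1 / 2)"
        unfolding norm_mult complex_mod_cnj using y by (intro mult_mono) auto
      then have d: "3 / 4 \<le> cmod (1 - cnj x * y)"
        using norm_triangle_ineq2[of 1 "cnj x * y"] by simp
      have "cmod (moebius x y) = cmod (x - y) / cmod (1 - cnj x * y)" by (simp add: moebius_def norm_divide)
      also have "\<dots> \<le> cmod (x - y) / (3 / 4)" using d by (intro divide_left_mono) (auto intro: mult_pos_pos)
      also have "\<dots> < e" using x(2) by simp
      finally show ?thesis using x(1) by blast
    qed
  qed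
qed

lemma complex_bounded_net:
  assumes "0 < e"
  obtains N where "finite N" "\<And>y. cmod y \<le> L \<Longrightarrow> \<exists>x\<in>N. cmod (y - x) < e"
proof -
  obtain N where N: "finite N" "cball (0::complex) L \<subseteq> (\<Union>x\<in>N. ball x e)"
    using seq_compact_imp_totally_bounded[OF compact_imp_seq_compact[OF compact_cball[of "0::complex" L]]] assms
    by (elim allE[of _ e] impE exE conjE)
  show ?thesis
  proof (rule that[OF N(1)])
    fix y :: complex assume "cmod y \<le> L"
    then obtain x where "x \<in> N" "cmod (x - y) < e" using subsetD[OF N(2), of y] by (auto simp: dist_norm)
    then show "\<exists>x\<in>N. cmod (y - x) < e" by (auto simp: norm_minus_commute)
  qed
qed

text \<open>Each point is moved by a pseudohyperbolic distance of at most \<open>1 / 2\<close>, in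
  the coordinate centered at that point. By the comparison at bounded distance each term changes at
  most by \<open>16 / 3\<close>, the reciprocal of \<open>(1 - (1 / 2)\<^sup>2) / 4\<close>.\<close>

lemma carleson_bound_translate:
  assumes Z: "carleson_bound M Z" and x: "cmod x \<le> 1 / 2"
  shows "carleson_bound (16 / 3 * M) ((\<lambda>a. moebius a x) ` Z)"
  unfolding carleson_bound_def
proof (intro conjI allI impI)
  have x1: "cmod x < 1" using x by simp
  have Z1: "cmod a < 1" if "a \<in> Z" for a using Z that by (auto simp: carleson_bound_def)
  show "(\<lambda>a. moebius a x) ` Z \<subseteq> unit_disk"
    using moebius_in_disk[OF Z1 x1] by auto
  fix F and z :: complex assume F: "finite F" "F \<subseteq> (\<lambda>a. moebius a x) ` Z" and z: "cmod z < 1"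
  \<comment> \<open>Different points of \<open>Z\<close> may be moved to the same place, so one
    preimage is chosen for each point of \<open>F\<close>.\<close>
  obtain G where G': "G \<subseteq> Z" "inj_on (\<lambda>a. moebius a x) G" "F = (\<lambda>a. moebius a x) ` G"
    using iffD1[OF subset_image_inj F(2)] by (elim exE conjE)
  then have G: "G \<subseteq> Z" "finite G" "F = (\<lambda>a. moebius a x) ` G" "inj_on (\<lambda>a. moebius a x) G"
    using F(1) finite_imageD[OF _ G'(2)] by simp_all
  have "(\<Sum>b\<in>F. 1 - (cmod (moebius b z))\<^sup>2) = (\<Sum>a\<in>G. 1 - (cmod (moebius (moebius a x) z))\<^sup>2)"
    unfolding G(3) by (rule sum.reindex_cong[OF G(4) refl refl])
  also have "\<dots> \<le> (\<Sum>a\<in>G. 16 / 3 * (1 - (cmod (moebius a z))\<^sup>2))"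
  proof (rule sum_mono)
    fix a assume "a \<in> G"
    then have a: "cmod a < 1" using G(1) Z1 by blast
    let ?y = "moebius a x"
    have y: "cmod ?y < 1" by (rule moebius_in_disk[OF a x1])
    have "cmod (moebius ?y a) \<le> 1 / 2"
      using x by (simp add: norm_moebius_commute[of ?y a] moebius_moebius[OF a x1])
    from one_minus_norm_moebius_near[OF z y a this]
    have "(1 - (cmod (moebius z ?y))\<^sup>2) * (3 / 16) \<le> 1 - (cmod (moebius z a))\<^sup>2"
      by (simp add: power2_eq_square)
    then show "1 - (cmod (moebius ?y z))\<^sup>2 \<le> 16 / 3 * (1 - (cmod (moebius a z))\<^sup>2)"
      by (simp add: norm_moebius_commute[of _ z])
  qed
  also have "\<dots> = 16 / 3 * (\<Sum>a\<in>G. 1 - (cmod (moebius a z))\<^sup>2)" by (rule sum_distrib_left[symmetric])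
  also have "\<dots> \<le> 16 / 3 * M"
    using Z G z unfolding carleson_bound_def by (intro mult_left_mono) auto
  finally show "(\<Sum>b\<in>F. 1 - (cmod (moebius b z))\<^sup>2) \<le> 16 / 3 * M" .
qed

lemma toeplitz_ideal_mult:
  assumes u: "good_symbol u" and x: "bounded_symbol x" "toeplitz x \<in> toeplitz_ideal"
  shows "toeplitz (\<lambda>w. u w * x w) \<in> toeplitz_ideal"
proof -
  have xT: "toeplitz x \<in> toeplitz_algebra" using x(2) toeplitz_ideal_subset by blast
  have "toeplitz (\<lambda>w. u w * x w) - (toeplitz u o\<^sub>L toeplitz x) + (toeplitz u o\<^sub>L toeplitz x) \<in> toeplitz_ideal"
    by (intro toeplitz_ideal_add good_symbol_mult_ideal u x xT toeplitz_ideal_compose_left good_symbol_toeplitz)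
  then show ?thesis by simp
qed

lemma toeplitz_ideal_sum:
  assumes "finite I" "\<And>i. i \<in> I \<Longrightarrow> bounded_symbol (x i)" "\<And>i. i \<in> I \<Longrightarrow> toeplitz (x i) \<in> toeplitz_ideal"
  shows "bounded_symbol (\<lambda>w. \<Sum>i\<in>I. x i w) \<and> toeplitz (\<lambda>w. \<Sum>i\<in>I. x i w) \<in> toeplitz_ideal"
  using assms
proof (induction I rule: finite_induct)
  case empty
  have "toeplitz (\<lambda>w. 0) = 0"
    using toeplitz_diff[OF bounded_symbol_const bounded_symbol_const, of 0 0] by simp
  then show ?case by (simp add: toeplitz_ideal_zero bounded_symbol_const)
next
  case (insert i I)
  then have b: "bounded_symbol (x i)" "bounded_symbol (\<lambda>w. \<Sum>i\<in>I. x i w)"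
    and t: "toeplitz (x i) \<in> toeplitz_ideal" "toeplitz (\<lambda>w. \<Sum>i\<in>I. x i w) \<in> toeplitz_ideal" by auto
  show ?case
    using toeplitz_ideal_add[OF t] bounded_symbol_add[OF b] insert.hyps by (simp add: toeplitz_add[OF b])
qed

text \<open>
  The symbol is approximated by a weighted average of its values near the points of finitely many
  sequences, the weights being functions of \<open>|B|\<^sup>2\<close> for the corresponding Blaschke products \<open>B\<close>.
\<close>

lemma toeplitz_in_ideal_of_small:
  assumes u: "bounded_symbol u" and L: "0 \<le> L" "\<And>w. cmod w < 1 \<Longrightarrow> cmod (u w) \<le> L"
    "\<And>z w. cmod z < 1 \<Longrightarrow> cmod w < 1 \<Longrightarrow> cmod (u z - u w) \<le> L * cmod (moebius z w)"
    and f: "f \<in> H_infinity"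
    and small: "\<And>e. 0 < e \<Longrightarrow> \<exists>d>0. \<forall>z. cmod z < 1 \<longrightarrow> energy f z < ennreal d \<longrightarrow> cmod (u z) < e"
  shows "toeplitz u \<in> toeplitz_ideal"
proof (rule closed_approximableI[OF closed_toeplitz_ideal])
  fix e0 :: real assume e0: "0 < e0"
  \<comment> \<open>The worst case is a point of small energy with total weight below
    \<open>1 / 2\<close>: there \<open>u\<close> contributes \<open>e\<close> and the average up to
    \<open>3 * e\<close>.\<close>
  define e where "e = e0 / 4"
  have e: "0 < e" using e0 by (simp add: e_def)
  obtain d where d0: "0 < d" "\<forall>z. cmod z < 1 \<longrightarrow> energy f z < ennreal d \<longrightarrow> cmod (u z) < e"
    using small[OF e] by (elim exE conjE)
  note d = d0(1) d0(2)[rule_format]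
  obtain K where K: "\<And>w. cmod w < 1 \<Longrightarrow> cmod (f w) \<le> K"
    using bounded_symbol_bound[OF bounded_symbol_holomorphic[OF f]] by blast
  let ?E = "{z. cmod z < 1 \<and> ennreal d \<le> energy f z}"
  obtain Z where Z: "Z \<subseteq> ?E" "\<And>a b. a \<in> Z \<Longrightarrow> b \<in> Z \<Longrightarrow> a \<noteq> b \<Longrightarrow> 1 / 2 \<le> cmod (moebius a b)"
    "\<And>w. w \<in> ?E \<Longrightarrow> w \<in> Z \<or> (\<exists>a\<in>Z. cmod (moebius a w) < 1 / 2)"
    by (rule maximal_separated_subset[of "\<lambda>a b. cmod (moebius a b)" ?E "1 / 2", OF norm_moebius_commute]) (rule that)
  have Z1: "cmod a < 1" if "a \<in> Z" for a using Z(1) that by blast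
  define M where "M = 16 / 3 * (64 / 15 * K\<^sup>2 / d)"
  have M0: "0 \<le> M" using d by (simp add: M_def)
  have cZ: "carleson_bound (64 / 15 * K\<^sup>2 / d) Z"
    using Z by (intro carleson_bound_energy[OF H_infinity_holomorphic[OF f] K d(1)]) auto
  \<comment> \<open>The bound \<open>e / (L + 1)\<close> lets \<open>u\<close> change by at most
    \<open>e\<close> within distance \<open>\<eta>\<close>; the bound with \<open>M\<close> makes
    the mass near the zeros at most one half in \<open>blaschke_limit\<close>.\<close>
  define \<eta> where "\<eta> = min (1 / 4) (min (e / (L + 1)) (1 / (16 * (M + 1))))"
  have \<eta>: "0 < \<eta>" "\<eta> \<le> 1 / 2" "L * \<eta> \<le> e" "16 / 3 * M * \<eta>\<^sup>2 \<le> 1 / 2"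
  proof -
    show p: "0 < \<eta>" using e L(1) M0 by (simp add: \<eta>_def)
    show "\<eta> \<le> 1 / 2" by (simp add: \<eta>_def)
    have "L * \<eta> \<le> (L + 1) * (e / (L + 1))" using L(1) p by (intro mult_mono) (auto simp: \<eta>_def)
    then show "L * \<eta> \<le> e" using L(1) by simp
    have "\<eta>\<^sup>2 \<le> \<eta> * 1" unfolding power2_eq_square using p by (intro mult_left_mono) (auto simp: \<eta>_def)
    also have "\<dots> \<le> 1 / (16 * (M + 1))" by (simp add: \<eta>_def)
    finally have "16 / 3 * M * \<eta>\<^sup>2 \<le> 16 / 3 * M * (1 / (16 * (M + 1)))" using M0 by (intro mult_left_mono) auto
    also have "\<dots> \<le> 1 / 2" using M0 by (simp add: field_simps)
    finally show "16 / 3 * M * \<eta>\<^sup>2 \<le> 1 / 2" .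
  qed
  define s where "s = exp (- M / \<eta>\<^sup>2)"
  have s: "0 < s" "s \<le> 1" using M0 by (auto simp: s_def)
  define c where "c = s / 2"
  have c: "0 < c" "c \<le> 1" using s by (auto simp: c_def)
  \<comment> \<open>Within this distance of a zero \<open>|B|\<^sup>2\<close> is at most
    \<open>c / 4\<close>, where the cutoff \<open>\<beta>\<close> below is at least
    \<open>1 / 2\<close>.\<close>
  define e' where "e' = sqrt c / 2"
  have e': "0 < e'" "e'\<^sup>2 = c / 4" using c by (auto simp: e'_def power_divide)
  obtain N where N: "finite N" "\<And>x. x \<in> N \<Longrightarrow> cmod x \<le> 1 / 2"
    "\<And>y. cmod y \<le> 1 / 2 \<Longrightarrow> \<exists>x\<in>N. cmod (moebius x y) < e'"
    by (rule pseudohyperbolic_net[OF e'(1)]) (rule that)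
  obtain V where V: "finite V" "\<And>y. cmod y \<le> L \<Longrightarrow> \<exists>x\<in>V. cmod (y - x) < e"
    by (rule complex_bounded_net[OF e, of L]) (rule that)
  \<comment> \<open>Points of \<open>?E\<close> are only within \<open>1 / 2\<close> of
    \<open>Z\<close>. Moving every point of \<open>Z\<close> by each \<open>fst i\<close> of a net
    of that ball brings some moved point within \<open>e'\<close>. Sorting by the value
    \<open>snd i\<close> makes \<open>u\<close> nearly constant on each resulting zero set, so that
    a single number can multiply its weight.\<close>
  define Y where "Y i = {moebius a (fst i) |a. a \<in> Z \<and> cmod (u (moebius a (fst i)) - snd i) < e}" for i
  let ?I = "N \<times> V"
  have cY: "carleson_bound M (Y i)" if "i \<in> ?I" for i
  proof -
    have "cmod (fst i) \<le> 1 / 2" using N(2) that by auto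
    from carleson_bound_translate[OF cZ this] show ?thesis
      unfolding M_def by (rule carleson_bound_subset) (auto simp: Y_def)
  qed
  have "\<forall>i\<in>?I. \<exists>B. B \<in> H_infinity \<and> (\<forall>w. cmod w < 1 \<longrightarrow> cmod (B w) \<le> 1) \<and>
    (\<forall>a\<in>Y i. \<forall>w. cmod w < 1 \<longrightarrow> cmod (B w) \<le> cmod (moebius a w)) \<and>
    (\<forall>w. cmod w < 1 \<longrightarrow> (\<forall>a\<in>Y i. \<eta> \<le> cmod (moebius a w)) \<longrightarrow> s \<le> (cmod (B w))\<^sup>2) \<and>
    (\<forall>g. c * (norm g)\<^sup>2 \<le> (\<integral>w. (cmod (B w))\<^sup>2 * (cmod (Rep_bergman g w))\<^sup>2 \<partial>dA))"
  proof
    fix i assume "i \<in> ?I"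
    from blaschke_limit[OF cY[OF this] \<eta>(1,2,4)]
    show "\<exists>B. B \<in> H_infinity \<and> (\<forall>w. cmod w < 1 \<longrightarrow> cmod (B w) \<le> 1) \<and>
      (\<forall>a\<in>Y i. \<forall>w. cmod w < 1 \<longrightarrow> cmod (B w) \<le> cmod (moebius a w)) \<and>
      (\<forall>w. cmod w < 1 \<longrightarrow> (\<forall>a\<in>Y i. \<eta> \<le> cmod (moebius a w)) \<longrightarrow> s \<le> (cmod (B w))\<^sup>2) \<and>
      (\<forall>g. c * (norm g)\<^sup>2 \<le> (\<integral>w. (cmod (B w))\<^sup>2 * (cmod (Rep_bergman g w))\<^sup>2 \<partial>dA))"
      unfolding s_def c_def Bex_def .
  qed
  then obtain B where "\<forall>i\<in>?I. B i \<in> H_infinity \<and> (\<forall>w. cmod w < 1 \<longrightarrow> cmod (B i w) \<le> 1) \<and>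
    (\<forall>a\<in>Y i. \<forall>w. cmod w < 1 \<longrightarrow> cmod (B i w) \<le> cmod (moebius a w)) \<and>
    (\<forall>w. cmod w < 1 \<longrightarrow> (\<forall>a\<in>Y i. \<eta> \<le> cmod (moebius a w)) \<longrightarrow> s \<le> (cmod (B i w))\<^sup>2) \<and>
    (\<forall>g. c * (norm g)\<^sup>2 \<le> (\<integral>w. (cmod (B i w))\<^sup>2 * (cmod (Rep_bergman g w))\<^sup>2 \<partial>dA))"
    unfolding bchoice_iff by (elim exE)
  note B = this[THEN bspec]
  have B1: "B i \<in> H_infinity" "\<And>w. cmod w < 1 \<Longrightarrow> cmod (B i w) \<le> 1"
    "\<And>a w. a \<in> Y i \<Longrightarrow> cmod w < 1 \<Longrightarrow> cmod (B i w) \<le> cmod (moebius a w)"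
    "\<And>w. cmod w < 1 \<Longrightarrow> (\<And>a. a \<in> Y i \<Longrightarrow> \<eta> \<le> cmod (moebius a w)) \<Longrightarrow> s \<le> (cmod (B i w))\<^sup>2"
    "\<And>g. c * (norm g)\<^sup>2 \<le> (\<integral>w. (cmod (B i w))\<^sup>2 * (cmod (Rep_bergman g w))\<^sup>2 \<partial>dA)" if "i \<in> ?I" for i
    using B[OF that] by simp_all
  define \<beta> where "\<beta> t = max 0 (1 - 2 * t / c)" for t :: real
  have \<beta>: "continuous_on {0..1} \<beta>" "\<And>t. c / 2 \<le> t \<Longrightarrow> t \<le> 1 \<Longrightarrow> \<beta> t = 0"
  proof -
    show "continuous_on {0..1} \<beta>" unfolding \<beta>_def using c by (intro continuous_intros) auto
    show "\<beta> t = 0" if "c / 2 \<le> t" for t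
    proof -
      have "1 - 2 * t / c \<le> 0" using that c by (simp add: field_simps)
      then show ?thesis unfolding \<beta>_def by (rule max_absorb1)
    qed
  qed
  define x where "x i w = \<beta> ((cmod (B i w))\<^sup>2)" for i w
  have xt: "toeplitz (\<lambda>w. complex_of_real (x i w)) \<in> toeplitz_ideal"
    and xg: "good_symbol (\<lambda>w. complex_of_real (x i w))" if "i \<in> ?I" for i
    unfolding x_def
    using toeplitz_localized_in_ideal[OF B1(1,2)[OF that] c B1(5)[OF that] \<beta>] by simp_all
  have x01: "0 \<le> x i w" "x i w \<le> 1" for i w
    using c by (auto simp: x_def \<beta>_def)
  have x_near: "cmod (u w - snd i) \<le> 2 * e" if i: "i \<in> ?I" and w: "cmod w < 1" and pos: "x i w \<noteq> 0" for i w
  proof -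
    \<comment> \<open>A nonzero weight puts \<open>|B|\<^sup>2\<close> below
      \<open>c / 2 < s\<close>, whereas it is at least \<open>s\<close> at distance
      \<open>\<eta>\<close> from all zeros. So \<open>w\<close> is within \<open>\<eta>\<close> of a
      zero, where \<open>u\<close> is close to \<open>snd i\<close>.\<close>
    have "(cmod (B i w))\<^sup>2 < c / 2"
    proof (rule ccontr)
      assume "\<not> ?thesis"
      moreover have "(cmod (B i w))\<^sup>2 \<le> 1" using B1(2)[OF i w] by (simp add: power_le_one)
      ultimately have "x i w = 0" unfolding x_def by (intro \<beta>) auto
      then show False using pos by simp
    qed
    also have "c / 2 < s" using s by (simp add: c_def)
    finally have "\<not> (\<forall>a\<in>Y i. \<eta> \<le> cmod (moebius a w))" using B1(4)[OF i w] by fastforce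
    then obtain y where y: "y \<in> Y i" "cmod (moebius y w) < \<eta>" by (auto simp: not_le)
    then obtain a where a: "a \<in> Z" "y = moebius a (fst i)" "cmod (u y - snd i) < e" by (auto simp: Y_def)
    have "cmod (fst i) < 1" using N(2)[of "fst i"] i by auto
    then have y1: "cmod y < 1" unfolding a(2) by (intro moebius_in_disk Z1[OF a(1)])
    have "cmod (u w - u y) \<le> L * cmod (moebius y w)"
      using L(3)[OF y1 w] by (simp add: norm_minus_commute)
    also have "\<dots> \<le> L * \<eta>" using y(2) L(1) by (intro mult_left_mono) auto
    finally have "cmod (u w - u y) \<le> e" using \<eta>(3) by simp
    then show ?thesis
      using norm_triangle_ineq[of "u w - u y" "u y - snd i"] a(3) by simp
  qed
  have x_large: "\<exists>i\<in>?I. 1 / 2 \<le> x i w" if w: "w \<in> ?E" for w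
  proof -
    have w1: "cmod w < 1" using w by simp
    obtain a where a: "a \<in> Z" "cmod (moebius a w) \<le> 1 / 2"
    proof (cases "w \<in> Z")
      case True
      then show ?thesis by (intro that[of w]) (auto simp: moebius_def)
    next
      case False
      then show ?thesis using Z(3)[OF w] that by (meson less_imp_le)
    qed
    note a1 = Z1[OF a(1)]
    obtain \<zeta> where \<zeta>: "\<zeta> \<in> N" "cmod (moebius \<zeta> (moebius a w)) < e'" using N(3)[OF a(2)] by blast
    have \<zeta>1: "cmod \<zeta> < 1" using N(2)[OF \<zeta>(1)] by simp
    define y where "y = moebius a \<zeta>"
    have y1: "cmod y < 1" unfolding y_def by (rule moebius_in_disk[OF a1 \<zeta>1])
    have "cmod (moebius y w) = cmod (moebius (moebius a y) (moebius a w))"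
      by (rule norm_moebius_moebius[OF a1 y1 w1, symmetric])
    also have "moebius a y = \<zeta>" unfolding y_def by (rule moebius_moebius[OF a1 \<zeta>1])
    finally have yw: "cmod (moebius y w) < e'" using \<zeta>(2) by simp
    obtain v where v: "v \<in> V" "cmod (u y - v) < e" using V(2)[OF L(2)[OF y1]] by blast
    have i: "(\<zeta>, v) \<in> ?I" using \<zeta> v by simp
    have "y \<in> Y (\<zeta>, v)" unfolding Y_def using a(1) v(2) by (auto simp: y_def)
    then have "cmod (B (\<zeta>, v) w) \<le> e'" using B1(3)[OF i _ w1] yw by fastforce
    then have "(cmod (B (\<zeta>, v) w))\<^sup>2 \<le> e'\<^sup>2" by (intro power_mono) auto
    then have "(cmod (B (\<zeta>, v) w))\<^sup>2 \<le> c / 4" using e'(2) by simp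
    then have "1 / 2 \<le> x (\<zeta>, v) w"
      using c unfolding x_def \<beta>_def by (simp add: field_simps)
    then show ?thesis using i by blast
  qed
  have finI: "finite ?I" using N(1) V(1) by simp
  define n where "n w = (\<Sum>i\<in>?I. x i w)" for w
  have n: "n w \<in> {0..real (card ?I)}" for w
    using sum_mono[of ?I "\<lambda>i. x i w" "\<lambda>_. 1"] x01 by (auto simp: n_def sum_nonneg)
  have ng: "good_symbol (\<lambda>w. complex_of_real (n w))"
    unfolding n_def of_real_sum by (intro good_symbol_sum finI xg)
  \<comment> \<open>Where the total weight is at least \<open>1 / 2\<close> this normalizes to a
    genuine average. Below that the point is outside \<open>?E\<close> and \<open>u\<close> is
    small; freezing the denominator keeps \<open>\<gamma>\<close> a continuous function of
    \<open>n\<close>, hence a good symbol.\<close>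
  define \<gamma> where "\<gamma> w = 1 / max (n w) (1 / 2)" for w
  have \<gamma>g: "good_symbol (\<lambda>w. complex_of_real (\<gamma> w))"
    unfolding \<gamma>_def
    by (rule good_symbol_continuous[OF ng n, of "\<lambda>t. 1 / max t (1 / 2)"]) (intro continuous_intros, auto simp: max_def)
  define v where "v i w = complex_of_real (\<gamma> w) * (snd i * complex_of_real (x i w))" for i w
  have vb: "bounded_symbol (v i)" and vt: "toeplitz (v i) \<in> toeplitz_ideal" if "i \<in> ?I" for i
  proof -
    have 1: "toeplitz (\<lambda>w. snd i * complex_of_real (x i w)) \<in> toeplitz_ideal"
      by (rule toeplitz_ideal_mult[OF good_symbol_const good_symbol_bounded[OF xg[OF that]] xt[OF that]])
    have 2: "good_symbol (\<lambda>w. snd i * complex_of_real (x i w))"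
      by (intro good_symbol_mult good_symbol_const xg that)
    show "toeplitz (v i) \<in> toeplitz_ideal"
      unfolding v_def by (rule toeplitz_ideal_mult[OF \<gamma>g good_symbol_bounded[OF 2] 1])
    have "good_symbol (v i)" unfolding v_def by (rule good_symbol_mult[OF \<gamma>g 2])
    then show "bounded_symbol (v i)" by (rule good_symbol_bounded)
  qed
  let ?u = "\<lambda>w. \<Sum>i\<in>?I. v i w"
  have "bounded_symbol ?u \<and> toeplitz ?u \<in> toeplitz_ideal"
    by (rule toeplitz_ideal_sum[OF finI vb vt])
  then have U: "bounded_symbol ?u" "toeplitz ?u \<in> toeplitz_ideal" by (rule conjunct1, rule conjunct2)
  have "cmod (u w - ?u w) \<le> e0" if w: "cmod w < 1" for w
  proof -
    have ueq: "?u w = complex_of_real (\<gamma> w) * (\<Sum>i\<in>?I. snd i * complex_of_real (x i w))"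
      by (simp add: v_def sum_distrib_left)
    have diff: "cmod ((\<Sum>i\<in>?I. snd i * complex_of_real (x i w)) - complex_of_real (n w) * u w) \<le> 2 * e * n w"
    proof -
      have "(\<Sum>i\<in>?I. snd i * complex_of_real (x i w)) - complex_of_real (n w) * u w
          = (\<Sum>i\<in>?I. complex_of_real (x i w) * (snd i - u w))"
        unfolding n_def of_real_sum sum_distrib_right sum_subtractf[symmetric]
        by (intro sum.cong refl) (simp add: algebra_simps)
      also have "cmod \<dots> \<le> (\<Sum>i\<in>?I. cmod (complex_of_real (x i w) * (snd i - u w)))" by (rule norm_sum)
      also have "\<dots> \<le> (\<Sum>i\<in>?I. 2 * e * x i w)"
      proof (rule sum_mono)
        fix i assume i: "i \<in> ?I"
        show "cmod (complex_of_real (x i w) * (snd i - u w)) \<le> 2 * e * x i w"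
        proof (cases "x i w = 0")
          case False
          have "x i w * cmod (snd i - u w) \<le> x i w * (2 * e)"
            using x_near[OF i w False] x01(1)[of i w] by (intro mult_left_mono) (simp_all add: norm_minus_commute)
          then show ?thesis using x01(1)[of i w] by (simp add: norm_mult mult.commute)
        qed simp
      qed
      also have "\<dots> = 2 * e * n w" unfolding n_def by (rule sum_distrib_left[symmetric])
      finally show ?thesis .
    qed
    have n0: "0 \<le> n w" using n[of w] by simp
    show ?thesis
    proof (cases "1 / 2 \<le> n w")
      case True
      then have g: "\<gamma> w = 1 / n w" and n1: "n w \<noteq> 0" by (auto simp: \<gamma>_def)
      have "?u w - u w = complex_of_real (\<gamma> w) * ((\<Sum>i\<in>?I. snd i * complex_of_real (x i w)) - complex_of_real (n w) * u w)"
        unfolding ueq right_diff_distrib using g n1 by simp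
      then have "cmod (?u w - u w) = \<gamma> w * cmod ((\<Sum>i\<in>?I. snd i * complex_of_real (x i w)) - complex_of_real (n w) * u w)"
        using g n0 by (simp add: norm_mult norm_divide)
      also have "\<dots> \<le> \<gamma> w * (2 * e * n w)" using g n0 by (intro mult_left_mono diff) auto
      also have "\<dots> = 2 * e" using g n1 by simp
      finally show ?thesis using e by (simp add: norm_minus_commute e_def)
    next
      case False
      then have g: "\<gamma> w = 2" by (simp add: \<gamma>_def)
      have "w \<notin> ?E"
      proof
        assume "w \<in> ?E"
        then obtain i where i: "i \<in> ?I" "1 / 2 \<le> x i w" using x_large by blast
        have "x i w \<le> n w" unfolding n_def using x01 by (intro member_le_sum[OF i(1) _ finI]) auto
        then show False using i(2) False by simp
      qed
      then have us: "cmod (u w) < e" using d(2)[OF w] w by (auto simp: not_le)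
      have "cmod (\<Sum>i\<in>?I. snd i * complex_of_real (x i w)) \<le> 2 * e * n w + n w * cmod (u w)"
        using diff norm_triangle_ineq2[of "\<Sum>i\<in>?I. snd i * complex_of_real (x i w)" "complex_of_real (n w) * u w"] n0
        by (simp add: norm_mult)
      also have "\<dots> \<le> 2 * e * n w + n w * e" using us n0 by (intro add_left_mono mult_left_mono) auto
      also have "\<dots> = 3 * e * n w" by simp
      also have "\<dots> \<le> 3 * e * (1 / 2)" using False e by (intro mult_left_mono) auto
      finally have "cmod (?u w) \<le> 3 * e" unfolding ueq g by (simp add: norm_mult)
      then show ?thesis using us norm_triangle_ineq4[of "u w" "?u w"] by (simp add: e_def)
    qed
  qed
  then have "norm (toeplitz u - toeplitz ?u) \<le> e0" by (rule norm_toeplitz_diff_le[OF u U(1)])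
  then show "\<exists>y\<in>toeplitz_ideal. norm (toeplitz u - y) \<le> e0" using U(2) by blast
qed

section \<open>Berezin transforms of the commutator ideal\<close>

text \<open>Bounded complex-linear maps of the bounded operators into themselves. The conditions are
  restricted to \<open>bounded_ops\<close>, where \<open>berezin\<close> is known to give a bounded
  symbol.\<close>

definition op_linear :: "((bergman \<Rightarrow>\<^sub>L bergman) \<Rightarrow> (bergman \<Rightarrow>\<^sub>L bergman)) \<Rightarrow> bool"
  where "op_linear L \<longleftrightarrow> L ` bounded_ops \<subseteq> bounded_ops \<and>
    (\<forall>S\<in>bounded_ops. \<forall>R\<in>bounded_ops. L (S + R) = L S + L R) \<and>
    (\<forall>c. \<forall>S\<in>bounded_ops. L (op_scaleC c S) = op_scaleC c (L S)) \<and>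
    (\<exists>k\<ge>0. \<forall>S\<in>bounded_ops. norm (L S) \<le> k * norm S)"

lemma op_linearI:
  assumes "\<And>S. S \<in> bounded_ops \<Longrightarrow> L S \<in> bounded_ops"
    and "\<And>S R. S \<in> bounded_ops \<Longrightarrow> R \<in> bounded_ops \<Longrightarrow> L (S + R) = L S + L R"
    and "\<And>c S. S \<in> bounded_ops \<Longrightarrow> L (op_scaleC c S) = op_scaleC c (L S)"
    and "\<And>S. S \<in> bounded_ops \<Longrightarrow> norm (L S) \<le> k * norm S" "0 \<le> k"
  shows "op_linear L"
  unfolding op_linear_def using assms by (intro conjI ballI allI exI[of _ k] image_subsetI)

lemma
  assumes "op_linear L"
  shows op_linear_bounded_ops: "S \<in> bounded_ops \<Longrightarrow> L S \<in> bounded_ops"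
    and op_linear_add: "S \<in> bounded_ops \<Longrightarrow> R \<in> bounded_ops \<Longrightarrow> L (S + R) = L S + L R"
    and op_linear_scale: "S \<in> bounded_ops \<Longrightarrow> L (op_scaleC c S) = op_scaleC c (L S)"
  using assms by (simp_all add: op_linear_def image_subset_iff)

lemma op_linear_bound:
  assumes "op_linear L"
  obtains k where "0 \<le> k" "\<And>S. S \<in> bounded_ops \<Longrightarrow> norm (L S) \<le> k * norm S"
proof -
  from assms obtain k where "0 \<le> k" "\<forall>S\<in>bounded_ops. norm (L S) \<le> k * norm S"
    unfolding op_linear_def by (elim conjE exE)
  then show ?thesis by (intro that[of k]) simp_all
qed

lemma op_scaleC_zero: "op_scaleC 0 S = 0"
  by (rule blinfun_eqI, rule bergman_eqI) (simp add: op_scaleC_apply Rep_bergman_simps)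

lemma op_scaleC_diff: "op_scaleC c (S - R) = op_scaleC c S - op_scaleC c R"
  by (rule blinfun_eqI) (simp add: op_scaleC_apply blinfun.diff_left scaleC_diff_right)

lemma op_linear_zero: "op_linear L \<Longrightarrow> L 0 = 0"
  using op_linear_scale[of L 0 0] by (simp add: op_scaleC_zero bounded_ops_zero)

lemma op_linear_diff:
  assumes L: "op_linear L" and S: "S \<in> bounded_ops" and R: "R \<in> bounded_ops"
  shows "L (S - R) = L S - L R"
  using op_linear_add[OF L bounded_ops_diff[OF S R] R] by simp

text \<open>The classes of operators used below are cut out of a closed subspace by conditions of
  the form \<open>L i S \<in> K\<close>. This lemma and the next give closedness and linearity for
  all of them; the index set accommodates quantified multipliers.\<close>

lemma closed_op_linear_preimage:
  assumes A: "closed A" "A \<subseteq> bounded_ops" and K: "closed K"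
    and L: "\<And>i. i \<in> I \<Longrightarrow> op_linear (L i)"
  shows "closed {S \<in> A. \<forall>i\<in>I. L i S \<in> K}"
proof -
  have "continuous_on A (L i)" if i: "i \<in> I" for i
  proof -
    obtain k where k: "0 \<le> k" "\<And>S. S \<in> bounded_ops \<Longrightarrow> norm (L i S) \<le> k * norm S"
      by (rule op_linear_bound[OF L[OF i]]) (rule that)
    have "k-lipschitz_on A (L i)"
    proof (rule lipschitz_onI[OF _ k(1)])
      fix S R assume "S \<in> A" "R \<in> A"
      then have SR: "S \<in> bounded_ops" "R \<in> bounded_ops" using A(2) by (simp_all add: subset_iff)
      show "dist (L i S) (L i R) \<le> k * dist S R"
        using k(2)[OF bounded_ops_diff[OF SR]] by (simp add: dist_norm op_linear_diff[OF L[OF i] SR])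
    qed
    then show ?thesis by (rule lipschitz_on_continuous_on)
  qed
  then have "closed (A \<inter> L i -` K)" if "i \<in> I" for i
    using continuous_closed_preimage[OF _ A(1) K] that by simp
  then have "closed (\<Inter>i\<in>I. A \<inter> L i -` K)" by (rule closed_INT[OF ballI])
  then have "closed (A \<inter> (\<Inter>i\<in>I. A \<inter> L i -` K))" by (rule closed_Int[OF A(1)])
  moreover have "A \<inter> (\<Inter>i\<in>I. A \<inter> L i -` K) = {S \<in> A. \<forall>i\<in>I. L i S \<in> K}" by auto
  ultimately show ?thesis by simp
qed

lemma complex_subspace_op_linear_preimage:
  assumes A: "complex_subspace A" "A \<subseteq> bounded_ops" and K: "complex_subspace K"
    and L: "\<And>i. i \<in> I \<Longrightarrow> op_linear (L i)"
  shows "complex_subspace {S \<in> A. \<forall>i\<in>I. L i S \<in> K}"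
proof -
  have A': "S \<in> bounded_ops" if "S \<in> A" for S using that A(2) by (rule subsetD[rotated])
  show ?thesis
    using A(1) K unfolding complex_subspace_def
    by (auto simp: op_linear_zero[OF L] op_linear_add[OF L A' A'] op_linear_scale[OF L A'])
qed

lemma op_linear_id: "op_linear (\<lambda>S. S)"
  by (rule op_linearI[where k = 1]) simp_all

lemma op_linear_compose_left: "R \<in> bounded_ops \<Longrightarrow> op_linear (\<lambda>S. R o\<^sub>L S)"
  by (rule op_linearI[where k = "norm R"])
    (auto intro!: blinfun_eqI simp: bounded_ops_compose blinfun.add_left blinfun.add_right op_scaleC_apply
      bounded_ops_scaleC norm_blinfun_compose)

lemma op_linear_compose_right: "R \<in> bounded_ops \<Longrightarrow> op_linear (\<lambda>S. S o\<^sub>L R)"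
  using norm_blinfun_compose[of _ R]
  by (intro op_linearI[where k = "norm R"])
    (auto intro!: blinfun_eqI simp: bounded_ops_compose blinfun.add_left op_scaleC_apply mult.commute)

lemma op_linear_minus:
  assumes L: "op_linear L" and M: "op_linear M"
  shows "op_linear (\<lambda>S. L S - M S)"
proof -
  obtain k where k: "0 \<le> k" "\<And>S. S \<in> bounded_ops \<Longrightarrow> norm (L S) \<le> k * norm S"
    by (rule op_linear_bound[OF L]) (rule that)
  obtain l where l: "0 \<le> l" "\<And>S. S \<in> bounded_ops \<Longrightarrow> norm (M S) \<le> l * norm S"
    by (rule op_linear_bound[OF M]) (rule that)
  show ?thesis
  proof (rule op_linearI[where k = "k + l"])
    fix S assume S: "S \<in> bounded_ops"
    show "L S - M S \<in> bounded_ops"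
      by (intro bounded_ops_diff op_linear_bounded_ops[OF L] op_linear_bounded_ops[OF M] S)
    show "L (op_scaleC c S) - M (op_scaleC c S) = op_scaleC c (L S - M S)" for c
      by (simp add: op_linear_scale[OF L S] op_linear_scale[OF M S] op_scaleC_diff)
    show "L (S + R) - M (S + R) = (L S - M S) + (L R - M R)" if "R \<in> bounded_ops" for R
      by (simp add: op_linear_add[OF L S that] op_linear_add[OF M S that])
    show "norm (L S - M S) \<le> (k + l) * norm S"
      using norm_triangle_ineq4[of "L S" "M S"] k(2)[OF S] l(2)[OF S] by (simp add: distrib_right)
  qed (use k l in simp)
qed

lemma op_linear_comp:
  assumes L: "op_linear L" and M: "op_linear M"
  shows "op_linear (\<lambda>S. L (M S))"
proof -
  obtain k where k: "0 \<le> k" "\<And>S. S \<in> bounded_ops \<Longrightarrow> norm (L S) \<le> k * norm S"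
    by (rule op_linear_bound[OF L]) (rule that)
  obtain l where l: "0 \<le> l" "\<And>S. S \<in> bounded_ops \<Longrightarrow> norm (M S) \<le> l * norm S"
    by (rule op_linear_bound[OF M]) (rule that)
  note b = op_linear_bounded_ops[OF M]
  show ?thesis
  proof (rule op_linearI[where k = "k * l"])
    fix S assume S: "S \<in> bounded_ops"
    show "L (M S) \<in> bounded_ops" by (intro op_linear_bounded_ops[OF L] b S)
    show "L (M (op_scaleC c S)) = op_scaleC c (L (M S))" for c
      by (simp add: op_linear_scale[OF M S] op_linear_scale[OF L b[OF S]])
    show "L (M (S + R)) = L (M S) + L (M R)" if "R \<in> bounded_ops" for R
      by (simp add: op_linear_add[OF M S that] op_linear_add[OF L b[OF S] b[OF that]])
    have "norm (L (M S)) \<le> k * norm (M S)" by (rule k(2)[OF b[OF S]])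
    also have "\<dots> \<le> k * (l * norm S)" by (intro mult_left_mono l(2) S k)
    finally show "norm (L (M S)) \<le> k * l * norm S" by (simp add: mult.assoc)
  qed (use k l in simp)
qed

lemma op_linear_toeplitz_berezin: "op_linear (\<lambda>S. toeplitz (berezin S))"
proof (rule op_linearI[where k = 1])
  fix S assume S: "S \<in> bounded_ops"
  note b = bounded_symbol_berezin[OF S]
  show "toeplitz (berezin S) \<in> bounded_ops" by (rule toeplitz_bounded_ops[OF b])
  show "toeplitz (berezin (op_scaleC c S)) = op_scaleC c (toeplitz (berezin S))" for c
    unfolding toeplitz_scale[OF b, symmetric] by (rule toeplitz_cong) (rule berezin_op_scaleC)
  show "toeplitz (berezin (S + R)) = toeplitz (berezin S) + toeplitz (berezin R)" if "R \<in> bounded_ops" for R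
    unfolding toeplitz_add[OF b bounded_symbol_berezin[OF that], symmetric]
    by (rule toeplitz_cong) (rule berezin_add)
  show "norm (toeplitz (berezin S)) \<le> 1 * norm S"
    using norm_toeplitz_le[OF b norm_berezin_le] by simp
qed simp

section \<open>From generating commutators to the whole ideal\<close>

lemma toeplitz_berezin_commutator_in_ideal:
  assumes A: "A \<in> toeplitz_algebra" and B: "B \<in> toeplitz_algebra"
    and f: "f \<in> H_infinity" and g: "g \<in> H_infinity"
  defines "X \<equiv> A o\<^sub>L ((toeplitz f o\<^sub>L toeplitz (\<lambda>w. cnj (g w))) - (toeplitz (\<lambda>w. cnj (g w)) o\<^sub>L toeplitz f)) o\<^sub>L B"
  shows "toeplitz (berezin X) \<in> toeplitz_ideal"
proof (rule toeplitz_in_ideal_of_small[where L = "4 * norm X" and f = f])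
  have "X \<in> toeplitz_algebra"
    unfolding X_def
    by (intro toeplitz_algebra_compose toeplitz_algebra_diff A B toeplitz_holomorphic_in_algebra
        toeplitz_cnj_holomorphic_in_algebra f g)
  then have X: "X \<in> bounded_ops" by (rule toeplitz_algebra_bounded_ops)
  show "bounded_symbol (berezin X)" by (rule bounded_symbol_berezin[OF X])
  show "cmod (berezin X w) \<le> 4 * norm X" if "cmod w < 1" for w
    using norm_berezin_le[OF that, of X] norm_ge_zero[of X] by linarith
  show "cmod (berezin X z - berezin X w) \<le> 4 * norm X * cmod (moebius z w)" if "cmod z < 1" "cmod w < 1" for z w
    by (rule berezin_lipschitz[OF that X])
  show "\<exists>d>0. \<forall>z. cmod z < 1 \<longrightarrow> energy f z < ennreal d \<longrightarrow> cmod (berezin X z) < e" if "0 < e" for e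
    unfolding X_def by (rule berezin_commutator_small[OF A B f g that])
qed (simp_all add: f)

lemma id_in_toeplitz_algebra: "id_blinfun \<in> toeplitz_algebra"
  using toeplitz_holomorphic_in_algebra[OF H_infinity_const[of 1]] by (simp add: toeplitz_one)

lemma blinfun_compose_id: "id_blinfun o\<^sub>L S = S" "S o\<^sub>L id_blinfun = S"
  by (rule blinfun_eqI, simp)+

lemma blinfun_compose_assoc: "(A o\<^sub>L B) o\<^sub>L C = A o\<^sub>L (B o\<^sub>L C)"
  by (rule blinfun_eqI) simp

text \<open>For fixed \<open>S\<close> the operators commuting with \<open>S\<close> modulo
  \<open>J\<close> form a closed subalgebra, so it suffices that they contain the generators. This
  is used once with \<open>S\<close> a generator and then, with the result, for every
  \<open>S\<close>; commutators within one of the two families of generators vanish.\<close>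

lemma toeplitz_ideal_generated:
  assumes J: "closed_ideal toeplitz_algebra J"
    and gen: "\<And>f g. f \<in> H_infinity \<Longrightarrow> g \<in> H_infinity \<Longrightarrow>
      (toeplitz f o\<^sub>L toeplitz (\<lambda>w. cnj (g w))) - (toeplitz (\<lambda>w. cnj (g w)) o\<^sub>L toeplitz f) \<in> J"
  shows "toeplitz_ideal \<subseteq> J"
proof -
  let ?T = toeplitz_algebra
  let ?c = "\<lambda>R S :: bergman \<Rightarrow>\<^sub>L bergman. (R o\<^sub>L S) - (S o\<^sub>L R)"
  have Tb: "?T \<subseteq> bounded_ops" by (rule subsetI) (rule toeplitz_algebra_bounded_ops)
  have cJ: "closed J" and sJ: "complex_subspace J"
    and J0: "0 \<in> J" and Jadd: "\<And>S R. S \<in> J \<Longrightarrow> R \<in> J \<Longrightarrow> S + R \<in> J"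
    and Jl: "\<And>S R. S \<in> ?T \<Longrightarrow> R \<in> J \<Longrightarrow> S o\<^sub>L R \<in> J"
    and Jr: "\<And>S R. S \<in> ?T \<Longrightarrow> R \<in> J \<Longrightarrow> R o\<^sub>L S \<in> J"
    using J by (simp_all add: closed_ideal_def complex_subspace_def)
  have neg: "?c S R \<in> J" if "?c R S \<in> J" for R S
    using complex_subspace_diff[OF sJ J0 that] by simp
  have centralizer: "?T \<subseteq> {R \<in> ?T. \<forall>i\<in>{S}. ?c R i \<in> J}"
    if S: "S \<in> ?T" and "\<And>h. h \<in> H_infinity \<Longrightarrow> ?c (toeplitz h) S \<in> J"
      "\<And>h. h \<in> H_infinity \<Longrightarrow> ?c (toeplitz (\<lambda>w. cnj (h w))) S \<in> J" for S
  proof (rule toeplitz_algebra_subsetI)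
    have lin: "op_linear (\<lambda>R. ?c R i)" if "i \<in> {S}" for i
      using that S Tb by (intro op_linear_minus op_linear_compose_left op_linear_compose_right) auto
    show "closed {R \<in> ?T. \<forall>i\<in>{S}. ?c R i \<in> J}"
      by (rule closed_op_linear_preimage[OF closed_toeplitz_algebra Tb cJ lin])
    show "complex_subspace {R \<in> ?T. \<forall>i\<in>{S}. ?c R i \<in> J}"
      by (rule complex_subspace_op_linear_preimage[OF complex_subspace_toeplitz_algebra Tb sJ lin])
    fix R Q assume "R \<in> {R \<in> ?T. \<forall>i\<in>{S}. ?c R i \<in> J}" "Q \<in> {R \<in> ?T. \<forall>i\<in>{S}. ?c R i \<in> J}"
    then have RQ: "R \<in> ?T" "?c R S \<in> J" "Q \<in> ?T" "?c Q S \<in> J" by simp_all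
    \<comment> \<open>The Leibniz rule for commutators; both terms lie in the ideal
      \<open>J\<close>.\<close>
    have "?c (R o\<^sub>L Q) S = (R o\<^sub>L ?c Q S) + (?c R S o\<^sub>L Q)"
      by (rule blinfun_eqI) (simp add: blinfun.diff_left blinfun.diff_right blinfun.add_left)
    also have "\<dots> \<in> J" by (intro Jadd Jl Jr RQ)
    finally show "R o\<^sub>L Q \<in> {R \<in> ?T. \<forall>i\<in>{S}. ?c R i \<in> J}" using RQ by (simp add: toeplitz_algebra_compose)
  qed (use that toeplitz_holomorphic_in_algebra toeplitz_cnj_holomorphic_in_algebra in simp_all)
  have comm: "?c (toeplitz f) (toeplitz g) = 0" if "f \<in> H_infinity" "g \<in> H_infinity" for f g
    using that by (simp add: toeplitz_compose_holomorphic bounded_symbol_holomorphic mult.commute)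
  have comm': "?c (toeplitz (\<lambda>w. cnj (f w))) (toeplitz (\<lambda>w. cnj (g w))) = 0"
    if "f \<in> H_infinity" "g \<in> H_infinity" for f g
    using that by (simp add: toeplitz_cnj_holomorphic_compose bounded_symbol_cnj bounded_symbol_holomorphic mult.commute)
  have 1: "?c R (toeplitz g) \<in> J" if "R \<in> ?T" "g \<in> H_infinity" for R g
    using subsetD[OF centralizer[OF toeplitz_holomorphic_in_algebra[OF that(2)]] that(1)]
      comm[OF _ that(2)] neg[OF gen[OF that(2)]] J0 by simp
  have 2: "?c R (toeplitz (\<lambda>w. cnj (g w))) \<in> J" if "R \<in> ?T" "g \<in> H_infinity" for R g
    using subsetD[OF centralizer[OF toeplitz_cnj_holomorphic_in_algebra[OF that(2)]] that(1)]
      comm'[OF _ that(2)] gen[OF _ that(2)] J0 by simp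
  have 3: "?c R S \<in> J" if "R \<in> ?T" "S \<in> ?T" for R S
    using subsetD[OF centralizer[OF that(2)] that(1)] neg[OF 1[OF that(2)]] neg[OF 2[OF that(2)]] by simp
  show ?thesis by (rule toeplitz_ideal_subsetI[OF J 3])
qed

text \<open>The operators whose Berezin symbol gives an element of the ideal form a subspace but not
  visibly an ideal. Demanding the property for all \<open>A R B\<close> with \<open>A\<close> and
  \<open>B\<close> in the algebra makes the class \<open>?J\<close> two-sided, so that it need only
  contain the generating commutators.\<close>

lemma toeplitz_berezin_in_ideal:
  assumes "R \<in> toeplitz_ideal"
  shows "toeplitz (berezin R) \<in> toeplitz_ideal"
proof -
  let ?T = toeplitz_algebra and ?C = toeplitz_ideal
  let ?L = "\<lambda>i R. toeplitz (berezin (fst i o\<^sub>L (R o\<^sub>L snd i)))"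
  let ?J = "{R \<in> ?C. \<forall>i\<in>?T \<times> ?T. ?L i R \<in> ?C}"
  have Tb: "?T \<subseteq> bounded_ops" by (rule subsetI) (rule toeplitz_algebra_bounded_ops)
  have Cb: "?C \<subseteq> bounded_ops" using toeplitz_ideal_subset Tb by (rule subset_trans)
  have lin: "op_linear (?L i)" if "i \<in> ?T \<times> ?T" for i
    using that
    by (intro op_linear_comp[OF op_linear_toeplitz_berezin] op_linear_comp[OF op_linear_compose_left]
        op_linear_compose_right subsetD[OF Tb]) auto
  have "closed_ideal ?T ?J"
    unfolding closed_ideal_def
  proof (intro conjI ballI)
    show "?J \<subseteq> ?T" using toeplitz_ideal_subset by (rule subset_trans[rotated]) simp
    show "closed ?J" by (rule closed_op_linear_preimage[OF closed_toeplitz_ideal Cb closed_toeplitz_ideal lin])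
    show "complex_subspace ?J"
      by (rule complex_subspace_op_linear_preimage[OF complex_subspace_toeplitz_ideal Cb complex_subspace_toeplitz_ideal lin])
    fix S R assume S: "S \<in> ?T" and "R \<in> ?J"
    then have R: "R \<in> ?C" "\<And>A B. A \<in> ?T \<Longrightarrow> B \<in> ?T \<Longrightarrow> toeplitz (berezin (A o\<^sub>L (R o\<^sub>L B))) \<in> ?C"
      by simp_all
    have "toeplitz (berezin (A o\<^sub>L ((S o\<^sub>L R) o\<^sub>L B))) \<in> ?C" if "A \<in> ?T" "B \<in> ?T" for A B
      using R(2)[OF toeplitz_algebra_compose[OF that(1) S] that(2)] by (simp add: blinfun_compose_assoc)
    then show "S o\<^sub>L R \<in> ?J" using toeplitz_ideal_compose_left[OF S R(1)] by simp
    have "toeplitz (berezin (A o\<^sub>L ((R o\<^sub>L S) o\<^sub>L B))) \<in> ?C" if "A \<in> ?T" "B \<in> ?T" for A B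
      using R(2)[OF that(1) toeplitz_algebra_compose[OF S that(2)]] by (simp add: blinfun_compose_assoc)
    then show "R o\<^sub>L S \<in> ?J" using toeplitz_ideal_compose_right[OF S R(1)] by simp
  qed
  then have "?C \<subseteq> ?J"
  proof (rule toeplitz_ideal_generated)
    fix f g assume fg: "f \<in> H_infinity" "g \<in> H_infinity"
    let ?c = "(toeplitz f o\<^sub>L toeplitz (\<lambda>w. cnj (g w))) - (toeplitz (\<lambda>w. cnj (g w)) o\<^sub>L toeplitz f)"
    have "toeplitz (berezin (A o\<^sub>L (?c o\<^sub>L B))) \<in> ?C" if "A \<in> ?T" "B \<in> ?T" for A B
      using toeplitz_berezin_commutator_in_ideal[OF that fg] by (simp add: blinfun_compose_assoc)
    moreover have "?c \<in> ?C"
      by (intro commutator_in_toeplitz_ideal toeplitz_holomorphic_in_algebra toeplitz_cnj_holomorphic_in_algebra fg)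
    ultimately show "?c \<in> ?J" by simp
  qed
  from subsetD[OF this assms] have "?L (id_blinfun, id_blinfun) R \<in> ?C"
    using id_in_toeplitz_algebra by simp
  then show ?thesis by (simp add: blinfun_compose_id)
qed

text \<open>Kernels are eigenvectors of adjoints of multiplication operators; paired with the kernel
  at \<open>z\<close>, the operator of a holomorphic symbol acts as its value at
  \<open>z\<close>.\<close>

lemma berezin_toeplitz_holomorphic_cnj:
  assumes F: "F \<in> H_infinity" and G: "G \<in> H_infinity" and z: "cmod z < 1"
  shows "berezin (toeplitz F o\<^sub>L toeplitz (\<lambda>w. cnj (G w))) z = F z * cnj (G z)"
proof -
  let ?k = "normalized_kernel z" and ?G = "toeplitz (\<lambda>w. cnj (G w))"
  have mult: "cinner (toeplitz h f) ?k = h z * cinner f ?k" if "h \<in> H_infinity" for h f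
    by (simp add: cinner_normalized_kernel[OF z] Rep_toeplitz_holomorphic[OF that z])
  have G': "bounded_symbol G" by (rule bounded_symbol_holomorphic[OF G])
  have "cinner (?G ?k) ?k = cinner ?k (toeplitz G ?k)"
    using cinner_adj_left[OF toeplitz_bounded_ops[OF G']] by (simp add: adj_toeplitz[OF G'])
  also have "\<dots> = cnj (cinner (toeplitz G ?k) ?k)" by (rule cinner_commute)
  also have "\<dots> = cnj (G z)"
    by (simp add: mult[OF G] cinner_self norm_normalized_kernel[OF z])
  finally show ?thesis by (simp add: berezin_def mult[OF F])
qed

text \<open>
  Sandwiching with \<open>T\<^sub>F\<close> and the adjoint of \<open>T\<^sub>G\<close> makes the class of good operators stable under left
  multiplication by the generators: a holomorphic symbol is absorbed into \<open>F\<close>, an antiholomorphic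
  one is moved to the right modulo the commutator ideal and absorbed into \<open>G\<close>.
\<close>

theorem corollary2p17:
  fixes S :: "bergman \<Rightarrow>\<^sub>L bergman"
  assumes "S \<in> toeplitz_algebra"
  shows "S - toeplitz (berezin S) \<in> commutator_ideal toeplitz_algebra"
proof -
  let ?T = toeplitz_algebra and ?C = toeplitz_ideal
  let ?D = "\<lambda>S. S - toeplitz (berezin S)"
  let ?s = "\<lambda>i S. toeplitz (fst i) o\<^sub>L (S o\<^sub>L toeplitz (\<lambda>w. cnj (snd i w)))"
  define G where "G = {S \<in> ?T. \<forall>i\<in>H_infinity \<times> H_infinity. ?D (?s i S) \<in> ?C}"
  have GI: "S \<in> G" if "S \<in> ?T" "\<And>i. i \<in> H_infinity \<times> H_infinity \<Longrightarrow> ?D (?s i S) \<in> ?C" for S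
    unfolding G_def by (intro CollectI conjI ballI that)
  have GT: "S \<in> ?T" if "S \<in> G" for S using that unfolding G_def by (elim CollectE conjE)
  have GD: "?D (?s i S) \<in> ?C" if "S \<in> G" "i \<in> H_infinity \<times> H_infinity" for i S
    using that unfolding G_def by (elim CollectE conjE) (rule bspec)
  note hT = toeplitz_holomorphic_in_algebra and cT = toeplitz_cnj_holomorphic_in_algebra
  note hb = bounded_symbol_holomorphic and cb = bounded_symbol_cnj[OF bounded_symbol_holomorphic]
  have Tb: "?T \<subseteq> bounded_ops" by (rule subsetI) (rule toeplitz_algebra_bounded_ops)
  have lin: "op_linear (\<lambda>S. ?D (?s i S))" if i: "i \<in> H_infinity \<times> H_infinity" for i
  proof (rule op_linear_comp[where L = ?D])
    show "op_linear ?D" by (rule op_linear_minus[OF op_linear_id op_linear_toeplitz_berezin])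
    have "fst i \<in> H_infinity" "snd i \<in> H_infinity" using i by auto
    then have b: "toeplitz (fst i) \<in> bounded_ops" "toeplitz (\<lambda>w. cnj (snd i w)) \<in> bounded_ops"
      by (simp_all add: toeplitz_bounded_ops hb cb)
    show "op_linear (?s i)"
      by (rule op_linear_comp[OF op_linear_compose_left[OF b(1)] op_linear_compose_right[OF b(2)]])
  qed
  have clG: "closed G"
    unfolding G_def by (rule closed_op_linear_preimage[OF closed_toeplitz_algebra Tb closed_toeplitz_ideal lin])
  have subG: "complex_subspace G"
    unfolding G_def by (rule complex_subspace_op_linear_preimage[OF complex_subspace_toeplitz_algebra Tb complex_subspace_toeplitz_ideal lin])
  then have Gadd: "\<forall>S\<in>G. \<forall>R\<in>G. S + R \<in> G" unfolding complex_subspace_def by (elim conjE)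
  \<comment> \<open>The stability of the ideal under the Berezin map enters here; it allows
    commutators to be discarded inside \<open>G\<close>.\<close>
  have CG: "S \<in> G" if S: "S \<in> ?C" for S
  proof -
    have "?D (?s i S) \<in> ?C" if "i \<in> H_infinity \<times> H_infinity" for i
    proof -
      have "?s i S \<in> ?C"
        using that by (intro toeplitz_ideal_compose_left toeplitz_ideal_compose_right hT cT S) auto
      then show ?thesis by (intro toeplitz_ideal_diff toeplitz_berezin_in_ideal)
    qed
    then show ?thesis by (intro GI subsetD[OF toeplitz_ideal_subset S])
  qed
  have idG: "id_blinfun \<in> G"
  proof -
    have "?D (toeplitz f o\<^sub>L toeplitz (\<lambda>w. cnj (g w))) \<in> ?C" if fg: "f \<in> H_infinity" "g \<in> H_infinity" for f g
    proof -
      have "toeplitz (berezin (toeplitz f o\<^sub>L toeplitz (\<lambda>w. cnj (g w)))) = toeplitz (\<lambda>w. cnj (g w) * f w)"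
        by (rule toeplitz_cong) (simp add: berezin_toeplitz_holomorphic_cnj[OF fg] mult.commute)
      also have "\<dots> = toeplitz (\<lambda>w. cnj (g w)) o\<^sub>L toeplitz f"
        by (rule toeplitz_compose_holomorphic[OF fg(1) cb[OF fg(2)], symmetric])
      finally show ?thesis using commutator_in_toeplitz_ideal[OF hT[OF fg(1)] cT[OF fg(2)]] by simp
    qed
    then have "?D (?s i id_blinfun) \<in> ?C" if "i \<in> H_infinity \<times> H_infinity" for i
      using that unfolding blinfun_compose_id by auto
    then show ?thesis by (intro GI id_in_toeplitz_algebra)
  qed
  \<comment> \<open>\<open>G\<close> is not visibly closed under products, but its left multipliers
    are. Once these exhaust the algebra, every operator is recovered by applying it to the identity
    in \<open>G\<close>.\<close>
  have "?T \<subseteq> {A \<in> ?T. \<forall>S\<in>G. A o\<^sub>L S \<in> G}" (is "_ \<subseteq> ?H")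
  proof (rule toeplitz_algebra_subsetI)
    have lin': "op_linear (\<lambda>A. A o\<^sub>L S)" if "S \<in> G" for S
      using that by (intro op_linear_compose_right subsetD[OF Tb] GT)
    show "closed ?H" by (rule closed_op_linear_preimage[OF closed_toeplitz_algebra Tb clG lin'])
    show "complex_subspace ?H"
      by (rule complex_subspace_op_linear_preimage[OF complex_subspace_toeplitz_algebra Tb subG lin'])
    show "A o\<^sub>L B \<in> ?H" if A: "A \<in> ?H" and B: "B \<in> ?H" for A B
    proof (intro CollectI conjI ballI)
      show "A o\<^sub>L B \<in> ?T" using A B by (intro toeplitz_algebra_compose) simp_all
      fix S assume "S \<in> G"
      then have "B o\<^sub>L S \<in> G" using B by (intro bspec[OF conjunct2[OF CollectD[OF B]]])
      then have "A o\<^sub>L (B o\<^sub>L S) \<in> G" by (intro bspec[OF conjunct2[OF CollectD[OF A]]])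
      then show "(A o\<^sub>L B) o\<^sub>L S \<in> G" by (simp only: blinfun_compose_assoc)
    qed
    fix h assume h: "h \<in> H_infinity"
    show "toeplitz h \<in> ?H"
    proof (intro CollectI conjI ballI hT h, rule GI)
      fix S assume S: "S \<in> G"
      show "toeplitz h o\<^sub>L S \<in> ?T" by (intro toeplitz_algebra_compose hT h GT S)
      fix i assume "i \<in> H_infinity \<times> H_infinity"
      then have i': "fst i \<in> H_infinity" "snd i \<in> H_infinity" by auto
      have eq: "?s i (toeplitz h o\<^sub>L S) = ?s (\<lambda>w. fst i w * h w, snd i) S"
        by (simp add: toeplitz_compose_holomorphic[OF h hb[OF i'(1)], symmetric] blinfun_compose_assoc)
      have m: "(\<lambda>w. fst i w * h w, snd i) \<in> H_infinity \<times> H_infinity"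
        using H_infinity_mult[OF i'(1) h] i'(2) by simp
      show "?D (?s i (toeplitz h o\<^sub>L S)) \<in> ?C" unfolding eq by (rule GD[OF S m])
    qed
    let ?h = "toeplitz (\<lambda>w. cnj (h w))"
    show "?h \<in> ?H"
    proof (intro CollectI conjI ballI cT h)
      fix S assume S: "S \<in> G"
      then have ST: "S \<in> ?T" by (rule GT)
      have "S o\<^sub>L ?h \<in> G"
      proof (rule GI)
        show "S o\<^sub>L ?h \<in> ?T" by (intro toeplitz_algebra_compose ST cT h)
        fix i assume i: "i \<in> H_infinity \<times> H_infinity"
        then have i': "fst i \<in> H_infinity" "snd i \<in> H_infinity" by auto
        have eq: "?s i (S o\<^sub>L ?h) = ?s (fst i, \<lambda>w. h w * snd i w) S"
          by (simp add: toeplitz_cnj_holomorphic_compose[OF h cb[OF i'(2)]] blinfun_compose_assoc)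
        have m: "(fst i, \<lambda>w. h w * snd i w) \<in> H_infinity \<times> H_infinity"
          using H_infinity_mult[OF h i'(2)] i'(1) by simp
        show "?D (?s i (S o\<^sub>L ?h)) \<in> ?C" unfolding eq by (rule GD[OF S m])
      qed
      moreover have "(?h o\<^sub>L S) - (S o\<^sub>L ?h) \<in> G"
        by (intro CG commutator_in_toeplitz_ideal cT h ST)
      ultimately have "((?h o\<^sub>L S) - (S o\<^sub>L ?h)) + (S o\<^sub>L ?h) \<in> G"
        by (intro Gadd[rule_format])
      then show "?h o\<^sub>L S \<in> G" by simp
    qed
  qed
  from subsetD[OF this assms] have "S o\<^sub>L id_blinfun \<in> G"
    using idG by (elim CollectE conjE) (rule bspec)
  then have "S \<in> G" by (simp only: blinfun_compose_id)
  from GD[OF this, of "(\<lambda>_. 1, \<lambda>_. 1)"] show ?thesis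
    by (simp add: H_infinity_const toeplitz_one blinfun_compose_id)
qed

end
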